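(* Let $p$ be an odd prime and $G=\langle\tau\rangle$ a cyclic group of order $p$. Let $M$ be a finitely generated $\mathbb{Z}_p[G]$-module whose $\mathbb{Z}_p$-torsion subgroup $M_t$ is cyclic. Then $M$ is a direct sum of modules from the following list (with the indicated Tate cohomology $\hat H^0(G,\cdot)$ and $H^1(G,\cdot)$): $\mathbb{Z}/p^i\mathbb{Z}$ ($i\ge1$): $\mathbb{F}_p$, $\mathbb{F}_p$; $F_i$ ($i\ge2$, any admissible parameter $w$): $0$, $0$; $\mathbb{Z}_p$: $\mathbb{F}_p$, $0$; $A$: $0$, $\mathbb{F}_p$; $\mathbb{Z}_p[G]$: $0$, $0$; $\{\mathbb{Z}/p^i\mathbb{Z}\mid\mathbb{Z}_p\}$ ($i\ge1$): $\mathbb{F}_p$, $0$; $\{\mathbb{Z}/p^i\mathbb{Z}\mid A\}$ ($i\ge1$): $0$, $\mathbb{F}_p$; $\{\mathbb{Z}/p^i\mathbb{Z}\mid\mathbb{Z}_p\oplus A\}$ ($i\ge1$): $0$, $0$. The decomposition is unique up to reordering the summands.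
   Context: $\mathbb{Z}/p^i\mathbb{Z}$ has trivial $G$-action. For $i\ge2$, $F_i$ is the cyclic group $\mathbb{Z}/p^i\mathbb{Z}$ on which $\tau$ acts by multiplication by some $w\in1+p^{i-1}\mathbb{Z}/p^i\mathbb{Z}$, $w\ne1$. $\mathbb{Z}_p$ is the trivial lattice; $A$ is the kernel of the norm map $\mathbb{Z}_p[G]\to\mathbb{Z}_p$, identified with $\mathbb{Z}_p[\zeta]$ ($\zeta$ a primitive $p$-th root of unity) with $\tau$ acting as multiplication by $\zeta$. Fix a $\mathbb{Z}_p$-linear map $f:\mathbb{Z}_p[\zeta]\to\mathbb{Z}/p^i\mathbb{Z}$ with $f(p/(1-\zeta))\notin p(\mathbb{Z}/p^i\mathbb{Z})$. Define: $\{\mathbb{Z}/p^i\mathbb{Z}\mid\mathbb{Z}_p\}=\mathbb{Z}/p^i\mathbb{Z}\times\mathbb{Z}_p$ with $\tau(t,x)=(t+p^{i-1}x,x)$; $\{\mathbb{Z}/p^i\mathbb{Z}\mid A\}=\mathbb{Z}/p^i\mathbb{Z}\times\mathbb{Z}_p[\zeta]$ with $\tau(t,y)=(t+f(y),\zeta y)$; $\{\mathbb{Z}/p^i\mathbb{Z}\mid\mathbb{Z}_p\oplus A\}=\mathbb{Z}/p^i\mathbb{Z}\times\mathbb{Z}_p\times\mathbb{Z}_p[\zeta]$ with $\tau(t,x,y)=(t+p^{i-1}x+f(y),x,\zeta y)$. These are non-split extensions of the lattice part by $\mathbb{Z}/p^i\mathbb{Z}$ and their isomorphism classes do not depend on $f$.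 *)

theory Defs
  imports
    "HOL-Algebra.Algebra"
    "HOL-Number_Theory.Number_Theory"
    "HOL-Library.Multiset"
begin

section \<open>The ring of p-adic integers\<close>

text \<open>The inverse limit of the rings \<open>\<int>/p\<^sup>n\<close>: an element is the sequence of its residues,
  \<open>x n \<in> {0..<p\<^sup>n}\<close> being the residue modulo \<open>p\<^sup>n\<close>.\<close>

type_synonym padic = "nat \<Rightarrow> int"

definition Zp :: "nat \<Rightarrow> padic ring" where
  "Zp p = \<lparr>carrier = {x. \<forall>n. 0 \<le> x n \<and> x n < int p ^ n \<and> x (Suc n) mod int p ^ n = x n},
     monoid.mult = (\<lambda>x y n. (x n * y n) mod int p ^ n),
     monoid.one = (\<lambda>n. 1 mod int p ^ n),
     ring.zero = (\<lambda>n. 0),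
     ring.add = (\<lambda>x y n. (x n + y n) mod int p ^ n)\<rparr>"


section \<open>Group rings and modules over them\<close>

text \<open>\<open>R[G]\<close> for a finite group \<open>G\<close>, as functions on \<open>carrier G\<close> with the convolution product.\<close>

definition group_ring ::
    "('r, 'c) ring_scheme \<Rightarrow> ('g, 'd) monoid_scheme \<Rightarrow> ('g \<Rightarrow> 'r) ring" where
  "group_ring R G = \<lparr>carrier = carrier G \<rightarrow>\<^sub>E carrier R,
     monoid.mult = (\<lambda>a b. \<lambda>g\<in>carrier G. \<Oplus>\<^bsub>R\<^esub>h\<in>carrier G. a h \<otimes>\<^bsub>R\<^esub> b (inv\<^bsub>G\<^esub> h \<otimes>\<^bsub>G\<^esub> g)),
     monoid.one = (\<lambda>g\<in>carrier G. if g = \<one>\<^bsub>G\<^esub> then \<one>\<^bsub>R\<^esub> else \<zero>\<^bsub>R\<^esub>),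
     ring.zero = (\<lambda>g\<in>carrier G. \<zero>\<^bsub>R\<^esub>),
     ring.add = (\<lambda>a b. \<lambda>g\<in>carrier G. a g \<oplus>\<^bsub>R\<^esub> b g)\<rparr>"

text \<open>The element \<open>a g\<close> of \<open>R[G]\<close>, for \<open>a \<in> R\<close> and \<open>g \<in> G\<close>.\<close>

definition gr_single ::
    "('r, 'c) ring_scheme \<Rightarrow> ('g, 'd) monoid_scheme \<Rightarrow> 'r \<Rightarrow> 'g \<Rightarrow> 'g \<Rightarrow> 'r" where
  "gr_single R G a g = (\<lambda>h\<in>carrier G. if h = g then a else \<zero>\<^bsub>R\<^esub>)"

definition g_act ::
    "('r, 'c) ring_scheme \<Rightarrow> ('g, 'd) monoid_scheme \<Rightarrow> ('g \<Rightarrow> 'r, 'm, 'e) module_scheme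
      \<Rightarrow> 'g \<Rightarrow> 'm \<Rightarrow> 'm" where
  "g_act R G M g x = gr_single R G \<one>\<^bsub>R\<^esub> g \<odot>\<^bsub>M\<^esub> x"

definition mod_hom ::
    "('r, 'c) ring_scheme \<Rightarrow> ('r, 'm, 'd) module_scheme \<Rightarrow> ('r, 'n, 'e) module_scheme
      \<Rightarrow> ('m \<Rightarrow> 'n) set" where
  "mod_hom R M N = {h \<in> carrier M \<rightarrow> carrier N.
     (\<forall>x\<in>carrier M. \<forall>y\<in>carrier M. h (x \<oplus>\<^bsub>M\<^esub> y) = h x \<oplus>\<^bsub>N\<^esub> h y) \<and>
     (\<forall>a\<in>carrier R. \<forall>x\<in>carrier M. h (a \<odot>\<^bsub>M\<^esub> x) = a \<odot>\<^bsub>N\<^esub> h x)}"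

definition mod_iso ::
    "('r, 'c) ring_scheme \<Rightarrow> ('r, 'm, 'd) module_scheme \<Rightarrow> ('r, 'n, 'e) module_scheme \<Rightarrow> bool" where
  "mod_iso R M N \<longleftrightarrow> (\<exists>h\<in>mod_hom R M N. bij_betw h (carrier M) (carrier N))"

definition fin_gen :: "('r, 'c) ring_scheme \<Rightarrow> ('r, 'm, 'd) module_scheme \<Rightarrow> bool" where
  "fin_gen R M \<longleftrightarrow> (\<exists>S. finite S \<and> S \<subseteq> carrier M \<and>
     carrier M = {\<Oplus>\<^bsub>M\<^esub>s\<in>S. a s \<odot>\<^bsub>M\<^esub> s | a. a \<in> S \<rightarrow> carrier R})"

text \<open>\<open>M\<close> is the internal direct sum of the listed submodules.\<close>

definition direct_sum ::
    "('r, 'c) ring_scheme \<Rightarrow> ('r, 'm, 'd) module_scheme \<Rightarrow> 'm set list \<Rightarrow> bool" where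
  "direct_sum R M Ns \<longleftrightarrow> (\<forall>j<length Ns. submodule (Ns ! j) R M) \<and>
     (\<forall>x\<in>carrier M. \<exists>!f. f \<in> (\<Pi>\<^sub>E j\<in>{..<length Ns}. Ns ! j) \<and>
        x = (\<Oplus>\<^bsub>M\<^esub>j\<in>{..<length Ns}. f j))"

text \<open>The torsion of an \<open>R[G]\<close>-module with respect to the coefficient ring \<open>R\<close>
  (a domain).\<close>

definition coeff_torsion ::
    "('r, 'c) ring_scheme \<Rightarrow> ('g, 'd) monoid_scheme \<Rightarrow> ('g \<Rightarrow> 'r, 'm, 'e) module_scheme
      \<Rightarrow> 'm set" where
  "coeff_torsion R G M = {x \<in> carrier M. \<exists>a\<in>carrier R. a \<noteq> \<zero>\<^bsub>R\<^esub> \<and>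
     gr_single R G a \<one>\<^bsub>G\<^esub> \<odot>\<^bsub>M\<^esub> x = \<zero>\<^bsub>M\<^esub>}"


section \<open>Group cohomology\<close>

definition norm_map ::
    "('r, 'c) ring_scheme \<Rightarrow> ('g, 'd) monoid_scheme \<Rightarrow> ('g \<Rightarrow> 'r, 'm, 'e) module_scheme
      \<Rightarrow> 'm \<Rightarrow> 'm" where
  "norm_map R G M x = (\<Oplus>\<^bsub>M\<^esub>g\<in>carrier G. g_act R G M g x)"

definition invariants ::
    "('r, 'c) ring_scheme \<Rightarrow> ('g, 'd) monoid_scheme \<Rightarrow> ('g \<Rightarrow> 'r, 'm, 'e) module_scheme
      \<Rightarrow> 'm set" where
  "invariants R G M = {x \<in> carrier M. \<forall>g\<in>carrier G. g_act R G M g x = x}"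

definition tate_H0 ::
    "('r, 'c) ring_scheme \<Rightarrow> ('g, 'd) monoid_scheme \<Rightarrow> ('g \<Rightarrow> 'r, 'm, 'e) module_scheme
      \<Rightarrow> 'm set monoid" where
  "tate_H0 R G M = (add_monoid M)\<lparr>carrier := invariants R G M\<rparr> Mod (norm_map R G M ` carrier M)"

text \<open>Crossed homomorphisms \<open>G \<rightarrow> M\<close> under pointwise addition, modulo the principal ones.\<close>

definition cocycles ::
    "('r, 'c) ring_scheme \<Rightarrow> ('g, 'd) monoid_scheme \<Rightarrow> ('g \<Rightarrow> 'r, 'm, 'e) module_scheme
      \<Rightarrow> ('g \<Rightarrow> 'm) monoid" where
  "cocycles R G M = \<lparr>carrier = {c \<in> carrier G \<rightarrow>\<^sub>E carrier M.
       \<forall>g\<in>carrier G. \<forall>h\<in>carrier G. c (g \<otimes>\<^bsub>G\<^esub> h) = c g \<oplus>\<^bsub>M\<^esub> g_act R G M g (c h)},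
     monoid.mult = (\<lambda>c d. \<lambda>g\<in>carrier G. c g \<oplus>\<^bsub>M\<^esub> d g),
     monoid.one = (\<lambda>g\<in>carrier G. \<zero>\<^bsub>M\<^esub>)\<rparr>"

definition coboundaries ::
    "('r, 'c) ring_scheme \<Rightarrow> ('g, 'd) monoid_scheme \<Rightarrow> ('g \<Rightarrow> 'r, 'm, 'e) module_scheme
      \<Rightarrow> ('g \<Rightarrow> 'm) set" where
  "coboundaries R G M = {(\<lambda>g\<in>carrier G. g_act R G M g x \<ominus>\<^bsub>M\<^esub> x) | x. x \<in> carrier M}"

definition group_H1 ::
    "('r, 'c) ring_scheme \<Rightarrow> ('g, 'd) monoid_scheme \<Rightarrow> ('g \<Rightarrow> 'r, 'm, 'e) module_scheme
      \<Rightarrow> ('g \<Rightarrow> 'm) set monoid" where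
  "group_H1 R G M = cocycles R G M Mod coboundaries R G M"


section \<open>Modules over the p-adic integers\<close>

text \<open>The library's record of modules extends that of rings, so a multiplication has to be supplied
  as well; it plays no role for modules.\<close>

definition with_smult ::
    "('m, 'c) ring_scheme \<Rightarrow> ('r \<Rightarrow> 'm \<Rightarrow> 'm) \<Rightarrow> ('r, 'm) module" where
  "with_smult N s = \<lparr>carrier = carrier N, monoid.mult = monoid.mult N, monoid.one = monoid.one N,
     ring.zero = ring.zero N, ring.add = ring.add N, smult = s\<rparr>"

definition self_mod :: "('r, 'c) ring_scheme \<Rightarrow> ('r, 'r) module" where
  "self_mod R = with_smult R (monoid.mult R)"

definition prod_mod ::
    "('r, 'm, 'c) module_scheme \<Rightarrow> ('r, 'n, 'd) module_scheme \<Rightarrow> ('r, 'm \<times> 'n) module" where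
  "prod_mod M N = with_smult (RDirProd M N) (\<lambda>a (x, y). (a \<odot>\<^bsub>M\<^esub> x, a \<odot>\<^bsub>N\<^esub> y))"

text \<open>\<open>\<int>/p\<^sup>i\<close>, on which a p-adic integer acts through its residue modulo \<open>p\<^sup>i\<close>.\<close>

definition Zmod :: "nat \<Rightarrow> nat \<Rightarrow> (padic, int) module" where
  "Zmod p i = with_smult (residue_ring (int p ^ i)) (\<lambda>a t. (a i * t) mod int p ^ i)"

text \<open>\<open>\<int>\<^sub>p[\<zeta>]\<close> is realised as \<open>\<int>\<^sub>p[X]/(1 + X + \<dots> + X\<^bsup>p-1\<^esup>)\<close>,
  with \<open>\<zeta>\<close> the class of \<open>X\<close>.\<close>

definition cyclo_poly :: "nat \<Rightarrow> nat \<Rightarrow> padic" where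
  "cyclo_poly p = (\<lambda>k. if k < p then \<one>\<^bsub>Zp p\<^esub> else \<zero>\<^bsub>Zp p\<^esub>)"

definition cyclo_ideal :: "nat \<Rightarrow> (nat \<Rightarrow> padic) set" where
  "cyclo_ideal p = PIdl\<^bsub>UP (Zp p)\<^esub> (cyclo_poly p)"

definition Zp_zeta :: "nat \<Rightarrow> (nat \<Rightarrow> padic) set ring" where
  "Zp_zeta p = UP (Zp p) Quot cyclo_ideal p"

definition zeta_const :: "nat \<Rightarrow> padic \<Rightarrow> (nat \<Rightarrow> padic) set" where
  "zeta_const p a = cyclo_ideal p +>\<^bsub>UP (Zp p)\<^esub> monom (UP (Zp p)) a 0"

definition zeta :: "nat \<Rightarrow> (nat \<Rightarrow> padic) set" where
  "zeta p = cyclo_ideal p +>\<^bsub>UP (Zp p)\<^esub> monom (UP (Zp p)) \<one>\<^bsub>Zp p\<^esub> 1"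

definition Zp_zeta_mod :: "nat \<Rightarrow> (padic, (nat \<Rightarrow> padic) set) module" where
  "Zp_zeta_mod p = with_smult (Zp_zeta p) (\<lambda>a y. zeta_const p a \<otimes>\<^bsub>Zp_zeta p\<^esub> y)"

text \<open>The \<open>\<int>\<^sub>p\<close>-linear maps \<open>f : \<int>\<^sub>p[\<zeta>] \<rightarrow> \<int>/p\<^sup>i\<close> with \<open>f (p/(1-\<zeta>)) \<notin> p (\<int>/p\<^sup>i)\<close>;
  \<open>y\<close> is the quotient \<open>p/(1-\<zeta>)\<close>.\<close>

definition admissible_map :: "nat \<Rightarrow> nat \<Rightarrow> ((nat \<Rightarrow> padic) set \<Rightarrow> int) \<Rightarrow> bool" where
  "admissible_map p i f \<longleftrightarrow> f \<in> mod_hom (Zp p) (Zp_zeta_mod p) (Zmod p i) \<and>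
     (\<exists>y\<in>carrier (Zp_zeta p).
        (\<one>\<^bsub>Zp_zeta p\<^esub> \<ominus>\<^bsub>Zp_zeta p\<^esub> zeta p) \<otimes>\<^bsub>Zp_zeta p\<^esub> y
          = [p] \<cdot>\<^bsub>Zp_zeta p\<^esub> \<one>\<^bsub>Zp_zeta p\<^esub> \<and>
        f y \<notin> (\<lambda>t. (int p * t) mod int p ^ i) ` carrier (Zmod p i))"


section \<open>The modules in the list\<close>

abbreviation ZpG :: "nat \<Rightarrow> ('g, 'd) monoid_scheme \<Rightarrow> ('g \<Rightarrow> padic) ring" where
  "ZpG p G \<equiv> group_ring (Zp p) G"

text \<open>The \<open>\<int>\<^sub>p[G]\<close>-module given by a \<open>\<int>\<^sub>p\<close>-module \<open>N\<close> on which the generator \<open>\<tau>\<close> of the group \<open>G\<close>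
  of order \<open>p\<close> acts by the automorphism \<open>t\<close>: the element \<open>\<Sum>\<^sub>k a\<^sub>k \<tau>\<^sup>k\<close> sends \<open>x\<close> to
  \<open>\<Sum>\<^sub>k a\<^sub>k t\<^sup>k(x)\<close>.\<close>

definition tau_mod ::
    "nat \<Rightarrow> ('g, 'd) monoid_scheme \<Rightarrow> 'g \<Rightarrow> (padic, 'm) module \<Rightarrow> ('m \<Rightarrow> 'm)
      \<Rightarrow> ('g \<Rightarrow> padic, 'm) module" where
  "tau_mod p G \<tau> N t =
     with_smult N (\<lambda>a x. \<Oplus>\<^bsub>N\<^esub>k\<in>{..<p}. a (\<tau> [^]\<^bsub>G\<^esub> k) \<odot>\<^bsub>N\<^esub> (t ^^ k) x)"

definition M_cyc :: "nat \<Rightarrow> ('g, 'd) monoid_scheme \<Rightarrow> 'g \<Rightarrow> nat \<Rightarrow> ('g \<Rightarrow> padic, int) module" where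
  "M_cyc p G \<tau> i = tau_mod p G \<tau> (Zmod p i) (\<lambda>t. t)"

definition admissible_unit :: "nat \<Rightarrow> nat \<Rightarrow> int \<Rightarrow> bool" where
  "admissible_unit p i w \<longleftrightarrow> w \<in> {0..<int p ^ i} \<and> [w = 1] (mod int p ^ (i - 1)) \<and> w \<noteq> 1"

definition M_F ::
    "nat \<Rightarrow> ('g, 'd) monoid_scheme \<Rightarrow> 'g \<Rightarrow> nat \<Rightarrow> int \<Rightarrow> ('g \<Rightarrow> padic, int) module" where
  "M_F p G \<tau> i w = tau_mod p G \<tau> (Zmod p i) (\<lambda>t. (w * t) mod int p ^ i)"

definition M_Zp :: "nat \<Rightarrow> ('g, 'd) monoid_scheme \<Rightarrow> 'g \<Rightarrow> ('g \<Rightarrow> padic, padic) module" where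
  "M_Zp p G \<tau> = tau_mod p G \<tau> (self_mod (Zp p)) (\<lambda>x. x)"

definition M_reg :: "nat \<Rightarrow> ('g, 'd) monoid_scheme \<Rightarrow> ('g \<Rightarrow> padic, 'g \<Rightarrow> padic) module" where
  "M_reg p G = self_mod (ZpG p G)"

text \<open>On \<open>\<int>\<^sub>p[G]\<close> the norm is \<open>\<Sum>\<^sub>g a\<^sub>g g \<mapsto> (\<Sum>\<^sub>g a\<^sub>g) \<cdot> \<Sum>\<^sub>g g\<close>, with image
  \<open>\<int>\<^sub>p \<cdot> \<Sum>\<^sub>g g\<close>, a copy of \<open>\<int>\<^sub>p\<close>.\<close>

definition M_A :: "nat \<Rightarrow> ('g, 'd) monoid_scheme \<Rightarrow> ('g \<Rightarrow> padic, 'g \<Rightarrow> padic) module" where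
  "M_A p G = (M_reg p G)\<lparr>carrier :=
     {a \<in> carrier (M_reg p G). norm_map (Zp p) G (M_reg p G) a = \<zero>\<^bsub>M_reg p G\<^esub>}\<rparr>"

text \<open>\<open>{\<int>/p\<^sup>i | \<int>\<^sub>p}\<close>, \<open>{\<int>/p\<^sup>i | A}\<close> and \<open>{\<int>/p\<^sup>i | \<int>\<^sub>p \<oplus> A}\<close>.\<close>

definition M_ext_Zp ::
    "nat \<Rightarrow> ('g, 'd) monoid_scheme \<Rightarrow> 'g \<Rightarrow> nat \<Rightarrow> ('g \<Rightarrow> padic, int \<times> padic) module" where
  "M_ext_Zp p G \<tau> i = tau_mod p G \<tau> (prod_mod (Zmod p i) (self_mod (Zp p)))
     (\<lambda>(t, x). ((t + int p ^ (i - 1) * x i) mod int p ^ i, x))"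

definition M_ext_A ::
    "nat \<Rightarrow> ('g, 'd) monoid_scheme \<Rightarrow> 'g \<Rightarrow> ((nat \<Rightarrow> padic) set \<Rightarrow> int) \<Rightarrow> nat
      \<Rightarrow> ('g \<Rightarrow> padic, int \<times> (nat \<Rightarrow> padic) set) module" where
  "M_ext_A p G \<tau> f i = tau_mod p G \<tau> (prod_mod (Zmod p i) (Zp_zeta_mod p))
     (\<lambda>(t, y). ((t + f y) mod int p ^ i, zeta p \<otimes>\<^bsub>Zp_zeta p\<^esub> y))"

definition M_ext_ZpA ::
    "nat \<Rightarrow> ('g, 'd) monoid_scheme \<Rightarrow> 'g \<Rightarrow> ((nat \<Rightarrow> padic) set \<Rightarrow> int) \<Rightarrow> nat
      \<Rightarrow> ('g \<Rightarrow> padic, int \<times> padic \<times> (nat \<Rightarrow> padic) set) module" where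
  "M_ext_ZpA p G \<tau> f i =
     tau_mod p G \<tau> (prod_mod (Zmod p i) (prod_mod (self_mod (Zp p)) (Zp_zeta_mod p)))
     (\<lambda>(t, x, y). ((t + int p ^ (i - 1) * x i + f y) mod int p ^ i, x, zeta p \<otimes>\<^bsub>Zp_zeta p\<^esub> y))"

text \<open>Names for the entries of the list. The modules themselves have elements of different types, so
  they cannot be members of one HOL list; a decomposition is recorded by the list of its names.\<close>

datatype entry = E_cyc nat | E_F nat int | E_Zp | E_A | E_reg
  | E_ext_Zp nat | E_ext_A nat | E_ext_ZpA nat

fun in_list :: "nat \<Rightarrow> entry \<Rightarrow> bool" where
  "in_list p (E_cyc i) \<longleftrightarrow> i \<ge> 1"
| "in_list p (E_F i w) \<longleftrightarrow> i \<ge> 2 \<and> admissible_unit p i w"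
| "in_list p E_Zp \<longleftrightarrow> True"
| "in_list p E_A \<longleftrightarrow> True"
| "in_list p E_reg \<longleftrightarrow> True"
| "in_list p (E_ext_Zp i) \<longleftrightarrow> i \<ge> 1"
| "in_list p (E_ext_A i) \<longleftrightarrow> i \<ge> 1"
| "in_list p (E_ext_ZpA i) \<longleftrightarrow> i \<ge> 1"

text \<open>\<open>f i\<close> is the map \<open>\<int>\<^sub>p[\<zeta>] \<rightarrow> \<int>/p\<^sup>i\<close> fixed for the construction of the extensions.\<close>

fun iso_to_entry ::
    "nat \<Rightarrow> ('g, 'd) monoid_scheme \<Rightarrow> 'g \<Rightarrow> (nat \<Rightarrow> (nat \<Rightarrow> padic) set \<Rightarrow> int)
      \<Rightarrow> ('g \<Rightarrow> padic, 'm, 'e) module_scheme \<Rightarrow> entry \<Rightarrow> bool" where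
  "iso_to_entry p G \<tau> f N (E_cyc i) \<longleftrightarrow> mod_iso (ZpG p G) N (M_cyc p G \<tau> i)"
| "iso_to_entry p G \<tau> f N (E_F i w) \<longleftrightarrow> mod_iso (ZpG p G) N (M_F p G \<tau> i w)"
| "iso_to_entry p G \<tau> f N E_Zp \<longleftrightarrow> mod_iso (ZpG p G) N (M_Zp p G \<tau>)"
| "iso_to_entry p G \<tau> f N E_A \<longleftrightarrow> mod_iso (ZpG p G) N (M_A p G)"
| "iso_to_entry p G \<tau> f N E_reg \<longleftrightarrow> mod_iso (ZpG p G) N (M_reg p G)"
| "iso_to_entry p G \<tau> f N (E_ext_Zp i) \<longleftrightarrow> mod_iso (ZpG p G) N (M_ext_Zp p G \<tau> i)"
| "iso_to_entry p G \<tau> f N (E_ext_A i) \<longleftrightarrow> mod_iso (ZpG p G) N (M_ext_A p G \<tau> (f i) i)"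
| "iso_to_entry p G \<tau> f N (E_ext_ZpA i) \<longleftrightarrow> mod_iso (ZpG p G) N (M_ext_ZpA p G \<tau> (f i) i)"

definition decomposes_as ::
    "nat \<Rightarrow> ('g, 'd) monoid_scheme \<Rightarrow> 'g \<Rightarrow> (nat \<Rightarrow> (nat \<Rightarrow> padic) set \<Rightarrow> int)
      \<Rightarrow> ('g \<Rightarrow> padic, 'm, 'e) module_scheme \<Rightarrow> entry list \<Rightarrow> bool" where
  "decomposes_as p G \<tau> f M es \<longleftrightarrow> (\<forall>e\<in>set es. in_list p e) \<and>
     (\<exists>Ns. direct_sum (ZpG p G) M Ns \<and>
        list_all2 (\<lambda>N e. iso_to_entry p G \<tau> f (M\<lparr>carrier := N\<rparr>) e) Ns es)"

end

theory Submission
  imports Defs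
begin

text \<open>Put \<open>s = \<tau> - 1\<close> and let \<open>n\<close> be the norm element of \<open>R = \<int>\<^sub>p[G]\<close>. Then \<open>s n = 0\<close>, \<open>R\<close> is local with
maximal ideal \<open>(s, n)\<close>, and \<open>R/s\<close>, \<open>R/n\<close> are discrete valuation rings with uniformisers \<open>n\<close>, \<open>s\<close>.
These properties alone (a nodal ring) are used: the torsion is generated by one \<open>t\<close>, and over it a
minimal system of generators can be chosen of three kinds (free, killed by \<open>s\<close> or killed by \<open>n\<close>
modulo torsion). Row operations, which are symmetric in \<open>s\<close> and \<open>n\<close>, concentrate the relations with
\<open>t\<close> in at most one generator killed by \<open>s\<close> and one killed by \<open>n\<close>. Each entry of the list is thus
characterised by a presentation with generators \<open>t\<close>, \<open>x\<close>, \<open>y\<close>. Uniqueness follows by counting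
dimensions of Tate cohomology and of quotients attached to the torsion, which are additive over direct
sums; cohomology of a cyclic group is \<open>ker s / im n\<close> and \<open>ker n / im s\<close>.\<close>


text \<open>The torsion submodule \<open>T\<close>, generated by \<open>t\<close>, breaks the
  symmetry: \<open>n\<close> acts on it as \<open>p\<close>, whereas \<open>s\<close> acts as zero
  or, for F_i, as \<open>c p^(i-1)\<close> with \<open>0 < c < p\<close>. If \<open>x\<close> is
  killed by \<open>s\<close> modulo \<open>T\<close>, then \<open>s x\<close> is killed by
  \<open>n\<close>, hence lies in the socle of \<open>T\<close>, and it may be changed by
  \<open>s T\<close>. If \<open>y\<close> is killed by \<open>n\<close> modulo \<open>T\<close>,
  then \<open>n y\<close> is killed by \<open>s\<close>, and it may be changed by
  \<open>n T\<close>. In F_i the socle is \<open>s T\<close>, and the elements killed by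
  \<open>s\<close> form \<open>n T\<close>; both obstructions vanish and F_i splits off. For trivial
  action each obstruction space is one-dimensional over the residue field. Its nonzero class is
  normalised to \<open>s x = n^(i-1) t\<close>, respectively \<open>n y = t\<close>, and the
  presence or absence of \<open>x\<close> and of \<open>y\<close> gives the four entries whose
  torsion has trivial action. The obstacle is to find generators that are independent modulo
  \<open>T\<close>. This is the purpose of a weight: a relation that is not a consequence of the
  kinds of the generators would allow a system of smaller weight.\<close>

section \<open>Nodal rings\<close>

text \<open>Abstract form of two discrete valuation rings R/s and R/n glued along their residue
  field. \<open>sep_s\<close> and \<open>sep_n\<close> express that each quotient is separated for
  the powers of the other element; \<open>ann_s\<close> and \<open>ann_n\<close> make each of the
  ideals sR and nR the annihilator of the other element. The axioms are invariant under exchanging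
  \<open>s\<close> and \<open>n\<close>, so that only one half of each dual pair of results has to
  be proved.\<close>

locale nodal_ring = cring R for R (structure) +
fixes s n :: 'a
assumes s_closed [simp, intro]: "s : carrier R" and n_closed [simp, intro]: "n : carrier R"
 and sn [simp]: "s \<otimes> n = \<zero>"
 and local: "r : carrier R ==>
 r : Units R \<or> (EX a:carrier R. EX b:carrier R. r = s \<otimes> a \<oplus> n \<otimes> b)"
 and proper: "[|a : carrier R; b : carrier R|] ==> s \<otimes> a \<oplus> n \<otimes> b ~= \<one>"
 and sep_s: "[|r : carrier R;
  !!k::nat. EX a:carrier R. EX b:carrier R. r = n [^] k \<otimes> a \<oplus> s \<otimes> b|]
 ==> EX b:carrier R. r = s \<otimes> b"
 and sep_n: "[|r : carrier R;
  !!k::nat. EX a:carrier R. EX b:carrier R. r = s [^] k \<otimes> a \<oplus> n \<otimes> b|]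
 ==> EX b:carrier R. r = n \<otimes> b"
 and ann_s: "[|r : carrier R; s \<otimes> r = \<zero>|] ==> EX b:carrier R. r = n \<otimes> b"
 and ann_n: "[|r : carrier R; n \<otimes> r = \<zero>|] ==> EX b:carrier R. r = s \<otimes> b"
 and n_pow: "n [^] (k::nat) ~= \<zero>" and s_pow: "s [^] (k::nat) ~= \<zero>"
begin

abbreviation RR where "RR \<equiv> carrier R"

lemma ns [simp]: "n \<otimes> s = \<zero>"
by (subst m_comm) simp_all

lemma swap: "nodal_ring R n s"
proof (intro nodal_ring.intro nodal_ring_axioms.intro)
show "cring R" by unfold_locales
show "n : RR" "s : RR" "n \<otimes> s = \<zero>" by simp_all
next
fix r assume "r : RR"
then show "r : Units R \<or> (EX a:RR. EX b:RR. r = n \<otimes> a \<oplus> s \<otimes> b)"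
 using local[of r] by (metis a_comm m_closed n_closed s_closed)
next
fix a b assume "a : RR" "b : RR"
then show "n \<otimes> a \<oplus> s \<otimes> b ~= \<one>"
 using proper[of b a] by (metis a_comm m_closed n_closed s_closed)
next
fix r assume "r : RR"
 "!!k::nat. EX a:RR. EX b:RR. r = s [^] k \<otimes> a \<oplus> n \<otimes> b"
then show "EX b:RR. r = n \<otimes> b" by (rule sep_n)
next
fix r assume "r : RR"
 "!!k::nat. EX a:RR. EX b:RR. r = n [^] k \<otimes> a \<oplus> s \<otimes> b"
then show "EX b:RR. r = s \<otimes> b" by (rule sep_s)
qed (rule ann_n ann_s n_pow s_pow; assumption?)+

definition "mx = {s \<otimes> a \<oplus> n \<otimes> b | a b. a : RR & b : RR}"

lemma mx_iff: "r : RR ==> r : mx \<longleftrightarrow> r ~: Units R"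
proof
assume r: "r : RR" "r : mx"
then obtain a b where ab: "a : RR" "b : RR" "r = s \<otimes> a \<oplus> n \<otimes> b"
 by (auto simp: mx_def)
show "r ~: Units R"
proof
 assume u: "r : Units R"
 have "\<one> = s \<otimes> (a \<otimes> inv r) \<oplus> n \<otimes> (b \<otimes> inv r)"
 proof -
 have "\<one> = (s \<otimes> a \<oplus> n \<otimes> b) \<otimes> inv r" using ab(3) Units_r_inv[OF u] by simp
 then show ?thesis using ab u by (simp only: l_distr m_assoc s_closed n_closed m_closed Units_inv_closed)
 qed
 then show False using proper[of "a \<otimes> inv r" "b \<otimes> inv r"] ab u by simp
qed
next
assume "r : RR" "r ~: Units R"
then show "r : mx" using local[of r] by (auto simp: mx_def)
qed

lemma mxE:
assumes "r : RR" "r ~: Units R"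
obtains a b where "a : RR" "b : RR" "r = s \<otimes> a \<oplus> n \<otimes> b"
using local[OF assms(1)] assms(2) by blast

lemma pow_n_s: "k > 0 ==> n [^] (k::nat) \<otimes> s = \<zero>"
by (cases k) (simp_all add: m_assoc)

text \<open>The valuation of R/s for a whole family: \<open>k\<close> is the least valuation of a
  member, so after division by \<open>n^k\<close> some quotient is a unit. The member that is
  nonzero modulo \<open>s\<close> keeps \<open>k\<close> finite.\<close>

lemma family_dvr:
assumes I: "r : I \<rightarrow> RR" "i : I" "!!b. b : RR ==> r i ~= s \<otimes> b"
obtains k a b where "a : I \<rightarrow> RR" "b : I \<rightarrow> RR"
 "!!j. j : I ==> r j = n [^] (k::nat) \<otimes> a j \<oplus> s \<otimes> b j"
 "EX j:I. a j : Units R"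
proof -
define P where "P k \<longleftrightarrow> (ALL j:I. EX a:RR. EX b:RR. r j = n [^] (k::nat) \<otimes> a \<oplus> s \<otimes> b)"
 for k
have "\<exists>k. ~ P k" using sep_s[of "r i"] I unfolding P_def by (metis Pi_mem)
then have nP: "~ P (LEAST k. ~ P k)" by (rule LeastI_ex)
have P0: "P 0" unfolding P_def
proof
 fix j assume "j : I"
 then have "r j = n [^] (0::nat) \<otimes> r j \<oplus> s \<otimes> \<zero>" "r j : RR"
 using Pi_mem[OF I(1)] by simp_all
 then show "EX a:RR. EX b:RR. r j = n [^] (0::nat) \<otimes> a \<oplus> s \<otimes> b" by blast
qed
then obtain k where k: "(LEAST k. ~ P k) = Suc k" using nP by (metis not0_implies_Suc)
have "P k" using not_less_Least[of k "%k. ~ P k"] k by auto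
then obtain a b where ab: "!!j. j : I ==> a j : RR"
 "!!j. j : I ==> b j : RR"
 "!!j. j : I ==> r j = n [^] k \<otimes> a j \<oplus> s \<otimes> b j"
 unfolding P_def by metis
have "EX j:I. a j : Units R"
proof (rule ccontr)
 assume c: "~ ?thesis"
 \<comment> \<open>If no quotient were a unit, each would lie in the maximal ideal; its
   \<open>n\<close> part supplies one more factor \<open>n\<close>, and its \<open>s\<close> part is
   absorbed by the multiple of \<open>s\<close>.\<close>
 have "P (Suc k)" unfolding P_def
 proof
 fix j assume j: "j : I"
 then obtain c d where cd: "c : RR" "d : RR" "a j = s \<otimes> c \<oplus> n \<otimes> d"
  using c ab mxE by metis
 have "r j = n [^] Suc k \<otimes> d \<oplus> s \<otimes> (n [^] k \<otimes> c \<oplus> b j)"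
  using ab[OF j] cd by (simp add: r_distr m_ac a_ac)
 then show "EX a:RR. EX b:RR. r j = n [^] Suc k \<otimes> a \<oplus> s \<otimes> b"
  using cd ab j by blast
 qed
 then show False using nP k by simp
qed
then show ?thesis using that[of a b k] ab by blast
qed

lemma dvr:
assumes "r : RR" "!!b. b : RR ==> r ~= s \<otimes> b"
shows "\<exists>k u b. u : Units R & b : RR & r = n [^] (k::nat) \<otimes> u \<oplus> s \<otimes> b"
proof -
show ?thesis
proof (rule family_dvr[of "%_. r" "{0::nat}" 0])
 fix k a b
 assume "a : {0::nat} \<rightarrow> RR" "b : {0::nat} \<rightarrow> RR"
 "!!j. j : {0::nat} ==> r = n [^] (k::nat) \<otimes> a j \<oplus> s \<otimes> b j" "EX j:{0::nat}. a j : Units R"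
 then show ?thesis by auto
qed (use assms in auto)
qed

text \<open>That is, \<open>n\<close> is regular modulo \<open>s\<close>. Otherwise
  \<open>r = n^k u + s c\<close> with a unit \<open>u\<close>. A second factor \<open>n\<close>
  kills \<open>s b\<close>, so \<open>n^(k+2) u = 0\<close>, although no power of \<open>n\<close>
  vanishes.\<close>

lemma n_mult_s:
assumes r: "r : RR" and "b : RR" "n \<otimes> r = s \<otimes> b"
shows "EX b:RR. r = s \<otimes> b"
proof (rule ccontr)
assume "~ ?thesis"
then obtain k u c where u: "u : Units R" "c : RR" "r = n [^] (k::nat) \<otimes> u \<oplus> s \<otimes> c"
 using dvr[OF r] by blast
have "n \<otimes> (n \<otimes> r) = n \<otimes> (s \<otimes> b)" using assms by simp
also have "\<dots> = (n \<otimes> s) \<otimes> b" using assms by (simp only: m_assoc n_closed s_closed)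
also have "\<dots> = \<zero>" using assms by simp
finally have e: "n \<otimes> (n \<otimes> r) = \<zero>" .
have z: "n \<otimes> (s \<otimes> c) = \<zero>" using u by (simp add: m_assoc[symmetric])
have "n \<otimes> (n \<otimes> r) = n [^] Suc (Suc k) \<otimes> u"
 using u Units_closed[OF u(1)] z by (simp add: r_distr m_ac)
then have "n [^] Suc (Suc k) \<otimes> u \<otimes> inv u = \<zero>" using e u by simp
moreover have "n [^] Suc (Suc k) \<otimes> u \<otimes> inv u = n [^] Suc (Suc k)"
 using Units_r_inv[OF u(1)] Units_closed[OF u(1)] Units_inv_closed[OF u(1)]
 by (simp only: m_assoc n_closed nat_pow_closed r_one)
ultimately show False using n_pow by metis
qed

text \<open>As \<open>n b\<close> is a multiple of \<open>s\<close>, so is \<open>b\<close>, and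
  then \<open>n b = 0\<close>: the two branches of the node meet only in zero.\<close>

lemma s_int_n:
assumes "a : RR" "b : RR" "s \<otimes> a = n \<otimes> b"
shows "s \<otimes> a = \<zero>"
proof -
obtain c where "c : RR" "b = s \<otimes> c" using n_mult_s[of b a] assms by auto
then show ?thesis using assms by (simp add: m_assoc[symmetric])
qed

end

section \<open>Minimal systems of generators modulo a submodule\<close>

text \<open>Modulo \<open>T\<close>, a generator of kind \<open>KX\<close> is killed by
  \<open>s\<close> and one of kind \<open>KY\<close> by \<open>n\<close>, while \<open>KZ\<close>
  carries no condition. In a minimal system they span copies of R/s, R/n and R modulo
  \<open>T\<close>.\<close>

datatype kind = KX | KY | KZ

definition span_over ::
"('r, 'c) ring_scheme => ('r, 'm, 'd) module_scheme => 'm set => nat set => (nat => 'm) => 'm set" where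
"span_over R M T I v =
 {t \<oplus>\<^bsub>M\<^esub> (\<Oplus>\<^bsub>M\<^esub>j\<in>I. r j \<odot>\<^bsub>M\<^esub> v j) | t r. t : T & r : I \<rightarrow> carrier R}"

definition gsys ::
"('r, 'c) ring_scheme => ('r, 'm, 'd) module_scheme => 'r => 'r => 'm set
 => nat set => (nat => 'm) => (nat => kind) => bool" where
"gsys R M s n T I v k \<longleftrightarrow> finite I & v : I \<rightarrow> carrier M &
 (ALL j:I. (k j = KX --> s \<odot>\<^bsub>M\<^esub> v j : T) & (k j = KY --> n \<odot>\<^bsub>M\<^esub> v j : T)) &
 span_over R M T I v = carrier M"

text \<open>A \<open>KZ\<close> generator counts twice, since R has both R/s and R/n as quotients.
  Thus the weight drops not only when a generator is removed but also when a free one is replaced by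
  one with a relation.\<close>

definition weight :: "nat set => (nat => kind) => nat" where
"weight I k = (\<Sum>j\<in>I. if k j = KZ then 2 else 1)"

definition min_gsys ::
"('r, 'c) ring_scheme => ('r, 'm, 'd) module_scheme => 'r => 'r => 'm set
 => nat set => (nat => 'm) => (nat => kind) => bool" where
"min_gsys R M s n T I v k \<longleftrightarrow> gsys R M s n T I v k &
 (\<forall>I' v' k'. gsys R M s n T I' v' k' --> weight I k <= weight I' k')"

lemma span_overI:
"[|t : T; r : I \<rightarrow> carrier R; x = t \<oplus>\<^bsub>M\<^esub> (\<Oplus>\<^bsub>M\<^esub>j\<in>I. r j \<odot>\<^bsub>M\<^esub> v j)|]
 ==> x : span_over R M T I v"
unfolding span_over_def by blast

locale nodal_module = R?: nodal_ring R s n + M?: module R M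
for R (structure) and s n and M (structure)
begin

text \<open>ASCII operators abbreviate the module operations here and, with suffixes \<open>:\<close>, \<open>|\<close>, \<open>@\<close>,
the operations of the group ring, of the p-adic integers and of the group further below.\<close>

abbreviation MM where "MM \<equiv> carrier M"
abbreviation smult_M (infixl "**" 70) where "a ** x \<equiv> a \<odot>\<^bsub>M\<^esub> x"
abbreviation add_M (infixl "+." 65) where "x +. y \<equiv> x \<oplus>\<^bsub>M\<^esub> y"
abbreviation minus_M (infixl "-." 65) where "x -. y \<equiv> x \<ominus>\<^bsub>M\<^esub> y"
abbreviation neg_M ("-. _" [81] 80) where "-. x \<equiv> \<ominus>\<^bsub>M\<^esub> x"
abbreviation zero_M ("\<theta>") where "\<theta> \<equiv> \<zero>\<^bsub>M\<^esub>"

lemma swap_module: "nodal_module R n s M"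
using R.swap module_axioms by (simp add: nodal_module_def)

lemma lc_closed [simp]:
"[|r : I \<rightarrow> RR; v : I \<rightarrow> MM|] ==> (\<Oplus>\<^bsub>M\<^esub>j\<in>I. r j ** v j) : MM"
by (rule M.finsum_closed) auto

lemma sub_add: "[|submodule S R M; x : S; y : S|] ==> x +. y : S"
using submoduleE(5) by blast
lemma sub_smult: "[|submodule S R M; r : RR; y : S|] ==> r ** y : S"
using submoduleE(4) by blast
lemma sub_neg: "[|submodule S R M; y : S|] ==> -. y : S"
using submoduleE(3) by blast
lemma sub_carrier: "[|submodule S R M; y : S|] ==> y : MM"
using submoduleE(1) by blast
lemma sub_zero: "submodule S R M ==> \<theta> : S"
using subgroup.one_closed[OF submodule.axioms(1)] by fastforce

lemma sub_finsum:
assumes "submodule S R M" "!!j. j : I ==> f j : S"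
shows "finsum M f I : S"
proof (cases "finite I")
case True
then show ?thesis using assms(2)
proof (induction I)
 case empty
 then show ?case using sub_zero[OF assms(1)] by simp
next
 case (insert i I)
 then have "f : I \<rightarrow> MM" "f i : MM"
 using sub_carrier[OF assms(1)] by auto
 then show ?case using insert sub_add[OF assms(1)] by simp
qed
next
case False
then show ?thesis using sub_zero[OF assms(1)] by (simp add: finsum_infinite)
qed

lemma sub_cancel:
assumes S: "submodule S R M" and x: "x : MM" "x +. y : S" "y : S"
shows "x : S"
proof -
have y: "y : MM" using S x sub_carrier by blast
have "(x +. y) +. -. y : S" using S x sub_add sub_neg by blast
then show ?thesis using x y by (simp add: M.add.m_assoc M.r_neg)
qed

lemma sub_unit:
assumes S: "submodule S R M" and x: "x : MM" "u : Units R" "u ** x : S"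
shows "x : S"
proof -
have "inv u ** (u ** x) : S" using S x sub_smult by blast
moreover have "inv u ** (u ** x) = x"
 using x Units_l_inv[of u] by (simp add: smult_assoc1[symmetric] Units_closed)
ultimately show ?thesis by simp
qed

lemma lc_add:
assumes "finite I" "a : I \<rightarrow> RR" "b : I \<rightarrow> RR" "v : I \<rightarrow> MM"
shows "(\<Oplus>\<^bsub>M\<^esub>j\<in>I. (a j \<oplus> b j) ** v j)
 = (\<Oplus>\<^bsub>M\<^esub>j\<in>I. a j ** v j) +. (\<Oplus>\<^bsub>M\<^esub>j\<in>I. b j ** v j)"
proof -
have "(\<Oplus>\<^bsub>M\<^esub>j\<in>I. (a j \<oplus> b j) ** v j)
 = (\<Oplus>\<^bsub>M\<^esub>j\<in>I. a j ** v j +. b j ** v j)"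
 using assms by (intro M.finsum_cong') (auto simp: smult_l_distr Pi_iff)
also have "\<dots> = (\<Oplus>\<^bsub>M\<^esub>j\<in>I. a j ** v j) +. (\<Oplus>\<^bsub>M\<^esub>j\<in>I. b j ** v j)"
 using assms by (intro M.finsum_addf) (auto simp: Pi_iff)
finally show ?thesis .
qed

lemma lc_smult:
assumes "finite I" "a : I \<rightarrow> RR" "c : RR" "v : I \<rightarrow> MM"
shows "(\<Oplus>\<^bsub>M\<^esub>j\<in>I. (c \<otimes> a j) ** v j) = c ** (\<Oplus>\<^bsub>M\<^esub>j\<in>I. a j ** v j)"
proof -
have "(\<Oplus>\<^bsub>M\<^esub>j\<in>I. (c \<otimes> a j) ** v j) = (\<Oplus>\<^bsub>M\<^esub>j\<in>I. c ** (a j ** v j))"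
 using assms by (intro M.finsum_cong') (auto simp: smult_assoc1 Pi_iff)
also have "\<dots> = c ** (\<Oplus>\<^bsub>M\<^esub>j\<in>I. a j ** v j)"
 using assms by (intro finsum_smult_ldistr[symmetric]) (auto simp: Pi_iff)
finally show ?thesis .
qed

lemma lc_zero: "v : I \<rightarrow> MM ==> (\<Oplus>\<^bsub>M\<^esub>j\<in>I. \<zero> ** v j) = \<theta>"
by (intro M.add.finprod_one_eqI) (auto simp: Pi_iff)

lemma lc_delta:
assumes "finite I" "i : I" "v : I \<rightarrow> MM"
shows "(\<Oplus>\<^bsub>M\<^esub>j\<in>I. (if j = i then \<one> else \<zero>) ** v j) = v i"
proof -
have "(\<Oplus>\<^bsub>M\<^esub>j\<in>I. (if j = i then \<one> else \<zero>) ** v j)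
 = (\<Oplus>\<^bsub>M\<^esub>j\<in>I. if i = j then v j else \<theta>)"
 using assms by (intro M.finsum_cong') (auto simp: Pi_iff)
then show ?thesis using assms by (simp add: M.finsum_singleton)
qed

context
fixes T I and v :: "nat => 'c"
assumes T: "submodule T R M" and I: "finite I" and v: "v : I \<rightarrow> MM"
begin

lemma span_submodule: "submodule (span_over R M T I v) R M"
proof (rule submoduleI)
show "span_over R M T I v <= MM"
 using T v sub_carrier by (auto simp: span_over_def)
have "\<theta> = \<theta> +. (\<Oplus>\<^bsub>M\<^esub>j\<in>I. \<zero> ** v j)"
 by (subst lc_zero) (use v in auto)
then show "\<theta> : span_over R M T I v"
 by (intro span_overI[OF sub_zero[OF T], of "%_. \<zero>"]) auto
next
fix a r assume a: "r : RR" "a : span_over R M T I v"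
then obtain t c where tc: "t : T" "c : I \<rightarrow> RR" "a = t +. (\<Oplus>\<^bsub>M\<^esub>j\<in>I. c j ** v j)"
 by (auto simp: span_over_def)
have "r ** a = r ** t +. (\<Oplus>\<^bsub>M\<^esub>j\<in>I. (r \<otimes> c j) ** v j)"
 using tc a v I T sub_carrier by (simp add: lc_smult smult_r_distr)
moreover have "(%j. r \<otimes> c j) : I \<rightarrow> RR" using tc a by auto
ultimately show "r ** a : span_over R M T I v"
 using tc a sub_smult[OF T] by (intro span_overI[where t = "r ** t"])
next
fix a b assume a: "a : span_over R M T I v" and b: "b : span_over R M T I v"
then obtain t c t' c' where tc: "t : T" "c : I \<rightarrow> RR" "a = t +. (\<Oplus>\<^bsub>M\<^esub>j\<in>I. c j ** v j)"
 "t' : T" "c' : I \<rightarrow> RR" "b = t' +. (\<Oplus>\<^bsub>M\<^esub>j\<in>I. c' j ** v j)"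
 by (auto simp: span_over_def)
have "a +. b = (t +. t') +. (\<Oplus>\<^bsub>M\<^esub>j\<in>I. (c j \<oplus> c' j) ** v j)"
 using tc v I T sub_carrier by (simp add: lc_add M.add.m_ac)
moreover have "(%j. c j \<oplus> c' j) : I \<rightarrow> RR" using tc by auto
ultimately show "a +. b : span_over R M T I v"
 using tc sub_add[OF T] by (intro span_overI[where t = "t +. t'"])
next
fix a assume a: "a : span_over R M T I v"
then obtain t c where tc: "t : T" "c : I \<rightarrow> RR" "a = t +. (\<Oplus>\<^bsub>M\<^esub>j\<in>I. c j ** v j)"
 by (auto simp: span_over_def)
have l: "(\<Oplus>\<^bsub>M\<^esub>j\<in>I. c j ** v j) : MM" using tc v by simp
have "-. a = -. t +. (\<ominus> \<one>) ** (\<Oplus>\<^bsub>M\<^esub>j\<in>I. c j ** v j)"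
 using tc l sub_carrier[OF T] by (simp add: smult_l_minus M.minus_add)
then have "-. a = -. t +. (\<Oplus>\<^bsub>M\<^esub>j\<in>I. (\<ominus> \<one> \<otimes> c j) ** v j)"
 using tc v I by (simp add: lc_smult)
moreover have "(%j. \<ominus> \<one> \<otimes> c j) : I \<rightarrow> RR" using tc by auto
ultimately show "-. a : span_over R M T I v"
 using tc sub_neg[OF T] by (intro span_overI[where t = "-. t"])
qed

lemma span_T: "T <= span_over R M T I v"
proof
fix t assume t: "t : T"
have "t = t +. (\<Oplus>\<^bsub>M\<^esub>j\<in>I. \<zero> ** v j)"
 by (subst lc_zero) (use v t sub_carrier[OF T] in auto)
then show "t : span_over R M T I v" by (intro span_overI[OF t, of "%_. \<zero>"]) auto
qed

lemma span_v: "i : I ==> v i : span_over R M T I v"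
proof -
assume i: "i : I"
have "v i = \<theta> +. (\<Oplus>\<^bsub>M\<^esub>j\<in>I. (if j = i then \<one> else \<zero>) ** v j)"
 using lc_delta[OF I i v] Pi_mem[OF v i] by simp
moreover have "(%j. if j = i then \<one> else \<zero>) : I \<rightarrow> RR" by auto
ultimately show "v i : span_over R M T I v"
 by (intro span_overI[OF sub_zero[OF T]])
qed

lemma span_least:
assumes "submodule S R M" "T <= S" "!!j. j : I ==> v j : S"
shows "span_over R M T I v <= S"
using assms by (fastforce simp: span_over_def Pi_iff intro!: sub_add sub_finsum sub_smult)

end

lemma smult_s_n [simp]: "x : MM ==> s ** (n ** x) = \<theta>"
by (simp add: smult_assoc1[symmetric])
lemma smult_n_s [simp]: "x : MM ==> n ** (s ** x) = \<theta>"
by (simp add: smult_assoc1[symmetric])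

lemma smult_comm:
"[|a : RR; b : RR; x : MM|] ==> a ** (b ** x) = b ** (a ** x)"
by (metis smult_assoc1 m_comm)

end

lemma weight_less_drop:
"[|finite I; i : I|] ==> weight (I - {i}) k < weight I k"
by (simp add: weight_def sum.remove[of I i])

lemma weight_less_upd:
"[|finite I; i : I; k i = KZ; l ~= KZ|] ==> weight I (k(i := l)) < weight I k"
by (simp add: weight_def sum.remove[of I i] cong: sum.cong_simp)

text \<open>\<open>T_sat\<close> says that M/T has no nonzero element killed by the maximal ideal.
  It is the only property of the torsion submodule that enters the choice of generators.\<close>

locale nodal_over = nodal_module R s n M
for R (structure) and s n and M (structure) +
fixes T :: "'c set"
assumes T: "submodule T R M"
 and T_sat: "[|x : carrier M; s \<odot>\<^bsub>M\<^esub> x : T; n \<odot>\<^bsub>M\<^esub> x : T|] ==> x : T"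
begin

lemma swap_over: "nodal_over R n s M T"
using swap_module T T_sat by (simp add: nodal_over_def nodal_over_axioms_def)

text \<open>Saturation removes one factor \<open>n\<close> at a time: the element with one factor
  fewer is sent into \<open>T\<close> by \<open>n\<close> and, since \<open>s x\<close> is in
  \<open>T\<close>, by \<open>s\<close> as well.\<close>

lemma T_pow:
"[|x : MM; s ** x : T; n [^] (q::nat) ** x : T|] ==> x : T"
proof (induction q)
case (Suc q)
let ?y = "n [^] q ** x"
have "n ** ?y = n [^] Suc q ** x"
 using Suc.prems(1) by (simp add: smult_assoc1 smult_comm)
moreover have "s ** ?y = n [^] q ** (s ** x)" using Suc.prems(1) by (simp add: smult_comm)
ultimately have "?y : T"
 using Suc.prems T_sat[of ?y] sub_smult[OF T _ Suc.prems(2), of "n [^] q"] by simp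
then show ?case using Suc.IH Suc.prems by blast
qed simp

lemma finsum_split:
assumes "finite I" "J <= I" "f : I \<rightarrow> MM"
shows "finsum M f I = finsum M f J +. finsum M f (I - J)"
proof -
have "finsum M f (J \<union> (I - J)) = finsum M f J +. finsum M f (I - J)"
 using assms by (intro M.finsum_Un_disjoint) (auto intro: finite_subset)
moreover have "J \<union> (I - J) = I" using assms by auto
ultimately show ?thesis by simp
qed

lemma finsum_remove:
assumes "finite I" "i : I" "f : I \<rightarrow> MM"
shows "finsum M f I = f i +. finsum M f (I - {i})"
using finsum_split[of I "{i}" f] assms by (simp add: Pi_iff)

text \<open>A coefficient outside sR contradicts minimality. Multiplication by \<open>n\<close>
  sends the \<open>KY\<close> terms into \<open>T\<close> and replaces free generators
  \<open>v\<close> by \<open>n v\<close>, which are killed by \<open>s\<close>; the relation then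
  lives over the valuation ring R/s. Dividing by the common power of \<open>n\<close> leaves a
  relation with a unit coefficient, and this unit makes the system lighter.\<close>

lemma coeff_not_KY:
assumes min: "min_gsys R M s n T I v k" and r: "r : I \<rightarrow> RR"
 and rel: "(\<Oplus>\<^bsub>M\<^esub>j\<in>I. r j ** v j) : T" and i: "i : I" "k i ~= KY"
shows "EX b:RR. r i = s \<otimes> b"
proof (rule ccontr)
assume neg: "~ ?thesis"
have sys: "gsys R M s n T I v k" using min by (simp add: min_gsys_def)
have I: "finite I" and v: "v : I \<rightarrow> MM"
 and KX: "!!j. [|j : I; k j = KX|] ==> s ** v j : T"
 and KY: "!!j. [|j : I; k j = KY|] ==> n ** v j : T"
 and span: "span_over R M T I v = MM"
 using sys by (auto simp: gsys_def)
have v': "!!j. j : I ==> v j : MM" and r': "!!j. j : I ==> r j : RR"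
 using v r by auto
note TM = sub_carrier[OF T]
define I' where "I' = {j : I. k j ~= KY}"
define e where "e j = (if k j = KZ then r j else n \<otimes> r j)" for j
define w where "w j = (if k j = KZ then n ** v j else v j)" for j
have I'I: "I' <= I" and fI': "finite I'" using I by (auto simp: I'_def)
have k': "k j = KX \<or> k j = KZ" if "j : I'" for j using that by (cases "k j") (auto simp: I'_def)
have e: "e : I' \<rightarrow> RR" and w: "w : I' \<rightarrow> MM"
 using I'I r' v' by (auto simp: e_def w_def)
have w': "!!j. j : I' ==> w j : MM" using w by auto
have sw: "s ** w j : T" if "j : I'" for j
 using that k'[OF that] KX[of j] I'I v' sub_zero[OF T] by (auto simp: w_def)
have 1: "(\<Oplus>\<^bsub>M\<^esub>j\<in>I'. e j ** w j) : T"
proof -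
 have "n ** (\<Oplus>\<^bsub>M\<^esub>j\<in>I. r j ** v j) : T" using sub_smult[OF T _ rel] by simp
 then have "(\<Oplus>\<^bsub>M\<^esub>j\<in>I. (n \<otimes> r j) ** v j) : T" using I r v by (simp add: lc_smult)
 then have "(\<Oplus>\<^bsub>M\<^esub>j\<in>I'. (n \<otimes> r j) ** v j) +. (\<Oplus>\<^bsub>M\<^esub>j\<in>I - I'. (n \<otimes> r j) ** v j) : T"
 using finsum_split[OF I I'I, of "%j. (n \<otimes> r j) ** v j"] r' v' by (simp add: Pi_iff)
 moreover have "(\<Oplus>\<^bsub>M\<^esub>j\<in>I - I'. (n \<otimes> r j) ** v j) : T"
 proof (rule sub_finsum[OF T])
 fix j assume j: "j : I - I'"
 then have "(n \<otimes> r j) ** v j = r j ** (n ** v j)"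
  using r' v' by (simp add: smult_assoc1 smult_comm)
 then show "(n \<otimes> r j) ** v j : T" using j KY r' sub_smult[OF T] by (auto simp: I'_def)
 qed
 moreover have "(\<Oplus>\<^bsub>M\<^esub>j\<in>I'. (n \<otimes> r j) ** v j) : MM"
 using I'I r' v' by (intro M.finsum_closed) auto
 ultimately have "(\<Oplus>\<^bsub>M\<^esub>j\<in>I'. (n \<otimes> r j) ** v j) : T" using sub_cancel[OF T] by blast
 moreover have "(\<Oplus>\<^bsub>M\<^esub>j\<in>I'. (n \<otimes> r j) ** v j) = (\<Oplus>\<^bsub>M\<^esub>j\<in>I'. e j ** w j)"
 using I'I r' v' e w by (intro M.finsum_cong') (auto simp: e_def w_def smult_assoc1 smult_comm)
 ultimately show ?thesis by simp
qed
\<comment> \<open>The factor \<open>n\<close> introduced for generators of kind \<open>KX\<close>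
  does no harm because \<open>n\<close> is regular modulo \<open>s\<close>.\<close>
have ei: "e i ~= s \<otimes> b" if "b : RR" for b
 using that neg n_mult_s[of "r i"] r' i by (auto simp: e_def)
have iI: "i : I'" using i by (simp add: I'_def)
obtain q a b where a: "a : I' \<rightarrow> RR" and b: "b : I' \<rightarrow> RR"
 and eab: "!!j. j : I' ==> e j = n [^] (q::nat) \<otimes> a j \<oplus> s \<otimes> b j"
 and au: "EX j:I'. a j : Units R"
 using family_dvr[OF e iI ei] by metis
have a': "!!j. j : I' ==> a j : RR" and b': "!!j. j : I' ==> b j : RR"
 using a b by auto
define L where "L = (\<Oplus>\<^bsub>M\<^esub>j\<in>I'. a j ** w j)"
have L: "L : MM" using a w by (simp add: L_def)
have sum1: "(\<Oplus>\<^bsub>M\<^esub>j\<in>I'. e j ** w j) = n [^] q ** L +. (\<Oplus>\<^bsub>M\<^esub>j\<in>I'. (s \<otimes> b j) ** w j)"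
proof -
 have "(\<Oplus>\<^bsub>M\<^esub>j\<in>I'. e j ** w j) = (\<Oplus>\<^bsub>M\<^esub>j\<in>I'. (n [^] q \<otimes> a j \<oplus> s \<otimes> b j) ** w j)"
 using eab a' b' w' by (intro M.finsum_cong') auto
 also have "\<dots> = (\<Oplus>\<^bsub>M\<^esub>j\<in>I'. (n [^] q \<otimes> a j) ** w j) +. (\<Oplus>\<^bsub>M\<^esub>j\<in>I'. (s \<otimes> b j) ** w j)"
 using a' b' w by (intro lc_add[OF fI']) auto
 also have "(\<Oplus>\<^bsub>M\<^esub>j\<in>I'. (n [^] q \<otimes> a j) ** w j) = n [^] q ** L"
 unfolding L_def using a w by (intro lc_smult[OF fI']) auto
 finally show ?thesis .
qed
have "(\<Oplus>\<^bsub>M\<^esub>j\<in>I'. (s \<otimes> b j) ** w j) : T"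
proof (rule sub_finsum[OF T])
 fix j assume j: "j : I'"
 then have "(s \<otimes> b j) ** w j = b j ** (s ** w j)"
 using b' w' by (simp add: smult_assoc1 smult_comm)
 then show "(s \<otimes> b j) ** w j : T" using sub_smult[OF T b'[OF j] sw[OF j]] by simp
qed
then have nL: "n [^] q ** L : T" using sub_cancel[OF T, of "n [^] q ** L"] 1 sum1 L by simp
have "s ** L = (\<Oplus>\<^bsub>M\<^esub>j\<in>I'. (s \<otimes> a j) ** w j)"
 unfolding L_def using a w by (intro lc_smult[OF fI', symmetric]) auto
moreover have "(\<Oplus>\<^bsub>M\<^esub>j\<in>I'. (s \<otimes> a j) ** w j) : T"
proof (rule sub_finsum[OF T])
 fix j assume j: "j : I'"
 then have "(s \<otimes> a j) ** w j = a j ** (s ** w j)"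
 using a' w' by (simp add: smult_assoc1 smult_comm)
 then show "(s \<otimes> a j) ** w j : T" using sub_smult[OF T a'[OF j] sw[OF j]] by simp
qed
\<comment> \<open>Saturation cancels the power \<open>n^q\<close>: \<open>L\<close> is sent into
  \<open>T\<close> by \<open>n^q\<close> and by \<open>s\<close>.\<close>
ultimately have LT: "L : T" using T_pow[OF L _ nL] by simp
show False
proof (cases "EX j:I'. k j = KX & a j : Units R")
 case True
 then obtain j where j: "j : I'" "k j = KX" "a j : Units R" by auto
 let ?S = "span_over R M T (I - {j}) v"
 have S: "submodule ?S R M" using T I v by (intro span_submodule) auto
 have TS: "T <= ?S" using T I v by (intro span_T) auto
 have vS: "!!l. [|l : I; l ~= j|] ==> v l : ?S" using T I v by (intro span_v) auto
 have "L = a j ** w j +. (\<Oplus>\<^bsub>M\<^esub>l\<in>I' - {j}. a l ** w l)"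
 unfolding L_def using a' w' by (intro finsum_remove[OF fI' j(1)]) auto
 moreover have "(\<Oplus>\<^bsub>M\<^esub>l\<in>I' - {j}. a l ** w l) : ?S"
 using vS I'I a' by (intro sub_finsum[OF S]) (auto simp: w_def intro!: sub_smult[OF S])
 ultimately have "a j ** w j : ?S"
 using sub_cancel[OF S, of "a j ** w j"] LT TS a' w' j by auto
 then have "v j : ?S" using sub_unit[OF S _ j(3), of "v j"] w'[OF j(1)] j(2) by (simp add: w_def)
 then have "span_over R M T I v <= ?S" using vS TS by (intro span_least[OF T I v S]) auto
 then have "gsys R M s n T (I - {j}) v k"
 using I v KX KY span sub_carrier[OF S] by (auto simp: gsys_def)
 then have "weight I k <= weight (I - {j}) k" using min unfolding min_gsys_def by blast
 then show False using weight_less_drop[OF I, of j k] j I'I by auto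
next
 case False
 then obtain j where j: "j : I'" "k j = KZ" "a j : Units R" using au k' by blast
 have "\<exists>c d. c : RR & d : RR & (k l = KX --> a l = s \<otimes> c \<oplus> n \<otimes> d)"
 if "l : I'" for l
 proof (cases "k l = KX")
 case True
 then show ?thesis using mxE[of "a l"] a'[OF that] False that by metis
 qed auto
 then obtain c d where cd: "!!l. l : I' ==> c l : RR" "!!l. l : I' ==> d l : RR"
 "!!l. [|l : I'; k l = KX|] ==> a l = s \<otimes> c l \<oplus> n \<otimes> d l" by metis
 \<comment> \<open>Now the \<open>KX\<close> coefficients of \<open>L\<close> are of the form
   \<open>s c + n d\<close>, and their \<open>s c\<close> parts land in \<open>T\<close>. Hence
   \<open>L\<close> is \<open>n y\<close> modulo \<open>T\<close> for the combination
   \<open>y\<close> with coefficients \<open>g\<close>. As \<open>g j\<close> is a unit,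
   \<open>y\<close> can replace \<open>v j\<close>, with kind \<open>KY\<close> instead of
   \<open>KZ\<close>.\<close>
 define g where "g l = (if k l = KZ then a l else d l)" for l
 define y where "y = (\<Oplus>\<^bsub>M\<^esub>l\<in>I'. g l ** v l)"
 have g: "!!l. l : I' ==> g l : RR" using a' cd by (simp add: g_def)
 have vI': "!!l. l : I' ==> v l : MM" using v' I'I by auto
 have y: "y : MM" unfolding y_def using g vI' by (intro lc_closed) auto
 let ?h = "%l. if k l = KZ then \<theta> else c l ** (s ** v l)"
 have hT: "!!l. l : I' ==> ?h l : T"
 using k' KX I'I cd sub_zero[OF T] sub_smult[OF T] by fastforce
 have "L = (\<Oplus>\<^bsub>M\<^esub>l\<in>I'. (n \<otimes> g l) ** v l +. ?h l)"
 unfolding L_def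
 proof (intro M.finsum_cong' refl)
 fix l assume l: "l : I'"
 show "a l ** w l = (n \<otimes> g l) ** v l +. ?h l"
  using k'[OF l] a'[OF l] vI'[OF l] cd(1,2)[OF l] cd(3)[OF l] M.a_comm
  by (auto simp: w_def g_def smult_assoc1 smult_comm smult_l_distr)
 qed (use g vI' hT TM in auto)
 also have "\<dots> = (\<Oplus>\<^bsub>M\<^esub>l\<in>I'. (n \<otimes> g l) ** v l) +. (\<Oplus>\<^bsub>M\<^esub>l\<in>I'. ?h l)"
 using g vI' hT TM by (intro M.finsum_addf) auto
 also have "(\<Oplus>\<^bsub>M\<^esub>l\<in>I'. (n \<otimes> g l) ** v l) = n ** y"
 unfolding y_def using g vI' by (intro lc_smult[OF fI']) auto
 finally have "n ** y +. (\<Oplus>\<^bsub>M\<^esub>l\<in>I'. ?h l) : T" using LT by simp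
 moreover have "(\<Oplus>\<^bsub>M\<^esub>l\<in>I'. ?h l) : T" by (rule sub_finsum[OF T]) (rule hT)
 ultimately have nyT: "n ** y : T" using sub_cancel[OF T] y by blast
 let ?v = "v(j := y)" and ?k = "k(j := KY)"
 let ?S = "span_over R M T I ?v"
 have jI: "j : I" using j I'I by auto
 have vv: "?v : I \<rightarrow> MM" using v y by auto
 have S: "submodule ?S R M" using T I vv by (intro span_submodule)
 have TS: "T <= ?S" using T I vv by (intro span_T)
 have yS: "y : ?S" using span_v[OF T I vv jI] by simp
 have vS: "!!l. [|l : I; l ~= j|] ==> v l : ?S" using span_v[OF T I vv] by fastforce
 have "y = g j ** v j +. (\<Oplus>\<^bsub>M\<^esub>l\<in>I' - {j}. g l ** v l)"
 unfolding y_def using g vI' by (intro finsum_remove[OF fI' j(1)]) auto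
 moreover have "(\<Oplus>\<^bsub>M\<^esub>l\<in>I' - {j}. g l ** v l) : ?S"
 using vS I'I g by (intro sub_finsum[OF S]) (auto intro!: sub_smult[OF S])
 ultimately have "g j ** v j : ?S"
 using sub_cancel[OF S, of "g j ** v j"] yS g vI' j by auto
 then have "v j : ?S" using sub_unit[OF S, of "v j" "a j"] vI' j by (auto simp: g_def)
 then have "span_over R M T I v <= ?S" using vS TS by (intro span_least[OF T I v S]) auto
 then have "gsys R M s n T I ?v ?k"
 using I vv KX KY span sub_carrier[OF S] nyT by (auto simp: gsys_def)
 then have "weight I k <= weight I ?k" using min unfolding min_gsys_def by blast
 then show False using weight_less_upd[of I j k KY] I jI j(2) by simp
qed
qed

end

fun kswap :: "kind => kind" where
"kswap KX = KY" | "kswap KY = KX" | "kswap KZ = KZ"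

lemma kswap_simps [simp]: "kswap k = KX \<longleftrightarrow> k = KY" "kswap k = KY \<longleftrightarrow> k = KX" "kswap k = KZ \<longleftrightarrow> k = KZ"
"kswap (kswap k) = k"
by (cases k; simp)+

lemma gsys_swap: "gsys R M n s T I v (kswap \<circ> k) \<longleftrightarrow> gsys R M s n T I v k"
by (auto simp: gsys_def)

lemma min_gsys_swap:
assumes "min_gsys R M s n T I v k"
shows "min_gsys R M n s T I v (kswap \<circ> k)"
unfolding min_gsys_def
proof (intro conjI allI impI)
show "gsys R M n s T I v (kswap \<circ> k)" using assms by (simp add: gsys_swap min_gsys_def)
fix I' v' k' assume "gsys R M n s T I' v' k'"
then have "gsys R M s n T I' v' (kswap \<circ> k')" by (simp add: gsys_swap)
then have "weight I k <= weight I' (kswap \<circ> k')" using assms by (simp add: min_gsys_def)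
then show "weight I (kswap \<circ> k) <= weight I' k'" by (simp add: weight_def)
qed

context nodal_over
begin

lemma coeff_not_KX:
assumes "min_gsys R M s n T I v k" "r : I \<rightarrow> RR"
 "(\<Oplus>\<^bsub>M\<^esub>j\<in>I. r j ** v j) : T" "i : I" "k i ~= KX"
shows "EX b:RR. r i = n \<otimes> b"
using nodal_over.coeff_not_KY[OF swap_over min_gsys_swap[OF assms(1)] assms(2-4)] assms(5) by simp

text \<open>Such a coefficient is divisible by \<open>s\<close> and by \<open>n\<close>, and the
  branches meet only in zero.\<close>

lemma coeff_KZ:
assumes "min_gsys R M s n T I v k" "r : I \<rightarrow> RR"
 "(\<Oplus>\<^bsub>M\<^esub>j\<in>I. r j ** v j) : T" "i : I" "k i = KZ"
shows "r i = \<zero>"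
using coeff_not_KX[OF assms(1-4)] coeff_not_KY[OF assms(1-4)] assms(5) s_int_n by auto

text \<open>A finite generating set becomes a system when all its members are declared to be of kind
  \<open>KZ\<close>; among the weights that occur there is a least one.\<close>

lemma min_gsys_exists:
assumes "fin_gen R M"
shows "\<exists>I v k. min_gsys R M s n T I v k"
proof -
obtain S where S: "finite S" "S <= MM"
 "MM = {\<Oplus>\<^bsub>M\<^esub>x\<in>S. a x ** x | a. a : S \<rightarrow> RR}"
 using assms by (auto simp: fin_gen_def)
obtain v where v: "bij_betw v {0..<card S} S" using S(1) ex_bij_betw_nat_finite by blast
let ?I = "{0..<card S}"
have vc: "v : ?I \<rightarrow> MM" using v S(2) by (auto simp: bij_betw_def)
have "x : span_over R M T ?I v" if xM: "x : MM" for x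
proof -
 obtain a where a: "a : S \<rightarrow> RR" "x = (\<Oplus>\<^bsub>M\<^esub>y\<in>S. a y ** y)" using subsetD[OF equalityD1[OF S(3)] xM] by blast
 have "x = (\<Oplus>\<^bsub>M\<^esub>y\<in>v ` ?I. a y ** y)" using a v by (simp add: bij_betw_def)
 also have "\<dots> = (\<Oplus>\<^bsub>M\<^esub>j\<in>?I. a (v j) ** v j)"
 using a v S(2) by (intro M.finsum_reindex) (auto simp: bij_betw_def)
 finally have "x = \<theta> +. (\<Oplus>\<^bsub>M\<^esub>j\<in>?I. a (v j) ** v j)" using that by simp
 moreover have "(%j. a (v j)) : ?I \<rightarrow> RR" using a v by (auto simp: bij_betw_def)
 ultimately show ?thesis using span_overI[OF sub_zero[OF T]] by metis
qed
then have "span_over R M T ?I v = MM"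
 using sub_carrier[OF span_submodule[OF T _ vc]] by auto
then have "gsys R M s n T ?I v (%_. KZ)" using vc by (simp add: gsys_def)
then have ex: "\<exists>w I v k. gsys R M s n T I v k & weight I k = w" by blast
define w0 where "w0 = (LEAST w. \<exists>I v k. gsys R M s n T I v k & weight I k = w)"
have "\<exists>I v k. gsys R M s n T I v k & weight I k = w0"
 unfolding w0_def using ex by (rule LeastI_ex)
then obtain I v k where g: "gsys R M s n T I v k" "weight I k = w0" by blast
have "w0 <= weight I' k'" if "gsys R M s n T I' v' k'" for I' v' k'
 unfolding w0_def using that by (intro Least_le) blast
then have "min_gsys R M s n T I v k" using g by (auto simp: min_gsys_def)
then show ?thesis by blast
qed

text \<open>With the index set and the kinds unchanged the weight is unchanged too, so minimality is
  inherited once the new vectors generate.\<close>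

lemma min_gsys_modify:
assumes min: "min_gsys R M s n T I v k" and v': "v' : I \<rightarrow> MM"
 and X: "!!j. [|j : I; k j = KX|] ==> s ** v' j : T"
 and Y: "!!j. [|j : I; k j = KY|] ==> n ** v' j : T"
 and gen: "!!j. j : I ==> v j : span_over R M T I v'"
shows "min_gsys R M s n T I v' k"
proof -
have g: "finite I" "v : I \<rightarrow> MM" "span_over R M T I v = MM"
 using min by (auto simp: min_gsys_def gsys_def)
have S: "submodule (span_over R M T I v') R M" using T g v' by (intro span_submodule)
have "span_over R M T I v <= span_over R M T I v'"
 using g gen span_T[OF T g(1) v'] by (intro span_least[OF T g(1,2) S]) auto
then have "span_over R M T I v' = MM" using g sub_carrier[OF S] by auto
then have "gsys R M s n T I v' k" using g v' X Y by (auto simp: gsys_def)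
then show ?thesis using min by (auto simp: min_gsys_def)
qed

end

section \<open>Presentations of the entries by three generators\<close>

definition gen3 ::
"('r, 'c) ring_scheme => ('r, 'm, 'd) module_scheme => 'm => 'm => 'm => 'm set" where
"gen3 R M t x y = {a \<odot>\<^bsub>M\<^esub> t \<oplus>\<^bsub>M\<^esub> b \<odot>\<^bsub>M\<^esub> x \<oplus>\<^bsub>M\<^esub> c \<odot>\<^bsub>M\<^esub> y | a b c.
 a : carrier R & b : carrier R & c : carrier R}"

text \<open>A generator of cyclic torsion of order \<open>p^i\<close>. On it \<open>n\<close> acts
  as \<open>p\<close>, so powers of \<open>p\<close> are written as powers of \<open>n\<close>;
  \<open>s\<close> acts as \<open>c p^(i-1)\<close>, where \<open>c = 0\<close> is the trivial
  action and \<open>c > 0\<close> belongs to F_i.\<close>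

definition is_tor ::
"('r, 'c) ring_scheme => ('r, 'm, 'd) module_scheme => 'r => 'r => nat => nat => 'm => bool" where
"is_tor R M s n i c t \<longleftrightarrow> i >= 1 & t : carrier M &
 s \<odot>\<^bsub>M\<^esub> t = ([c] \<cdot>\<^bsub>R\<^esub> \<one>\<^bsub>R\<^esub> \<otimes>\<^bsub>R\<^esub> n [^]\<^bsub>R\<^esub> (i - 1)) \<odot>\<^bsub>M\<^esub> t &
 n [^]\<^bsub>R\<^esub> i \<odot>\<^bsub>M\<^esub> t = \<zero>\<^bsub>M\<^esub> & n [^]\<^bsub>R\<^esub> (i - 1) \<odot>\<^bsub>M\<^esub> t ~= \<zero>\<^bsub>M\<^esub>"

text \<open>The argument \<open>n\<close> may be either of the two branch elements. For
  \<open>x\<close> killed by the other one modulo R t, the condition says that \<open>x\<close>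
  generates a full copy of a branch modulo R t.\<close>

definition free_over ::
"('r, 'c) ring_scheme => ('r, 'm, 'd) module_scheme => 'r => 'm => 'm => bool" where
"free_over R M n t x \<longleftrightarrow> x : carrier M &
 (\<forall>k::nat. ALL a:carrier R. n [^]\<^bsub>R\<^esub> k \<odot>\<^bsub>M\<^esub> x ~= a \<odot>\<^bsub>M\<^esub> t)"

text \<open>The number \<open>c\<close> in \<open>w = 1 + c q^(i-1)\<close>; only through it does
  the parameter of F_i enter the presentation.\<close>

definition F_coeff :: "nat => nat => int => nat" where
"F_coeff q i w = nat ((w - 1) div int q ^ (i - 1))"

text \<open>Generators that an entry does not have are set to zero, so that one shape serves all
  entries. In the extensions the classes are normalised: \<open>s x\<close> is the socle element
  \<open>n^(i-1) t\<close>, and \<open>n y\<close> is the generator \<open>t\<close> itself. The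
  free generator of the regular module takes the place of \<open>x\<close>.\<close>

fun cond ::
"('r, 'c) ring_scheme => ('r, 'm, 'd) module_scheme => 'r => 'r => nat => 'm => 'm => 'm
 => entry => bool" where
"cond R M s n q t x y (E_cyc i) \<longleftrightarrow> is_tor R M s n i 0 t & x = \<zero>\<^bsub>M\<^esub> & y = \<zero>\<^bsub>M\<^esub>"
| "cond R M s n q t x y (E_F i w) \<longleftrightarrow> i >= 2 & is_tor R M s n i (F_coeff q i w) t & x = \<zero>\<^bsub>M\<^esub> & y = \<zero>\<^bsub>M\<^esub>"
| "cond R M s n q t x y E_Zp \<longleftrightarrow> t = \<zero>\<^bsub>M\<^esub> & y = \<zero>\<^bsub>M\<^esub> & free_over R M n \<zero>\<^bsub>M\<^esub> x & s \<odot>\<^bsub>M\<^esub> x = \<zero>\<^bsub>M\<^esub>"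
| "cond R M s n q t x y E_A \<longleftrightarrow> t = \<zero>\<^bsub>M\<^esub> & x = \<zero>\<^bsub>M\<^esub> & free_over R M s \<zero>\<^bsub>M\<^esub> y & n \<odot>\<^bsub>M\<^esub> y = \<zero>\<^bsub>M\<^esub>"
| "cond R M s n q t x y E_reg \<longleftrightarrow> t = \<zero>\<^bsub>M\<^esub> & y = \<zero>\<^bsub>M\<^esub> & free_over R M s \<zero>\<^bsub>M\<^esub> x & free_over R M n \<zero>\<^bsub>M\<^esub> x"
| "cond R M s n q t x y (E_ext_Zp i) \<longleftrightarrow> is_tor R M s n i 0 t & y = \<zero>\<^bsub>M\<^esub> &
 free_over R M n t x & s \<odot>\<^bsub>M\<^esub> x = n [^]\<^bsub>R\<^esub> (i - 1) \<odot>\<^bsub>M\<^esub> t"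
| "cond R M s n q t x y (E_ext_A i) \<longleftrightarrow> is_tor R M s n i 0 t & x = \<zero>\<^bsub>M\<^esub> &
 free_over R M s t y & n \<odot>\<^bsub>M\<^esub> y = t"
| "cond R M s n q t x y (E_ext_ZpA i) \<longleftrightarrow> is_tor R M s n i 0 t &
 free_over R M n t x & s \<odot>\<^bsub>M\<^esub> x = n [^]\<^bsub>R\<^esub> (i - 1) \<odot>\<^bsub>M\<^esub> t &
 free_over R M s t y & n \<odot>\<^bsub>M\<^esub> y = t"

definition pres ::
"('r, 'c) ring_scheme => ('r, 'm, 'd) module_scheme => 'r => 'r => nat => 'm set => entry => bool" where
"pres R M s n q N e \<longleftrightarrow> (EX t:N. EX x:N. EX y:N. N = gen3 R M t x y & cond R M s n q t x y e)"

text \<open>The annihilator of a generator of a cyclic torsion module.\<close>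

definition tor_ideal :: "('r, 'c) ring_scheme => 'r => 'r => nat => nat => 'r set" where
"tor_ideal R s n i c = {(s \<ominus>\<^bsub>R\<^esub> [c] \<cdot>\<^bsub>R\<^esub> \<one>\<^bsub>R\<^esub> \<otimes>\<^bsub>R\<^esub> n [^]\<^bsub>R\<^esub> (i - 1)) \<otimes>\<^bsub>R\<^esub> a
 \<oplus>\<^bsub>R\<^esub> n [^]\<^bsub>R\<^esub> i \<otimes>\<^bsub>R\<^esub> b | a b. a : carrier R & b : carrier R}"

text \<open>The relations \<open>a t + b x + c y = 0\<close> that the presentation predicts. They
  are expressed in R alone, which makes modules with elements of different types comparable.\<close>

fun rel3 :: "('r, 'c) ring_scheme => 'r => 'r => nat => 'r => 'r => 'r => entry => bool" where
"rel3 R s n q a b c (E_cyc i) \<longleftrightarrow> a : tor_ideal R s n i 0"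
| "rel3 R s n q a b c (E_F i w) \<longleftrightarrow> a : tor_ideal R s n i (F_coeff q i w)"
| "rel3 R s n q a b c E_Zp \<longleftrightarrow> (EX b':carrier R. b = s \<otimes>\<^bsub>R\<^esub> b')"
| "rel3 R s n q a b c E_A \<longleftrightarrow> (EX c':carrier R. c = n \<otimes>\<^bsub>R\<^esub> c')"
| "rel3 R s n q a b c E_reg \<longleftrightarrow> b = \<zero>\<^bsub>R\<^esub>"
| "rel3 R s n q a b c (E_ext_Zp i) \<longleftrightarrow> (EX b':carrier R. b = s \<otimes>\<^bsub>R\<^esub> b' &
 a \<oplus>\<^bsub>R\<^esub> n [^]\<^bsub>R\<^esub> (i - 1) \<otimes>\<^bsub>R\<^esub> b' : tor_ideal R s n i 0)"
| "rel3 R s n q a b c (E_ext_A i) \<longleftrightarrow> (EX c':carrier R. c = n \<otimes>\<^bsub>R\<^esub> c' &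
 a \<oplus>\<^bsub>R\<^esub> c' : tor_ideal R s n i 0)"
| "rel3 R s n q a b c (E_ext_ZpA i) \<longleftrightarrow> (EX b':carrier R. EX c':carrier R. b = s \<otimes>\<^bsub>R\<^esub> b' &
 c = n \<otimes>\<^bsub>R\<^esub> c' & a \<oplus>\<^bsub>R\<^esub> n [^]\<^bsub>R\<^esub> (i - 1) \<otimes>\<^bsub>R\<^esub> b' \<oplus>\<^bsub>R\<^esub> c' : tor_ideal R s n i 0)"

context nodal_ring
begin

lemma unit_add_mx:
assumes "u : Units R" "a : RR" "b : RR"
shows "u \<oplus> (s \<otimes> a \<oplus> n \<otimes> b) : Units R"
proof (rule ccontr)
assume "~ ?thesis"
moreover have "u \<oplus> (s \<otimes> a \<oplus> n \<otimes> b) : RR" using assms Units_closed[OF assms(1)] by simp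
ultimately obtain c d where cd: "c : RR" "d : RR"
 "u \<oplus> (s \<otimes> a \<oplus> n \<otimes> b) = s \<otimes> c \<oplus> n \<otimes> d" using mxE by metis
then have "u = (s \<otimes> c \<oplus> n \<otimes> d) \<ominus> (s \<otimes> a \<oplus> n \<otimes> b)"
 using assms Units_closed[OF assms(1)] by (metis add.inv_solve_right' m_closed a_closed minus_eq n_closed s_closed)
also have "\<dots> = s \<otimes> (c \<ominus> a) \<oplus> n \<otimes> (d \<ominus> b)" using cd(1,2) assms by (simp add: minus_eq r_distr r_minus minus_add a_ac)
finally have "u : mx" using cd assms by (auto simp: mx_def)
then show False using mx_iff assms Units_closed by blast
qed

lemma unit_add_n: "[|u : Units R; b : RR|] ==> u \<oplus> n \<otimes> b : Units R"
using unit_add_mx[of u \<zero> b] by simp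

lemma tor_idealI:
"[|a = (s \<ominus> [c] \<cdot>\<^bsub>R\<^esub> \<one> \<otimes> n [^] (i - 1)) \<otimes> b \<oplus> n [^] i \<otimes> d; b : RR; d : RR|]
 ==> a : tor_ideal R s n i c"
unfolding tor_ideal_def by blast

text \<open>Modulo this ideal \<open>s\<close> becomes \<open>c n^(i-1)\<close> and
  \<open>n^i\<close> becomes zero, so that only the valuation in \<open>n\<close> remains. The
  condition on \<open>c\<close> keeps \<open>c n^(i-1)\<close> inside the maximal ideal.\<close>

lemma tor_ideal_cases:
assumes a: "a : RR" and i: "i >= 1" "c = 0 \<or> i >= 2"
shows "a : tor_ideal R s n i c \<or> (\<exists>k u b d. k < i & u : Units R & b : RR & d : RR &
 a = n [^] (k::nat) \<otimes> u \<oplus> ((s \<ominus> [c] \<cdot>\<^bsub>R\<^esub> \<one> \<otimes> n [^] (i - 1)) \<otimes> b \<oplus> n [^] i \<otimes> d))"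
 (is "_ \<or> ?R")
proof -
let ?c = "[c] \<cdot>\<^bsub>R\<^esub> \<one>" and ?j = "s \<ominus> [c] \<cdot>\<^bsub>R\<^esub> \<one> \<otimes> n [^] (i - 1)"
have j: "?j : RR" by simp
obtain A b where A: "A = \<zero> \<or> (\<exists>k u. u : Units R & A = n [^] (k::nat) \<otimes> u)" "A : RR"
 "b : RR" "a = A \<oplus> s \<otimes> b"
proof (cases "EX b:RR. a = s \<otimes> b")
 case True
 then show ?thesis using that[of \<zero>] by auto
next
 case False
 then show ?thesis using dvr[OF a] that Units_closed by (metis m_closed n_closed nat_pow_closed)
qed
obtain m where m: "i = Suc m" using i by (cases i) auto
have sb: "s \<otimes> b = ?j \<otimes> b \<oplus> ?c \<otimes> n [^] m \<otimes> b"
 using A m by (simp add: minus_eq l_distr l_minus m_assoc a_assoc l_neg)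
\<comment> \<open>Common end of the cases, with remainder \<open>n^m r\<close> for
  \<open>m = i - 1\<close>: either \<open>r\<close> is a unit and \<open>k = m\<close>, or
  \<open>r\<close> is in the maximal ideal. For \<open>m > 0\<close> its \<open>s\<close> part is
  then killed by \<open>n^m\<close>, and its \<open>n\<close> part falls into the multiples of
  \<open>n^i\<close>.\<close>
have fin: ?thesis if r: "r : RR" and e: "A \<oplus> ?c \<otimes> n [^] m \<otimes> b = n [^] m \<otimes> r" and m0: "m > 0 \<or> A = \<zero> & c = 0" for r
proof -
 have eq: "a = n [^] m \<otimes> r \<oplus> ?j \<otimes> b"
 proof -
 have "A \<oplus> (y \<oplus> x) = (A \<oplus> x) \<oplus> y" if "x : RR" "y : RR" for x y
  using that A by (simp add: a_ac)
 then have "a = (A \<oplus> ?c \<otimes> n [^] m \<otimes> b) \<oplus> ?j \<otimes> b"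
  unfolding A(4) sb using A j by (metis add.nat_pow_closed m_closed n_closed nat_pow_closed one_closed)
 then show ?thesis using e by simp
 qed
 show ?thesis
 proof (cases "r : Units R")
 case True
 have "a = n [^] m \<otimes> r \<oplus> (?j \<otimes> b \<oplus> n [^] i \<otimes> \<zero>)" using eq r j A by simp
 then have ?R using True A m by blast
 then show ?thesis ..
 next
 case False
 then obtain r1 r2 where r12: "r1 : RR" "r2 : RR" "r = s \<otimes> r1 \<oplus> n \<otimes> r2"
  using mxE[OF r] by metis
 show ?thesis
 proof (cases "m > 0")
  case True
  then have "n [^] m \<otimes> (s \<otimes> r1) = \<zero>" using pow_n_s[of m] r12 by (simp add: m_assoc[symmetric])
  then have "n [^] m \<otimes> r = n [^] i \<otimes> r2" using r12 m by (simp add: r_distr m_assoc)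
  then have "a = ?j \<otimes> b \<oplus> n [^] i \<otimes> r2" using eq j A r12 a_comm by simp
  then show ?thesis using A r12 by (auto simp: tor_ideal_def)
 next
  case False
  then have "A = \<zero>" "c = 0" using m0 by auto
  then have "a = ?j \<otimes> b \<oplus> n [^] i \<otimes> \<zero>" using A by (simp add: minus_eq)
  then show ?thesis using tor_idealI A(3) zero_closed by blast
 qed
 qed
qed
show ?thesis
proof (cases "A = \<zero>")
 case True
 have "A \<oplus> ?c \<otimes> n [^] m \<otimes> b = n [^] m \<otimes> (?c \<otimes> b)" using True A by (simp add: m_ac)
 moreover have "m > 0 \<or> A = \<zero> & c = 0" using True i m by auto
 ultimately show ?thesis using A by (intro fin) auto
next
 case False
 then obtain k u where k: "u : Units R" "A = n [^] (k::nat) \<otimes> u" using A by auto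
 note u = Units_closed[OF k(1)]
 consider "k < m" | "m <= k" "m > 0" | "m = 0" by linarith
 then show ?thesis
 proof cases
 case 1
 then obtain d where d: "m = k + Suc d" using less_imp_Suc_add by fastforce
 have e: "a = n [^] k \<otimes> (u \<oplus> n \<otimes> (?c \<otimes> n [^] d \<otimes> b)) \<oplus> (?j \<otimes> b \<oplus> n [^] i \<otimes> \<zero>)"
 proof -
  have "?c \<otimes> n [^] m \<otimes> b = n [^] k \<otimes> (n \<otimes> (?c \<otimes> n [^] d \<otimes> b))"
  using A unfolding d by (simp add: nat_pow_mult[symmetric] m_ac)
  then have "a = n [^] k \<otimes> u \<oplus> (?j \<otimes> b \<oplus> n [^] k \<otimes> (n \<otimes> (?c \<otimes> n [^] d \<otimes> b)))"
  using A(4) sb k by simp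
  then show ?thesis using A j u by (simp add: r_distr a_ac)
 qed
 have "u \<oplus> n \<otimes> (?c \<otimes> n [^] d \<otimes> b) : Units R" using k A by (intro unit_add_n) auto
 then show ?thesis using e A 1 m by (metis less_Suc_eq zero_closed)
 next
 case 2
 then obtain d where d: "k = m + d" using le_Suc_ex by blast
 have "A \<oplus> ?c \<otimes> n [^] m \<otimes> b = n [^] m \<otimes> (n [^] d \<otimes> u \<oplus> ?c \<otimes> b)"
  unfolding k d using u A by (simp add: nat_pow_mult[symmetric] r_distr m_ac)
 then show ?thesis using u A 2 by (intro fin) auto
 next
 case 3
 then have c: "c = 0" "i = 1" using i m by auto
 have sj: "s \<otimes> b = ?j \<otimes> b" using c A by (simp add: minus_eq)
 show ?thesis
 proof (cases "k = 0")
  case True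
  have "a = n [^] (0::nat) \<otimes> u \<oplus> (?j \<otimes> b \<oplus> n [^] i \<otimes> \<zero>)" using A(4) k sj True u A j by simp
  then show ?thesis using k A c by (metis zero_closed zero_less_one)
 next
  case False
  then obtain d where d: "k = Suc d" by (cases k) auto
  have "a = ?j \<otimes> b \<oplus> n [^] i \<otimes> (n [^] d \<otimes> u)"
  using A(4) sj k d c u A j a_comm by (simp add: m_ac)
  moreover have "n [^] d \<otimes> u : RR" using u by simp
  ultimately show ?thesis using tor_idealI A(3) by blast
 qed
 qed
qed
qed

end

context nodal_module
begin

lemma gen3I: "[|a : RR; b : RR; c : RR|] ==>
a ** t +. b ** x +. c ** y : gen3 R M t x y"
by (auto simp: gen3_def)

lemma n_pow_smult_zero:
assumes "t : MM" "n [^] (k::nat) ** t = \<theta>" "k <= m"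
shows "n [^] m ** t = \<theta>"
proof -
obtain d where "m = d + k" using assms(3) le_Suc_ex by (metis add.commute)
then show ?thesis using assms by (simp add: nat_pow_mult[symmetric] smult_assoc1)
qed

text \<open>An element outside the ideal acts on \<open>t\<close> as \<open>n^k u\<close> with
  \<open>k < i\<close> and a unit \<open>u\<close>; if it killed \<open>t\<close>, then
  \<open>n^(i-1) t\<close> would vanish.\<close>

lemma tor_ann:
assumes t: "is_tor R M s n i c t" and c: "c = 0 \<or> i >= 2" and a: "a : RR"
shows "a ** t = \<theta> \<longleftrightarrow> a : tor_ideal R s n i c"
proof -
have i: "i >= 1" and tM: "t : MM"
 and st: "s ** t = ([c] \<cdot>\<^bsub>R\<^esub> \<one> \<otimes> n [^] (i - 1)) ** t"
 and n0: "n [^] i ** t = \<theta>" and n1: "n [^] (i - 1) ** t ~= \<theta>"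
 using t by (auto simp: is_tor_def)
have kill: "((s \<ominus> [c] \<cdot>\<^bsub>R\<^esub> \<one> \<otimes> n [^] (i - 1)) \<otimes> b \<oplus> n [^] i \<otimes> d) ** t = \<theta>"
 if bd: "b : RR" "d : RR" for b d
proof -
 have "(s \<ominus> [c] \<cdot>\<^bsub>R\<^esub> \<one> \<otimes> n [^] (i - 1)) ** t = \<theta>"
 using tM st by (simp add: R.minus_eq smult_l_distr smult_l_minus M.r_neg)
 moreover have "(s \<ominus> [c] \<cdot>\<^bsub>R\<^esub> \<one> \<otimes> n [^] (i - 1)) \<otimes> b = b \<otimes> (s \<ominus> [c] \<cdot>\<^bsub>R\<^esub> \<one> \<otimes> n [^] (i - 1))"
 "n [^] i \<otimes> d = d \<otimes> n [^] i" using bd by (simp_all add: R.m_comm)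
 ultimately show ?thesis using bd tM n0 by (simp add: smult_l_distr smult_assoc1)
qed
show ?thesis
proof
 assume z: "a ** t = \<theta>"
 show "a : tor_ideal R s n i c"
 proof (rule ccontr)
 assume "a ~: tor_ideal R s n i c"
 then obtain k u b d where k: "k < i" "u : Units R" "b : RR" "d : RR"
  "a = n [^] (k::nat) \<otimes> u \<oplus> ((s \<ominus> [c] \<cdot>\<^bsub>R\<^esub> \<one> \<otimes> n [^] (i - 1)) \<otimes> b \<oplus> n [^] i \<otimes> d)"
  using tor_ideal_cases[OF a i c] by blast
 note u = R.Units_closed[OF k(2)]
 have "(n [^] k \<otimes> u) ** t = \<theta>"
  using z kill[OF k(3,4)] k u tM by (simp add: smult_l_distr)
 then have "inv u ** ((u \<otimes> n [^] k) ** t) = \<theta>" using k u by (simp add: R.m_comm)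
 then have "n [^] k ** t = \<theta>"
  using k u tM R.Units_l_inv[OF k(2)]
  by (simp add: smult_assoc1[symmetric] R.m_assoc[symmetric])
 then show False using n_pow_smult_zero[OF tM, of k "i - 1"] k n1 by simp
 qed
next
 assume "a : tor_ideal R s n i c"
 then show "a ** t = \<theta>" using kill by (auto simp: tor_ideal_def)
qed
qed

text \<open>If \<open>b\<close> is not in sR, write \<open>b = n^k u + s v\<close> with a unit
  \<open>u\<close>. Since \<open>s x\<close> is a multiple of \<open>t\<close>, the relation puts
  \<open>n^k x\<close> into R t, against freeness.\<close>

lemma free_coeff:
assumes f: "free_over R M n t x" and t: "t : MM" and r: "r : RR" "s ** x = r ** t"
 and b: "b : RR" and a: "a : RR" and e: "b ** x = a ** t"
shows "EX b':RR. b = s \<otimes> b'"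
proof (rule ccontr)
assume "~ ?thesis"
then obtain k u v where u: "u : Units R" "v : RR" "b = n [^] (k::nat) \<otimes> u \<oplus> s \<otimes> v"
 using dvr[OF b] by blast
have x: "x : MM" using f by (simp add: free_over_def)
note uc = R.Units_closed[OF u(1)]
have "b ** x = (n [^] k \<otimes> u) ** x +. (v \<otimes> r) ** t"
 using u uc x t r by (simp add: smult_l_distr smult_assoc1 smult_comm[of s v])
then have "(n [^] k \<otimes> u) ** x +. (v \<otimes> r) ** t = a ** t" using e by simp
then have "(n [^] k \<otimes> u) ** x = a ** t -. (v \<otimes> r) ** t"
 using u uc x t r a by (metis M.add.inv_solve_right' M.minus_eq R.m_closed R.nat_pow_closed n_closed smult_closed)
also have "\<dots> = (a \<ominus> v \<otimes> r) ** t"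
 using a u r t by (simp add: R.minus_eq M.minus_eq smult_l_distr smult_l_minus)
finally have "inv u ** ((u \<otimes> n [^] k) ** x) = (inv u \<otimes> (a \<ominus> v \<otimes> r)) ** t"
 using u uc a r t by (simp add: smult_assoc1 R.m_comm)
then have "n [^] k ** x = (inv u \<otimes> (a \<ominus> v \<otimes> r)) ** t"
 using u uc x R.Units_l_inv[OF u(1)] by (simp add: smult_assoc1[symmetric] R.m_assoc[symmetric])
then show False using f u a r by (auto simp: free_over_def)
qed

lemma free_coeff_s:
assumes "free_over R M s t y" "t : MM" "r : RR" "n ** y = r ** t"
 and "b : RR" "a : RR" "b ** y = a ** t"
shows "EX b':RR. b = n \<otimes> b'"
using nodal_module.free_coeff[OF swap_module assms] by simp

end

section \<open>Isomorphism through equal relations\<close>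

definition comb3 ::
"('r, 'm, 'd) module_scheme => 'm => 'm => 'm => 'r => 'r => 'r => 'm" where
"comb3 M t x y a b c = a \<odot>\<^bsub>M\<^esub> t \<oplus>\<^bsub>M\<^esub> b \<odot>\<^bsub>M\<^esub> x \<oplus>\<^bsub>M\<^esub> c \<odot>\<^bsub>M\<^esub> y"

lemma gen3_comb3: "gen3 R M t x y = {comb3 M t x y a b c | a b c.
 a : carrier R & b : carrier R & c : carrier R}"
by (simp add: gen3_def comb3_def)

lemma (in abelian_group) diff_zero_iff:
assumes "u : carrier G" "v : carrier G"
shows "u \<ominus> v = \<zero> \<longleftrightarrow> u = v"
proof
assume "u \<ominus> v = \<zero>"
then have "\<ominus> (\<ominus> v) = u" using assms by (intro minus_equality) (simp_all add: minus_eq)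
then show "u = v" using assms by simp
qed (use assms in \<open>simp add: minus_eq r_neg\<close>)

context module
begin

lemma comb3_closed [simp]:
"[|t : carrier M; x : carrier M; y : carrier M; a : carrier R; b : carrier R; c : carrier R|]
 ==> comb3 M t x y a b c : carrier M"
by (simp add: comb3_def)

lemma comb3_add:
"[|t : carrier M; x : carrier M; y : carrier M; a : carrier R; b : carrier R; c : carrier R;
 a' : carrier R; b' : carrier R; c' : carrier R|]
 ==> comb3 M t x y (a \<oplus> a') (b \<oplus> b') (c \<oplus> c') = comb3 M t x y a b c \<oplus>\<^bsub>M\<^esub> comb3 M t x y a' b' c'"
by (simp add: comb3_def smult_l_distr M.add.m_ac)

lemma comb3_smult:
"[|t : carrier M; x : carrier M; y : carrier M; a : carrier R; b : carrier R; c : carrier R;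
 r : carrier R|]
 ==> comb3 M t x y (r \<otimes> a) (r \<otimes> b) (r \<otimes> c) = r \<odot>\<^bsub>M\<^esub> comb3 M t x y a b c"
by (simp add: comb3_def smult_assoc1 smult_r_distr)

text \<open>Differences are written with the scalar \<open>\<ominus> \<one>\<close>, so that
  \<open>comb3_add\<close> and \<open>comb3_smult\<close> cover subtraction as well.\<close>

lemma comb3_eq_iff:
assumes "t : carrier M" "x : carrier M" "y : carrier M" "a : carrier R" "b : carrier R" "c : carrier R"
 "a' : carrier R" "b' : carrier R" "c' : carrier R"
shows "comb3 M t x y a b c = comb3 M t x y a' b' c' \<longleftrightarrow>
 comb3 M t x y (a \<oplus> \<ominus> \<one> \<otimes> a') (b \<oplus> \<ominus> \<one> \<otimes> b') (c \<oplus> \<ominus> \<one> \<otimes> c') = \<zero>\<^bsub>M\<^esub>"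
proof -
have "comb3 M t x y (a \<oplus> \<ominus> \<one> \<otimes> a') (b \<oplus> \<ominus> \<one> \<otimes> b') (c \<oplus> \<ominus> \<one> \<otimes> c')
 = comb3 M t x y a b c \<oplus>\<^bsub>M\<^esub> (\<ominus> \<one>) \<odot>\<^bsub>M\<^esub> comb3 M t x y a' b' c'"
 using assms by (simp add: comb3_add comb3_smult del: R.l_minus)
also have "\<dots> = comb3 M t x y a b c \<ominus>\<^bsub>M\<^esub> comb3 M t x y a' b' c'"
 using assms by (simp add: smult_l_minus M.minus_eq)
finally show ?thesis using assms by (simp add: M.diff_zero_iff)
qed

lemma comb3_mem_gen3:
"[|a : carrier R; b : carrier R; c : carrier R|] ==> comb3 M t x y a b c : gen3 R M t x y"
by (auto simp: gen3_comb3)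

end

text \<open>The map keeps the coefficients of a chosen representation. Equality of two combinations
  is a relation between their coefficients, so the hypothesis makes the map independent of the
  choice, and injective for the same reason.\<close>

lemma mod_iso_gen3:
fixes M :: "('r, 'm, 'd) module_scheme" and M' :: "('r, 'n, 'e) module_scheme"
assumes M: "module R M" and M': "module R M'"
 and g: "t : carrier M" "x : carrier M" "y : carrier M" "carrier M = gen3 R M t x y"
 and g': "t' : carrier M'" "x' : carrier M'" "y' : carrier M'" "carrier M' = gen3 R M' t' x' y'"
 and rel: "!!a b c. [|a : carrier R; b : carrier R; c : carrier R|] ==>
 comb3 M t x y a b c = \<zero>\<^bsub>M\<^esub> \<longleftrightarrow> comb3 M' t' x' y' a b c = \<zero>\<^bsub>M'\<^esub>"
shows "mod_iso R M M'"
proof -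
interpret M: module R M by fact
interpret M': module R M' by fact
have "\<exists>a b c. a : carrier R & b : carrier R & c : carrier R & m = comb3 M t x y a b c"
 if "m : carrier M" for m using that equalityD1[OF g(4)] unfolding gen3_comb3 by blast
then obtain \<alpha> \<beta> \<gamma> where ab: "!!m. m : carrier M ==> \<alpha> m : carrier R"
 "!!m. m : carrier M ==> \<beta> m : carrier R" "!!m. m : carrier M ==> \<gamma> m : carrier R"
 "!!m. m : carrier M ==> m = comb3 M t x y (\<alpha> m) (\<beta> m) (\<gamma> m)" by metis
have eq: "comb3 M t x y a b c = comb3 M t x y a' b' c' \<longleftrightarrow>
 comb3 M' t' x' y' a b c = comb3 M' t' x' y' a' b' c'"
 if "a : carrier R" "b : carrier R" "c : carrier R" "a' : carrier R" "b' : carrier R" "c' : carrier R"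
 for a b c a' b' c'
 using M.comb3_eq_iff[OF g(1-3) that] M'.comb3_eq_iff[OF g'(1-3) that] rel that
 by (simp del: M.R.l_minus)
define h where "h m = comb3 M' t' x' y' (\<alpha> m) (\<beta> m) (\<gamma> m)" for m
have h: "h (comb3 M t x y a b c) = comb3 M' t' x' y' a b c"
 if abc: "a : carrier R" "b : carrier R" "c : carrier R" for a b c
proof -
 let ?m = "comb3 M t x y a b c"
 have m: "?m : carrier M" using abc g(1-3) by simp
 show ?thesis unfolding h_def
 using eq[OF ab(1-3)[OF m] abc] ab(4)[OF m] by simp
qed
have hc: "h m : carrier M'" if "m : carrier M" for m
 using ab(1-3)[OF that] g'(1-3) by (simp add: h_def)
have "h : mod_hom R M M'" unfolding mod_hom_def
proof (intro CollectI conjI ballI)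
 show "h : carrier M \<rightarrow> carrier M'" using hc by auto
 fix u v assume uv: "u : carrier M" "v : carrier M"
 have "h (u \<oplus>\<^bsub>M\<^esub> v) = h (comb3 M t x y (\<alpha> u) (\<beta> u) (\<gamma> u) \<oplus>\<^bsub>M\<^esub> comb3 M t x y (\<alpha> v) (\<beta> v) (\<gamma> v))"
 using ab(4)[OF uv(1)] ab(4)[OF uv(2)] by simp
 also have "\<dots> = h (comb3 M t x y (\<alpha> u \<oplus>\<^bsub>R\<^esub> \<alpha> v) (\<beta> u \<oplus>\<^bsub>R\<^esub> \<beta> v) (\<gamma> u \<oplus>\<^bsub>R\<^esub> \<gamma> v))"
 using ab(1-3) uv g(1-3) by (simp add: M.comb3_add)
 also have "\<dots> = h u \<oplus>\<^bsub>M'\<^esub> h v"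
 using ab(1-3) uv g'(1-3) by (simp add: h M'.comb3_add) (simp add: h_def)
 finally show "h (u \<oplus>\<^bsub>M\<^esub> v) = h u \<oplus>\<^bsub>M'\<^esub> h v" .
next
 fix r u assume r: "r : carrier R" and u: "u : carrier M"
 have "h (r \<odot>\<^bsub>M\<^esub> u) = h (r \<odot>\<^bsub>M\<^esub> comb3 M t x y (\<alpha> u) (\<beta> u) (\<gamma> u))"
 using ab(4)[OF u] by simp
 also have "\<dots> = h (comb3 M t x y (r \<otimes>\<^bsub>R\<^esub> \<alpha> u) (r \<otimes>\<^bsub>R\<^esub> \<beta> u) (r \<otimes>\<^bsub>R\<^esub> \<gamma> u))"
 using ab(1-3)[OF u] r g(1-3) by (simp add: M.comb3_smult)
 also have "\<dots> = r \<odot>\<^bsub>M'\<^esub> h u"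
 using ab(1-3)[OF u] r g'(1-3) by (simp add: h M'.comb3_smult) (simp add: h_def)
 finally show "h (r \<odot>\<^bsub>M\<^esub> u) = r \<odot>\<^bsub>M'\<^esub> h u" .
qed
moreover have "bij_betw h (carrier M) (carrier M')"
 unfolding bij_betw_def
proof
 show "inj_on h (carrier M)"
 proof (rule inj_onI)
 fix u v assume uv: "u : carrier M" "v : carrier M" "h u = h v"
 then show "u = v"
  using eq[OF ab(1-3)[OF uv(1)] ab(1-3)[OF uv(2)]] ab(4)[OF uv(1)] ab(4)[OF uv(2)]
  by (simp add: h_def)
 qed
 have "m' : h ` carrier M" if m': "m' : carrier M'" for m'
 proof -
 obtain a b c where abc: "a : carrier R" "b : carrier R" "c : carrier R" "m' = comb3 M' t' x' y' a b c"
  using subsetD[OF equalityD1[OF g'(4)] m'] unfolding gen3_comb3 by blast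
 then have "m' = h (comb3 M t x y a b c)" by (simp add: h)
 then show ?thesis using M.comb3_closed[OF g(1-3) abc(1-3)] by blast
 qed
 then show "h ` carrier M = carrier M'" using hc by auto
qed
ultimately show ?thesis by (auto simp: mod_iso_def)
qed

lemma mod_iso_sym:
assumes M: "module R M" and M': "module R M'" and iso: "mod_iso R M M'"
shows "mod_iso R M' M"
proof -
interpret M: module R M by fact
interpret M': module R M' by fact
obtain h where h: "h : mod_hom R M M'" and bij: "bij_betw h (carrier M) (carrier M')"
 using iso by (auto simp: mod_iso_def)
define g where "g = inv_into (carrier M) h"
have gb: "bij_betw g (carrier M') (carrier M)" unfolding g_def by (rule bij_betw_inv_into[OF bij])
have gc: "!!u. u : carrier M' ==> g u : carrier M" using gb by (auto simp: bij_betw_def)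
have hg: "!!u. u : carrier M' ==> h (g u) = u" unfolding g_def using bij by (meson bij_betw_inv_into_right)
have gh: "!!u. u : carrier M ==> g (h u) = u" unfolding g_def using bij by (meson bij_betw_inv_into_left)
have hadd: "!!u v. [|u : carrier M; v : carrier M|] ==> h (u \<oplus>\<^bsub>M\<^esub> v) = h u \<oplus>\<^bsub>M'\<^esub> h v"
 and hsm: "!!r u. [|r : carrier R; u : carrier M|] ==> h (r \<odot>\<^bsub>M\<^esub> u) = r \<odot>\<^bsub>M'\<^esub> h u"
 using h by (auto simp: mod_hom_def)
have "g : mod_hom R M' M" unfolding mod_hom_def
proof (intro CollectI conjI ballI)
 show "g : carrier M' \<rightarrow> carrier M" using gc by auto
 fix u v assume "u : carrier M'" "v : carrier M'"
 then show "g (u \<oplus>\<^bsub>M'\<^esub> v) = g u \<oplus>\<^bsub>M\<^esub> g v" using gh[of "g u \<oplus>\<^bsub>M\<^esub> g v"] gc hadd hg by simp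
next
 fix r u assume "r : carrier R" "u : carrier M'"
 then show "g (r \<odot>\<^bsub>M'\<^esub> u) = r \<odot>\<^bsub>M\<^esub> g u" using gh[of "r \<odot>\<^bsub>M\<^esub> g u"] gc hsm hg by simp
qed
then show ?thesis using gb by (auto simp: mod_iso_def)
qed

text \<open>The conditions of a presentation are equations and inequations between multiples of the
  generators; a bijective homomorphism preserves and reflects them.\<close>

lemma pres_transfer:
assumes M: "nodal_module R s n M" and M': "nodal_module R s n M'" and iso: "mod_iso R M M'"
 and pr: "pres R M s n q (carrier M) e"
shows "pres R M' s n q (carrier M') e"
proof -
interpret M: nodal_module R s n M by fact
interpret M': nodal_module R s n M' by fact
obtain h where h: "h : mod_hom R M M'" and bij: "bij_betw h (carrier M) (carrier M')"
 using iso by (auto simp: mod_iso_def)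
have hc: "!!u. u : carrier M ==> h u : carrier M'"
 and hadd: "!!u v. [|u : carrier M; v : carrier M|] ==> h (u \<oplus>\<^bsub>M\<^esub> v) = h u \<oplus>\<^bsub>M'\<^esub> h v"
 and hsm: "!!r u. [|r : carrier R; u : carrier M|] ==> h (r \<odot>\<^bsub>M\<^esub> u) = r \<odot>\<^bsub>M'\<^esub> h u"
 using h by (auto simp: mod_hom_def)
have heq: "!!u v. [|u : carrier M; v : carrier M|] ==> h u = h v \<longleftrightarrow> u = v"
 using bij by (meson bij_betw_imp_inj_on inj_on_eq_iff)
have h0: "h \<zero>\<^bsub>M\<^esub> = \<zero>\<^bsub>M'\<^esub>"
 using hsm[of "\<zero>\<^bsub>R\<^esub>" "\<zero>\<^bsub>M\<^esub>"] hc by simp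
have h00: "!!u. u : carrier M ==> h u = \<zero>\<^bsub>M'\<^esub> \<longleftrightarrow> u = \<zero>\<^bsub>M\<^esub>" using heq h0 M.zero_closed by metis
obtain t x y where g: "t : carrier M" "x : carrier M" "y : carrier M"
 "carrier M = gen3 R M t x y" and c: "cond R M s n q t x y e"
 using pr by (auto simp: pres_def)
have hcomb: "h (comb3 M t x y a b c) = comb3 M' (h t) (h x) (h y) a b c"
 if "a : carrier R" "b : carrier R" "c : carrier R" for a b c
 using that g(1-3) by (simp add: comb3_def hadd hsm)
have "carrier M' = h ` carrier M" using bij by (simp add: bij_betw_def)
also have "\<dots> = h ` gen3 R M t x y" using g(4) by simp
also have "\<dots> = gen3 R M' (h t) (h x) (h y)"
 unfolding gen3_comb3 by (fastforce simp: hcomb image_iff)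
finally have gen: "carrier M' = gen3 R M' (h t) (h x) (h y)" .
have tor: "is_tor R M' s n i d (h t) = is_tor R M s n i d t" for i d
 using g(1) hc by (simp add: is_tor_def hsm[symmetric] heq h00)
have fr: "free_over R M' r (h u) (h v) = free_over R M r u v"
 if "r : carrier R" "u : carrier M" "v : carrier M" for r u v
 using that hc by (simp add: free_over_def hsm[symmetric] heq)
have fr0: "free_over R M' r \<zero>\<^bsub>M'\<^esub> (h v) = free_over R M r \<zero>\<^bsub>M\<^esub> v"
 if "r : carrier R" "v : carrier M" for r v
 using fr[of r "\<zero>\<^bsub>M\<^esub>" v] that h0 by simp
have "cond R M' s n q (h t) (h x) (h y) e"
 using c g(1-3) by (cases e) (simp_all add: tor fr fr0 hsm[symmetric] heq h0 h00)
then show ?thesis unfolding pres_def using gen g hc by blast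
qed

context nodal_module
begin

text \<open>Freeness forces the coefficient of \<open>x\<close> into sR and that of \<open>y\<close>
  into nR. The values of \<open>s x\<close> and \<open>n y\<close> then move the whole combination
  to a multiple of \<open>t\<close>, whose annihilator is known.\<close>

lemma comb3_rel:
assumes g: "t : MM" "x : MM" "y : MM" and c: "cond R M s n q t x y e"
 and abc: "a : RR" "b : RR" "c : RR"
shows "comb3 M t x y a b c = \<theta> \<longleftrightarrow> rel3 R s n q a b c e"
proof -
have st0: "s ** t = \<theta>" if "is_tor R M s n i 0 t" for i
 using that g by (simp add: is_tor_def)
have opp: "v = (\<ominus> r) ** t" if "r ** t +. v = \<theta>" "r : RR" "v : MM" for r v
proof -
 have "-. (r ** t) = v" using that g by (intro M.minus_equality) (simp_all add: M.a_comm)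
 then show ?thesis using that g by (simp add: smult_l_minus)
qed
have bx: "(s \<otimes> b') ** x = (n [^] (i - 1) \<otimes> b') ** t"
 if "b' : RR" "s ** x = n [^] (i - (1::nat)) ** t" for b' i
proof -
 have "(s \<otimes> b') ** x = (b' \<otimes> s) ** x" "(n [^] (i - (1::nat)) \<otimes> b') ** t = (b' \<otimes> n [^] (i - (1::nat))) ** t"
 using that by (simp_all add: R.m_comm)
 then show ?thesis using that g by (simp add: smult_assoc1)
qed
have cy: "(n \<otimes> c') ** y = c' ** t" if "c' : RR" "n ** y = t" for c'
proof -
 have "(n \<otimes> c') ** y = (c' \<otimes> n) ** y" using that by (simp add: R.m_comm)
 then show ?thesis using that g by (simp add: smult_assoc1)
qed
show ?thesis
proof (cases e)
 case (E_cyc i)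
 then show ?thesis using c g abc tor_ann[of i 0 t a] by (simp add: comb3_def)
next
 case (E_F i w)
 then show ?thesis using c g abc tor_ann[of i _ t a] by (simp add: comb3_def)
next
 case E_Zp
 then have f: "free_over R M n \<theta> x" "s ** x = \<zero> ** \<theta>" using c by auto
 have "b ** x = \<theta> \<longleftrightarrow> (EX b':RR. b = s \<otimes> b')"
 proof
 assume "b ** x = \<theta>"
 then show "EX b':RR. b = s \<otimes> b'" using free_coeff[OF f(1) _ _ f(2) abc(2), of \<zero>] by simp
 next
 assume "EX b':RR. b = s \<otimes> b'"
 then show "b ** x = \<theta>" using f g by (auto simp: smult_assoc1 smult_comm[of s])
 qed
 then show ?thesis using E_Zp c g abc by (simp add: comb3_def)
next
 case E_A
 then have f: "free_over R M s \<theta> y" "n ** y = \<zero> ** \<theta>" using c by auto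
 have "c ** y = \<theta> \<longleftrightarrow> (EX b':RR. c = n \<otimes> b')"
 proof
 assume "c ** y = \<theta>"
 then show "EX b':RR. c = n \<otimes> b'" using free_coeff_s[OF f(1) _ _ f(2) abc(3), of \<zero>] by simp
 next
 assume "EX b':RR. c = n \<otimes> b'"
 then show "c ** y = \<theta>" using f g by (auto simp: smult_assoc1 smult_comm[of n])
 qed
 then show ?thesis using E_A c g abc by (simp add: comb3_def)
next
 case E_reg
 then have f: "free_over R M s \<theta> x" "free_over R M n \<theta> x" using c by auto
 have "b = \<zero>" if z: "b ** x = \<theta>"
 proof -
 \<comment> \<open>The generator is free in both directions: \<open>n x\<close> is killed by
   \<open>s\<close> and tests \<open>b\<close> modulo \<open>s\<close>, while \<open>s x\<close> is
   killed by \<open>n\<close> and tests \<open>b\<close> modulo \<open>n\<close>.\<close>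
 have "free_over R M n \<theta> (n ** x)" unfolding free_over_def
 proof (intro conjI allI ballI)
  fix k :: nat and a assume "a : RR"
  have "n [^] k ** (n ** x) = n [^] Suc k ** x" using g by (simp add: smult_assoc1)
  then show "n [^] k ** (n ** x) ~= a ** \<theta>"
  using f(2) \<open>a : RR\<close> unfolding free_over_def by metis
 qed (use g in simp)
 moreover have "b ** (n ** x) = \<zero> ** \<theta>" using z g abc by (simp add: smult_comm[of b])
 ultimately have 1: "EX b':RR. b = s \<otimes> b'"
  using free_coeff[of "\<theta>" "n ** x" \<zero> b \<zero>] g abc by simp
 have "free_over R M s \<theta> (s ** x)" unfolding free_over_def
 proof (intro conjI allI ballI)
  fix k :: nat and a assume "a : RR"
  have "s [^] k ** (s ** x) = s [^] Suc k ** x" using g by (simp add: smult_assoc1)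
  then show "s [^] k ** (s ** x) ~= a ** \<theta>"
  using f(1) \<open>a : RR\<close> unfolding free_over_def by metis
 qed (use g in simp)
 moreover have "b ** (s ** x) = \<zero> ** \<theta>" using z g abc by (simp add: smult_comm[of b])
 ultimately have 2: "EX b':RR. b = n \<otimes> b'"
  using free_coeff_s[of "\<theta>" "s ** x" \<zero> b \<zero>] g abc by simp
 show ?thesis using 1 2 s_int_n by auto
 qed
 then show ?thesis using E_reg c g abc by (auto simp: comb3_def)
next
 case (E_ext_Zp i)
 then have f: "is_tor R M s n i 0 t" "free_over R M n t x" "s ** x = n [^] (i - 1) ** t"
 "y = \<theta>" using c by auto
 have cmb: "comb3 M t x y a b c = a ** t +. b ** x" using f g abc by (simp add: comb3_def)
 have val: "comb3 M t x y a (s \<otimes> b') c = (a \<oplus> n [^] (i - 1) \<otimes> b') ** t" if "b' : RR" for b'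
 using f g abc that bx[OF that f(3)] by (simp add: comb3_def smult_l_distr)
 show ?thesis
 proof
 assume z: "comb3 M t x y a b c = \<theta>"
 have "b ** x = (\<ominus> a) ** t" using opp[of a] z cmb g abc by simp
 then obtain b' where b': "b' : RR" "b = s \<otimes> b'"
  using free_coeff[OF f(2) g(1) _ f(3) abc(2), of "\<ominus> a"] abc by auto
 then show "rel3 R s n q a b c e" using E_ext_Zp z val[OF b'(1)] tor_ann[OF f(1)] abc by auto
 next
 assume "rel3 R s n q a b c e"
 then show "comb3 M t x y a b c = \<theta>" using E_ext_Zp val tor_ann[OF f(1)] abc by auto
 qed
next
 case (E_ext_A i)
 then have f: "is_tor R M s n i 0 t" "free_over R M s t y" "n ** y = t"
 "x = \<theta>" using c by auto
 have cmb: "comb3 M t x y a b c = a ** t +. c ** y" using f g abc by (simp add: comb3_def)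
 have val: "comb3 M t x y a b (n \<otimes> c') = (a \<oplus> c') ** t" if "c' : RR" for c'
 using f(4) g abc that cy[OF that f(3)] by (simp add: comb3_def smult_l_distr)
 show ?thesis
 proof
 assume z: "comb3 M t x y a b c = \<theta>"
 have "c ** y = (\<ominus> a) ** t" using opp[of a] z cmb g abc by simp
 then obtain c' where c': "c' : RR" "c = n \<otimes> c'"
  using free_coeff_s[OF f(2) g(1) _ _ abc(3), of \<one> "\<ominus> a"] f(3) g(1) abc by auto
 then show "rel3 R s n q a b c e" using E_ext_A z val[OF c'(1)] tor_ann[OF f(1)] abc by auto
 next
 assume "rel3 R s n q a b c e"
 then show "comb3 M t x y a b c = \<theta>" using E_ext_A val tor_ann[OF f(1)] abc by auto
 qed
next
 case (E_ext_ZpA i)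
 then have f: "is_tor R M s n i 0 t" "free_over R M n t x" "s ** x = n [^] (i - 1) ** t"
 "free_over R M s t y" "n ** y = t" using c by auto
 have val: "comb3 M t x y a (s \<otimes> b') (n \<otimes> c') = (a \<oplus> n [^] (i - 1) \<otimes> b' \<oplus> c') ** t"
 if "b' : RR" "c' : RR" for b' c'
 using g abc that cy[OF that(2) f(5)] bx[OF that(1) f(3)] by (simp add: comb3_def smult_l_distr)
 show ?thesis
 proof
 assume z: "comb3 M t x y a b c = \<theta>"
 \<comment> \<open>A factor \<open>n\<close> turns \<open>c y\<close> into \<open>c t\<close> and
   isolates \<open>x\<close>; a factor \<open>s\<close> isolates \<open>y\<close>. What is found for
   \<open>n b\<close> and \<open>s c\<close> descends to \<open>b\<close> and \<open>c\<close>,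
   because each branch element is regular modulo the other.\<close>
 have "n ** comb3 M t x y a b c = (n \<otimes> a) ** t +. (n \<otimes> b) ** x +. c ** t"
  using cy[OF abc(3) f(5)] g abc by (simp add: comb3_def smult_r_distr smult_assoc1)
 also have "\<dots> = (n \<otimes> a \<oplus> c) ** t +. (n \<otimes> b) ** x"
  using g abc by (simp add: smult_l_distr M.add.m_ac)
 finally have "(n \<otimes> b) ** x = (\<ominus> (n \<otimes> a \<oplus> c)) ** t"
  using opp[of "n \<otimes> a \<oplus> c" "(n \<otimes> b) ** x"] z g abc by simp
 then have "EX b':RR. n \<otimes> b = s \<otimes> b'"
  using free_coeff[OF f(2) g(1) _ f(3), of "n \<otimes> b" "\<ominus> (n \<otimes> a \<oplus> c)"] abc by simp
 then obtain b' where b': "b' : RR" "b = s \<otimes> b'" using n_mult_s[OF abc(2)] by blast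
 have "s ** comb3 M t x y a b c = a ** (s ** t) +. b ** (s ** x) +. (s \<otimes> c) ** y"
  using g abc by (simp add: comb3_def smult_r_distr smult_assoc1 smult_comm)
 also have "\<dots> = (b \<otimes> n [^] (i - 1)) ** t +. (s \<otimes> c) ** y"
  using g abc st0[OF f(1)] f(3) by (simp add: smult_assoc1)
 finally have "(s \<otimes> c) ** y = (\<ominus> (b \<otimes> n [^] (i - 1))) ** t"
  using opp[of "b \<otimes> n [^] (i - 1)" "(s \<otimes> c) ** y"] z g abc by simp
 then have "EX c':RR. s \<otimes> c = n \<otimes> c'"
  using free_coeff_s[OF f(4) g(1), of \<one> "s \<otimes> c" "\<ominus> (b \<otimes> n [^] (i - 1))"] f(5) g abc by simp
 then obtain c' where c': "c' : RR" "c = n \<otimes> c'"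
  using nodal_ring.n_mult_s[OF R.swap abc(3)] by blast
 show "rel3 R s n q a b c e"
  using E_ext_ZpA z b' c' val[OF b'(1) c'(1)] tor_ann[OF f(1)] abc by auto
 next
 assume "rel3 R s n q a b c e"
 then show "comb3 M t x y a b c = \<theta>" using E_ext_ZpA val tor_ann[OF f(1)] abc by auto
 qed
qed
qed

end

lemma pres_imp_iso:
assumes M: "nodal_module R s n M" and M': "nodal_module R s n M'"
 and p: "pres R M s n q (carrier M) e" and p': "pres R M' s n q (carrier M') e"
shows "mod_iso R M M'"
proof -
interpret M: nodal_module R s n M by fact
interpret M': nodal_module R s n M' by fact
obtain t x y where g: "t : carrier M" "x : carrier M" "y : carrier M"
 "carrier M = gen3 R M t x y" and c: "cond R M s n q t x y e"
 using p by (auto simp: pres_def)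
obtain t' x' y' where g': "t' : carrier M'" "x' : carrier M'" "y' : carrier M'"
 "carrier M' = gen3 R M' t' x' y'" and c': "cond R M' s n q t' x' y' e"
 using p' by (auto simp: pres_def)
show ?thesis
 by (rule mod_iso_gen3[OF M.module_axioms M'.module_axioms g g'])
 (simp add: M.comb3_rel[OF g(1-3) c] M'.comb3_rel[OF g'(1-3) c'])
qed

text \<open>Isomorphism with a concrete module, whose elements have another type, becomes an
  internal property of \<open>M\<close>.\<close>

lemma iso_iff_pres:
assumes M: "nodal_module R s n M" and E: "nodal_module R s n E"
 and p: "pres R E s n q (carrier E) e"
shows "mod_iso R M E \<longleftrightarrow> pres R M s n q (carrier M) e"
using pres_imp_iso[OF M E _ p] pres_transfer[OF E M _ p] mod_iso_sym[of R M E] M E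
by (meson nodal_module_def)

section \<open>Cyclic submodules and direct sums\<close>

definition cyc :: "('r, 'c) ring_scheme => ('r, 'm, 'd) module_scheme => 'm => 'm set" where
"cyc R M x = {a \<odot>\<^bsub>M\<^esub> x | a. a : carrier R}"

context module
begin

lemma cycI: "a : carrier R ==> a \<odot>\<^bsub>M\<^esub> x : cyc R M x"
by (auto simp: cyc_def)

lemma cyc_gen3:
assumes "x : carrier M"
shows "gen3 R M \<zero>\<^bsub>M\<^esub> x \<zero>\<^bsub>M\<^esub> = cyc R M x" "gen3 R M \<zero>\<^bsub>M\<^esub> \<zero>\<^bsub>M\<^esub> x = cyc R M x"
 "gen3 R M x \<zero>\<^bsub>M\<^esub> \<zero>\<^bsub>M\<^esub> = cyc R M x"
proof -
have eqs: "!!a b c. [|a : carrier R; b : carrier R; c : carrier R|] ==> comb3 M \<zero>\<^bsub>M\<^esub> x \<zero>\<^bsub>M\<^esub> a b c = b \<odot>\<^bsub>M\<^esub> x"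
 "!!a b c. [|a : carrier R; b : carrier R; c : carrier R|] ==> comb3 M \<zero>\<^bsub>M\<^esub> \<zero>\<^bsub>M\<^esub> x a b c = c \<odot>\<^bsub>M\<^esub> x"
 "!!a b c. [|a : carrier R; b : carrier R; c : carrier R|] ==> comb3 M x \<zero>\<^bsub>M\<^esub> \<zero>\<^bsub>M\<^esub> a b c = a \<odot>\<^bsub>M\<^esub> x"
 using assms by (simp_all add: comb3_def)
show "gen3 R M \<zero>\<^bsub>M\<^esub> x \<zero>\<^bsub>M\<^esub> = cyc R M x" "gen3 R M \<zero>\<^bsub>M\<^esub> \<zero>\<^bsub>M\<^esub> x = cyc R M x"
 "gen3 R M x \<zero>\<^bsub>M\<^esub> \<zero>\<^bsub>M\<^esub> = cyc R M x"
 unfolding gen3_comb3 cyc_def using eqs by (safe; metis)+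
qed

lemma cyc_self: "x : carrier M ==> x : cyc R M x"
using cycI[of \<one> x] by simp

lemma gen3_submodule:
assumes "t : carrier M" "x : carrier M" "y : carrier M"
shows "submodule (gen3 R M t x y) R M"
proof (rule submoduleI)
show "gen3 R M t x y <= carrier M" using assms by (auto simp: gen3_comb3)
have "\<zero>\<^bsub>M\<^esub> = comb3 M t x y \<zero> \<zero> \<zero>" using assms by (simp add: comb3_def)
then show "\<zero>\<^bsub>M\<^esub> : gen3 R M t x y" by (simp add: comb3_mem_gen3)
next
fix u r assume r: "r : carrier R" and "u : gen3 R M t x y"
then obtain a b c where u: "a : carrier R" "b : carrier R" "c : carrier R" "u = comb3 M t x y a b c"
 by (auto simp: gen3_comb3)
then have "r \<odot>\<^bsub>M\<^esub> u = comb3 M t x y (r \<otimes> a) (r \<otimes> b) (r \<otimes> c)" using r assms by (simp add: comb3_smult)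
then show "r \<odot>\<^bsub>M\<^esub> u : gen3 R M t x y" using u r by (simp add: comb3_mem_gen3)
next
fix u assume "u : gen3 R M t x y"
then obtain a b c where u: "a : carrier R" "b : carrier R" "c : carrier R" "u = comb3 M t x y a b c"
 by (auto simp: gen3_comb3)
then have "\<ominus>\<^bsub>M\<^esub> u = (\<ominus> \<one>) \<odot>\<^bsub>M\<^esub> u" using assms by (simp add: smult_l_minus)
also have "\<dots> = comb3 M t x y (\<ominus> \<one> \<otimes> a) (\<ominus> \<one> \<otimes> b) (\<ominus> \<one> \<otimes> c)"
 unfolding u(4) using u(1-3) assms by (intro comb3_smult[symmetric]) auto
finally show "\<ominus>\<^bsub>M\<^esub> u : gen3 R M t x y" using u by (simp add: comb3_mem_gen3)
next
fix u v assume "u : gen3 R M t x y" "v : gen3 R M t x y"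
then obtain a b c a' b' c' where u: "a : carrier R" "b : carrier R" "c : carrier R" "u = comb3 M t x y a b c"
 "a' : carrier R" "b' : carrier R" "c' : carrier R" "v = comb3 M t x y a' b' c'"
 by (auto simp: gen3_comb3)
then have "u \<oplus>\<^bsub>M\<^esub> v = comb3 M t x y (a \<oplus> a') (b \<oplus> b') (c \<oplus> c')" using assms by (simp add: comb3_add)
then show "u \<oplus>\<^bsub>M\<^esub> v : gen3 R M t x y" using u by (simp add: comb3_mem_gen3)
qed

lemma cyc_submodule: "x : carrier M ==> submodule (cyc R M x) R M"
using gen3_submodule[of "\<zero>\<^bsub>M\<^esub>" x "\<zero>\<^bsub>M\<^esub>"] cyc_gen3(1) by simp

text \<open>Two decompositions of one element differ by a decomposition of zero, formed with the
  scalar \<open>\<ominus> \<one>\<close>.\<close>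

lemma direct_sumI:
assumes sub: "!!N. N : set Ns ==> submodule N R M"
 and ex: "!!m. m : carrier M ==>
 \<exists>f. (\<forall>j<length Ns. f j : Ns ! j) & m = (\<Oplus>\<^bsub>M\<^esub>j\<in>{..<length Ns}. f j)"
 and zero: "!!f j. [|!!j. j < length Ns ==> f j : Ns ! j; (\<Oplus>\<^bsub>M\<^esub>j\<in>{..<length Ns}. f j) = \<zero>\<^bsub>M\<^esub>;
 j < length Ns|] ==> f j = \<zero>\<^bsub>M\<^esub>"
shows "direct_sum R M Ns"
unfolding direct_sum_def
proof (intro conjI allI impI ballI)
fix j assume "j < length Ns" then show "submodule (Ns ! j) R M" using sub by simp
next
fix m assume m: "m : carrier M"
let ?n = "length Ns"
have sub': "!!j. j < ?n ==> submodule (Ns ! j) R M" using sub by simp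
have car: "!!j x. [|j < ?n; x : Ns ! j|] ==> x : carrier M" using submoduleE(1)[OF sub'] by blast
obtain f where f: "!!j. j < ?n ==> f j : Ns ! j" "m = (\<Oplus>\<^bsub>M\<^esub>j\<in>{..<?n}. f j)"
 using ex[OF m] by blast
have fc: "f j : carrier M" if "j < ?n" for j using f car that by blast
show "\<exists>!f. f : (\<Pi>\<^sub>E j\<in>{..<?n}. Ns ! j) & m = (\<Oplus>\<^bsub>M\<^esub>j\<in>{..<?n}. f j)"
proof (rule ex1I[of _ "restrict f {..<?n}"])
 have "(\<Oplus>\<^bsub>M\<^esub>j\<in>{..<?n}. restrict f {..<?n} j) = (\<Oplus>\<^bsub>M\<^esub>j\<in>{..<?n}. f j)"
 using fc by (intro M.finsum_cong') auto
 then show "restrict f {..<?n} : (\<Pi>\<^sub>E j\<in>{..<?n}. Ns ! j) &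
  m = (\<Oplus>\<^bsub>M\<^esub>j\<in>{..<?n}. restrict f {..<?n} j)" using f by auto
next
 fix g assume g: "g : (\<Pi>\<^sub>E j\<in>{..<?n}. Ns ! j) & m = (\<Oplus>\<^bsub>M\<^esub>j\<in>{..<?n}. g j)"
 then have gN: "!!j. j < ?n ==> g j : Ns ! j" by auto
 have gc: "g j : carrier M" if "j < ?n" for j using gN car that by blast
 let ?d = "%j. f j \<oplus>\<^bsub>M\<^esub> (\<ominus> \<one>) \<odot>\<^bsub>M\<^esub> g j"
 have "(\<Oplus>\<^bsub>M\<^esub>j\<in>{..<?n}. ?d j) = (\<Oplus>\<^bsub>M\<^esub>j\<in>{..<?n}. f j) \<oplus>\<^bsub>M\<^esub> (\<Oplus>\<^bsub>M\<^esub>j\<in>{..<?n}. (\<ominus> \<one>) \<odot>\<^bsub>M\<^esub> g j)"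
 using fc gc by (intro M.finsum_addf) auto
 also have "(\<Oplus>\<^bsub>M\<^esub>j\<in>{..<?n}. (\<ominus> \<one>) \<odot>\<^bsub>M\<^esub> g j) = (\<ominus> \<one>) \<odot>\<^bsub>M\<^esub> (\<Oplus>\<^bsub>M\<^esub>j\<in>{..<?n}. g j)"
 using gc by (intro finsum_smult_ldistr[symmetric]) auto
 also have "(\<Oplus>\<^bsub>M\<^esub>j\<in>{..<?n}. g j) = m" using g by simp
 also have "(\<Oplus>\<^bsub>M\<^esub>j\<in>{..<?n}. f j) = m" using f by simp
 also have "m \<oplus>\<^bsub>M\<^esub> (\<ominus> \<one>) \<odot>\<^bsub>M\<^esub> m = \<zero>\<^bsub>M\<^esub>" using m by (simp add: smult_l_minus M.r_neg)
 finally have z: "(\<Oplus>\<^bsub>M\<^esub>j\<in>{..<?n}. ?d j) = \<zero>\<^bsub>M\<^esub>" .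
 have dN: "?d j : Ns ! j" if "j < ?n" for j
 using submoduleE(4,5)[OF sub'[OF that]] f(1)[OF that] gN[OF that] by simp
 have "g j = f j" if j: "j < ?n" for j
 proof -
 have "f j \<ominus>\<^bsub>M\<^esub> g j = \<zero>\<^bsub>M\<^esub>"
  using zero[OF dN z j] fc[OF j] gc[OF j] by (simp add: smult_l_minus M.minus_eq)
 then show ?thesis using M.diff_zero_iff[OF fc[OF j] gc[OF j]] by simp
 qed
 then show "g = restrict f {..<?n}" using g by (auto simp: PiE_def extensional_def restrict_def)
qed
qed

lemma finsum_lessThan_Suc_shift:
assumes "!!j. j < Suc l ==> f j : carrier M"
shows "(\<Oplus>\<^bsub>M\<^esub>j\<in>{..<Suc l}. f j) = f 0 \<oplus>\<^bsub>M\<^esub> (\<Oplus>\<^bsub>M\<^esub>j\<in>{..<l}. f (Suc j))"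
proof -
have "(\<Oplus>\<^bsub>M\<^esub>j\<in>insert 0 (Suc ` {..<l}). f j) = f 0 \<oplus>\<^bsub>M\<^esub> (\<Oplus>\<^bsub>M\<^esub>j\<in>Suc ` {..<l}. f j)"
 using assms by (intro M.finsum_insert) auto
also have "(\<Oplus>\<^bsub>M\<^esub>j\<in>Suc ` {..<l}. f j) = (\<Oplus>\<^bsub>M\<^esub>j\<in>{..<l}. f (Suc j))"
 using assms by (intro M.finsum_reindex) auto
finally show ?thesis by (simp add: lessThan_Suc_eq_insert_0)
qed

lemma direct_sum_zeroI:
assumes ds: "direct_sum R M Ns" and f: "!!j. j < length Ns ==> f j : Ns ! j"
 and s0: "(\<Oplus>\<^bsub>M\<^esub>j\<in>{..<length Ns}. f j) = \<zero>\<^bsub>M\<^esub>" and j: "j < length Ns"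
shows "f j = \<zero>\<^bsub>M\<^esub>"
proof -
let ?n = "length Ns"
have sub: "!!j. j < ?n ==> submodule (Ns ! j) R M" using ds by (simp add: direct_sum_def)
have car: "!!j x. [|j < ?n; x : Ns ! j|] ==> x : carrier M" using submoduleE(1)[OF sub] by blast
have z: "!!j. j < ?n ==> \<zero>\<^bsub>M\<^esub> : Ns ! j"
 using subgroup.one_closed[OF submodule.axioms(1)[OF sub]] by fastforce
have 1: "restrict f {..<?n} : (\<Pi>\<^sub>E j\<in>{..<?n}. Ns ! j)" using f by auto
have 2: "(\<lambda>j\<in>{..<?n}. \<zero>\<^bsub>M\<^esub>) : (\<Pi>\<^sub>E j\<in>{..<?n}. Ns ! j)" using z by auto
have "(\<Oplus>\<^bsub>M\<^esub>j\<in>{..<?n}. restrict f {..<?n} j) = (\<Oplus>\<^bsub>M\<^esub>j\<in>{..<?n}. f j)"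
 using f car by (intro M.finsum_cong') auto
moreover have "(\<Oplus>\<^bsub>M\<^esub>j\<in>{..<?n}. (\<lambda>j\<in>{..<?n}. \<zero>\<^bsub>M\<^esub>) j) = \<zero>\<^bsub>M\<^esub>"
 by (intro M.add.finprod_one_eqI) auto
ultimately have "restrict f {..<?n} = (\<lambda>j\<in>{..<?n}. \<zero>\<^bsub>M\<^esub>)"
 using ds 1 2 s0 unfolding direct_sum_def by (metis M.zero_closed)
then show ?thesis using j by (metis lessThan_iff restrict_apply)
qed

text \<open>For torsion-free modules, where the summand spanned by \<open>T\<close> is zero and must
  not appear in the list.\<close>

lemma direct_sum_drop_zero:
assumes ds: "direct_sum R M ({\<zero>\<^bsub>M\<^esub>} # Ns)"
shows "direct_sum R M Ns"
proof (rule direct_sumI)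
have sub: "!!j. j < Suc (length Ns) ==> submodule (({\<zero>\<^bsub>M\<^esub>} # Ns) ! j) R M"
 using ds by (simp add: direct_sum_def)
show s: "submodule N R M" if "N : set Ns" for N
 using that sub by (metis Suc_mono in_set_conv_nth nth_Cons_Suc)
have car: "!!j x. [|j < length Ns; x : Ns ! j|] ==> x : carrier M"
 using submoduleE(1)[OF s] by (meson nth_mem subsetD)
show "\<exists>f. (\<forall>j<length Ns. f j : Ns ! j) & m = (\<Oplus>\<^bsub>M\<^esub>j\<in>{..<length Ns}. f j)"
 if m: "m : carrier M" for m
proof -
 obtain f where f: "f : (\<Pi>\<^sub>E j\<in>{..<Suc (length Ns)}. ({\<zero>\<^bsub>M\<^esub>} # Ns) ! j)"
 "m = (\<Oplus>\<^bsub>M\<^esub>j\<in>{..<Suc (length Ns)}. f j)"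
 using ds m by (fastforce simp: direct_sum_def)
 have f0: "f 0 = \<zero>\<^bsub>M\<^esub>" using f(1) PiE_mem[OF f(1), of 0] by simp
 have fS: "f (Suc j) : Ns ! j" if "j < length Ns" for j
 using PiE_mem[OF f(1), of "Suc j"] that by simp
 have "f j : carrier M" if "j < Suc (length Ns)" for j
 using that f0 fS car by (cases j) auto
 then have "m = (\<Oplus>\<^bsub>M\<^esub>j\<in>{..<length Ns}. f (Suc j))"
 using f(2) f0 fS car by (simp add: finsum_lessThan_Suc_shift)
 then show ?thesis using fS by (intro exI[of _ "%j. f (Suc j)"]) auto
qed
show "f j = \<zero>\<^bsub>M\<^esub>" if f: "!!j. j < length Ns ==> f j : Ns ! j"
 "(\<Oplus>\<^bsub>M\<^esub>j\<in>{..<length Ns}. f j) = \<zero>\<^bsub>M\<^esub>" and j: "j < length Ns" for f j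
proof -
 let ?g = "%j. case j of 0 => \<zero>\<^bsub>M\<^esub> | Suc j => f j"
 have g: "!!j. j < Suc (length Ns) ==> ?g j : carrier M" using f(1) car by (auto split: nat.split)
 have "(\<Oplus>\<^bsub>M\<^esub>j\<in>{..<Suc (length Ns)}. ?g j) = ?g 0 \<oplus>\<^bsub>M\<^esub> (\<Oplus>\<^bsub>M\<^esub>j\<in>{..<length Ns}. ?g (Suc j))"
 by (rule finsum_lessThan_Suc_shift[OF g])
 then have "(\<Oplus>\<^bsub>M\<^esub>j\<in>{..<length ({\<zero>\<^bsub>M\<^esub>} # Ns)}. ?g j) = \<zero>\<^bsub>M\<^esub>" using f(2) by simp
 moreover have "?g j : ({\<zero>\<^bsub>M\<^esub>} # Ns) ! j" if "j < length ({\<zero>\<^bsub>M\<^esub>} # Ns)" for j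
 using that f(1) by (cases j) auto
 ultimately have "?g (Suc j) = \<zero>\<^bsub>M\<^esub>" using direct_sum_zeroI[OF ds, of ?g "Suc j"] j by simp
 then show ?thesis by simp
qed
qed

end

section \<open>Splitting off generators without link to the torsion\<close>

fun lat_entry :: "kind => entry" where
"lat_entry KX = E_Zp" | "lat_entry KY = E_A" | "lat_entry KZ = E_reg"

context nodal_over
begin

text \<open>If \<open>n^l v\<close> were in \<open>T\<close>, minimality would make the coefficient
  \<open>n^l\<close> a multiple of \<open>s\<close>, and then \<open>n^(l+1)\<close> would be
  zero.\<close>

lemma free_of_min:
assumes min: "min_gsys R M s n T I v k" and j: "j : I" "k j ~= KY" and t: "t : T"
shows "free_over R M n t (v j)"
unfolding free_over_def
proof (intro conjI allI ballI notI)
have I: "finite I" and v: "v : I \<rightarrow> MM" using min by (auto simp: min_gsys_def gsys_def)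
then show vj: "v j : MM" using j by auto
fix l :: nat and a assume a: "a : RR" and e: "n [^] l ** v j = a ** t"
let ?r = "%i. if i = j then n [^] l else \<zero>"
have "(\<Oplus>\<^bsub>M\<^esub>i\<in>I. ?r i ** v i) = (\<Oplus>\<^bsub>M\<^esub>i\<in>I. (n [^] l \<otimes> (if i = j then \<one> else \<zero>)) ** v i)"
 using v by (intro M.finsum_cong') auto
also have "\<dots> = n [^] l ** v j" using I v j by (subst lc_smult) (auto simp: lc_delta)
finally have "(\<Oplus>\<^bsub>M\<^esub>i\<in>I. ?r i ** v i) : T" using e a t sub_smult[OF T] by simp
moreover have "?r : I \<rightarrow> RR" by auto
ultimately obtain b where b: "b : RR" "?r j = s \<otimes> b"
 using coeff_not_KY[OF min _ _ j(1), of ?r] j(2) by blast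
then have "n [^] Suc l = (s \<otimes> b) \<otimes> n" by simp
also have "\<dots> = b \<otimes> (s \<otimes> n)" using b by (simp only: R.m_ac s_closed n_closed R.m_closed)
also have "\<dots> = \<zero>" using b by simp
finally show False using n_pow by blast
qed

lemma free_of_min_s:
assumes "min_gsys R M s n T I v k" "j : I" "k j ~= KX" "t : T"
shows "free_over R M s t (v j)"
using nodal_over.free_of_min[OF swap_over min_gsys_swap[OF assms(1)]] assms by simp

text \<open>Here \<open>J\<close> collects the generators whose relations reach into
  \<open>T\<close>; all others satisfy theirs exactly. By minimality the coefficients of a relation
  modulo \<open>T\<close> are those dictated by the kinds, so every term outside \<open>J\<close>
  vanishes by itself and the sum is direct.\<close>

lemma assemble:
assumes min: "min_gsys R M s n T I v k" and J: "J <= I"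
 and X: "!!j. [|j : I - J; k j = KX|] ==> s ** v j = \<theta>"
 and Y: "!!j. [|j : I - J; k j = KY|] ==> n ** v j = \<theta>"
shows "\<exists>Ns es. direct_sum R M (span_over R M T J v # Ns) &
 list_all2 (pres R M s n q) Ns es & set es <= {E_Zp, E_A, E_reg}"
proof -
have I: "finite I" and v: "v : I \<rightarrow> MM" and span: "span_over R M T I v = MM"
 using min by (auto simp: min_gsys_def gsys_def)
have vc: "!!j. j : I ==> v j : MM" using v by auto
have fJ: "finite J" and vJ: "v : J \<rightarrow> MM" using I J v finite_subset by auto
define js where "js = sorted_list_of_set (I - J)"
have js: "set js = I - J" "distinct js" using I by (auto simp: js_def)
let ?l = "length js"
have bij: "bij_betw (nth js) {..<?l} (I - J)" using bij_betw_nth[OF js(2)] js(1) by simp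
have jsI: "!!l. l < ?l ==> js ! l : I - J" using js(1) nth_mem by blast
define Ns where "Ns = map (%j. cyc R M (v j)) js"
define es where "es = map (%j. lat_entry (k j)) js"
let ?H = "span_over R M T J v"
have H: "submodule ?H R M" by (rule span_submodule[OF T fJ vJ])
have reidx: "(\<Oplus>\<^bsub>M\<^esub>l\<in>{..<?l}. g (js ! l)) = (\<Oplus>\<^bsub>M\<^esub>j\<in>I - J. g j)" if "g : I - J \<rightarrow> MM" for g
proof -
 have "(\<Oplus>\<^bsub>M\<^esub>j\<in>nth js ` {..<?l}. g j) = (\<Oplus>\<^bsub>M\<^esub>l\<in>{..<?l}. g (js ! l))"
 using bij that by (intro M.finsum_reindex) (auto simp: bij_betw_def)
 then show ?thesis using bij by (simp add: bij_betw_def)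
qed
have ds: "direct_sum R M (?H # Ns)"
proof (rule direct_sumI)
 show "submodule N R M" if "N : set (?H # Ns)" for N
 using that H js(1) vc by (auto simp: Ns_def intro!: cyc_submodule)
 have lenNs: "length (?H # Ns) = Suc ?l" by (simp add: Ns_def)
 show "\<exists>f. (\<forall>j<length (?H # Ns). f j : (?H # Ns) ! j) & m = (\<Oplus>\<^bsub>M\<^esub>j\<in>{..<length (?H # Ns)}. f j)"
 if m: "m : MM" for m
 proof -
 obtain t r where t: "t : T" "r : I \<rightarrow> RR" "m = t +. (\<Oplus>\<^bsub>M\<^esub>j\<in>I. r j ** v j)"
  using subsetD[OF equalityD2[OF span] m] unfolding span_over_def by blast
 have rc: "!!j. j : I ==> r j : RR" using t by auto
 let ?h = "t +. (\<Oplus>\<^bsub>M\<^esub>j\<in>J. r j ** v j)"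
 let ?f = "%l. case l of 0 => ?h | Suc l => r (js ! l) ** v (js ! l)"
 have hH: "?h : ?H" using t J by (intro span_overI[of t T r]) auto
 have fc: "!!j. j < Suc ?l ==> ?f j : MM"
  using sub_carrier[OF H hH] jsI rc vc by (auto split: nat.split)
 have "(\<Oplus>\<^bsub>M\<^esub>j\<in>{..<Suc ?l}. ?f j) = ?f 0 +. (\<Oplus>\<^bsub>M\<^esub>j\<in>{..<?l}. ?f (Suc j))"
  by (rule finsum_lessThan_Suc_shift[OF fc])
 also have "(\<Oplus>\<^bsub>M\<^esub>j\<in>{..<?l}. ?f (Suc j)) = (\<Oplus>\<^bsub>M\<^esub>j\<in>I - J. r j ** v j)"
  using reidx[of "%j. r j ** v j"] rc vc by simp
 also have "?f 0 +. (\<Oplus>\<^bsub>M\<^esub>j\<in>I - J. r j ** v j) =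
  t +. ((\<Oplus>\<^bsub>M\<^esub>j\<in>J. r j ** v j) +. (\<Oplus>\<^bsub>M\<^esub>j\<in>I - J. r j ** v j))"
  using t sub_carrier[OF T] J rc vc by (subst nat.case) (intro M.a_assoc lc_closed; auto)
 also have "\<dots> = m"
  using t(3) finsum_split[OF I J, of "%j. r j ** v j"] rc vc by (simp add: Pi_iff)
 finally have "m = (\<Oplus>\<^bsub>M\<^esub>j\<in>{..<length (?H # Ns)}. ?f j)" unfolding lenNs by (rule sym)
 moreover have "?f j : (?H # Ns) ! j" if "j < length (?H # Ns)" for j
  using that hH jsI rc by (cases j) (auto simp: Ns_def intro!: cycI)
 ultimately show ?thesis by blast
 qed
 show "f j = \<theta>" if f: "!!j. j < length (?H # Ns) ==> f j : (?H # Ns) ! j"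
 "(\<Oplus>\<^bsub>M\<^esub>j\<in>{..<length (?H # Ns)}. f j) = \<theta>" and jl: "j < length (?H # Ns)" for f j
 proof -
 obtain t r where t: "t : T" "r : J \<rightarrow> RR" "f 0 = t +. (\<Oplus>\<^bsub>M\<^esub>j\<in>J. r j ** v j)"
  using f(1)[of 0] by (auto simp: span_over_def)
 have "EX a:RR. f (Suc l) = a ** v (js ! l)" if "l < ?l" for l
  using f(1)[of "Suc l"] that by (auto simp: Ns_def cyc_def)
 then obtain a where a: "!!l. l < ?l ==> a l : RR"
  "!!l. l < ?l ==> f (Suc l) = a l ** v (js ! l)" by metis
 \<comment> \<open>The position of an index in the list \<open>js\<close>; it carries the
   coefficients of the listed summands back to the index set \<open>I\<close>.\<close>
 define idx where "idx = inv_into {..<?l} (nth js)"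
 have idx: "!!l. l < ?l ==> idx (js ! l) = l"
  using bij_betw_inv_into_left[OF bij] by (simp add: idx_def)
 have idx': "!!j. j : I - J ==> idx j < ?l"
  using bij_betwE[OF bij_betw_inv_into[OF bij]] by (auto simp: idx_def)
 define r' where "r' j = (if j : J then r j else a (idx j))" for j
 have r': "r' : I \<rightarrow> RR" using t a idx' by (auto simp: r'_def)
 then have r'c: "!!j. j : I ==> r' j : RR" by auto
 have f0c: "f 0 : MM" using f(1)[of 0] sub_carrier[OF H] by simp
 have fc: "!!j. j < Suc ?l ==> f j : MM"
 proof -
  fix j assume "j < Suc ?l"
  then show "f j : MM" using f0c a jsI vc by (cases j) auto
 qed
 have "(\<Oplus>\<^bsub>M\<^esub>j\<in>{..<Suc ?l}. f j) = f 0 +. (\<Oplus>\<^bsub>M\<^esub>l\<in>{..<?l}. f (Suc l))"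
  by (rule finsum_lessThan_Suc_shift[OF fc])
 also have "(\<Oplus>\<^bsub>M\<^esub>l\<in>{..<?l}. f (Suc l)) = (\<Oplus>\<^bsub>M\<^esub>l\<in>{..<?l}. r' (js ! l) ** v (js ! l))"
  using a jsI idx vc by (intro M.finsum_cong') (auto simp: r'_def)
 also have "\<dots> = (\<Oplus>\<^bsub>M\<^esub>j\<in>I - J. r' j ** v j)"
  using r'c vc by (intro reidx) auto
 finally have s0: "f 0 +. (\<Oplus>\<^bsub>M\<^esub>j\<in>I - J. r' j ** v j) = \<theta>"
  using f(2) by (simp add: Ns_def)
 have f0: "f 0 = t +. (\<Oplus>\<^bsub>M\<^esub>j\<in>J. r' j ** v j)"
  unfolding t(3) using t(2) vJ
  by (intro arg_cong[of _ _ "%z. t +. z"] M.finsum_cong') (auto simp: r'_def Pi_iff)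
 have tc: "t : MM" using t sub_carrier[OF T] by blast
 have r'J: "r' : J \<rightarrow> RR" "r' : I - J \<rightarrow> RR" "v : I - J \<rightarrow> MM" using r' J v by auto
 have "t +. (\<Oplus>\<^bsub>M\<^esub>j\<in>I. r' j ** v j) = \<theta>"
  using s0 f0 finsum_split[OF I J, of "%j. r' j ** v j"] r'c vc tc r'J vJ
  by (simp add: Pi_iff M.a_assoc)
 then have "(\<Oplus>\<^bsub>M\<^esub>j\<in>I. r' j ** v j) +. t : T" using sub_zero[OF T] tc r' v by (simp add: M.a_comm)
 then have rT: "(\<Oplus>\<^bsub>M\<^esub>j\<in>I. r' j ** v j) : T" using sub_cancel[OF T _ _ t(1)] r' v by simp
 \<comment> \<open>The extended family of coefficients is a relation modulo \<open>T\<close>.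
   Minimality puts \<open>r' j\<close> into sR, into nR or makes it zero, according to the kind, and
   outside \<open>J\<close> such a coefficient kills \<open>v j\<close>.\<close>
 have z: "r' j ** v j = \<theta>" if j: "j : I - J" for j
 proof (cases "k j")
  case KX
  then have "k j ~= KY" by simp
  then obtain b where "b : RR" "r' j = s \<otimes> b"
  using coeff_not_KY[OF min r' rT] DiffD1[OF j] by blast
  then show ?thesis using X[OF j KX] j vc by (simp add: smult_assoc1 smult_comm[of s])
 next
  case KY
  then have "k j ~= KX" by simp
  then obtain b where "b : RR" "r' j = n \<otimes> b"
  using coeff_not_KX[OF min r' rT] DiffD1[OF j] by blast
  then show ?thesis using Y[OF j KY] j vc by (simp add: smult_assoc1 smult_comm[of n])
 next
  case KZ
  then show ?thesis using coeff_KZ[OF min r' rT] j vc by simp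
 qed
 have "(\<Oplus>\<^bsub>M\<^esub>j\<in>I - J. r' j ** v j) = \<theta>" using z by (intro M.add.finprod_one_eqI) auto
 then have "f 0 = \<theta>" using s0 f0c by simp
 moreover have "f (Suc l) = \<theta>" if l: "l < ?l" for l
  using z[OF jsI[OF l]] a(2)[OF l] jsI[OF l] idx[OF l] by (simp add: r'_def)
 ultimately show ?thesis using jl lenNs by (cases j) auto
 qed
qed
have pres: "pres R M s n q (cyc R M (v j)) (lat_entry (k j))" if j: "j : I - J" for j
proof -
 have vj: "v j : MM" and jI: "j : I" using vc j by auto
 have z: "\<theta> : cyc R M (v j)" and self: "v j : cyc R M (v j)"
 using sub_zero[OF cyc_submodule[OF vj]] cyc_self[OF vj] by auto
 show ?thesis
 proof (cases "k j")
 case KX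
 have "cond R M s n q \<theta> (v j) \<theta> E_Zp"
  using free_of_min[OF min jI _ sub_zero[OF T]] KX X[OF j KX] by simp
 then show ?thesis unfolding pres_def using KX z self cyc_gen3(1)[OF vj] by (metis lat_entry.simps(1))
 next
 case KY
 have "cond R M s n q \<theta> \<theta> (v j) E_A"
  using free_of_min_s[OF min jI _ sub_zero[OF T]] KY Y[OF j KY] by simp
 then show ?thesis unfolding pres_def using KY z self cyc_gen3(2)[OF vj] by (metis lat_entry.simps(2))
 next
 case KZ
 have "cond R M s n q \<theta> (v j) \<theta> E_reg"
  using free_of_min_s[OF min jI _ sub_zero[OF T]] free_of_min[OF min jI _ sub_zero[OF T]] KZ by simp
 then show ?thesis unfolding pres_def using KZ z self cyc_gen3(1)[OF vj] by (metis lat_entry.simps(3))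
 qed
qed
have "list_all2 (pres R M s n q) Ns es"
 using pres js(1) by (auto simp: Ns_def es_def list_all2_map1 list_all2_map2 list_all2_same)
moreover have "set es <= {E_Zp, E_A, E_reg}"
proof
 fix e assume "e : set es"
 then obtain j where "e = lat_entry (k j)" by (auto simp: es_def)
 then show "e : {E_Zp, E_A, E_reg}" by (cases "k j") auto
qed
ultimately show ?thesis using ds by blast
qed

end

section \<open>Existence: normalising the links with cyclic torsion\<close>

context nodal_module
begin

lemma tor_cases:
assumes t: "is_tor R M s n i c t" and c: "c = 0 \<or> i >= 2" and a: "a : RR"
shows "a ** t = \<theta> \<or> (\<exists>k<i. EX u:Units R. a ** t = (n [^] k \<otimes> u) ** t)"
proof -
have i: "i >= 1" and tM: "t : MM" using t by (auto simp: is_tor_def)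
consider "a : tor_ideal R s n i c"
 | k u b d where "k < i" "u : Units R" "b : RR" "d : RR"
 "a = n [^] (k::nat) \<otimes> u \<oplus> ((s \<ominus> [c] \<cdot>\<^bsub>R\<^esub> \<one> \<otimes> n [^] (i - 1)) \<otimes> b \<oplus> n [^] i \<otimes> d)"
 using tor_ideal_cases[OF a i c] by blast
then show ?thesis
proof cases
 case 1
 then show ?thesis using tor_ann[OF t c a] by simp
next
 case 2
 let ?j = "(s \<ominus> [c] \<cdot>\<^bsub>R\<^esub> \<one> \<otimes> n [^] (i - 1)) \<otimes> b \<oplus> n [^] i \<otimes> d"
 have j: "?j : RR" using 2 by simp
 have "?j : tor_ideal R s n i c" using 2 tor_idealI by blast
 then have "?j ** t = \<theta>" using tor_ann[OF t c j] by simp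
 then have "a ** t = (n [^] k \<otimes> u) ** t"
 unfolding 2(5) using smult_l_distr[of "n [^] k \<otimes> u" ?j t] j tM R.Units_closed[OF 2(2)] by simp
 then show ?thesis using 2 by blast
qed
qed

lemma tor_unit_pow:
assumes t: "is_tor R M s n i c t" and u: "u : Units R" and z: "(n [^] (k::nat) \<otimes> u) ** t = \<theta>"
shows "k >= i"
proof (rule ccontr)
assume ki: "~ k >= i"
have tM: "t : MM" using t by (auto simp: is_tor_def)
note uc = R.Units_closed[OF u]
have "inv u ** ((u \<otimes> n [^] k) ** t) = \<theta>" using z u uc by (simp add: R.m_comm)
then have "n [^] k ** t = \<theta>"
 using u uc tM R.Units_l_inv[OF u] by (simp add: smult_assoc1[symmetric] R.m_assoc[symmetric])
then show False using n_pow_smult_zero[OF tM, of k "i - 1"] t ki by (simp add: is_tor_def)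
qed

text \<open>A nonzero multiple of \<open>t\<close> is \<open>n^k u t\<close> with
  \<open>k < i\<close>; if \<open>n\<close> kills it, then \<open>k + 1\<close> is at least
  \<open>i\<close>. So the socle of R t is spanned by \<open>n^(i-1) t\<close>.\<close>

lemma tor_n_kill:
assumes t: "is_tor R M s n i c t" and c: "c = 0 \<or> i >= 2" and a: "a : RR"
 and z: "n ** (a ** t) = \<theta>"
shows "a ** t = \<theta> \<or> (EX u:Units R. a ** t = (n [^] (i - 1) \<otimes> u) ** t)"
proof (cases "a ** t = \<theta>")
case False
have tM: "t : MM" using t by (auto simp: is_tor_def)
obtain k u where k: "k < i" "u : Units R" "a ** t = (n [^] k \<otimes> u) ** t"
 using tor_cases[OF t c a] False by blast
note u = R.Units_closed[OF k(2)]
have "(n [^] Suc k \<otimes> u) ** t = n ** ((n [^] k \<otimes> u) ** t)"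
 using u tM by (simp add: smult_assoc1[symmetric] R.m_ac)
then have "(n [^] Suc k \<otimes> u) ** t = \<theta>" using z k by simp
then have "i - 1 = k" using tor_unit_pow[OF t k(2)] k(1) by fastforce
then show ?thesis using k by blast
qed simp

lemma cyc_unit:
assumes "u : Units R" "x : MM"
shows "cyc R M (u ** x) = cyc R M x"
proof
note u = R.Units_closed[OF assms(1)]
show "cyc R M (u ** x) <= cyc R M x"
proof
 fix y assume "y : cyc R M (u ** x)"
 then obtain a where "a : RR" "y = a ** (u ** x)" by (auto simp: cyc_def)
 then show "y : cyc R M x" using cycI[of "a \<otimes> u" x] u assms by (simp add: smult_assoc1)
qed
show "cyc R M x <= cyc R M (u ** x)"
proof
 fix y assume "y : cyc R M x"
 then obtain a where a: "a : RR" "y = a ** x" by (auto simp: cyc_def)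
 have "(a \<otimes> inv u) ** (u ** x) = y"
 using a u assms R.Units_l_inv[OF assms(1)] by (simp add: smult_assoc1[symmetric] R.m_assoc)
 then show "y : cyc R M (u ** x)" using cycI[of "a \<otimes> inv u" "u ** x"] a assms by simp
qed
qed

lemma is_tor_unit:
assumes t: "is_tor R M s n i c t" and u: "u : Units R"
shows "is_tor R M s n i c (u ** t)"
proof -
have tM: "t : MM" using t by (auto simp: is_tor_def)
note uc = R.Units_closed[OF u]
have "n [^] (i - 1) ** (u ** t) ~= \<theta>"
 using tor_unit_pow[OF t u, of "i - 1"] tM uc t by (auto simp: smult_assoc1 is_tor_def)
moreover have "[c] \<cdot>\<^bsub>R\<^esub> \<one> \<otimes> n [^] (i - 1) : RR" by simp
ultimately show ?thesis
 using t tM uc unfolding is_tor_def by (simp add: smult_comm[of _ u])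
qed

lemma n_pow_mx:
assumes "is_tor R M s n i 0 t" "u : RR"
shows "s ** (u ** t) = \<theta>"
using assms by (simp add: is_tor_def smult_comm[of s])

end

context nodal_over
begin

lemma span_empty: "span_over R M T {} v = T"
proof
show "T <= span_over R M T {} v" by (rule span_T[OF T]) auto
show "span_over R M T {} v <= T" by (rule span_least[OF T _ _ T]) auto
qed

text \<open>Changing generators by elements of \<open>T\<close> affects neither their relations
  modulo \<open>T\<close> nor what they generate together with \<open>T\<close>.\<close>

lemma adjust:
assumes min: "min_gsys R M s n T I v k" and \<tau>: "!!j. j : I ==> \<tau> j : T"
shows "min_gsys R M s n T I (%j. v j -. \<tau> j) k"
proof -
have I: "finite I" and v: "!!j. j : I ==> v j : MM"
 and KX: "!!j. [|j : I; k j = KX|] ==> s ** v j : T"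
 and KY: "!!j. [|j : I; k j = KY|] ==> n ** v j : T"
 using min by (auto simp: min_gsys_def gsys_def)
let ?v = "%j. v j -. \<tau> j"
have \<tau>c: "!!j. j : I ==> \<tau> j : MM" using \<tau> sub_carrier[OF T] by blast
have vc: "?v : I \<rightarrow> MM" using v \<tau>c by simp
have sm: "r ** ?v j : T" if "j : I" "r : RR" "r ** v j : T" for r j
proof -
 have "r ** ?v j = r ** v j +. r ** (-. \<tau> j)"
 using that v \<tau>c by (simp add: M.minus_eq smult_r_distr)
 then show ?thesis using that \<tau> sub_add[OF T] sub_smult[OF T] sub_neg[OF T] by simp
qed
show ?thesis
proof (rule min_gsys_modify[OF min vc])
 fix j assume j: "j : I"
 have S: "submodule (span_over R M T I ?v) R M" by (rule span_submodule[OF T I vc])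
 have "?v j +. \<tau> j : span_over R M T I ?v"
 using sub_add[OF S span_v[OF T I vc j]] span_T[OF T I vc] \<tau>[OF j] by blast
 moreover have "?v j +. \<tau> j = v j"
 using v[OF j] \<tau>c[OF j] by (simp add: M.minus_eq M.a_assoc M.l_neg)
 ultimately show "v j : span_over R M T I ?v" by simp
qed (use sm KX KY in simp_all)
qed

text \<open>An elementary row operation with pivot \<open>j0\<close>. Multiples of the pivot are
  subtracted only from generators of the same kind, so that their relations modulo \<open>T\<close>
  survive.\<close>

lemma adjust_unit:
assumes min: "min_gsys R M s n T I v k" and j0: "j0 : I" and u: "u : Units R"
 and \<rho>: "!!j. j : I ==> \<rho> j : RR" and k: "!!j. [|j : I; k j ~= k j0|] ==> \<rho> j = \<zero>"
defines "v' \<equiv> %j. if j = j0 then u ** v j0 else v j -. \<rho> j ** v j0"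
shows "min_gsys R M s n T I v' k"
proof -
have I: "finite I" and v: "!!j. j : I ==> v j : MM"
 and KX: "!!j. [|j : I; k j = KX|] ==> s ** v j : T"
 and KY: "!!j. [|j : I; k j = KY|] ==> n ** v j : T"
 using min by (auto simp: min_gsys_def gsys_def)
note uc = R.Units_closed[OF u]
have v'c: "v' : I \<rightarrow> MM" using v \<rho> uc j0 by (auto simp: v'_def)
have sm: "r ** v' j : T"
 if "j : I" "r : RR" "r ** v j : T" "k j = k j0 ==> r ** v j0 : T" for r j
proof -
 have "r ** (\<rho> j ** v j0) : T"
 proof (cases "k j = k j0")
 case True
 then show ?thesis using that \<rho> v j0 sub_smult[OF T] by (simp add: smult_comm[of r])
 next
 case False
 then show ?thesis using k[OF that(1)] v j0 that sub_zero[OF T] by simp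
 qed
 moreover have "r ** (v j -. \<rho> j ** v j0)
  = r ** v j +. -. (r ** (\<rho> j ** v j0))"
 using that v j0 \<rho> by (simp add: M.minus_eq smult_r_distr smult_r_minus)
 moreover have "r ** (u ** v j0) = u ** (r ** v j0)"
 using that v j0 uc by (simp add: smult_comm)
 ultimately show ?thesis
 using that uc sub_add[OF T] sub_neg[OF T] sub_smult[OF T] by (auto simp: v'_def)
qed
show ?thesis
proof (rule min_gsys_modify[OF min v'c])
 fix j assume j: "j : I"
 let ?S = "span_over R M T I v'"
 have S: "submodule ?S R M" by (rule span_submodule[OF T I v'c])
 have "u ** v j0 : ?S" using span_v[OF T I v'c j0] by (simp add: v'_def)
 then have j0S: "v j0 : ?S" using sub_unit[OF S _ u] v j0 by simp
 show "v j : ?S"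
 proof (cases "j = j0")
 case False
 then have "v j -. \<rho> j ** v j0 : ?S" using span_v[OF T I v'c j] by (simp add: v'_def)
 then have "(v j -. \<rho> j ** v j0) +. \<rho> j ** v j0 : ?S"
  using sub_add[OF S _ sub_smult[OF S \<rho>[OF j] j0S]] by simp
 then show ?thesis using v j j0 \<rho> by (simp add: M.minus_eq M.a_assoc M.l_neg)
 qed (use j0S in simp)
next
 fix j assume j: "j : I" "k j = KX"
 then show "s ** v' j : T" using sm[OF j(1) _ KX[OF j]] KX[OF j0] by simp
next
 fix j assume j: "j : I" "k j = KY"
 then show "n ** v' j : T" using sm[OF j(1) _ KY[OF j]] KY[OF j0] by simp
qed
qed

lemma exists_torsion_free:
assumes "fin_gen R M" "T = {\<theta>}"
shows "\<exists>Ns es. direct_sum R M Ns & list_all2 (pres R M s n q) Ns es & set es <= {E_Zp, E_A, E_reg}"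
proof -
obtain I v k where min: "min_gsys R M s n T I v k" using min_gsys_exists[OF assms(1)] by blast
have "\<exists>Ns es. direct_sum R M (span_over R M T {} v # Ns) &
 list_all2 (pres R M s n q) Ns es & set es <= {E_Zp, E_A, E_reg}"
 using min assms(2) by (intro assemble[OF min]) (auto simp: min_gsys_def gsys_def)
then show ?thesis using direct_sum_drop_zero unfolding span_empty unfolding assms(2) by blast
qed

text \<open>Each link with \<open>T\<close> can be undone by subtracting torsion. For kind
  \<open>KX\<close>, \<open>s v\<close> is killed by \<open>n\<close>, hence in the socle, which is
  already filled by \<open>s T\<close> because \<open>c\<close> is a unit. For kind
  \<open>KY\<close>, \<open>n v\<close> is killed by \<open>s\<close>, which excludes generators of
  \<open>T\<close>, so \<open>n v\<close> lies in \<open>n T\<close>.\<close>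

lemma exists_F:
assumes fg: "fin_gen R M" and t: "is_tor R M s n i (F_coeff q i w) t" and Tt: "T = cyc R M t"
 and i: "i >= 2" and c: "[F_coeff q i w] \<cdot>\<^bsub>R\<^esub> \<one> : Units R"
shows "\<exists>Ns es. direct_sum R M Ns & list_all2 (pres R M s n q) Ns es &
 set es <= {E_F i w, E_Zp, E_A, E_reg}"
proof -
let ?c = "[F_coeff q i w] \<cdot>\<^bsub>R\<^esub> \<one>"
obtain I v k where min: "min_gsys R M s n T I v k" using min_gsys_exists[OF fg] by blast
have I: "finite I" and v: "!!j. j : I ==> v j : MM"
 and KX: "!!j. [|j : I; k j = KX|] ==> s ** v j : T"
 and KY: "!!j. [|j : I; k j = KY|] ==> n ** v j : T"
 using min by (auto simp: min_gsys_def gsys_def)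
have tM: "t : MM" and st: "s ** t = (?c \<otimes> n [^] (i - 1)) ** t"
 and n1: "n [^] (i - 1) ** t ~= \<theta>"
 using t by (auto simp: is_tor_def)
note cc = R.Units_closed[OF c]
have "\<exists>\<tau>\<in>T. (k j = KX --> s ** \<tau> = s ** v j) & (k j = KY --> n ** \<tau> = n ** v j)"
 if j: "j : I" for j
proof (cases "k j")
 case kX: KX
 obtain a where a: "a : RR" "s ** v j = a ** t" using KX[OF j kX] Tt by (auto simp: cyc_def)
 have "n ** (a ** t) = \<theta>" using a(2)[symmetric] v[OF j] by simp
 then consider "a ** t = \<theta>"
 | u where "u : Units R" "a ** t = (n [^] (i - 1) \<otimes> u) ** t"
 using tor_n_kill[OF t _ a(1)] i by blast
 then show ?thesis
 proof cases
 case 1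
 then show ?thesis using sub_zero[OF T] a kX by (intro bexI[of _ "\<theta>"]) auto
 next
 case 2
 note u = R.Units_closed[OF 2(1)]
 have "s ** ((inv ?c \<otimes> u) ** t) = (inv ?c \<otimes> u) ** (s ** t)"
  using u tM c by (simp add: smult_comm)
 also have "\<dots> = (inv ?c \<otimes> u \<otimes> (?c \<otimes> n [^] (i - 1))) ** t"
  unfolding st using u tM c cc by (intro smult_assoc1[symmetric]) auto
 also have "inv ?c \<otimes> u \<otimes> (?c \<otimes> n [^] (i - 1)) = (inv ?c \<otimes> ?c) \<otimes> (n [^] (i - 1) \<otimes> u)"
  using u c cc by (simp only: R.m_ac R.Units_inv_closed R.m_closed R.nat_pow_closed n_closed)
 finally have "s ** ((inv ?c \<otimes> u) ** t) = s ** v j"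
  using a 2 u R.Units_l_inv[OF c] by simp
 moreover have "(inv ?c \<otimes> u) ** t : T" unfolding Tt using u c by (intro cycI) simp
 ultimately show ?thesis using kX by auto
 qed
next
 case kY: KY
 obtain a where a: "a : RR" "n ** v j = a ** t" using KY[OF j kY] Tt by (auto simp: cyc_def)
 have sz: "s ** (a ** t) = \<theta>" using a(2)[symmetric] v[OF j] by simp
 consider "a ** t = \<theta>"
 | l u where "l < i" "u : Units R" "a ** t = (n [^] (l::nat) \<otimes> u) ** t"
 using tor_cases[OF t _ a(1)] i by blast
 then show ?thesis
 proof cases
 case 1
 then show ?thesis using sub_zero[OF T] a kY by (intro bexI[of _ "\<theta>"]) auto
 next
 case 2
 note u = R.Units_closed[OF 2(2)]
 show ?thesis
 proof (cases l)
  case 0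
  \<comment> \<open>For \<open>l = 0\<close> the element \<open>n v\<close> would generate
    \<open>T\<close> and yet be killed by \<open>s\<close>; but \<open>s\<close> sends it to a unit
    multiple of \<open>n^(i-1) t\<close>, which is not zero.\<close>
  have "s ** (u ** t) = \<theta>" using sz 2 0 u by simp
  then have "u ** ((?c \<otimes> n [^] (i - 1)) ** t) = \<theta>" using st u tM by (simp add: smult_comm[of s])
  then have "(u \<otimes> (?c \<otimes> n [^] (i - 1))) ** t = \<theta>" using u tM cc by (simp add: smult_assoc1)
  moreover have "u \<otimes> (?c \<otimes> n [^] (i - 1)) = n [^] (i - 1) \<otimes> (u \<otimes> ?c)"
  using u cc by (simp only: R.m_ac R.m_closed R.nat_pow_closed n_closed)
  ultimately have "i - 1 >= i" using tor_unit_pow[OF t, of "u \<otimes> ?c" "i - 1"] 2 c by simp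
  then show ?thesis using i by simp
 next
  case (Suc l')
  have "n ** ((n [^] l' \<otimes> u) ** t) = (n [^] l \<otimes> u) ** t"
  using u tM Suc by (simp add: smult_assoc1[symmetric] R.m_ac)
  moreover have "(n [^] l' \<otimes> u) ** t : T" unfolding Tt using u by (intro cycI) simp
  ultimately show ?thesis using a 2 kY by auto
 qed
 qed
next
 case KZ
 then show ?thesis using sub_zero[OF T] by auto
qed
then obtain \<tau> where \<tau>: "!!j. j : I ==> \<tau> j : T"
 "!!j. [|j : I; k j = KX|] ==> s ** \<tau> j = s ** v j"
 "!!j. [|j : I; k j = KY|] ==> n ** \<tau> j = n ** v j" by metis
let ?v = "%j. v j -. \<tau> j"
have \<tau>c: "!!j. j : I ==> \<tau> j : MM" using \<tau> sub_carrier[OF T] by blast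
have min': "min_gsys R M s n T I ?v k" using adjust[OF min] \<tau>(1) by blast
have "\<exists>Ns es. direct_sum R M (span_over R M T {} ?v # Ns) &
 list_all2 (pres R M s n q) Ns es & set es <= {E_Zp, E_A, E_reg}"
 using \<tau>(2,3) \<tau>c v
 by (intro assemble[OF min']) (auto simp: M.minus_eq smult_r_distr smult_r_minus M.r_neg)
then obtain Ns es where Ns: "direct_sum R M (T # Ns)" "list_all2 (pres R M s n q) Ns es"
 "set es <= {E_Zp, E_A, E_reg}" by (auto simp: span_empty)
have "pres R M s n q T (E_F i w)"
 unfolding pres_def
proof (intro bexI conjI)
 show "T = gen3 R M t \<theta> \<theta>" using cyc_gen3(3)[OF tM] Tt by simp
 show "cond R M s n q t \<theta> \<theta> (E_F i w)" using t i by simp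
qed (use sub_zero[OF T] cyc_self[OF tM] Tt in auto)
then have "list_all2 (pres R M s n q) (T # Ns) (E_F i w # es)" using Ns by simp
moreover have "set (E_F i w # es) <= {E_F i w, E_Zp, E_A, E_reg}" using Ns by auto
ultimately show ?thesis using Ns(1) by blast
qed

text \<open>Only the class of \<open>n v\<close> in \<open>T\<close> modulo \<open>n T\<close>
  matters. If it is nonzero for some generator, that generator becomes the pivot that clears the
  other ones of kind \<open>KY\<close>; if all classes vanish, subtracting torsion makes every
  relation exact.\<close>

lemma cyclic_adjust_KY:
assumes min: "min_gsys R M s n T I v k" and t: "is_tor R M s n i 0 t" and Tt: "T = cyc R M t"
shows "\<exists>v' t' J. min_gsys R M s n T I v' k & is_tor R M s n i 0 t' & T = cyc R M t' &
 (J = {} \<or> (EX j:I. J = {j} & k j = KY & n ** v' j = t')) &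
 (ALL j:I - J. k j = KY --> n ** v' j = \<theta>)"
proof -
have I: "finite I" and v: "!!j. j : I ==> v j : MM"
 and KY: "!!j. [|j : I; k j = KY|] ==> n ** v j : T"
 using min by (auto simp: min_gsys_def gsys_def)
have tM: "t : MM" using t by (auto simp: is_tor_def)
show ?thesis
proof (cases "EX j:I. k j = KY & (EX u:Units R. n ** v j = u ** t)")
 case True
 then obtain j1 u where j1: "j1 : I" "k j1 = KY" "u : Units R" "n ** v j1 = u ** t" by auto
 define t' where "t' = u ** t"
 have t': "is_tor R M s n i 0 t'" "T = cyc R M t'"
 using is_tor_unit[OF t j1(3)] cyc_unit[OF j1(3) tM] Tt by (auto simp: t'_def)
 have t'M: "t' : MM" using t' by (auto simp: is_tor_def)
 have "EX a:RR. (k j ~= KY --> a = \<zero>) & (k j = KY --> n ** v j = a ** t')" if "j : I" for j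
 proof (cases "k j = KY")
 case True
 then show ?thesis using KY[OF that True] t'(2) by (auto simp: cyc_def)
 qed auto
 then obtain \<rho> where \<rho>: "!!j. j : I ==> \<rho> j : RR" "!!j. [|j : I; k j ~= KY|] ==> \<rho> j = \<zero>"
 "!!j. [|j : I; k j = KY|] ==> n ** v j = \<rho> j ** t'" by metis
 \<comment> \<open>The pivot is scaled by one only: the unit has been absorbed by the new torsion
   generator \<open>t'\<close>, so that \<open>n v' = t'\<close> holds exactly.\<close>
 define v' where "v' = (%j. if j = j1 then \<one> ** v j1 else v j -. \<rho> j ** v j1)"
 have "min_gsys R M s n T I v' k"
 unfolding v'_def using \<rho> j1 by (intro adjust_unit[OF min j1(1)]) auto
 moreover have "n ** v' j1 = t'" using j1 v by (simp add: v'_def t'_def)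
 moreover have "n ** v' j = \<theta>" if j: "j : I" "j ~= j1" "k j = KY" for j
 proof -
 have "n ** v' j = n ** v j -. \<rho> j ** (n ** v j1)"
  using j v j1 \<rho>(1) by (simp add: v'_def M.minus_eq smult_r_distr smult_r_minus smult_comm[of n])
 then show ?thesis using \<rho>(1,3)[OF j(1)] j(3) j1(4) t'M by (simp add: t'_def M.minus_eq M.r_neg)
 qed
 ultimately show ?thesis using t' j1
 by (intro exI[of _ v'] exI[of _ t'] exI[of _ "{j1}"]) auto
next
 case False
 have "\<exists>\<tau>\<in>T. k j = KY --> n ** \<tau> = n ** v j" if j: "j : I" for j
 proof (cases "k j = KY")
 case True
 obtain a where a: "a : RR" "n ** v j = a ** t" using KY[OF j True] Tt by (auto simp: cyc_def)
 consider "a ** t = \<theta>"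
  | l u where "l < i" "u : Units R" "a ** t = (n [^] (l::nat) \<otimes> u) ** t"
  using tor_cases[OF t _ a(1)] by blast
 then show ?thesis
 proof cases
  case 1
  then show ?thesis using sub_zero[OF T] a by (intro bexI[of _ "\<theta>"]) auto
 next
  case 2
  note u = R.Units_closed[OF 2(2)]
  have "l ~= 0"
  proof
  assume "l = 0"
  then have "n ** v j = u ** t" using 2 a u by simp
  then show False using False j True 2 by blast
  qed
  then obtain l' where l: "l = Suc l'" by (cases l) auto
  have "n ** ((n [^] l' \<otimes> u) ** t) = (n [^] l \<otimes> u) ** t"
  using u tM l by (simp add: smult_assoc1[symmetric] R.m_ac)
  moreover have "(n [^] l' \<otimes> u) ** t : T" unfolding Tt using u by (intro cycI) simp
  ultimately show ?thesis using a 2 by auto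
 qed
 qed (use sub_zero[OF T] in auto)
 then obtain \<tau> where \<tau>: "!!j. j : I ==> \<tau> j : T"
 "!!j. [|j : I; k j = KY|] ==> n ** \<tau> j = n ** v j" by metis
 have "min_gsys R M s n T I (%j. v j -. \<tau> j) k" using adjust[OF min] \<tau>(1) by blast
 moreover have "n ** (v j -. \<tau> j) = \<theta>" if "j : I" "k j = KY" for j
 using \<tau>[OF that(1)] that v sub_carrier[OF T]
 by (simp add: M.minus_eq smult_r_distr smult_r_minus M.r_neg)
 ultimately show ?thesis using t Tt
 by (intro exI[of _ "%j. v j -. \<tau> j"] exI[of _ t] exI[of _ "{}"]) auto
qed
qed

text \<open>The element \<open>s v\<close> lies in the socle, hence is zero or a unit multiple of
  \<open>e\<close>. Subtracting torsion cannot change it because \<open>s\<close> kills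
  \<open>T\<close>, so a pivot is the only means. Generators of other kinds stay as they are, which
  preserves an earlier normalisation of kind \<open>KY\<close>.\<close>

lemma cyclic_adjust_KX:
assumes min: "min_gsys R M s n T I v k" and t: "is_tor R M s n i 0 t" and Tt: "T = cyc R M t"
shows "\<exists>v' J. min_gsys R M s n T I v' k & (ALL j:I. k j ~= KX --> v' j = v j) &
 (J = {} \<or> (EX j:I. J = {j} & k j = KX & s ** v' j = n [^] (i - 1) ** t)) &
 (ALL j:I - J. k j = KX --> s ** v' j = \<theta>)"
proof -
have I: "finite I" and v: "!!j. j : I ==> v j : MM"
 and KX: "!!j. [|j : I; k j = KX|] ==> s ** v j : T"
 using min by (auto simp: min_gsys_def gsys_def)
have tM: "t : MM" using t by (auto simp: is_tor_def)
define e where "e = n [^] (i - 1) ** t"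
have eM: "e : MM" using tM by (simp add: e_def)
have val: "s ** v j = \<theta> \<or> (EX u:Units R. s ** v j = u ** e)" if j: "j : I" "k j = KX" for j
proof -
 obtain a where a: "a : RR" "s ** v j = a ** t" using KX[OF j] Tt by (auto simp: cyc_def)
 have "n ** (a ** t) = \<theta>" using a(2)[symmetric] v[OF j(1)] by simp
 then consider "a ** t = \<theta>"
 | u where "u : Units R" "a ** t = (n [^] (i - 1) \<otimes> u) ** t"
 using tor_n_kill[OF t _ a(1)] by blast
 then show ?thesis
 proof cases
 case 2
 then have "a ** t = u ** e"
  using tM R.Units_closed[OF 2(1)] by (simp add: e_def smult_assoc1 smult_comm)
 then show ?thesis using a 2 by auto
 qed (use a in simp)
qed
show ?thesis
proof (cases "EX j:I. k j = KX & (EX u:Units R. s ** v j = u ** e)")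
 case True
 then obtain j0 u where j0: "j0 : I" "k j0 = KX" "u : Units R" "s ** v j0 = u ** e" by auto
 note u = R.Units_closed[OF j0(3)]
 have "EX a:RR. (k j ~= KX --> a = \<zero>) & (k j = KX --> s ** v j = a ** (s ** v j0))"
 if j: "j : I" for j
 proof (cases "k j = KX")
 case True
 then consider "s ** v j = \<theta>" | u' where "u' : Units R" "s ** v j = u' ** e" using val[OF j] by blast
 then show ?thesis
 proof cases
  case 1
  then show ?thesis using True u eM j0 by (intro bexI[of _ \<zero>]) auto
 next
  case 2
  have "(u' \<otimes> inv u) ** (s ** v j0) = (u' \<otimes> (inv u \<otimes> u)) ** e"
  using j0 u R.Units_closed[OF 2(1)] eM
  by (simp only: smult_assoc1[symmetric] R.m_assoc R.Units_inv_closed R.m_closed)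
  then show ?thesis using 2 True j0 R.Units_closed[OF 2(1)] R.Units_l_inv[OF j0(3)]
  by (intro bexI[of _ "u' \<otimes> inv u"]) auto
 qed
 qed auto
 then obtain \<rho> where \<rho>: "!!j. j : I ==> \<rho> j : RR" "!!j. [|j : I; k j ~= KX|] ==> \<rho> j = \<zero>"
 "!!j. [|j : I; k j = KX|] ==> s ** v j = \<rho> j ** (s ** v j0)" by metis
 define v' where "v' = (%j. if j = j0 then inv u ** v j0 else v j -. \<rho> j ** v j0)"
 have "min_gsys R M s n T I v' k"
 unfolding v'_def using \<rho> j0 by (intro adjust_unit[OF min j0(1)]) auto
 moreover have "s ** v' j0 = e"
 proof -
 have "s ** v' j0 = inv u ** (s ** v j0)"
  using j0 v by (simp add: v'_def smult_comm[of s])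
 also have "\<dots> = (inv u \<otimes> u) ** e"
  using j0 u eM by (simp only: smult_assoc1[symmetric] R.Units_inv_closed)
 finally show ?thesis using R.Units_l_inv[OF j0(3)] eM by simp
 qed
 moreover have "s ** v' j = \<theta>" if j: "j : I" "j ~= j0" "k j = KX" for j
 proof -
 have "s ** v' j = s ** v j -. \<rho> j ** (s ** v j0)"
  using j v j0 \<rho>(1) by (simp add: v'_def M.minus_eq smult_r_distr smult_r_minus smult_comm[of s])
 then show ?thesis using \<rho>(3)[OF j(1,3)] \<rho>(1)[OF j(1)] v[OF j0(1)] by (simp add: M.diff_zero_iff)
 qed
 moreover have "v' j = v j" if "j : I" "k j ~= KX" for j
 using that j0 v \<rho>(2)[OF that] by (auto simp: v'_def M.minus_eq)
 ultimately show ?thesis using j0 unfolding e_def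
 by (intro exI[of _ v'] exI[of _ "{j0}"]) auto
next
 case False
 then have "s ** v j = \<theta>" if "j : I" "k j = KX" for j using val that by blast
 then show ?thesis using min by (intro exI[of _ v] exI[of _ "{}"]) auto
qed
qed

text \<open>After both normalisations at most one generator of kind \<open>KX\<close> and one of
  kind \<open>KY\<close> are linked to \<open>T\<close>. Together with \<open>t\<close> they span
  the torsion entry; its four forms correspond to the emptiness of \<open>JX\<close> and of
  \<open>JY\<close>.\<close>

lemma exists_cyclic:
assumes fg: "fin_gen R M" and t0: "is_tor R M s n i 0 t0" and Tt0: "T = cyc R M t0"
shows "\<exists>Ns es. direct_sum R M Ns & list_all2 (pres R M s n q) Ns es &
 set es <= {E_cyc i, E_ext_Zp i, E_ext_A i, E_ext_ZpA i, E_Zp, E_A, E_reg}"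
proof -
obtain I v0 k where min0: "min_gsys R M s n T I v0 k" using min_gsys_exists[OF fg] by blast
obtain v1 t JY where min1: "min_gsys R M s n T I v1 k" and t: "is_tor R M s n i 0 t" "T = cyc R M t"
 and JY: "JY = {} \<or> (EX j:I. JY = {j} & k j = KY & n ** v1 j = t)"
 and sY: "!!j. [|j : I - JY; k j = KY|] ==> n ** v1 j = \<theta>"
 using cyclic_adjust_KY[OF min0 t0 Tt0] by auto
obtain v JX where min: "min_gsys R M s n T I v k" and v1: "!!j. [|j : I; k j ~= KX|] ==> v j = v1 j"
 and JX: "JX = {} \<or> (EX j:I. JX = {j} & k j = KX & s ** v j = n [^] (i - 1) ** t)"
 and sX: "!!j. [|j : I - JX; k j = KX|] ==> s ** v j = \<theta>"
 using cyclic_adjust_KX[OF min1 t] by auto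
have I: "finite I" and v: "!!j. j : I ==> v j : MM"
 using min by (auto simp: min_gsys_def gsys_def)
have tM: "t : MM" using t by (auto simp: is_tor_def)
have tT: "t : T" using cyc_self[OF tM] t(2) by simp
let ?J = "JX \<union> JY"
let ?H = "span_over R M T ?J v"
have J: "?J <= I" using JX JY by auto
have fJ: "finite ?J" and vJ: "v : ?J \<rightarrow> MM" using finite_subset[OF J I] J v by auto
have "\<exists>Ns es. direct_sum R M (?H # Ns) & list_all2 (pres R M s n q) Ns es & set es <= {E_Zp, E_A, E_reg}"
 using sX sY v1 by (intro assemble[OF min J]) auto
then obtain Ns es where Ns: "direct_sum R M (?H # Ns)" "list_all2 (pres R M s n q) Ns es"
 "set es <= {E_Zp, E_A, E_reg}" by blast
have HS: "submodule ?H R M" by (rule span_submodule[OF T fJ vJ])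
have tH: "t : ?H" using span_T[OF T fJ vJ] tT by blast
have vH: "!!j. j : ?J ==> v j : ?H" by (rule span_v[OF T fJ vJ])
have gen: "?H = gen3 R M t x y"
 if xy: "x : ?H" "y : ?H" "!!j. j : ?J ==> v j = x \<or> v j = y" for x y
proof
 have c: "x : MM" "y : MM" using xy sub_carrier[OF HS] by auto
 have G: "submodule (gen3 R M t x y) R M" by (rule gen3_submodule[OF tM c])
 have 1: "a ** t : gen3 R M t x y" if "a : RR" for a
 using gen3I[of a \<zero> \<zero> t x y] that c tM by simp
 have 2: "x : gen3 R M t x y" "y : gen3 R M t x y"
 using gen3I[of \<zero> \<one> \<zero> t x y] gen3I[of \<zero> \<zero> \<one> t x y] c tM by simp_all
 show "?H <= gen3 R M t x y"
 proof (rule span_least[OF T fJ vJ G])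
 show "T <= gen3 R M t x y" unfolding t(2) cyc_def using 1 by auto
 qed (use xy(3) 2 in metis)
 show "gen3 R M t x y <= ?H"
 using xy tH by (auto simp: gen3_def intro!: sub_add[OF HS] sub_smult[OF HS])
qed
have z: "\<theta> : ?H" by (rule sub_zero[OF HS])
have presI: "pres R M s n q ?H e"
 if "x : ?H" "y : ?H" "!!j. j : ?J ==> v j = x \<or> v j = y" "cond R M s n q t x y e" for x y e
 unfolding pres_def using gen[OF that(1-3)] that tH by blast
have "EX e:{E_cyc i, E_ext_Zp i, E_ext_A i, E_ext_ZpA i}. pres R M s n q ?H e"
proof (cases "JX = {}")
 case True
 show ?thesis
 proof (cases "JY = {}")
 case JY0: True
 have "pres R M s n q ?H (E_cyc i)"
  using z t(1) True JY0 by (intro presI[of "\<theta>" "\<theta>"]) auto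
 then show ?thesis by blast
 next
 case False
 then obtain y where y: "y : I" "JY = {y}" "k y = KY" "n ** v y = t" using JY v1 by force
 have "free_over R M s t (v y)" using free_of_min_s[OF min y(1) _ tT] y by simp
 then have "pres R M s n q ?H (E_ext_A i)"
  using z t(1) True y vH by (intro presI[of "\<theta>" "v y"]) auto
 then show ?thesis by blast
 qed
next
 case False
 then obtain x where x: "x : I" "JX = {x}" "k x = KX" "s ** v x = n [^] (i - 1) ** t" using JX by auto
 have fx: "free_over R M n t (v x)" using free_of_min[OF min x(1) _ tT] x by simp
 show ?thesis
 proof (cases "JY = {}")
 case True
 have "pres R M s n q ?H (E_ext_Zp i)"
  using z t(1) True x vH fx by (intro presI[of "v x" "\<theta>"]) auto
 then show ?thesis by blast
 next
 case False
 then obtain y where y: "y : I" "JY = {y}" "k y = KY" "n ** v y = t" using JY v1 by force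
 have "free_over R M s t (v y)" using free_of_min_s[OF min y(1) _ tT] y by simp
 then have "pres R M s n q ?H (E_ext_ZpA i)"
  using t(1) x y vH fx by (intro presI[of "v x" "v y"]) auto
 then show ?thesis by blast
 qed
qed
then obtain e where e: "e : {E_cyc i, E_ext_Zp i, E_ext_A i, E_ext_ZpA i}" "pres R M s n q ?H e" by blast
then have "list_all2 (pres R M s n q) (?H # Ns) (e # es)" using Ns by simp
moreover have "set (e # es) <= {E_cyc i, E_ext_Zp i, E_ext_A i, E_ext_ZpA i, E_Zp, E_A, E_reg}"
 using Ns e by auto
ultimately show ?thesis using Ns(1) by blast
qed

end

section \<open>Submodules and quotients that serve as invariants\<close>

definition Ker :: "('r, 'm, 'd) module_scheme => 'r => 'm set => 'm set" where
"Ker M a N = {x : N. a \<odot>\<^bsub>M\<^esub> x = \<zero>\<^bsub>M\<^esub>}"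

definition Img :: "('r, 'm, 'd) module_scheme => 'r => 'm set => 'm set" where
"Img M a N = {a \<odot>\<^bsub>M\<^esub> x | x. x : N}"

text \<open>Torsion expressed by \<open>s\<close> and \<open>n\<close> alone;
  \<open>coeff_torsion_eq\<close> identifies it with the torsion over Z_p.\<close>

definition Tors ::
"('r, 'c) ring_scheme => ('r, 'm, 'd) module_scheme => 'r => 'r => 'm set => 'm set" where
"Tors R M s n N = {x : N. \<exists>k::nat. n [^]\<^bsub>R\<^esub> k \<odot>\<^bsub>M\<^esub> x = \<zero>\<^bsub>M\<^esub> & s [^]\<^bsub>R\<^esub> k \<odot>\<^bsub>M\<^esub> x = \<zero>\<^bsub>M\<^esub>}"

text \<open>The quotient of this submodule for \<open>n\<close> by the one for
  \<open>n \<otimes> n\<close> sees only the summands that contain, modulo torsion, a copy of R/s or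
  of R.\<close>

definition ImgT ::
"('r, 'c) ring_scheme => ('r, 'm, 'd) module_scheme => 'r => 'r => 'r => 'm set => 'm set" where
"ImgT R M s n a N = {a \<odot>\<^bsub>M\<^esub> x \<oplus>\<^bsub>M\<^esub> \<tau> | x \<tau>. x : N & \<tau> : Tors R M s n N}"

text \<open>\<open>K/I\<close> is one-dimensional over the residue field.\<close>

definition simple_quot ::
"('r, 'c) ring_scheme => ('r, 'm, 'd) module_scheme => 'r => 'r => 'm set => 'm set => bool" where
"simple_quot R M s n K I \<longleftrightarrow> (EX u:K. u ~: I & s \<odot>\<^bsub>M\<^esub> u : I & n \<odot>\<^bsub>M\<^esub> u : I &
 (ALL x:K. EX a:carrier R. EX z:I. x = a \<odot>\<^bsub>M\<^esub> u \<oplus>\<^bsub>M\<^esub> z))"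

definition quot_card :: "('r, 'm, 'd) module_scheme => 'm set => 'm set => nat" where
"quot_card M K I = card ((%x. {x \<oplus>\<^bsub>M\<^esub> z | z. z : I}) ` K)"

text \<open>\<open>h0_entry\<close>, \<open>h1_entry\<close> and \<open>hv_entry\<close> mark the
  entries contributing one dimension to the kernel of \<open>s\<close> modulo the image of
  \<open>n\<close>, to the kernel of \<open>n\<close> modulo the image of \<open>s\<close>, and to
  the quotient built from \<open>ImgT\<close>. The third invariant detects the regular module, whose
  cohomology is zero.\<close>

fun h0_entry :: "entry => bool" where
"h0_entry (E_cyc i) = True" | "h0_entry E_Zp = True" | "h0_entry (E_ext_Zp i) = True"
| "h0_entry _ = False"

fun h1_entry :: "entry => bool" where
"h1_entry (E_cyc i) = True" | "h1_entry E_A = True" | "h1_entry (E_ext_A i) = True"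
| "h1_entry _ = False"

fun hv_entry :: "entry => bool" where
"hv_entry E_Zp = True" | "hv_entry E_reg = True" | "hv_entry (E_ext_Zp i) = True"
| "hv_entry (E_ext_ZpA i) = True" | "hv_entry _ = False"

fun tor_entry :: "entry => bool" where
"tor_entry E_Zp = False" | "tor_entry E_A = False" | "tor_entry E_reg = False" | "tor_entry _ = True"

text \<open>The integers from 0 to \<open>q - 1\<close> represent the residue field, each class
  once. A one-dimensional quotient therefore has \<open>q\<close> elements, and dimensions can be
  read off from cardinalities.\<close>

locale nodal_char = nodal_ring R s n for R (structure) and s n +
fixes q :: nat
assumes q_mx: "EX a:carrier R. EX b:carrier R. [q] \<cdot>\<^bsub>R\<^esub> \<one> = s \<otimes> a \<oplus> n \<otimes> b"
 and q_units: "[|0 < d; d < q|] ==> [d] \<cdot>\<^bsub>R\<^esub> \<one> : Units R"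
 and residue: "r : carrier R ==>
 \<exists>d<q. EX a:carrier R. EX b:carrier R. r = [d] \<cdot>\<^bsub>R\<^esub> \<one> \<oplus> (s \<otimes> a \<oplus> n \<otimes> b)"

locale nodal_char_module = R?: nodal_char R s n q + nodal_module R s n M
for R (structure) and s n and q and M (structure)

context nodal_module
begin

lemma unit_neg_n: "b : RR ==> \<one> \<ominus> n \<otimes> b : Units R"
using R.unit_add_n[of \<one> "\<ominus> b"] by (simp add: R.minus_eq R.r_minus)

lemma unit_smult_zero:
assumes "u : Units R" "x : MM" "u ** x = \<theta>"
shows "x = \<theta>"
proof -
have "inv u ** (u ** x) = x"
 using assms(1,2) R.Units_l_inv[OF assms(1)] R.Units_closed[OF assms(1)]
 by (simp only: smult_assoc1[symmetric] R.Units_inv_closed smult_one)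
then show ?thesis using assms by simp
qed

text \<open>Nakayama's lemma for a cyclic module: \<open>\<one> \<ominus> n \<otimes> b\<close> is a
  unit.\<close>

lemma eq_n_mult_zero:
assumes "x : MM" "b : RR" "x = (n \<otimes> b) ** x"
shows "x = \<theta>"
proof (rule unit_smult_zero[OF unit_neg_n[OF assms(2)] assms(1)])
have "(\<one> \<ominus> n \<otimes> b) ** x = x -. (n \<otimes> b) ** x"
 using assms(1,2) by (simp add: R.minus_eq M.minus_eq smult_l_distr smult_l_minus)
also have "\<dots> = \<theta>" using assms by (subst M.diff_zero_iff) auto
finally show "(\<one> \<ominus> n \<otimes> b) ** x = \<theta>" .
qed

lemma Ker_submodule:
assumes N: "submodule N R M" and a: "a : RR"
shows "submodule (Ker M a N) R M"
using sub_carrier[OF N] sub_zero[OF N] sub_neg[OF N] sub_add[OF N] sub_smult[OF N] a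
by (intro submoduleI) (auto simp: Ker_def smult_r_minus smult_r_distr smult_comm[of a])

lemma Img_submodule:
assumes N: "submodule N R M" and a: "a : RR"
shows "submodule (Img M a N) R M"
proof (rule submoduleI)
show "Img M a N <= MM" using sub_carrier[OF N] a by (auto simp: Img_def)
show "\<theta> : Img M a N" using sub_zero[OF N] a by (force simp: Img_def)
fix x assume "x : Img M a N"
then obtain y where y: "y : N" "x = a ** y" by (auto simp: Img_def)
have yM: "y : MM" using y sub_carrier[OF N] by blast
have "-. x = a ** (-. y)" using y yM a by (simp add: smult_r_minus)
then show "-. x : Img M a N" using sub_neg[OF N y(1)] by (auto simp: Img_def)
{ fix x' assume "x' : Img M a N"
 then obtain y' where y': "y' : N" "x' = a ** y'" by (auto simp: Img_def)
 have "x +. x' = a ** (y +. y')" using y y' yM sub_carrier[OF N] a by (simp add: smult_r_distr)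
 then show "x +. x' : Img M a N" using sub_add[OF N y(1) y'(1)] by (auto simp: Img_def) }
{ fix r assume r: "r : RR"
 have "r ** x = a ** (r ** y)" using y yM a r by (simp add: smult_comm)
 then show "r ** x : Img M a N" using sub_smult[OF N r y(1)] by (auto simp: Img_def) }
qed

lemma s_pow_smult_zero:
"[|t : MM; s [^] (k::nat) ** t = \<theta>; k <= m|] ==> s [^] m ** t = \<theta>"
using nodal_module.n_pow_smult_zero[OF swap_module] by blast

lemma Tors_submodule:
assumes N: "submodule N R M"
shows "submodule (Tors R M s n N) R M"
proof (rule submoduleI)
note NM = sub_carrier[OF N]
show "Tors R M s n N <= MM" using NM by (auto simp: Tors_def)
show "\<theta> : Tors R M s n N" using sub_zero[OF N] by (auto simp: Tors_def)
fix x assume "x : Tors R M s n N"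
then obtain k where x: "x : N" "n [^] (k::nat) ** x = \<theta>" "s [^] k ** x = \<theta>"
 by (auto simp: Tors_def)
show "-. x : Tors R M s n N"
 using x sub_neg[OF N x(1)] NM by (auto simp: Tors_def smult_r_minus intro!: exI[of _ k])
{ fix y assume "y : Tors R M s n N"
 then obtain l where y: "y : N" "n [^] (l::nat) ** y = \<theta>" "s [^] l ** y = \<theta>"
 by (auto simp: Tors_def)
 have "n [^] (k + l) ** x = \<theta>" "s [^] (k + l) ** x = \<theta>"
 "n [^] (k + l) ** y = \<theta>" "s [^] (k + l) ** y = \<theta>"
 using n_pow_smult_zero[OF NM[OF x(1)] x(2), of "k + l"] s_pow_smult_zero[OF NM[OF x(1)] x(3), of "k + l"]
  n_pow_smult_zero[OF NM[OF y(1)] y(2), of "k + l"] s_pow_smult_zero[OF NM[OF y(1)] y(3), of "k + l"]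
 by auto
 then show "x +. y : Tors R M s n N"
 using sub_add[OF N x(1) y(1)] NM x y by (auto simp: Tors_def smult_r_distr intro!: exI[of _ "k + l"]) }
{ fix r assume "r : RR"
 then show "r ** x : Tors R M s n N"
 using x sub_smult[OF N _ x(1)] NM by (auto simp: Tors_def smult_comm[of _ r] intro!: exI[of _ k]) }
qed

text \<open>One more factor of \<open>s\<close> and of \<open>n\<close> kills \<open>x\<close>
  itself. This is the saturation that the theory of minimal systems requires of
  \<open>T\<close>.\<close>

lemma Tors_sat:
assumes "submodule N R M" "x : N" "s ** x : Tors R M s n N" "n ** x : Tors R M s n N"
shows "x : Tors R M s n N"
proof -
have xM: "x : MM" using assms(1,2) sub_carrier by blast
obtain k l where k: "s [^] (k::nat) ** (s ** x) = \<theta>" and l: "n [^] (l::nat) ** (n ** x) = \<theta>"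
 using assms(3,4) by (auto simp: Tors_def)
have "s [^] Suc k ** x = \<theta>" "n [^] Suc l ** x = \<theta>"
 using k l xM by (simp_all add: smult_assoc1)
then have "s [^] Suc (k + l) ** x = \<theta>" "n [^] Suc (k + l) ** x = \<theta>"
 using n_pow_smult_zero[OF xM, of "Suc l" "Suc (k + l)"] s_pow_smult_zero[OF xM, of "Suc k" "Suc (k + l)"]
 by (auto simp del: R.nat_pow_Suc)
then show ?thesis using assms(2) unfolding Tors_def by blast
qed

lemma nodal_over_Tors: "nodal_over R s n M (Tors R M s n (MM))"
using nodal_module_axioms Tors_submodule[OF carrier_is_submodule] Tors_sat[OF carrier_is_submodule]
by (intro nodal_over.intro nodal_over_axioms.intro)

lemma ImgT_submodule:
assumes N: "submodule N R M" and a: "a : RR"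
shows "submodule (ImgT R M s n a N) R M"
proof -
have eq: "ImgT R M s n a N = {u +. v | u v. u : Img M a N & v : Tors R M s n N}"
 by (auto simp: ImgT_def Img_def)
note A = Img_submodule[OF N a] and B = Tors_submodule[OF N]
show ?thesis unfolding eq
proof (rule submoduleI)
 show "{u +. v | u v. u : Img M a N & v : Tors R M s n N} <= MM"
 using sub_carrier[OF A] sub_carrier[OF B] by auto
 have "\<theta> = \<theta> +. \<theta>" by simp
 then show "\<theta> : {u +. v | u v. u : Img M a N & v : Tors R M s n N}"
 using sub_zero[OF A] sub_zero[OF B] by blast
 fix x assume "x : {u +. v | u v. u : Img M a N & v : Tors R M s n N}"
 then obtain u v where x: "u : Img M a N" "v : Tors R M s n N" "x = u +. v" by blast
 have c: "u : MM" "v : MM" using x sub_carrier[OF A] sub_carrier[OF B] by auto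
 have "-. x = -. u +. -. v" using x c by (simp add: M.minus_add)
 then show "-. x : {u +. v | u v. u : Img M a N & v : Tors R M s n N}"
 using sub_neg[OF A x(1)] sub_neg[OF B x(2)] by blast
 { fix y assume "y : {u +. v | u v. u : Img M a N & v : Tors R M s n N}"
 then obtain u' v' where y: "u' : Img M a N" "v' : Tors R M s n N" "y = u' +. v'" by blast
 have c': "u' : MM" "v' : MM" using y sub_carrier[OF A] sub_carrier[OF B] by auto
 have "x +. y = (u +. u') +. (v +. v')" using x y c c' by (simp add: M.add.m_ac)
 then show "x +. y : {u +. v | u v. u : Img M a N & v : Tors R M s n N}"
  using sub_add[OF A x(1) y(1)] sub_add[OF B x(2) y(2)] by blast }
 { fix r assume r: "r : RR"
 have "r ** x = r ** u +. r ** v" using x c r by (simp add: smult_r_distr)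
 then show "r ** x : {u +. v | u v. u : Img M a N & v : Tors R M s n N}"
  using sub_smult[OF A r x(1)] sub_smult[OF B r x(2)] by blast }
qed
qed

lemma coset_eq_iff:
assumes I: "submodule I R M" and "x : MM" "y : MM"
shows "{x +. z | z. z : I} = {y +. z | z. z : I} \<longleftrightarrow> x -. y : I"
proof
assume "{x +. z | z. z : I} = {y +. z | z. z : I}"
moreover have "x : {x +. z | z. z : I}"
proof -
 have "x = x +. \<theta>" using assms by simp
 then show ?thesis using sub_zero[OF I] by blast
qed
ultimately obtain z where z: "z : I" "x = y +. z" by blast
have zc: "z : MM" using z sub_carrier[OF I] by blast
have "x -. y = (y +. -. y) +. z" using z zc assms by (simp add: M.minus_eq M.add.m_ac)
then show "x -. y : I" using z zc assms by (simp add: M.r_neg)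
next
assume d: "x -. y : I"
have *: "{x +. z | z. z : I} <= {y +. z | z. z : I}"
 if xy: "x : MM" "y : MM" "x -. y : I" for x y
proof
 fix w assume "w : {x +. z | z. z : I}"
 then obtain z where z: "z : I" "w = x +. z" by blast
 have zc: "z : MM" using z sub_carrier[OF I] by blast
 have "y +. ((x -. y) +. z) = (y +. -. y) +. (x +. z)"
 using xy zc by (simp add: M.minus_eq M.add.m_ac)
 then have "w = y +. ((x -. y) +. z)" using z zc xy by (simp add: M.r_neg)
 then show "w : {y +. z | z. z : I}" using sub_add[OF I xy(3) z(1)] by blast
qed
have "y -. x = -. (x -. y)" using assms by (simp add: M.minus_eq M.minus_add M.a_comm)
then have "y -. x : I" using sub_neg[OF I d] by simp
then show "{x +. z | z. z : I} = {y +. z | z. z : I}"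
 using *[OF assms(2,3) d] *[OF assms(3,2)] by blast
qed

lemma quot_card_trivial:
assumes I: "submodule I R M" and K: "submodule K R M" "K <= I"
shows "quot_card M K I = 1"
proof -
have "{x +. z | z. z : I} = {\<theta> +. z | z. z : I}" if "x : K" for x
 using that K sub_carrier[OF K(1)] sub_add[OF I _ sub_neg[OF I sub_zero[OF I]], of x]
 by (subst coset_eq_iff[OF I]) (auto simp: M.minus_eq)
then have "(%x. {x +. z | z. z : I}) ` K = (%_. {\<theta> +. z | z. z : I}) ` K"
 by (intro image_cong refl)
also have "\<dots> = {{\<theta> +. z | z. z : I}}"
 by (rule image_constant[OF sub_zero[OF K(1)]])
finally have "(%x. {x +. z | z. z : I}) ` K = {{\<theta> +. z | z. z : I}}" .
then show ?thesis by (simp add: quot_card_def)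
qed

end

context nodal_char_module
begin

text \<open>Only the residue of the coefficient matters, because the maximal ideal sends
  \<open>u\<close> into \<open>I\<close>.\<close>

lemma simple_quot_reps:
assumes I: "submodule I R M" and u: "u : MM" "u ~: I" "s ** u : I" "n ** u : I"
 and a: "a : RR" "z : I"
shows "\<exists>d<q. (a ** u +. z) -. ([d] \<cdot>\<^bsub>R\<^esub> \<one>) ** u : I"
proof -
obtain d b c where d: "d < q" "b : RR" "c : RR" "a = [d] \<cdot>\<^bsub>R\<^esub> \<one> \<oplus> (s \<otimes> b \<oplus> n \<otimes> c)"
 using residue[OF a(1)] by blast
have zc: "z : MM" using a sub_carrier[OF I] by blast
have dR: "[d] \<cdot>\<^bsub>R\<^esub> \<one> : RR" by simp
have 1: "a ** u = ([d] \<cdot>\<^bsub>R\<^esub> \<one>) ** u +. (b ** (s ** u) +. c ** (n ** u))"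
 using d u dR by (simp add: smult_l_distr smult_assoc1 smult_comm[of _ s] smult_comm[of _ n])
have w: "b ** (s ** u) +. c ** (n ** u) +. z : I"
 by (rule sub_add[OF I sub_add[OF I sub_smult[OF I d(2) u(3)] sub_smult[OF I d(3) u(4)]] a(2)])
have "(x +. y +. z) -. x = y +. z" if "x : MM" "y : MM" for x y
proof -
 have "(x +. y +. z) -. x = (x +. -. x) +. (y +. z)"
 using that zc by (simp add: M.minus_eq M.add.m_ac)
 then show ?thesis using that zc by (simp add: M.r_neg)
qed
then have "(a ** u +. z) -. ([d] \<cdot>\<^bsub>R\<^esub> \<one>) ** u =
 b ** (s ** u) +. c ** (n ** u) +. z"
 unfolding 1 using d u dR by simp
then show ?thesis using w d by metis
qed

text \<open>Distinct residues differ by an integer strictly between 0 and \<open>q\<close>; being a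
  unit, it would put \<open>u\<close> into \<open>I\<close>.\<close>

lemma simple_quot_inj:
assumes I: "submodule I R M" and u: "u : MM" "u ~: I"
 and d: "d < q" "d' < q" "([d] \<cdot>\<^bsub>R\<^esub> \<one>) ** u -. ([d'] \<cdot>\<^bsub>R\<^esub> \<one>) ** u : I"
shows "d = d'"
proof -
have *: False if dq: "d < q" and dd: "d' < d" and dI: "([d] \<cdot>\<^bsub>R\<^esub> \<one>) ** u -. ([d'] \<cdot>\<^bsub>R\<^esub> \<one>) ** u : I" for d d' :: nat
proof -
 obtain l where l: "d = l + d'" "0 < l" using dd by (metis add.commute less_imp_add_positive)
 have "[d] \<cdot>\<^bsub>R\<^esub> \<one> = [l] \<cdot>\<^bsub>R\<^esub> \<one> \<oplus> [d'] \<cdot>\<^bsub>R\<^esub> \<one>" unfolding l(1) by (simp add: R.add.nat_pow_mult)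
 then have "([d] \<cdot>\<^bsub>R\<^esub> \<one>) ** u -. ([d'] \<cdot>\<^bsub>R\<^esub> \<one>) ** u = ([l] \<cdot>\<^bsub>R\<^esub> \<one>) ** u"
 using u(1) by (simp add: smult_l_distr M.minus_eq M.a_assoc M.r_neg)
 then have "([l] \<cdot>\<^bsub>R\<^esub> \<one>) ** u : I" using dI by simp
 moreover have "[l] \<cdot>\<^bsub>R\<^esub> \<one> : Units R" using l dq by (intro q_units) auto
 ultimately show False using sub_unit[OF I u(1)] u(2) by blast
qed
have "([d'] \<cdot>\<^bsub>R\<^esub> \<one>) ** u -. ([d] \<cdot>\<^bsub>R\<^esub> \<one>) ** u
 = -. (([d] \<cdot>\<^bsub>R\<^esub> \<one>) ** u -. ([d'] \<cdot>\<^bsub>R\<^esub> \<one>) ** u)"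
 using u(1) by (simp add: M.minus_eq M.minus_add M.a_comm)
then have "([d'] \<cdot>\<^bsub>R\<^esub> \<one>) ** u -. ([d] \<cdot>\<^bsub>R\<^esub> \<one>) ** u : I"
 using sub_neg[OF I d(3)] by simp
then show ?thesis using *[OF d(1) _ d(3)] *[OF d(2)] by (meson linorder_neqE_nat)
qed

lemma quot_card_simple:
assumes I: "submodule I R M" and K: "submodule K R M" and sq: "simple_quot R M s n K I"
shows "quot_card M K I = q"
proof -
let ?co = "%x. {x +. z | z. z : I}"
obtain u where uK: "u : K" and u: "u ~: I" "s ** u : I" "n ** u : I"
 and gen: "!!x. x : K ==> EX a:RR. EX z:I. x = a ** u +. z"
 using sq by (auto simp: simple_quot_def)
have uM: "u : MM" using uK sub_carrier[OF K] by blast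
let ?g = "%d::nat. ?co (([d] \<cdot>\<^bsub>R\<^esub> \<one>) ** u)"
have "bij_betw ?g {..<q} (?co ` K)"
 unfolding bij_betw_def
proof
 show "inj_on ?g {..<q}"
 proof (rule inj_onI)
 fix d d' assume d: "d : {..<q}" "d' : {..<q}" "?g d = ?g d'"
 then have "([d] \<cdot>\<^bsub>R\<^esub> \<one>) ** u -. ([d'] \<cdot>\<^bsub>R\<^esub> \<one>) ** u : I"
  using coset_eq_iff[OF I, of "([d] \<cdot>\<^bsub>R\<^esub> \<one>) ** u" "([d'] \<cdot>\<^bsub>R\<^esub> \<one>) ** u"] uM by simp
 then show "d = d'" using simple_quot_inj[OF I uM u(1)] d by simp
 qed
 show "?g ` {..<q} = ?co ` K"
 proof
 show "?g ` {..<q} <= ?co ` K" using sub_smult[OF K _ uK] by auto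
 show "?co ` K <= ?g ` {..<q}"
 proof
  fix C assume "C : ?co ` K"
  then obtain x where x: "x : K" "C = ?co x" by blast
  obtain a z where az: "a : RR" "z : I" "x = a ** u +. z" using gen[OF x(1)] by blast
  obtain d where d: "d < q" "x -. ([d] \<cdot>\<^bsub>R\<^esub> \<one>) ** u : I"
  using simple_quot_reps[OF I uM u az(1,2)] az(3) by blast
  then have "?co x = ?g d"
  using coset_eq_iff[OF I, of x "([d] \<cdot>\<^bsub>R\<^esub> \<one>) ** u"] uM sub_carrier[OF K x(1)] by simp
  then show "C : ?g ` {..<q}" using x d by blast
 qed
 qed
qed
from bij_betw_same_card[OF this] show ?thesis by (simp add: quot_card_def)
qed

end

context nodal_module
begin

lemma ImgI: "x : N ==> z = a ** x ==> z : Img M a N"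
by (auto simp: Img_def)

lemma gen3_gens:
assumes "t : MM" "x : MM" "y : MM"
shows "t : gen3 R M t x y" "x : gen3 R M t x y" "y : gen3 R M t x y"
using gen3I[of \<one> \<zero> \<zero> t x y] gen3I[of \<zero> \<one> \<zero> t x y] gen3I[of \<zero> \<zero> \<one> t x y] assms by simp_all

text \<open>Up to a unit, \<open>s (u t)\<close> is the socle generator
  \<open>n^(i-1) t\<close>.\<close>

lemma cyc_unit_coeff:
assumes t: "is_tor R M s n i c t" and i: "i >= 2" and c: "[c] \<cdot>\<^bsub>R\<^esub> \<one> : Units R"
 and u: "u : Units R"
shows "s ** (u ** t) ~= \<theta>"
proof
assume z: "s ** (u ** t) = \<theta>"
let ?c = "[c] \<cdot>\<^bsub>R\<^esub> \<one>"
note uc = R.Units_closed[OF u]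
have tM: "t : MM" and st: "s ** t = (?c \<otimes> n [^] (i - 1)) ** t"
 using t by (auto simp: is_tor_def)
have "u ** (s ** t) = \<theta>" using z uc tM by (simp add: smult_comm[of s])
then have "(u \<otimes> (?c \<otimes> n [^] (i - 1))) ** t = \<theta>" unfolding st using uc tM by (simp add: smult_assoc1)
moreover have "u \<otimes> (?c \<otimes> n [^] (i - 1)) = n [^] (i - 1) \<otimes> (u \<otimes> ?c)"
 using uc R.Units_closed[OF c] by (simp only: R.m_ac R.m_closed R.nat_pow_closed n_closed)
ultimately have "i - 1 >= i" using tor_unit_pow[OF t, of "u \<otimes> ?c" "i - 1"] u c by simp
then show False using i by simp
qed

lemma pow_n_mult_s:
assumes "r : RR" "b : RR" "n [^] (k::nat) \<otimes> r = s \<otimes> b"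
shows "EX b:RR. r = s \<otimes> b"
using assms
proof (induction k arbitrary: r b)
case (Suc k)
have "n [^] k \<otimes> (n \<otimes> r) = s \<otimes> b" using Suc.prems by (simp add: R.m_assoc)
then obtain b' where "b' : RR" "n \<otimes> r = s \<otimes> b'" using Suc.IH[of "n \<otimes> r" b] Suc.prems by auto
then show ?case using n_mult_s Suc.prems by blast
qed auto

lemma free_pow_coeff:
assumes f: "free_over R M n t x" and t: "t : MM" and sx: "s ** x : cyc R M t"
 and b: "b : RR" and e: "(n [^] (k::nat) \<otimes> b) ** x : cyc R M t"
shows "EX b':RR. b = s \<otimes> b'"
proof -
obtain r where r: "r : RR" "s ** x = r ** t" using sx by (auto simp: cyc_def)
obtain a where a: "a : RR" "(n [^] k \<otimes> b) ** x = a ** t" using e by (auto simp: cyc_def)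
obtain b' where "b' : RR" "n [^] k \<otimes> b = s \<otimes> b'"
 using free_coeff[OF f t r _ a(1,2)] b by auto
then show ?thesis using pow_n_mult_s b by blast
qed

text \<open>The shape shared by all entries except the regular module.\<close>

definition tri :: "'c => 'c => 'c => bool" where
"tri t x y \<longleftrightarrow> t : MM & x : MM & y : MM &
 s ** x : cyc R M t & n ** y : cyc R M t &
 (x = \<theta> \<or> free_over R M n t x) & (y = \<theta> \<or> free_over R M s t y) &
 (\<exists>k::nat. n [^] k ** t = \<theta> & s [^] k ** t = \<theta>)"

text \<open>Besides \<open>n^i\<close>, also \<open>s^2\<close> kills \<open>t\<close>: either
  \<open>s t = 0\<close>, or \<open>i >= 2\<close> and \<open>s n^(i-1) = 0\<close>. The exponent
  \<open>i + 2\<close> serves both elements.\<close>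

lemma tor_nilpotent:
assumes t: "is_tor R M s n i c t" and c: "c = 0 \<or> i >= 2"
shows "\<exists>k::nat. n [^] k ** t = \<theta> & s [^] k ** t = \<theta>"
proof -
let ?c = "[c] \<cdot>\<^bsub>R\<^esub> \<one>"
have tM: "t : MM" and st: "s ** t = (?c \<otimes> n [^] (i - 1)) ** t"
 and n0: "n [^] i ** t = \<theta>" using t by (auto simp: is_tor_def)
have "s ** (s ** t) = \<theta>"
proof (cases "c = 0")
 case True
 then show ?thesis using st tM by simp
next
 case False
 then have "n [^] (i - 1) \<otimes> s = \<zero>" using c by (intro R.pow_n_s) auto
 moreover have "s \<otimes> (?c \<otimes> n [^] (i - 1)) = ?c \<otimes> (n [^] (i - 1) \<otimes> s)"
 by (simp add: R.m_ac)
 ultimately have "s \<otimes> (?c \<otimes> n [^] (i - 1)) = \<zero>" by simp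
 then show ?thesis unfolding st using tM by (simp add: smult_assoc1[symmetric])
qed
then have "s [^] (2::nat) ** t = \<theta>" using tM by (simp add: numeral_2_eq_2 smult_assoc1)
then have "s [^] (i + 2) ** t = \<theta>" using s_pow_smult_zero[OF tM, of 2 "i + 2"] by simp
moreover have "n [^] (i + 2) ** t = \<theta>" using n_pow_smult_zero[OF tM n0, of "i + 2"] by simp
ultimately show ?thesis by blast
qed

lemma cond_tri:
assumes g: "t : MM" "x : MM" "y : MM" and c: "cond R M s n q t x y e"
 and e: "e ~= E_reg"
shows "tri t x y"
proof -
have z: "\<theta> : cyc R M t" using sub_zero[OF cyc_submodule[OF g(1)]] .
have p: "n [^] (i - 1) ** t : cyc R M t" for i :: nat by (rule cycI) simp
note self = cyc_self[OF g(1)]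
show ?thesis
proof (cases e)
 case (E_cyc i)
 then show ?thesis using c g z tor_nilpotent[of i 0 t] by (simp add: tri_def)
next
 case (E_F i w)
 then show ?thesis using c g z tor_nilpotent[of i "F_coeff q i w" t] by (simp add: tri_def)
next
 case E_Zp
 then show ?thesis using c g z by (auto simp: tri_def)
next
 case E_A
 then show ?thesis using c g z by (auto simp: tri_def)
next
 case (E_ext_Zp i)
 then show ?thesis using c g z p tor_nilpotent[of i 0 t] by (simp add: tri_def)
next
 case (E_ext_A i)
 then show ?thesis using c g z self tor_nilpotent[of i 0 t] by (simp add: tri_def)
next
 case (E_ext_ZpA i)
 then show ?thesis using c g z p self tor_nilpotent[of i 0 t] by (simp add: tri_def)
qed (use e in simp)
qed

text \<open>A positive power of \<open>n\<close> sends the terms in \<open>t\<close> and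
  \<open>y\<close> into R t, which leaves a multiple of \<open>x\<close> to which freeness applies.
  The exponent is a successor because one factor \<open>n\<close> is spent on
  \<open>y\<close>.\<close>

lemma tri_coeff_x:
assumes tri: "tri t x y" and abc: "a : RR" "b : RR" "c : RR"
 and T: "n [^] Suc k ** (a ** t +. b ** x +. c ** y) : cyc R M t"
shows "x = \<theta> \<or> (EX b':RR. b = s \<otimes> b')"
proof -
have g: "t : MM" "x : MM" "y : MM" using tri by (auto simp: tri_def)
note C = cyc_submodule[OF g(1)]
let ?p = "n [^] Suc k"
have p: "?p : RR" by simp
have 1: "?p ** (a ** t) : cyc R M t"
 using sub_smult[OF C p sub_smult[OF C abc(1) cyc_self[OF g(1)]]] .
have 2: "?p ** (c ** y) : cyc R M t"
proof -
 have "?p ** (c ** y) = (n [^] k \<otimes> c) ** (n ** y)"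
 using abc g by (simp add: smult_assoc1 smult_comm[of n])
 then show ?thesis using tri abc sub_smult[OF C, of "n [^] k \<otimes> c" "n ** y"] by (simp add: tri_def)
qed
have "?p ** (a ** t +. b ** x +. c ** y) =
 (?p \<otimes> b) ** x +. (?p ** (a ** t) +. ?p ** (c ** y))"
 using abc g p by (simp add: smult_r_distr smult_assoc1 M.add.m_ac del: R.nat_pow_Suc)
then have "(?p \<otimes> b) ** x : cyc R M t"
 using sub_cancel[OF C _ _ sub_add[OF C 1 2], of "(?p \<otimes> b) ** x"] T abc g p by (simp del: R.nat_pow_Suc)
then show ?thesis using free_pow_coeff[of t x b "Suc k"] tri abc by (auto simp: tri_def)
qed

lemma tri_swap: "tri t x y ==> nodal_module.tri R n s M t y x"
using nodal_module.tri_def[OF swap_module] by (auto simp: tri_def)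

lemma tri_coeff_y:
assumes tri: "tri t x y" and abc: "a : RR" "b : RR" "c : RR"
 and T: "s [^] Suc k ** (a ** t +. b ** x +. c ** y) : cyc R M t"
shows "y = \<theta> \<or> (EX c':RR. c = n \<otimes> c')"
proof -
have g: "t : MM" "x : MM" "y : MM" using tri by (auto simp: tri_def)
have "a ** t +. b ** x +. c ** y = a ** t +. c ** y +. b ** x"
 using g abc by (simp add: M.add.m_ac)
then show ?thesis
 using nodal_module.tri_coeff_x[OF swap_module tri_swap[OF tri] abc(1,3,2), of k] T by simp
qed

lemma tri_sx:
assumes "tri t x y" "b : RR" "x = \<theta> \<or> (EX b':RR. b = s \<otimes> b')"
shows "b ** x : cyc R M t"
proof -
have g: "t : MM" "x : MM" and sx: "s ** x : cyc R M t" using assms(1) by (auto simp: tri_def)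
note C = cyc_submodule[OF g(1)]
show ?thesis
proof (cases "x = \<theta>")
 case True
 then show ?thesis using sub_zero[OF C] assms by simp
next
 case False
 then obtain b' where b': "b' : RR" "b = s \<otimes> b'" using assms(3) by blast
 have "b ** x = b' ** (s ** x)" using b' g by (simp add: smult_assoc1 smult_comm[of s])
 then show ?thesis using sub_smult[OF C b'(1) sx] by simp
qed
qed

lemma tri_ny:
"[|tri t x y; c : RR; y = \<theta> \<or> (EX c':RR. c = n \<otimes> c')|] ==> c ** y : cyc R M t"
using nodal_module.tri_sx[OF swap_module tri_swap] by blast

text \<open>For a torsion element, powers of \<open>n\<close> and of \<open>s\<close> force the
  coefficient of \<open>x\<close> into sR and that of \<open>y\<close> into nR; then both terms
  already lie in R t.\<close>

lemma Tors_tri: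
assumes tri: "tri t x y"
shows "Tors R M s n (gen3 R M t x y) = cyc R M t"
proof
have g: "t : MM" "x : MM" "y : MM" using tri by (auto simp: tri_def)
let ?N = "gen3 R M t x y"
have N: "submodule ?N R M" using g by (rule gen3_submodule)
note C = cyc_submodule[OF g(1)]
show "cyc R M t <= Tors R M s n ?N"
proof -
 have "t : Tors R M s n ?N" using tri gen3_gens(1)[OF g] by (auto simp: Tors_def tri_def)
 then show ?thesis using sub_smult[OF Tors_submodule[OF N]] by (auto simp: cyc_def)
qed
show "Tors R M s n ?N <= cyc R M t"
proof
 fix m assume m: "m : Tors R M s n ?N"
 then obtain k where k: "m : ?N" "n [^] (k::nat) ** m = \<theta>" "s [^] k ** m = \<theta>" by (auto simp: Tors_def)
 have mM: "m : MM" using k(1) sub_carrier[OF N] by blast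
 obtain a b c where abc: "a : RR" "b : RR" "c : RR"
 "m = a ** t +. b ** x +. c ** y" using k(1) by (auto simp: gen3_def)
 have "n [^] Suc k ** m : cyc R M t" "s [^] Suc k ** m : cyc R M t"
 using n_pow_smult_zero[OF mM k(2), of "Suc k"] s_pow_smult_zero[OF mM k(3), of "Suc k"] sub_zero[OF C]
 by (simp_all del: R.nat_pow_Suc)
 then have bc: "b ** x : cyc R M t" "c ** y : cyc R M t"
 using tri_sx[OF tri abc(2) tri_coeff_x[OF tri abc(1-3), of k]]
  tri_ny[OF tri abc(3) tri_coeff_y[OF tri abc(1-3), of k]] abc(4) by auto
 show "m : cyc R M t" unfolding abc(4)
 by (rule sub_add[OF C sub_add[OF C cycI[OF abc(1)] bc(1)] bc(2)])
qed
qed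

lemma reg_zero:
assumes c: "cond R M s n q t x y E_reg" and b: "b : RR"
shows "b ** x = \<theta> \<longleftrightarrow> b = \<zero>"
proof -
have g: "t : MM" "x : MM" "y : MM" and t: "t = \<theta>" "y = \<theta>"
 using c by (auto simp: free_over_def)
show ?thesis using comb3_rel[OF g c, of \<zero> b \<zero>] b t g by (simp add: comb3_def)
qed

text \<open>The coefficient of a torsion element is divisible by \<open>s\<close> and by
  \<open>n\<close>, hence zero.\<close>

lemma Tors_reg:
assumes c: "cond R M s n q t x y E_reg"
shows "Tors R M s n (gen3 R M t x y) = {\<theta>}"
proof
have g: "x : MM" and t: "t = \<theta>" "y = \<theta>" using c by (auto simp: free_over_def)
have N: "gen3 R M t x y = cyc R M x" using t cyc_gen3(1)[OF g] by simp
show "{\<theta>} <= Tors R M s n (gen3 R M t x y)"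
 using sub_zero[OF Tors_submodule[OF cyc_submodule[OF g]]] N by simp
show "Tors R M s n (gen3 R M t x y) <= {\<theta>}"
proof
 fix m assume "m : Tors R M s n (gen3 R M t x y)"
 then obtain k b where k: "n [^] (k::nat) ** m = \<theta>" "s [^] k ** m = \<theta>"
 and b: "b : RR" "m = b ** x" unfolding N by (auto simp: Tors_def cyc_def)
 have "n [^] k \<otimes> b = \<zero>" "s [^] k \<otimes> b = \<zero>"
 using reg_zero[OF c, of "n [^] k \<otimes> b"] reg_zero[OF c, of "s [^] k \<otimes> b"] k b g by (simp_all add: smult_assoc1)
 then have "EX d:RR. b = s \<otimes> d" "EX d:RR. b = n \<otimes> d"
 using pow_n_mult_s[OF b(1), of \<zero>] nodal_module.pow_n_mult_s[OF swap_module b(1), of \<zero>] by auto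
 then have "b = \<zero>" using s_int_n by auto
 then show "m : {\<theta>}" using b g by simp
qed
qed

text \<open>If \<open>t = n m\<close>, the coefficient of \<open>x\<close> in \<open>m\<close> is a
  multiple of \<open>s\<close>, unless \<open>x\<close> is zero, so \<open>n\<close> kills that
  term. Then \<open>t = n a t\<close>, and \<open>1 - n a\<close> is a unit.\<close>

lemma t_notin_nN:
assumes tri: "tri t x y" and y: "y = \<theta>" and t0: "t ~= \<theta>"
shows "t ~: Img M n (gen3 R M t x y)"
proof
have g: "t : MM" "x : MM" "y : MM" using tri by (auto simp: tri_def)
assume "t : Img M n (gen3 R M t x y)"
then obtain a b c where abc: "a : RR" "b : RR" "c : RR"
 "t = n ** (a ** t +. b ** x +. c ** y)" by (auto simp: Img_def gen3_def)
have "x = \<theta> \<or> (EX b':RR. b = s \<otimes> b')"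
 using tri_coeff_x[OF tri abc(1-3), of 0] abc(4) cyc_self[OF g(1)] by simp
then have "n ** (b ** x) = \<theta>" using g abc(2) by (auto simp: smult_assoc1)
then have "t = n ** (a ** t)" using abc y g by (simp add: smult_r_distr)
then have "t = (n \<otimes> a) ** t" using abc(1) g by (simp add: smult_assoc1)
then show False using eq_n_mult_zero[OF g(1) abc(1)] t0 by simp
qed

text \<open>If the socle element were \<open>s m\<close>, nothing would be left of \<open>m\<close>
  after applying \<open>s\<close>: \<open>t\<close> is killed by \<open>s\<close>, there is no
  \<open>x\<close>, and the coefficient of \<open>y\<close> is a multiple of \<open>n\<close> unless
  \<open>y\<close> is zero.\<close>

lemma socle_notin_sN:
assumes tri: "tri t x y" and x: "x = \<theta>" and t: "is_tor R M s n i 0 t"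
shows "n [^] (i - 1) ** t ~: Img M s (gen3 R M t x y)"
proof
have g: "t : MM" "x : MM" "y : MM" using tri by (auto simp: tri_def)
have st: "s ** t = \<theta>" using t by (simp add: is_tor_def)
assume "n [^] (i - 1) ** t : Img M s (gen3 R M t x y)"
then obtain a b c where abc: "a : RR" "b : RR" "c : RR"
 "n [^] (i - 1) ** t = s ** (a ** t +. b ** x +. c ** y)" by (auto simp: Img_def gen3_def)
have "s [^] Suc 0 ** (a ** t +. b ** x +. c ** y) : cyc R M t"
 using abc(4)[symmetric] cycI[of "n [^] (i - 1)" t] by simp
then have "y = \<theta> \<or> (EX c':RR. c = n \<otimes> c')" by (rule tri_coeff_y[OF tri abc(1-3)])
then have "s ** (c ** y) = \<theta>" using g abc(3) by (auto simp: smult_assoc1)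
then have "n [^] (i - 1) ** t = \<theta>"
 using abc x g st by (simp add: smult_r_distr smult_comm[of s a])
then show False using t by (simp add: is_tor_def)
qed

lemma tor_nonzero: "is_tor R M s n i c t ==> t ~= \<theta>"
by (auto simp: is_tor_def)

lemma socle_mult:
assumes t: "is_tor R M s n i 0 t" and b: "b : RR" and z: "b ** (n [^] (i - 1) ** t) = \<theta>"
shows "EX b1:RR. EX b2:RR. b = s \<otimes> b1 \<oplus> n \<otimes> b2"
proof (rule ccontr)
assume "~ ?thesis"
then have "b : Units R" using local[OF b] by blast
then have "n [^] (i - 1) ** t = \<theta>" using unit_smult_zero[OF _ _ z] t by (simp add: is_tor_def)
then show False using t by (simp add: is_tor_def)
qed

end

text \<open>The difference \<open>w - 1\<close> is a nonzero multiple of \<open>q^(i-1)\<close>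
  below \<open>q^i\<close>. It is not negative, since otherwise \<open>w\<close> would be at most
  \<open>1 - q^(i-1) < 0\<close>.\<close>

lemma F_coeff:
assumes q: "q > 1" and e: "in_list q (E_F i w)"
shows "0 < F_coeff q i w" "F_coeff q i w < q" "w = 1 + int (F_coeff q i w) * int q ^ (i - 1)"
proof -
have i: "i >= 2" and w: "0 <= w" "w < int q ^ i" "[w = 1] (mod int q ^ (i - 1))" "w ~= 1"
 using e by (auto simp: admissible_unit_def)
define D where "D = int q ^ (i - 1)"
have D: "D > 1" using q i by (simp add: D_def)
have qi: "int q ^ i = int q * D" using i by (simp add: D_def flip: power_Suc)
obtain k where k: "w - 1 = D * k" using w(3) by (auto simp: cong_iff_dvd_diff D_def)
have "k > 0"
proof (rule ccontr)
 assume "~ k > 0"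
 moreover have "k ~= 0" using k w(4) by auto
 ultimately have "D * k <= D * (-1)" using D by (intro mult_left_mono) auto
 then show False using k w(1) D by simp
qed
moreover have "k < int q"
proof -
 have "D * k < D * int q" using k w(2) qi by (simp add: mult.commute)
 then show ?thesis using D by simp
qed
moreover have F: "F_coeff q i w = nat k"
proof -
 have "F_coeff q i w = nat ((w - 1) div D)" by (simp only: F_coeff_def D_def)
 then show ?thesis using k D by simp
qed
ultimately show "0 < F_coeff q i w" "F_coeff q i w < q" by auto
show "w = 1 + int (F_coeff q i w) * int q ^ (i - 1)"
 using k \<open>k > 0\<close> unfolding F D_def[symmetric] by (simp add: mult.commute)
qed

section \<open>Kernels modulo images for the single entries\<close>

context nodal_char_module
begin

lemma Ker_mem: "[|z : Ker M a N|] ==> z : N & a ** z = \<theta>"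
by (simp add: Ker_def)

context
fixes t x y e
assumes q1: "q > 1" and g: "t : MM" "x : MM" "y : MM"
 and cnd: "cond R M s n q t x y e" and wf: "in_list q e"
begin

abbreviation (input) "N0 \<equiv> gen3 R M t x y"

lemma N0: "submodule N0 R M"
by (rule gen3_submodule[OF g])

lemma F_unit: "e = E_F i w ==> [F_coeff q i w] \<cdot>\<^bsub>R\<^esub> \<one> : Units R"
using F_coeff[OF q1, of i w] wf by (intro q_units) auto

lemma N0_elem:
assumes "m : N0"
obtains a b c where "a : RR" "b : RR" "c : RR"
 "m = a ** t +. b ** x +. c ** y"
using assms unfolding gen3_def by blast

lemma simple_quotI:
assumes "u : K" "u ~: I" "s ** u : I" "n ** u : I"
 "!!m. m : K ==> EX a:RR. EX z:I. m = a ** u +. z"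
shows "simple_quot R M s n K I"
using assms unfolding simple_quot_def by blast

lemma multiple_of_n:
assumes "a : RR" "r : RR" "a = n \<otimes> r" "z : N0"
shows "a ** z : Img M n N0"
using assms sub_carrier[OF N0] sub_smult[OF N0]
by (intro ImgI[of "r ** z"]) (auto simp: smult_assoc1)

lemma multiple_of_s:
assumes "a : RR" "r : RR" "a = s \<otimes> r" "z : N0"
shows "a ** z : Img M s N0"
using assms sub_carrier[OF N0] sub_smult[OF N0]
by (intro ImgI[of "r ** z"]) (auto simp: smult_assoc1)

text \<open>As \<open>b\<close> kills the socle, it is in the maximal ideal; its \<open>s\<close>
  part moves \<open>x\<close> into R t, and its \<open>n\<close> part gives a multiple of
  \<open>n\<close>.\<close>

lemma ext_x_coeff:
assumes t: "is_tor R M s n i 0 t" and sx: "s ** x = n [^] (i - 1) ** t"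
 and b: "b : RR" and z: "b ** (n [^] (i - 1) ** t) = \<theta>"
shows "EX a:RR. EX v:Img M n N0. b ** x = a ** t +. v"
proof -
obtain b1 b2 where b12: "b1 : RR" "b2 : RR" "b = s \<otimes> b1 \<oplus> n \<otimes> b2"
 using socle_mult[OF t b z] by blast
have "b ** x = b1 ** (s ** x) +. (n \<otimes> b2) ** x"
 using b12 g by (simp add: smult_l_distr smult_assoc1 smult_comm[of s])
also have "b1 ** (s ** x) = (b1 \<otimes> n [^] (i - 1)) ** t"
 unfolding sx using b12 g by (simp add: smult_assoc1)
finally show ?thesis using multiple_of_n[of "n \<otimes> b2" b2 x] b12 gen3_gens[OF g] R.m_closed R.nat_pow_closed n_closed
 by blast
qed

text \<open>In the nonzero cases the class is that of \<open>t\<close>, or of \<open>x\<close> when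
  there is no torsion. Otherwise: in F_i, \<open>s\<close> does not kill unit multiples of
  \<open>t\<close>; for the regular module \<open>ann_s\<close> applies; where \<open>y\<close> is
  present its coefficient lies in nR, and an equation \<open>n y = t\<close> turns all of R t into
  multiples of \<open>n\<close>.\<close>

lemma entry_h0:
"h0_entry e ==> simple_quot R M s n (Ker M s N0) (Img M n N0)"
"~ h0_entry e ==> Ker M s N0 <= Img M n N0"
proof -
note NM = sub_carrier[OF N0] and G = gen3_gens[OF g]
have I: "submodule (Img M n N0) R M" by (rule Img_submodule[OF N0]) simp
have zI: "\<theta> : Img M n N0" by (rule sub_zero[OF I])
have nI: "n ** z : Img M n N0" if "z : N0" for z using that by (intro ImgI) auto
have mem: "\<exists>a b c. a : RR & b : RR & c : RR &
 m = a ** t +. b ** x +. c ** y & s ** m = \<theta>" if "m : Ker M s N0" for m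
 using that N0_elem Ker_mem by metis
have y_coeff: "EX c'':RR. c = n \<otimes> c''"
 if tri: "tri t x y" "y ~= \<theta>" and "a : RR" "b : RR" "c : RR"
 "s ** (a ** t +. b ** x +. c ** y) = \<theta>" for a b c
 using tri_coeff_y[OF that(1,3-5), of 0] that sub_zero[OF cyc_submodule[OF g(1)]] by auto
show "simple_quot R M s n (Ker M s N0) (Img M n N0)" if h: "h0_entry e"
proof (cases e)
 case (E_cyc i)
 then have t: "is_tor R M s n i 0 t" and xy: "x = \<theta>" "y = \<theta>" using cnd by auto
 have st: "s ** t = \<theta>" using t g by (simp add: is_tor_def)
 show ?thesis
 proof (rule simple_quotI[of t])
 show "t : Ker M s N0" using G st by (simp add: Ker_def)
 show "t ~: Img M n N0" using t_notin_nN cond_tri[OF g cnd] E_cyc xy tor_nonzero[OF t] by simp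
 show "s ** t : Img M n N0" using st zI by simp
 show "n ** t : Img M n N0" by (rule nI[OF G(1)])
 fix m assume "m : Ker M s N0"
 then obtain a b c where "a : RR" "b : RR" "c : RR"
  "m = a ** t +. b ** x +. c ** y" using mem by blast
 then show "EX a:RR. EX z:Img M n N0. m = a ** t +. z"
  using zI xy g by (intro bexI[of _ a] bexI[of _ "\<theta>"]) auto
 qed
next
 case E_Zp
 then have c: "t = \<theta>" "y = \<theta>" "free_over R M n \<theta> x" "s ** x = \<theta>" using cnd by auto
 have x0: "x ~= \<theta>"
 proof
 assume "x = \<theta>"
 then have "n [^] (0::nat) ** x = \<zero> ** \<theta>" by simp
 then show False using c(3) R.zero_closed unfolding free_over_def by blast
 qed
 show ?thesis
 proof (rule simple_quotI[of x])
 show "x : Ker M s N0" using G c by (simp add: Ker_def)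
 show "x ~: Img M n N0"
 proof
  assume "x : Img M n N0"
  then obtain m where m: "m : N0" "x = n ** m" by (auto simp: Img_def)
  obtain a b d where "a : RR" "b : RR" "d : RR"
  "m = a ** t +. b ** x +. d ** y" by (rule N0_elem[OF m(1)])
  then have "x = (n \<otimes> b) ** x" "b : RR" using m c g by (simp_all add: smult_assoc1)
  then show False using eq_n_mult_zero[OF g(2)] x0 by blast
 qed
 show "s ** x : Img M n N0" using c zI by simp
 show "n ** x : Img M n N0" by (rule nI[OF G(2)])
 fix m assume "m : Ker M s N0"
 then obtain a b d where "a : RR" "b : RR" "d : RR"
  "m = a ** t +. b ** x +. d ** y" using mem by blast
 then show "EX a:RR. EX z:Img M n N0. m = a ** x +. z"
  using zI c g by (intro bexI[of _ b] bexI[of _ "\<theta>"]) auto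
 qed
next
 case (E_ext_Zp i)
 then have t: "is_tor R M s n i 0 t" and c: "y = \<theta>" "s ** x = n [^] (i - 1) ** t" using cnd by auto
 have st: "s ** t = \<theta>" using t g by (simp add: is_tor_def)
 show ?thesis
 proof (rule simple_quotI[of t])
 show "t : Ker M s N0" using G st by (simp add: Ker_def)
 show "t ~: Img M n N0" using t_notin_nN cond_tri[OF g cnd] E_ext_Zp c tor_nonzero[OF t] by simp
 show "s ** t : Img M n N0" using st zI by simp
 show "n ** t : Img M n N0" by (rule nI[OF G(1)])
 fix m assume "m : Ker M s N0"
 then obtain a b d where abd: "a : RR" "b : RR" "d : RR"
  "m = a ** t +. b ** x +. d ** y" "s ** m = \<theta>" using mem by blast
 have m: "m = a ** t +. b ** x" using abd c g by simp
 have "b ** (n [^] (i - 1) ** t) = \<theta>"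
  using abd(1,2,5) m st g c(2) by (simp add: smult_r_distr smult_comm[of s])
 then obtain a' v where v: "a' : RR" "v : Img M n N0" "b ** x = a' ** t +. v"
  using ext_x_coeff[OF t c(2) abd(2)] by blast
 have "m = (a \<oplus> a') ** t +. v"
  using m v abd g sub_carrier[OF I v(2)] by (simp add: smult_l_distr M.a_assoc)
 then show "EX a:RR. EX z:Img M n N0. m = a ** t +. z" using abd v R.a_closed by blast
 qed
qed (use h in simp_all)
show "Ker M s N0 <= Img M n N0" if h: "~ h0_entry e"
proof
 fix m assume "m : Ker M s N0"
 then obtain a b c where abc: "a : RR" "b : RR" "c : RR"
 "m = a ** t +. b ** x +. c ** y" "s ** m = \<theta>" using mem by blast
 show "m : Img M n N0"
 proof (cases e)
 case (E_F i w)
 then have t: "i >= 2" "is_tor R M s n i (F_coeff q i w) t" and xy: "x = \<theta>" "y = \<theta>" using cnd by auto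
 have m: "m = a ** t" using abc xy g by simp
 consider "a ** t = \<theta>"
  | l u where "l < i" "u : Units R" "a ** t = (n [^] (l::nat) \<otimes> u) ** t"
  using tor_cases[OF t(2) _ abc(1)] t(1) by blast
 then show ?thesis
 proof cases
  case 1
  then show ?thesis using m zI by simp
 next
  case 2
  note uc = R.Units_closed[OF 2(2)]
  show ?thesis
  proof (cases l)
  case 0
  then have "s ** (u ** t) = \<theta>" using abc(5) m 2 uc by simp
  then show ?thesis using cyc_unit_coeff[OF t(2,1) F_unit[OF E_F] 2(2)] by simp
  next
  case (Suc l')
  have "n [^] l \<otimes> u = n \<otimes> (n [^] l' \<otimes> u)" using Suc uc by (simp add: R.m_ac)
  then show ?thesis using multiple_of_n[OF _ _ _ G(1), of "n [^] l \<otimes> u" "n [^] l' \<otimes> u"] m 2 uc by simp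
  qed
 qed
 next
 case E_A
 then have c: "t = \<theta>" "x = \<theta>" using cnd by auto
 have m: "m = c ** y" using abc c g by simp
 show ?thesis
 proof (cases "y = \<theta>")
  case True
  then show ?thesis using m abc zI by simp
 next
  case False
  then obtain c'' where "c'' : RR" "c = n \<otimes> c''"
  using y_coeff[OF cond_tri[OF g cnd] _ abc(1-3)] abc(4,5) E_A by auto
  then show ?thesis using m multiple_of_n[OF abc(3) _ _ G(3)] by simp
 qed
 next
 case E_reg
 then have c: "t = \<theta>" "y = \<theta>" using cnd by auto
 have m: "m = b ** x" using abc c g by simp
 have "(s \<otimes> b) ** x = \<theta>" using abc m g by (simp add: smult_assoc1)
 then have "s \<otimes> b = \<zero>" using reg_zero[of q t x y "s \<otimes> b"] cnd E_reg abc by simp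
 then obtain b' where "b' : RR" "b = n \<otimes> b'" using ann_s abc by blast
 then show ?thesis using m multiple_of_n[OF abc(2) _ _ G(2)] by simp
 next
 case (E_ext_A i)
 then have c: "is_tor R M s n i 0 t" "x = \<theta>" "n ** y = t" using cnd by auto
 have y0: "y ~= \<theta>" using c(3) tor_nonzero[OF c(1)] by auto
 obtain c'' where c'': "c'' : RR" "c = n \<otimes> c''"
  using y_coeff[OF cond_tri[OF g cnd] y0 abc(1-3)] abc(4,5) E_ext_A by auto
 have "a ** t = (n \<otimes> a) ** y" using c(3)[symmetric] abc g by (simp add: smult_assoc1 smult_comm[of a])
 then have "m = (n \<otimes> a) ** y +. c ** y" using abc c(2) g by simp
 then show ?thesis
  using sub_add[OF I] multiple_of_n[OF _ abc(1) refl G(3)] multiple_of_n[OF abc(3) c'' G(3)] abc by simp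
 next
 case (E_ext_ZpA i)
 then have t: "is_tor R M s n i 0 t" and c: "s ** x = n [^] (i - 1) ** t" "n ** y = t" using cnd by auto
 have st: "s ** t = \<theta>" using t g by (simp add: is_tor_def)
 have y0: "y ~= \<theta>" using c(2) tor_nonzero[OF t] by auto
 obtain c'' where c'': "c'' : RR" "c = n \<otimes> c''"
  using y_coeff[OF cond_tri[OF g cnd] y0 abc(1-3)] abc(4,5) E_ext_ZpA by auto
 have aI: "r ** t : Img M n N0" if "r : RR" for r
 proof -
  have "r ** t = (n \<otimes> r) ** y" using c(2)[symmetric] that g by (simp add: smult_assoc1 smult_comm[of r])
  then show ?thesis using multiple_of_n[OF _ that refl G(3)] that by simp
 qed
 have "s ** (c ** y) = \<theta>" using c'' g by (simp add: smult_assoc1)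
 then have "b ** (n [^] (i - 1) ** t) = \<theta>"
  using abc st g c(1) by (simp add: smult_r_distr smult_comm[of s a] smult_comm[of s b])
 then obtain a' v where v: "a' : RR" "v : Img M n N0" "b ** x = a' ** t +. v"
  using ext_x_coeff[OF t c(1) abc(2)] by blast
 then have "b ** x : Img M n N0" using sub_add[OF I aI] by simp
 then show ?thesis unfolding abc(4)
  by (intro sub_add[OF I] aI abc(1) multiple_of_n[OF abc(3) c'' G(3)])
 qed (use h in simp_all)
qed
qed

lemma tor_n_kill_cases:
assumes t: "is_tor R M s n i d t" and d: "d = 0 \<or> i >= 2" and a: "a : RR" and z: "n ** (a ** t) = \<theta>"
shows "EX v:RR. a ** t = v ** (n [^] (i - 1) ** t)"
proof -
consider "a ** t = \<theta>" | u where "u : Units R" "a ** t = (n [^] (i - 1) \<otimes> u) ** t"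
 using tor_n_kill[OF t d a z] by blast
then show ?thesis
proof cases
 case 1
 then show ?thesis using g by (intro bexI[of _ \<zero>]) auto
next
 case 2
 then have "u : RR" by (simp add: R.Units_closed)
 then show ?thesis using 2 g by (intro bexI[of _ u]) (auto simp: smult_assoc1 smult_comm)
qed
qed

text \<open>With \<open>n y = t\<close> the element is \<open>r y\<close> for
  \<open>r = n a + c\<close>. That \<open>n\<close> kills it means \<open>r t = 0\<close>, so
  \<open>r\<close> is in the ideal of \<open>s\<close> and \<open>n^i\<close>; finally
  \<open>n^i y = n^(i-1) t\<close>.\<close>

lemma ny_kill:
assumes t: "is_tor R M s n i 0 t" and ny: "n ** y = t" and ac: "a : RR" "c : RR"
 and z: "n ** (a ** t +. c ** y) = \<theta>"
shows "EX d:RR. EX v:Img M s N0. a ** t +. c ** y = d ** (n [^] (i - 1) ** t) +. v"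
proof -
let ?r = "n \<otimes> a \<oplus> c"
have i: "i >= 1" using t by (simp add: is_tor_def)
have eq: "a ** t +. c ** y = ?r ** y"
 using ny[symmetric] ac g by (simp add: smult_l_distr smult_assoc1 smult_comm[of a])
have "?r ** t = \<theta>" using z unfolding eq using ac g ny by (simp add: smult_comm[of n])
then have "?r : tor_ideal R s n i 0" using tor_ann[OF t, of ?r] ac by simp
then obtain d1 d2 where d: "d1 : RR" "d2 : RR" "?r = s \<otimes> d1 \<oplus> n [^] i \<otimes> d2"
 by (auto simp: tor_ideal_def R.minus_eq)
have ni: "n [^] i \<otimes> d2 = d2 \<otimes> n [^] (i - 1) \<otimes> n" using d i
 by (metis R.m_assoc R.m_comm R.nat_pow_Suc R.nat_pow_closed Suc_diff_1 less_eq_Suc_le n_closed One_nat_def)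
have "?r ** y = (s \<otimes> d1) ** y +. (d2 \<otimes> n [^] (i - 1)) ** t"
 unfolding d(3) ni using d g ny by (simp add: smult_l_distr smult_assoc1)
also have "\<dots> = d2 ** (n [^] (i - 1) ** t) +. (s \<otimes> d1) ** y"
 using d g by (simp add: smult_assoc1 M.a_comm)
finally show ?thesis using eq d multiple_of_s[OF _ d(1) refl gen3_gens(3)[OF g]] by auto
qed

text \<open>In the nonzero cases the class is that of the socle element \<open>n^(i-1) t\<close>, or
  of \<open>y\<close> when there is no torsion. It disappears as soon as \<open>s\<close> reaches
  the socle, through \<open>s t\<close> in F_i and through \<open>s x\<close> in extensions with
  \<open>x\<close>. For \<open>E_Zp\<close> and \<open>E_reg\<close> the term in \<open>x\<close> is
  a multiple of \<open>s\<close>.\<close>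

lemma entry_h1:
"h1_entry e ==> simple_quot R M s n (Ker M n N0) (Img M s N0)"
"~ h1_entry e ==> Ker M n N0 <= Img M s N0"
proof -
note NM = sub_carrier[OF N0] and G = gen3_gens[OF g]
have I: "submodule (Img M s N0) R M" by (rule Img_submodule[OF N0]) simp
have zI: "\<theta> : Img M s N0" by (rule sub_zero[OF I])
have sI: "s ** z : Img M s N0" if "z : N0" for z using that by (intro ImgI) auto
have mem: "\<exists>a b c. a : RR & b : RR & c : RR &
 m = a ** t +. b ** x +. c ** y & n ** m = \<theta>" if "m : Ker M n N0" for m
 using that N0_elem Ker_mem by metis
have x_coeff: "x = \<theta> \<or> (EX b':RR. b = s \<otimes> b')"
 if tri: "tri t x y" and "a : RR" "b : RR" "c : RR"
 "n ** (a ** t +. b ** x +. c ** y) = \<theta>" for a b c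
 using tri_coeff_x[OF that(1-4), of 0] that sub_zero[OF cyc_submodule[OF g(1)]] by auto
have socle: "n ** (n [^] (i - 1) ** t) = \<theta>" "s ** (n [^] (i - 1) ** t) = \<theta>"
 "n [^] (i - 1) ** t : N0"
 if t: "is_tor R M s n i 0 t" for i
proof -
 have i: "i >= 1" using t by (simp add: is_tor_def)
 have "n ** (n [^] (i - 1) ** t) = n [^] Suc (i - 1) ** t" using g by (simp add: smult_assoc1 smult_comm)
 then show "n ** (n [^] (i - 1) ** t) = \<theta>" using t i by (simp add: is_tor_def del: R.nat_pow_Suc)
 show "s ** (n [^] (i - 1) ** t) = \<theta>" using n_pow_mx[OF t] by simp
 show "n [^] (i - 1) ** t : N0" using sub_smult[OF N0 _ G(1)] by simp
qed
show "simple_quot R M s n (Ker M n N0) (Img M s N0)" if h: "h1_entry e"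
proof (cases e)
 case (E_cyc i)
 then have t: "is_tor R M s n i 0 t" and xy: "x = \<theta>" "y = \<theta>" using cnd by auto
 show ?thesis
 proof (rule simple_quotI[of "n [^] (i - 1) ** t"])
 show "n [^] (i - 1) ** t : Ker M n N0" using socle[OF t] by (simp add: Ker_def)
 show "n [^] (i - 1) ** t ~: Img M s N0"
  using socle_notin_sN[OF cond_tri[OF g cnd] xy(1) t] E_cyc by simp
 fix m assume "m : Ker M n N0"
 then obtain a b c where abc: "a : RR" "b : RR" "c : RR"
  "m = a ** t +. b ** x +. c ** y" "n ** m = \<theta>" using mem by blast
 then have m: "m = a ** t" using xy g by simp
 obtain v where "v : RR" "m = v ** (n [^] (i - 1) ** t)"
  using tor_n_kill_cases[OF t _ abc(1)] abc(5) m by auto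
 then show "EX a:RR. EX z:Img M s N0. m = a ** (n [^] (i - 1) ** t) +. z"
  using zI g by (intro bexI[of _ v] bexI[of _ "\<theta>"]) auto
 qed (use socle[OF t] zI in auto)
next
 case E_A
 then have c: "t = \<theta>" "x = \<theta>" "free_over R M s \<theta> y" "n ** y = \<theta>" using cnd by auto
 have y0: "y ~= \<theta>"
 proof
 assume "y = \<theta>"
 then have "s [^] (0::nat) ** y = \<zero> ** \<theta>" by simp
 then show False using c(3) R.zero_closed unfolding free_over_def by blast
 qed
 show ?thesis
 proof (rule simple_quotI[of y])
 show "y : Ker M n N0" using G c by (simp add: Ker_def)
 show "y ~: Img M s N0"
 proof
  assume "y : Img M s N0"
  then obtain m where m: "m : N0" "y = s ** m" by (auto simp: Img_def)
  obtain a b d where "a : RR" "b : RR" "d : RR"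
  "m = a ** t +. b ** x +. d ** y" by (rule N0_elem[OF m(1)])
  then have "y = (s \<otimes> d) ** y" "d : RR" using m c g by (simp_all add: smult_assoc1)
  then show False using nodal_module.eq_n_mult_zero[OF swap_module g(3)] y0 by blast
 qed
 show "n ** y : Img M s N0" using c zI by simp
 show "s ** y : Img M s N0" by (rule sI[OF G(3)])
 fix m assume "m : Ker M n N0"
 then obtain a b d where "a : RR" "b : RR" "d : RR"
  "m = a ** t +. b ** x +. d ** y" using mem by blast
 then show "EX a:RR. EX z:Img M s N0. m = a ** y +. z"
  using zI c g by (intro bexI[of _ d] bexI[of _ "\<theta>"]) auto
 qed
next
 case (E_ext_A i)
 then have t: "is_tor R M s n i 0 t" and c: "x = \<theta>" "n ** y = t" using cnd by auto
 show ?thesis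
 proof (rule simple_quotI[of "n [^] (i - 1) ** t"])
 show "n [^] (i - 1) ** t : Ker M n N0" using socle[OF t] by (simp add: Ker_def)
 show "n [^] (i - 1) ** t ~: Img M s N0"
  using socle_notin_sN[OF cond_tri[OF g cnd] c(1) t] E_ext_A by simp
 fix m assume "m : Ker M n N0"
 then obtain a b d where abd: "a : RR" "b : RR" "d : RR"
  "m = a ** t +. b ** x +. d ** y" "n ** m = \<theta>" using mem by blast
 then have m: "m = a ** t +. d ** y" using c g by simp
 show "EX a:RR. EX z:Img M s N0. m = a ** (n [^] (i - 1) ** t) +. z"
  using ny_kill[OF t c(2) abd(1,3)] abd(5) m by simp
 qed (use socle[OF t] zI in auto)
qed (use h in simp_all)
show "Ker M n N0 <= Img M s N0" if h: "~ h1_entry e"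
proof
 fix m assume "m : Ker M n N0"
 then obtain a b c where abc: "a : RR" "b : RR" "c : RR"
 "m = a ** t +. b ** x +. c ** y" "n ** m = \<theta>" using mem by blast
 have bxI: "b ** x : Img M s N0" "n ** (b ** x) = \<theta>" if ne: "e ~= E_reg"
 proof -
 have x: "x = \<theta> \<or> (EX b':RR. b = s \<otimes> b')"
  using x_coeff[OF cond_tri[OF g cnd ne] abc(1-3)] abc(4,5) by simp
 show "b ** x : Img M s N0" using x multiple_of_s[OF abc(2) _ _ G(2)] zI abc(2) by auto
 show "n ** (b ** x) = \<theta>" using x abc(2) g by (auto simp: smult_assoc1)
 qed
 have rest: "n ** (a ** t +. c ** y) = \<theta>" if ne: "e ~= E_reg"
 using abc(5) bxI(2)[OF ne] abc g by (simp add: smult_r_distr)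
 have m: "m = b ** x +. (a ** t +. c ** y)" using abc g by (simp add: M.add.m_ac)
 show "m : Img M s N0"
 proof (cases e)
 case (E_F i w)
 then have t: "i >= 2" "is_tor R M s n i (F_coeff q i w) t" and xy: "x = \<theta>" "y = \<theta>" using cnd by auto
 let ?c = "[F_coeff q i w] \<cdot>\<^bsub>R\<^esub> \<one>"
 have c: "?c : Units R" by (rule F_unit[OF E_F])
 obtain v where v: "v : RR" "a ** t = v ** (n [^] (i - 1) ** t)"
  using tor_n_kill_cases[OF t(2) _ abc(1)] t(1) rest E_F xy abc g by auto
 have st: "s ** t = (?c \<otimes> n [^] (i - 1)) ** t" using t by (simp add: is_tor_def)
 have "n [^] (i - 1) ** t = inv ?c ** (s ** t)"
 proof -
  have "inv ?c ** (s ** t) = (inv ?c \<otimes> ?c) ** (n [^] (i - 1) ** t)"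
  unfolding st using c R.Units_closed[OF c] g
  by (simp only: smult_assoc1[symmetric] R.Units_inv_closed R.m_closed R.nat_pow_closed n_closed R.m_assoc)
  then show ?thesis using R.Units_l_inv[OF c] g by simp
 qed
 then have "n [^] (i - 1) ** t : Img M s N0" using sub_smult[OF I _ sI[OF G(1)]] c by simp
 then show ?thesis using sub_smult[OF I v(1)] v m xy abc g by simp
 next
 case E_Zp
 then show ?thesis using m cnd bxI abc g by simp
 next
 case E_reg
 then have c: "t = \<theta>" "y = \<theta>" using cnd by auto
 have m: "m = b ** x" using abc c g by simp
 have "(n \<otimes> b) ** x = \<theta>" using abc m g by (simp add: smult_assoc1)
 then have "n \<otimes> b = \<zero>" using reg_zero[of q t x y "n \<otimes> b"] cnd E_reg abc by simp
 then obtain b' where "b' : RR" "b = s \<otimes> b'" using ann_n abc by blast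
 then show ?thesis using m multiple_of_s[OF abc(2) _ _ G(2)] by simp
 next
 case (E_ext_Zp i)
 then have t: "is_tor R M s n i 0 t" and c: "y = \<theta>" "s ** x = n [^] (i - 1) ** t" using cnd by auto
 obtain v where v: "v : RR" "a ** t = v ** (n [^] (i - 1) ** t)"
  using tor_n_kill_cases[OF t _ abc(1)] rest E_ext_Zp c abc g by auto
 have "a ** t : Img M s N0" unfolding v(2) using sub_smult[OF I v(1) sI[OF G(2)]] c(2) by simp
 then show ?thesis using m c abc g sub_add[OF I] bxI E_ext_Zp by simp
 next
 case (E_ext_ZpA i)
 then have t: "is_tor R M s n i 0 t" and c: "s ** x = n [^] (i - 1) ** t" "n ** y = t" using cnd by auto
 have "n ** (a ** t +. c ** y) = \<theta>" using rest E_ext_ZpA by simp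
 then obtain d v where d: "d : RR" "v : Img M s N0"
  "a ** t +. c ** y = d ** (n [^] (i - 1) ** t) +. v"
  using ny_kill[OF t c(2) abc(1,3)] by blast
 have "d ** (n [^] (i - 1) ** t) : Img M s N0" using sub_smult[OF I d(1) sI[OF G(2)]] c(1) by simp
 then have "a ** t +. c ** y : Img M s N0" unfolding d(3) using sub_add[OF I _ d(2)] by blast
 then show ?thesis unfolding m using sub_add[OF I bxI(1)] E_ext_ZpA by blast
 qed (use h in simp_all)
qed
qed

end

end

section \<open>Recovering the torsion entry from the position of the torsion\<close>

fun tor_index :: "entry => nat" where
"tor_index (E_cyc i) = i" | "tor_index (E_F i w) = i" | "tor_index (E_ext_Zp i) = i"
| "tor_index (E_ext_A i) = i" | "tor_index (E_ext_ZpA i) = i" | "tor_index _ = 0"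

fun tor_coeff :: "nat => entry => nat" where
"tor_coeff q (E_F i w) = F_coeff q i w" | "tor_coeff q _ = 0"

fun has_x :: "entry => bool" where
"has_x (E_ext_Zp i) = True" | "has_x (E_ext_ZpA i) = True" | "has_x _ = False"

fun has_y :: "entry => bool" where
"has_y (E_ext_A i) = True" | "has_y (E_ext_ZpA i) = True" | "has_y _ = False"

definition socle_in_Img ::
"('r, 'c) ring_scheme => ('r, 'm, 'd) module_scheme => 'r => 'r => 'm set => bool" where
"socle_in_Img R M s n N \<longleftrightarrow> (ALL z:Tors R M s n N. n \<odot>\<^bsub>M\<^esub> z = \<zero>\<^bsub>M\<^esub> --> z : Img M s N)"

text \<open>Invariants of the torsion of \<open>N\<close> and of its position in \<open>N\<close> that determine the torsion entry.\<close>

definition tor_type ::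
"('r, 'c) ring_scheme => ('r, 'm, 'd) module_scheme => 'r => 'r => nat => 'm set => entry => bool" where
"tor_type R M s n q N e \<longleftrightarrow> (\<exists>t. Tors R M s n N = cyc R M t &
 is_tor R M s n (tor_index e) (tor_coeff q e) t & (tor_coeff q e ~= 0 --> tor_index e >= 2) &
 (tor_coeff q e = 0 --> (socle_in_Img R M s n N \<longleftrightarrow> has_x e) &
  (Tors R M s n N <= Img M n N \<longleftrightarrow> has_y e)))"

lemma (in module) cyc_zero: "cyc R M \<zero>\<^bsub>M\<^esub> = {\<zero>\<^bsub>M\<^esub>}"
proof -
have "\<zero>\<^bsub>M\<^esub> : cyc R M \<zero>\<^bsub>M\<^esub>" by (rule cyc_self) simp
then show ?thesis by (auto simp: cyc_def)
qed

context nodal_char_module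
begin

lemma free_nonzero: "free_over R M a t x ==> x ~= \<theta>" if "a : RR" "t : MM"
proof
assume f: "free_over R M a t x" and x: "x = \<theta>"
have "a [^] (0::nat) ** x = \<zero> ** t" using that x by simp
then show False using f R.zero_closed unfolding free_over_def by blast
qed

context
fixes t x y e
assumes q1: "q > 1" and g: "t : MM" "x : MM" "y : MM"
 and cnd: "cond R M s n q t x y e" and wf: "in_list q e"
begin

abbreviation (input) "N1 \<equiv> gen3 R M t x y"

text \<open>Modulo torsion \<open>t\<close> disappears and \<open>n\<close> kills \<open>y\<close>,
  so only \<open>n x\<close> remains; starting from the multiples of \<open>n\<close> rather than
  from the whole module removes the contribution of \<open>y\<close>. If \<open>n x\<close> were in
  the smaller submodule, \<open>1 - n b\<close> would be a multiple of \<open>s\<close> for some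
  \<open>b\<close>, against \<open>proper\<close>.\<close>

lemma entry_hv:
"hv_entry e ==> simple_quot R M s n (ImgT R M s n n N1) (ImgT R M s n (n \<otimes> n) N1)"
"~ hv_entry e ==> ImgT R M s n n N1 <= ImgT R M s n (n \<otimes> n) N1"
proof -
have N: "submodule N1 R M" by (rule gen3_submodule[OF g])
note G = gen3_gens[OF g] and C = cyc_submodule[OF g(1)]
have nn: "n \<otimes> n : RR" by simp
have I: "submodule (ImgT R M s n (n \<otimes> n) N1) R M" by (rule ImgT_submodule[OF N nn])
let ?T = "Tors R M s n N1"
have TN: "submodule ?T R M" by (rule Tors_submodule[OF N])
have Tt: "?T = cyc R M t"
proof (cases "e = E_reg")
 case True
 then have "t = \<theta>" using cnd by simp
 then show ?thesis using Tors_reg[of q t x y] cnd True by (simp add: cyc_zero)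
qed (rule Tors_tri[OF cond_tri[OF g cnd]])
have TI: "z : ImgT R M s n (n \<otimes> n) N1" if z: "z : ?T" for z
proof -
 have "z = (n \<otimes> n) ** \<theta> +. z" using sub_carrier[OF TN z] by simp
 then show ?thesis unfolding ImgT_def using sub_zero[OF N] z by blast
qed
have ny: "n ** y : cyc R M t"
 using cond_tri[OF g cnd] cnd sub_zero[OF C] by (cases "e = E_reg") (auto simp: tri_def)
have part: "n ** (a ** t +. b ** x +. c ** y) =
 b ** (n ** x) +. ((n \<otimes> a) ** t +. c ** (n ** y))"
 "(n \<otimes> a) ** t +. c ** (n ** y) : ?T"
 if "a : RR" "b : RR" "c : RR" for a b c
proof -
 show "n ** (a ** t +. b ** x +. c ** y) =
 b ** (n ** x) +. ((n \<otimes> a) ** t +. c ** (n ** y))"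
 using that g by (simp add: smult_r_distr smult_assoc1 smult_comm[of n b] smult_comm[of n c] M.add.m_ac)
 show "(n \<otimes> a) ** t +. c ** (n ** y) : ?T"
 unfolding Tt using that by (intro sub_add[OF C] cycI sub_smult[OF C _ ny]) auto
qed
have K_elem: "\<exists>a b c \<tau>. a : RR & b : RR & c : RR & \<tau> : ?T &
 m = n ** (a ** t +. b ** x +. c ** y) +. \<tau>"
 if "m : ImgT R M s n n N1" for m
 using that unfolding ImgT_def gen3_def by blast
show "ImgT R M s n n N1 <= ImgT R M s n (n \<otimes> n) N1" if h: "~ hv_entry e"
proof
 fix m assume "m : ImgT R M s n n N1"
 then obtain a b c \<tau> where m: "a : RR" "b : RR" "c : RR" "\<tau> : ?T"
 "m = n ** (a ** t +. b ** x +. c ** y) +. \<tau>" using K_elem by blast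
 have "x = \<theta>" using h cnd by (cases e) auto
 then have "b ** (n ** x) = \<theta>" using m by simp
 then have "n ** (a ** t +. b ** x +. c ** y) : ?T"
 using part[OF m(1-3)] sub_carrier[OF TN part(2)[OF m(1-3)]] by simp
 then show "m : ImgT R M s n (n \<otimes> n) N1" unfolding m(5) using TI sub_add[OF TN _ m(4)] by blast
qed
show "simple_quot R M s n (ImgT R M s n n N1) (ImgT R M s n (n \<otimes> n) N1)" if h: "hv_entry e"
 unfolding simple_quot_def
proof (intro bexI[of _ "n ** x"] conjI ballI)
 have "n ** x = n ** x +. \<theta>" using g by simp
 then show "n ** x : ImgT R M s n n N1" unfolding ImgT_def using G(2) sub_zero[OF TN] by blast
 show "s ** (n ** x) : ImgT R M s n (n \<otimes> n) N1" using g TI sub_zero[OF TN] by simp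
 have "n ** (n ** x) = (n \<otimes> n) ** x +. \<theta>" using g by (simp add: smult_assoc1)
 then show "n ** (n ** x) : ImgT R M s n (n \<otimes> n) N1"
 unfolding ImgT_def using G(2) sub_zero[OF TN] by blast
 show "n ** x ~: ImgT R M s n (n \<otimes> n) N1"
 proof
 assume "n ** x : ImgT R M s n (n \<otimes> n) N1"
 then obtain a b c \<tau> where m: "a : RR" "b : RR" "c : RR" "\<tau> : ?T"
  "n ** x = (n \<otimes> n) ** (a ** t +. b ** x +. c ** y) +. \<tau>"
  unfolding ImgT_def gen3_def by blast
 have \<tau>M: "\<tau> : MM" using m sub_carrier[OF TN] by blast
 let ?w = "a ** t +. b ** x +. c ** y"
 \<comment> \<open>This is \<open>x\<close> minus \<open>n\<close> times the combination
   \<open>?w\<close>; by the assumption, \<open>n\<close> sends it to the torsion element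
   \<open>\<tau>\<close>.\<close>
 let ?v = "(\<ominus> (n \<otimes> a)) ** t +. (\<one> \<ominus> n \<otimes> b) ** x +. (\<ominus> (n \<otimes> c)) ** y"
 have wM: "?w : MM" using m g by simp
 have v: "?v = x +. -. (n ** ?w)"
  using m(1-3) g by (simp add: smult_l_distr smult_r_distr smult_l_minus smult_assoc1 R.minus_eq M.minus_add M.add.m_ac)
 have "n ** ?v = n ** x +. -. ((n \<otimes> n) ** ?w)"
  unfolding v using wM g by (simp only: smult_r_distr smult_r_minus smult_assoc1 n_closed smult_closed M.a_inv_closed)
 also have "\<dots> = \<tau>"
 proof -
  have "(z +. \<tau>) +. -. z = \<tau>" if "z : MM" for z
  using that \<tau>M by (simp add: M.a_comm[of z \<tau>] M.a_assoc M.r_neg)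
  then show ?thesis unfolding m(5) using smult_closed[OF nn wM] by blast
 qed
 finally have nv: "n ** ?v = \<tau>" .
 have "EX b':RR. \<one> \<ominus> n \<otimes> b = s \<otimes> b'"
 proof (cases "e = E_reg")
  case True
  then have ty: "t = \<theta>" "y = \<theta>" using cnd by auto
  have "\<tau> = \<theta>" using m(4) Tt ty by (auto simp: cyc_def)
  then have "(n \<otimes> (\<one> \<ominus> n \<otimes> b)) ** x = \<theta>" using nv ty m(1-3) g by (simp add: smult_assoc1)
  then have "n \<otimes> (\<one> \<ominus> n \<otimes> b) = \<zero>" using reg_zero[of q t x y "n \<otimes> (\<one> \<ominus> n \<otimes> b)"] cnd True m by simp
  then show ?thesis using ann_n m by simp
 next
  case False
  have "x ~= \<theta>" using h cnd g False free_nonzero[OF n_closed] by (cases e) auto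
  moreover have "n [^] Suc 0 ** ?v : cyc R M t" using nv m(4) Tt by simp
  ultimately show ?thesis
  using tri_coeff_x[OF cond_tri[OF g cnd False], of "\<ominus> (n \<otimes> a)" "\<one> \<ominus> n \<otimes> b" "\<ominus> (n \<otimes> c)" 0] m(1-3)
  by simp
 qed
 then obtain b' where b': "b' : RR" "\<one> \<ominus> n \<otimes> b = s \<otimes> b'" by blast
 then have "s \<otimes> b' \<oplus> n \<otimes> b = \<one>" using m(2) b'(2)[symmetric] by (simp add: R.minus_eq R.a_assoc R.l_neg)
 then show False using proper[OF b'(1) m(2)] by simp
 qed
 fix m assume "m : ImgT R M s n n N1"
 then obtain a b c \<tau> where m: "a : RR" "b : RR" "c : RR" "\<tau> : ?T"
 "m = n ** (a ** t +. b ** x +. c ** y) +. \<tau>" using K_elem by blast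
 let ?p = "(n \<otimes> a) ** t +. c ** (n ** y)"
 have p: "?p +. \<tau> : ?T" by (rule sub_add[OF TN part(2)[OF m(1-3)] m(4)])
 have "m = b ** (n ** x) +. (?p +. \<tau>)"
 unfolding m(5) part(1)[OF m(1-3)]
 using m(2) g sub_carrier[OF TN part(2)[OF m(1-3)]] sub_carrier[OF TN m(4)] by (intro M.a_assoc) auto
 then show "EX a:RR. EX z:ImgT R M s n (n \<otimes> n) N1. m = a ** (n ** x) +. z"
 using TI[OF p] m(2) by blast
qed
qed

lemma entry_no_torsion: "~ tor_entry e ==> Tors R M s n N1 = {\<theta>}"
proof -
assume h: "~ tor_entry e"
show ?thesis
proof (cases "e = E_reg")
 case True
 then show ?thesis using Tors_reg[of q t x y] cnd by simp
next
 case False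
 then have "t = \<theta>" using h cnd by (cases e) auto
 then show ?thesis using Tors_tri[OF cond_tri[OF g cnd False]] by (simp add: cyc_zero)
qed
qed

lemma entry_is_tor:
assumes h: "tor_entry e"
shows "is_tor R M s n (tor_index e) (tor_coeff q e) t" "Tors R M s n N1 = cyc R M t"
 "tor_coeff q e ~= 0 ==> tor_index e >= 2"
proof -
have "e ~= E_reg" using h by auto
then show "Tors R M s n N1 = cyc R M t" using Tors_tri[OF cond_tri[OF g cnd]] by blast
show "is_tor R M s n (tor_index e) (tor_coeff q e) t" using h cnd by (cases e) auto
show "tor_coeff q e ~= 0 ==> tor_index e >= 2" using h cnd by (cases e) auto
qed

text \<open>An attached \<open>x\<close> gives \<open>s x = n^(i-1) t\<close>, and an attached
  \<open>y\<close> gives \<open>n y = t\<close>. Conversely, \<open>socle_notin_sN\<close> and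
  \<open>t_notin_nN\<close> exclude the inclusions when these generators are absent.\<close>

lemma entry_tor_type:
assumes h: "tor_entry e"
shows "tor_type R M s n q N1 e"
proof -
note T = entry_is_tor[OF h]
have N: "submodule N1 R M" by (rule gen3_submodule[OF g])
note G = gen3_gens[OF g]
have IS: "submodule (Img M s N1) R M" "submodule (Img M n N1) R M" by (rule Img_submodule[OF N], simp)+
have ne: "e ~= E_reg" using h by auto
note tri = cond_tri[OF g cnd ne]
have 1: "socle_in_Img R M s n N1 \<longleftrightarrow> has_x e" if c0: "tor_coeff q e = 0"
proof -
 let ?i = "tor_index e"
 have t: "is_tor R M s n ?i 0 t" using T(1) c0 by simp
 let ?z = "n [^] (?i - 1) ** t"
 have z: "?z : Tors R M s n N1" unfolding T(2) by (rule cycI) simp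
 have i: "?i >= 1" using t by (simp add: is_tor_def)
 have "n ** ?z = n [^] Suc (?i - 1) ** t" using g by (simp add: smult_assoc1 smult_comm)
 then have nz: "n ** ?z = \<theta>" using t i by (simp add: is_tor_def del: R.nat_pow_Suc)
 show ?thesis
 proof
 assume "has_x e"
 then have sx: "s ** x = ?z" using cnd by (cases e) auto
 show "socle_in_Img R M s n N1" unfolding socle_in_Img_def
 proof (intro ballI impI)
  fix w assume w: "w : Tors R M s n N1" "n ** w = \<theta>"
  then obtain a where a: "a : RR" "w = a ** t" unfolding T(2) by (auto simp: cyc_def)
  obtain v where v: "v : RR" "w = v ** ?z"
  using tor_n_kill_cases[OF q1 g cnd wf t _ a(1)] a w by auto
  show "w : Img M s N1" unfolding v(2) sx[symmetric]
  by (rule sub_smult[OF IS(1) v(1)]) (rule ImgI[OF G(2) refl])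
 qed
 next
 assume "socle_in_Img R M s n N1"
 then have zI: "?z : Img M s N1" using z nz by (simp add: socle_in_Img_def)
 show "has_x e"
 proof (rule ccontr)
  assume "~ has_x e"
  then have "x = \<theta>" using h cnd by (cases e) auto
  then show False using socle_notin_sN[OF tri _ t] zI by simp
 qed
 qed
qed
have 2: "Tors R M s n N1 <= Img M n N1 \<longleftrightarrow> has_y e"
proof
 assume "has_y e"
 then have ny: "n ** y = t" using cnd by (cases e) auto
 have "t : Img M n N1" by (rule ImgI[OF G(3)]) (simp add: ny)
 then show "Tors R M s n N1 <= Img M n N1" unfolding T(2) cyc_def using sub_smult[OF IS(2)] by blast
next
 assume a: "Tors R M s n N1 <= Img M n N1"
 show "has_y e"
 proof (rule ccontr)
 assume "~ has_y e"
 then have "y = \<theta>" using h cnd by (cases e) auto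
 moreover have "t : Img M n N1" using a cyc_self[OF g(1)] unfolding T(2) by blast
 ultimately show False using t_notin_nN[OF tri] tor_nonzero[OF T(1)] by simp
 qed
qed
show ?thesis unfolding tor_type_def by (intro exI[of _ t] conjI impI T 1 2)
qed

end

text \<open>The length is the nilpotency exponent of \<open>n\<close> on the torsion. The
  coefficient does not depend on the generator either: \<open>s t'\<close> is the same multiple of
  \<open>n^(i-1) t'\<close> for each of them. If it is zero, the two inclusions decide between four
  entries; if not, it gives back the parameter of F_i.\<close>

lemma tor_type_unique:
assumes q1: "q > 1" and e: "tor_type R M s n q N e" "tor_entry e" "in_list q e"
 and e': "tor_type R M s n q N e'" "tor_entry e'" "in_list q e'"
shows "e = e'"
proof -
obtain t where t: "Tors R M s n N = cyc R M t" "is_tor R M s n (tor_index e) (tor_coeff q e) t"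
 "tor_coeff q e ~= 0 --> tor_index e >= 2" using e(1) unfolding tor_type_def by blast
obtain t' where t': "Tors R M s n N = cyc R M t'" "is_tor R M s n (tor_index e') (tor_coeff q e') t'"
 "tor_coeff q e' ~= 0 --> tor_index e' >= 2" using e'(1) unfolding tor_type_def by blast
have tM: "t : MM" "t' : MM" using t t' by (auto simp: is_tor_def)
\<comment> \<open>A power of \<open>n\<close> that kills \<open>v\<close> kills its multiple
  \<open>u\<close>; used in both directions this makes the lengths equal.\<close>
have idx: "j >= i" if "is_tor R M s n i c u" "is_tor R M s n j d v" and uv: "u : cyc R M v" for i c u j d v
proof (rule ccontr)
 assume "~ j >= i"
 obtain a where a: "a : RR" "u = a ** v" using uv by (auto simp: cyc_def)
 have vM: "v : MM" using that(2) by (simp add: is_tor_def)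
 have "n [^] (i - 1) ** v = \<theta>"
 using n_pow_smult_zero[OF vM, of j "i - 1"] that(2) \<open>~ j >= i\<close> by (auto simp: is_tor_def)
 then have "n [^] (i - 1) ** u = \<theta>" using a vM by (simp add: smult_comm[of _ a])
 then show False using that(1) by (simp add: is_tor_def)
qed
have eq: "tor_index e = tor_index e'"
 using idx[OF t(2) t'(2)] idx[OF t'(2) t(2)] t(1) t'(1) cyc_self tM by fastforce
define i where "i = tor_index e"
have coeff_less: "tor_coeff q f < q" if "in_list q f" for f
 using that q1 F_coeff(2)[OF q1] by (cases f) auto
have ceq: "tor_coeff q e = tor_coeff q e'"
proof -
 obtain a where a: "a : RR" "t' = a ** t" using t(1) t'(1) cyc_self[OF tM(2)] by (auto simp: cyc_def)
 let ?z = "n [^] (i - 1) ** t'"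
 have zM: "?z : MM" using tM by simp
 have s1: "s ** t' = ([tor_coeff q e'] \<cdot>\<^bsub>R\<^esub> \<one>) ** ?z"
 using t'(2) eq tM by (simp add: is_tor_def i_def smult_assoc1)
 have "s ** t' = a ** (([tor_coeff q e] \<cdot>\<^bsub>R\<^esub> \<one> \<otimes> n [^] (i - 1)) ** t)"
 using t(2) a tM by (simp add: is_tor_def i_def smult_comm[of s a])
 also have "\<dots> = ([tor_coeff q e] \<cdot>\<^bsub>R\<^esub> \<one>) ** ?z"
 using a tM by (simp add: smult_assoc1 smult_comm[of a])
 finally have s2: "s ** t' = ([tor_coeff q e] \<cdot>\<^bsub>R\<^esub> \<one>) ** ?z" .
 \<comment> \<open>With the zero submodule for \<open>I\<close>, \<open>simple_quot_inj\<close> says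
   that distinct residues act differently on the nonzero element \<open>?z\<close>.\<close>
 have Z: "submodule {\<theta>} R M" by (rule submoduleI) auto
 have "?z ~: {\<theta>}" using t'(2) eq by (simp add: is_tor_def i_def)
 moreover have "([tor_coeff q e] \<cdot>\<^bsub>R\<^esub> \<one>) ** ?z -. ([tor_coeff q e'] \<cdot>\<^bsub>R\<^esub> \<one>) ** ?z : {\<theta>}"
 using s1 s2 zM by (simp add: M.diff_zero_iff)
 ultimately show ?thesis using simple_quot_inj[OF Z zM _ coeff_less[OF e(3)] coeff_less[OF e'(3)]] by blast
qed
have F: False if "F_coeff q j w = 0" "2 <= j" "admissible_unit q j w" for j w
 using F_coeff(1)[OF q1, of j w] that by simp
show ?thesis
proof (cases "tor_coeff q e = 0")
 case True
 then have "has_x e = has_x e'" "has_y e = has_y e'"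
 using e(1) e'(1) ceq by (auto simp: tor_type_def)
 then show ?thesis using True ceq eq e(2,3) e'(2,3) by (cases e; cases e') (auto dest: F)
next
 case False
 then obtain w w' where w: "e = E_F i w" "e' = E_F i w'"
 using ceq eq by (cases e; cases e') (auto simp: i_def)
 then have "w = w'" using F_coeff(3)[OF q1, of i w] F_coeff(3)[OF q1, of i w'] e(3) e'(3) ceq by simp
 then show ?thesis using w by simp
qed
qed

end

section \<open>Additivity of the invariants over direct sums\<close>

lemma card_image_same_fibres:
assumes "!!x y. [|x : K; y : K|] ==> g x = g y \<longleftrightarrow> h x = h y"
shows "card (g ` K) = card (h ` K)"
proof -
let ?\<phi> = "%c. h (inv_into K g c)"
have \<phi>: "?\<phi> (g x) = h x" if "x : K" for x
 using assms[of "inv_into K g (g x)" x] that by (simp add: f_inv_into_f inv_into_into)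
have "bij_betw ?\<phi> (g ` K) (h ` K)"
 unfolding bij_betw_def
proof
 show "inj_on ?\<phi> (g ` K)"
 proof (rule inj_onI)
 fix c d assume "c : g ` K" "d : g ` K" "?\<phi> c = ?\<phi> d"
 then obtain x y where xy: "x : K" "c = g x" "y : K" "d = g y" by blast
 then have "h x = h y" using \<open>?\<phi> c = ?\<phi> d\<close> \<phi> by metis
 then show "c = d" using xy assms by blast
 qed
 show "?\<phi> ` g ` K = h ` K" using \<phi> by (simp add: image_image cong: image_cong)
qed
then show ?thesis by (rule bij_betw_same_card)
qed

lemma prod_filter_power:
"(\<Prod>j<length es. if P (es ! j) then q else (1::nat)) = q ^ length (filter P es)"
proof (induction es)
case (Cons e es)
show ?case using Cons by (simp add: prod.lessThan_Suc_shift del: prod.lessThan_Suc)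
qed simp

context module
begin

text \<open>Membership in the submodule attached to \<open>M\<close> is decided componentwise.
  Kernels, images, torsion and \<open>ImgT\<close> are all of this kind, so one counting argument
  serves every pair of them.\<close>

definition additive_in :: "'c set list => ('c set => 'c set) => bool" where
"additive_in Ns F \<longleftrightarrow> (\<forall>f. (\<forall>j<length Ns. f j : Ns ! j) -->
 ((\<Oplus>\<^bsub>M\<^esub>j\<in>{..<length Ns}. f j) : F (carrier M) \<longleftrightarrow> (\<forall>j<length Ns. f j : F (Ns ! j))))"

lemma additive_inD:
assumes "additive_in Ns F" "!!j. j < length Ns ==> f j : Ns ! j"
shows "(\<Oplus>\<^bsub>M\<^esub>j\<in>{..<length Ns}. f j) : F (carrier M) \<longleftrightarrow> (\<forall>j<length Ns. f j : F (Ns ! j))"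
using assms unfolding additive_in_def by simp

context
fixes Ns assumes ds: "direct_sum R M Ns"
begin

lemma ds_sub: "j < length Ns ==> submodule (Ns ! j) R M"
using ds by (simp add: direct_sum_def)

lemma ds_carrier: "[|j < length Ns; x : Ns ! j|] ==> x : carrier M"
using submoduleE(1)[OF ds_sub] by blast

lemma ds_zero: "j < length Ns ==> \<zero>\<^bsub>M\<^esub> : Ns ! j"
using subgroup.one_closed[OF submodule.axioms(1)[OF ds_sub]] by fastforce

lemma ds_ex: "x : carrier M ==> \<exists>f. (\<forall>j<length Ns. f j : Ns ! j) & x = (\<Oplus>\<^bsub>M\<^esub>j\<in>{..<length Ns}. f j)"
using ds unfolding direct_sum_def PiE_def Pi_def by (metis (no_types, lifting) IntD1 lessThan_iff mem_Collect_eq)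

lemma ds_uniq:
assumes f: "!!j. j < length Ns ==> f j : Ns ! j" and g: "!!j. j < length Ns ==> g j : Ns ! j"
 and e: "(\<Oplus>\<^bsub>M\<^esub>j\<in>{..<length Ns}. f j) = (\<Oplus>\<^bsub>M\<^esub>j\<in>{..<length Ns}. g j)" and j: "j < length Ns"
shows "f j = g j"
proof -
let ?n = "length Ns"
have r: "restrict h {..<?n} : (\<Pi>\<^sub>E j\<in>{..<?n}. Ns ! j)"
 "(\<Oplus>\<^bsub>M\<^esub>j\<in>{..<?n}. restrict h {..<?n} j) = (\<Oplus>\<^bsub>M\<^esub>j\<in>{..<?n}. h j)"
 if "!!j. j < ?n ==> h j : Ns ! j" for h
proof -
 show "restrict h {..<?n} : (\<Pi>\<^sub>E j\<in>{..<?n}. Ns ! j)" using that by auto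
 show "(\<Oplus>\<^bsub>M\<^esub>j\<in>{..<?n}. restrict h {..<?n} j) = (\<Oplus>\<^bsub>M\<^esub>j\<in>{..<?n}. h j)"
 using that ds_carrier by (intro M.finsum_cong') auto
qed
have "(\<Oplus>\<^bsub>M\<^esub>j\<in>{..<?n}. f j) : carrier M" using f ds_carrier by (intro M.finsum_closed) auto
then have "restrict f {..<?n} = restrict g {..<?n}"
 using ds r[OF f] r[OF g] e unfolding direct_sum_def by metis
then show ?thesis using j by (metis lessThan_iff restrict_apply)
qed

lemma finsum_single_comp:
assumes j: "j < length Ns" and z: "z : carrier M" and f: "!!l. [|l < length Ns; l ~= j|] ==> f l = \<zero>\<^bsub>M\<^esub>" "f j = z"
shows "(\<Oplus>\<^bsub>M\<^esub>l\<in>{..<length Ns}. f l) = z"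
proof -
have "(\<Oplus>\<^bsub>M\<^esub>l\<in>{..<length Ns}. f l) = (\<Oplus>\<^bsub>M\<^esub>l\<in>{..<length Ns}. if j = l then z else \<zero>\<^bsub>M\<^esub>)"
 using f z by (intro M.finsum_cong') auto
also have "\<dots> = z" using M.finsum_singleton[of j "{..<length Ns}" "%_. z"] j z by simp
finally show ?thesis .
qed

lemma ds_smult:
assumes "a : carrier R" "!!j. j < length Ns ==> f j : Ns ! j"
shows "a \<odot>\<^bsub>M\<^esub> (\<Oplus>\<^bsub>M\<^esub>j\<in>{..<length Ns}. f j) = (\<Oplus>\<^bsub>M\<^esub>j\<in>{..<length Ns}. a \<odot>\<^bsub>M\<^esub> f j)"
using assms ds_carrier by (intro finsum_smult_ldistr) auto

lemma ds_smult_mem: "[|a : carrier R; j < length Ns; x : Ns ! j|] ==> a \<odot>\<^bsub>M\<^esub> x : Ns ! j"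
using submoduleE(4)[OF ds_sub] by blast

lemma ds_add_mem: "[|j < length Ns; x : Ns ! j; y : Ns ! j|] ==> x \<oplus>\<^bsub>M\<^esub> y : Ns ! j"
using submoduleE(5)[OF ds_sub] by blast

lemma ds_smult_zero_iff:
assumes a: "a : carrier R" and f: "!!j. j < length Ns ==> f j : Ns ! j"
shows "a \<odot>\<^bsub>M\<^esub> (\<Oplus>\<^bsub>M\<^esub>j\<in>{..<length Ns}. f j) = \<zero>\<^bsub>M\<^esub> \<longleftrightarrow> (\<forall>j<length Ns. a \<odot>\<^bsub>M\<^esub> f j = \<zero>\<^bsub>M\<^esub>)"
proof
assume "a \<odot>\<^bsub>M\<^esub> (\<Oplus>\<^bsub>M\<^esub>j\<in>{..<length Ns}. f j) = \<zero>\<^bsub>M\<^esub>"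
then have "(\<Oplus>\<^bsub>M\<^esub>j\<in>{..<length Ns}. a \<odot>\<^bsub>M\<^esub> f j) = \<zero>\<^bsub>M\<^esub>" using ds_smult[OF a f] by simp
then show "\<forall>j<length Ns. a \<odot>\<^bsub>M\<^esub> f j = \<zero>\<^bsub>M\<^esub>"
 using direct_sum_zeroI[OF ds, of "%j. a \<odot>\<^bsub>M\<^esub> f j"] ds_smult_mem[OF a] f by blast
next
assume "\<forall>j<length Ns. a \<odot>\<^bsub>M\<^esub> f j = \<zero>\<^bsub>M\<^esub>"
then have "(\<Oplus>\<^bsub>M\<^esub>j\<in>{..<length Ns}. a \<odot>\<^bsub>M\<^esub> f j) = \<zero>\<^bsub>M\<^esub>" by (intro M.add.finprod_one_eqI) auto
then show "a \<odot>\<^bsub>M\<^esub> (\<Oplus>\<^bsub>M\<^esub>j\<in>{..<length Ns}. f j) = \<zero>\<^bsub>M\<^esub>" using ds_smult[OF a f] by simp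
qed

lemma finsum_mem_carrier: "(!!j. j < length Ns ==> f j : Ns ! j) ==> (\<Oplus>\<^bsub>M\<^esub>j\<in>{..<length Ns}. f j) : carrier M"
using ds_carrier by (intro M.finsum_closed) auto

lemma additive_Ker: "a : carrier R ==> additive_in Ns (Ker M a)"
unfolding additive_in_def Ker_def using ds_smult_zero_iff finsum_mem_carrier by auto

lemma additive_Img:
assumes a: "a : carrier R"
shows "additive_in Ns (Img M a)"
unfolding additive_in_def
proof (intro allI impI)
fix f assume f': "\<forall>j<length Ns. f j : Ns ! j"
then have f: "!!j. j < length Ns ==> f j : Ns ! j" by blast
show "((\<Oplus>\<^bsub>M\<^esub>j\<in>{..<length Ns}. f j) : Img M a (carrier M)) = (\<forall>j<length Ns. f j : Img M a (Ns ! j))"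
proof
 assume "(\<Oplus>\<^bsub>M\<^esub>j\<in>{..<length Ns}. f j) : Img M a (carrier M)"
 then obtain x where x: "x : carrier M" "(\<Oplus>\<^bsub>M\<^esub>j\<in>{..<length Ns}. f j) = a \<odot>\<^bsub>M\<^esub> x" by (auto simp: Img_def)
 obtain g where g: "!!j. j < length Ns ==> g j : Ns ! j" "x = (\<Oplus>\<^bsub>M\<^esub>j\<in>{..<length Ns}. g j)"
 using ds_ex[OF x(1)] by blast
 have e: "(\<Oplus>\<^bsub>M\<^esub>j\<in>{..<length Ns}. f j) = (\<Oplus>\<^bsub>M\<^esub>j\<in>{..<length Ns}. a \<odot>\<^bsub>M\<^esub> g j)"
 unfolding x(2) g(2) by (rule ds_smult[OF a g(1)])
 have "f j = a \<odot>\<^bsub>M\<^esub> g j" if "j < length Ns" for j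
 using ds_uniq[OF f ds_smult_mem[OF a _ g(1)] e that] .
 then show "\<forall>j<length Ns. f j : Img M a (Ns ! j)" using g(1) unfolding Img_def by blast
next
 assume "\<forall>j<length Ns. f j : Img M a (Ns ! j)"
 then have "\<exists>x. j < length Ns --> x : Ns ! j & f j = a \<odot>\<^bsub>M\<^esub> x" for j unfolding Img_def by blast
 then obtain g where g: "!!j. j < length Ns ==> g j : Ns ! j" "!!j. j < length Ns ==> f j = a \<odot>\<^bsub>M\<^esub> g j" by metis
 have "(\<Oplus>\<^bsub>M\<^esub>j\<in>{..<length Ns}. f j) = (\<Oplus>\<^bsub>M\<^esub>j\<in>{..<length Ns}. a \<odot>\<^bsub>M\<^esub> g j)"
 using g ds_carrier f a by (intro M.finsum_cong') auto
 then have "(\<Oplus>\<^bsub>M\<^esub>j\<in>{..<length Ns}. f j) = a \<odot>\<^bsub>M\<^esub> (\<Oplus>\<^bsub>M\<^esub>j\<in>{..<length Ns}. g j)"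
 using ds_smult[OF a g(1)] by simp
 then show "(\<Oplus>\<^bsub>M\<^esub>j\<in>{..<length Ns}. f j) : Img M a (carrier M)"
 unfolding Img_def using finsum_mem_carrier[OF g(1)] by blast
qed
qed

text \<open>Apply additivity to the family that is \<open>z\<close> at \<open>j\<close> and zero
  elsewhere. It transfers the position of the torsion from the summand that contains it to the whole
  module.\<close>

lemma Img_component:
assumes a: "a : carrier R" and j: "j < length Ns" and z: "z : Ns ! j"
shows "z : Img M a (carrier M) \<longleftrightarrow> z : Img M a (Ns ! j)"
proof -
let ?f = "%l. if l = j then z else \<zero>\<^bsub>M\<^esub>"
have f: "\<forall>l<length Ns. ?f l : Ns ! l" using z ds_zero by auto
have s: "(\<Oplus>\<^bsub>M\<^esub>l\<in>{..<length Ns}. ?f l) = z" using j z ds_carrier by (intro finsum_single_comp) auto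
have "\<zero>\<^bsub>M\<^esub> : Img M a (Ns ! l)" if "l < length Ns" for l
 unfolding Img_def using ds_zero[OF that] a by force
then have "(\<forall>l<length Ns. ?f l : Img M a (Ns ! l)) \<longleftrightarrow> z : Img M a (Ns ! j)" using j by auto
moreover have "(\<Oplus>\<^bsub>M\<^esub>l\<in>{..<length Ns}. ?f l) : Img M a (carrier M) \<longleftrightarrow>
 (\<forall>l<length Ns. ?f l : Img M a (Ns ! l))"
 by (rule additive_inD[OF additive_Img[OF a]]) (use f in blast)
ultimately show ?thesis using s by simp
qed

end

end

context nodal_module
begin

context
fixes Ns assumes ds: "direct_sum R M Ns"
begin

lemma additive_Tors: "additive_in Ns (Tors R M s n)"
unfolding additive_in_def
proof (intro allI impI)
fix f assume f': "\<forall>j<length Ns. f j : Ns ! j"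
then have f: "!!j. j < length Ns ==> f j : Ns ! j" by blast
have fM: "!!j. j < length Ns ==> f j : MM" using f ds_carrier[OF ds] by blast
show "((\<Oplus>\<^bsub>M\<^esub>j\<in>{..<length Ns}. f j) : Tors R M s n (MM)) =
 (\<forall>j<length Ns. f j : Tors R M s n (Ns ! j))"
proof
 assume "(\<Oplus>\<^bsub>M\<^esub>j\<in>{..<length Ns}. f j) : Tors R M s n (MM)"
 then obtain k where "n [^] (k::nat) ** (\<Oplus>\<^bsub>M\<^esub>j\<in>{..<length Ns}. f j) = \<theta>"
 "s [^] k ** (\<Oplus>\<^bsub>M\<^esub>j\<in>{..<length Ns}. f j) = \<theta>" by (auto simp: Tors_def)
 then have "\<forall>j<length Ns. n [^] k ** f j = \<theta>" "\<forall>j<length Ns. s [^] k ** f j = \<theta>"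
 using ds_smult_zero_iff[OF ds _ f, of "n [^] k"] ds_smult_zero_iff[OF ds _ f, of "s [^] k"] by auto
 then show "\<forall>j<length Ns. f j : Tors R M s n (Ns ! j)" using f unfolding Tors_def by blast
next
 assume "\<forall>j<length Ns. f j : Tors R M s n (Ns ! j)"
 then have "\<exists>k::nat. j < length Ns --> n [^] k ** f j = \<theta> & s [^] k ** f j = \<theta>" for j
 unfolding Tors_def by blast
 then obtain k where k: "!!j. j < length Ns ==> n [^] (k j::nat) ** f j = \<theta>"
 "!!j. j < length Ns ==> s [^] (k j) ** f j = \<theta>" by metis
 define K where "K = (\<Sum>j<length Ns. k j)"
 have "k j <= K" if "j < length Ns" for j unfolding K_def using that by (intro member_le_sum) auto
 then have "n [^] K ** f j = \<theta>" "s [^] K ** f j = \<theta>" if "j < length Ns" for j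
 using n_pow_smult_zero[OF fM k(1)] s_pow_smult_zero[OF fM k(2)] that by blast+
 then have "n [^] K ** (\<Oplus>\<^bsub>M\<^esub>j\<in>{..<length Ns}. f j) = \<theta>"
 "s [^] K ** (\<Oplus>\<^bsub>M\<^esub>j\<in>{..<length Ns}. f j) = \<theta>"
 using ds_smult_zero_iff[OF ds _ f, of "n [^] K"] ds_smult_zero_iff[OF ds _ f, of "s [^] K"] by auto
 then show "(\<Oplus>\<^bsub>M\<^esub>j\<in>{..<length Ns}. f j) : Tors R M s n (MM)"
 unfolding Tors_def using finsum_mem_carrier[OF ds f] by blast
qed
qed

lemma additive_ImgT:
assumes a: "a : RR"
shows "additive_in Ns (ImgT R M s n a)"
unfolding additive_in_def
proof (intro allI impI)
fix f assume f': "\<forall>j<length Ns. f j : Ns ! j"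
then have f: "!!j. j < length Ns ==> f j : Ns ! j" by blast
note cM = ds_carrier[OF ds]
have sum: "a ** (\<Oplus>\<^bsub>M\<^esub>j\<in>{..<length Ns}. g j) +. (\<Oplus>\<^bsub>M\<^esub>j\<in>{..<length Ns}. h j)
 = (\<Oplus>\<^bsub>M\<^esub>j\<in>{..<length Ns}. a ** g j +. h j)"
 if g: "!!j. j < length Ns ==> g j : Ns ! j" and h: "!!j. j < length Ns ==> h j : Ns ! j" for g h
proof -
 have "(\<Oplus>\<^bsub>M\<^esub>j\<in>{..<length Ns}. a ** g j +. h j) =
 (\<Oplus>\<^bsub>M\<^esub>j\<in>{..<length Ns}. a ** g j) +. (\<Oplus>\<^bsub>M\<^esub>j\<in>{..<length Ns}. h j)"
 using g h cM a by (intro M.finsum_addf) auto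
 then show ?thesis using ds_smult[OF ds a g] by simp
qed
show "((\<Oplus>\<^bsub>M\<^esub>j\<in>{..<length Ns}. f j) : ImgT R M s n a (MM)) =
 (\<forall>j<length Ns. f j : ImgT R M s n a (Ns ! j))"
proof
 assume "(\<Oplus>\<^bsub>M\<^esub>j\<in>{..<length Ns}. f j) : ImgT R M s n a (MM)"
 then obtain x \<tau> where x: "x : MM" "\<tau> : Tors R M s n (MM)"
 "(\<Oplus>\<^bsub>M\<^esub>j\<in>{..<length Ns}. f j) = a ** x +. \<tau>" unfolding ImgT_def by blast
 obtain g where g: "!!j. j < length Ns ==> g j : Ns ! j" "x = (\<Oplus>\<^bsub>M\<^esub>j\<in>{..<length Ns}. g j)"
 using ds_ex[OF ds x(1)] by blast
 have \<tau>M: "\<tau> : MM" using x(2) by (simp add: Tors_def)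
 obtain h where h: "!!j. j < length Ns ==> h j : Ns ! j" "\<tau> = (\<Oplus>\<^bsub>M\<^esub>j\<in>{..<length Ns}. h j)"
 using ds_ex[OF ds \<tau>M] by blast
 have hT: "!!j. j < length Ns ==> h j : Tors R M s n (Ns ! j)"
 using additive_inD[OF additive_Tors h(1)] x(2) h(2) by blast
 have e: "(\<Oplus>\<^bsub>M\<^esub>j\<in>{..<length Ns}. f j) = (\<Oplus>\<^bsub>M\<^esub>j\<in>{..<length Ns}. a ** g j +. h j)"
 unfolding x(3) g(2) h(2) by (rule sum[OF g(1) h(1)])
 have "f j = a ** g j +. h j" if "j < length Ns" for j
 using ds_uniq[OF ds f ds_add_mem[OF ds _ ds_smult_mem[OF ds a _ g(1)] h(1)] e that] .
 then show "\<forall>j<length Ns. f j : ImgT R M s n a (Ns ! j)" using g(1) hT unfolding ImgT_def by blast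
next
 assume "\<forall>j<length Ns. f j : ImgT R M s n a (Ns ! j)"
 then have "\<exists>x \<tau>. j < length Ns --> x : Ns ! j & \<tau> : Tors R M s n (Ns ! j) & f j = a ** x +. \<tau>" for j
 unfolding ImgT_def by blast
 then obtain g h where gh: "!!j. j < length Ns ==> g j : Ns ! j"
 "!!j. j < length Ns ==> h j : Tors R M s n (Ns ! j)"
 "!!j. j < length Ns ==> f j = a ** g j +. h j" by metis
 have hN: "!!j. j < length Ns ==> h j : Ns ! j" using gh(2) by (simp add: Tors_def)
 have "(\<Oplus>\<^bsub>M\<^esub>j\<in>{..<length Ns}. f j) = (\<Oplus>\<^bsub>M\<^esub>j\<in>{..<length Ns}. a ** g j +. h j)"
 using gh(1,3) hN cM a by (intro M.finsum_cong') auto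
 then have e: "(\<Oplus>\<^bsub>M\<^esub>j\<in>{..<length Ns}. f j) =
  a ** (\<Oplus>\<^bsub>M\<^esub>j\<in>{..<length Ns}. g j) +. (\<Oplus>\<^bsub>M\<^esub>j\<in>{..<length Ns}. h j)"
 using sum[OF gh(1) hN] by simp
 have "(\<Oplus>\<^bsub>M\<^esub>j\<in>{..<length Ns}. h j) : Tors R M s n (MM)"
 using additive_inD[OF additive_Tors hN] gh(2) by blast
 then show "(\<Oplus>\<^bsub>M\<^esub>j\<in>{..<length Ns}. f j) : ImgT R M s n a (MM)"
 unfolding ImgT_def using e finsum_mem_carrier[OF ds gh(1)] by blast
qed
qed

text \<open>The map \<open>\<Phi>\<close> records the cosets of the components. It has the same
  fibres as the coset map of \<open>M\<close>, and its image is the full product of the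
  componentwise quotients.\<close>

lemma quot_card_prod:
assumes addK: "additive_in Ns K" and addI: "additive_in Ns I"
 and KM: "K (MM) <= MM" and KN: "!!j. j < length Ns ==> K (Ns ! j) <= Ns ! j"
 and IM: "submodule (I (MM)) R M" and IN: "!!j. j < length Ns ==> submodule (I (Ns ! j)) R M"
shows "quot_card M (K (MM)) (I (MM)) = (\<Prod>j<length Ns. quot_card M (K (Ns ! j)) (I (Ns ! j)))"
proof -
let ?n = "length Ns"
let ?co = "%I x. {x +. z | z. z : I}"
note cM = ds_carrier[OF ds]
have "\<exists>f. x : MM --> (\<forall>j<?n. f j : Ns ! j) & x = (\<Oplus>\<^bsub>M\<^esub>j\<in>{..<?n}. f j)" for x
 using ds_ex[OF ds] by blast
then obtain C where C: "!!x j. [|x : MM; j < ?n|] ==> C x j : Ns ! j"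
 "!!x. x : MM ==> x = (\<Oplus>\<^bsub>M\<^esub>j\<in>{..<?n}. C x j)" by metis
define \<Phi> where "\<Phi> x = (\<lambda>j\<in>{..<?n}. ?co (I (Ns ! j)) (C x j))" for x
have "\<Phi> ` K (MM) = (\<Pi>\<^sub>E j\<in>{..<?n}. ?co (I (Ns ! j)) ` K (Ns ! j))"
proof
 show "\<Phi> ` K (MM) <= (\<Pi>\<^sub>E j\<in>{..<?n}. ?co (I (Ns ! j)) ` K (Ns ! j))"
 proof
 fix F assume "F : \<Phi> ` K (MM)"
 then obtain x where x: "x : K (MM)" "F = \<Phi> x" by blast
 have xM: "x : MM" using x KM by blast
 have "(\<Oplus>\<^bsub>M\<^esub>j\<in>{..<?n}. C x j) : K (MM)" using C(2)[OF xM] x(1) by simp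
 then have "\<forall>j<?n. C x j : K (Ns ! j)"
  using additive_inD[OF addK C(1)[OF xM]] by blast
 then show "F : (\<Pi>\<^sub>E j\<in>{..<?n}. ?co (I (Ns ! j)) ` K (Ns ! j))" unfolding x(2) \<Phi>_def by auto
 qed
 show "(\<Pi>\<^sub>E j\<in>{..<?n}. ?co (I (Ns ! j)) ` K (Ns ! j)) <= \<Phi> ` K (MM)"
 proof
 fix F assume F: "F : (\<Pi>\<^sub>E j\<in>{..<?n}. ?co (I (Ns ! j)) ` K (Ns ! j))"
 have "\<forall>j. \<exists>k. j < ?n --> k : K (Ns ! j) & F j = ?co (I (Ns ! j)) k"
  using PiE_mem[OF F] by blast
 from choice[OF this] obtain k
  where k: "!!j. j < ?n ==> k j : K (Ns ! j)" "!!j. j < ?n ==> F j = ?co (I (Ns ! j)) (k j)" by blast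
 have kN: "!!j. j < ?n ==> k j : Ns ! j" using k(1) KN by blast
 let ?x = "\<Oplus>\<^bsub>M\<^esub>j\<in>{..<?n}. k j"
 have xM: "?x : MM" by (rule finsum_mem_carrier[OF ds kN])
 have xK: "?x : K (MM)" using additive_inD[OF addK kN] k(1) by blast
 have Cx: "C ?x j = k j" if "j < ?n" for j
  by (rule ds_uniq[OF ds C(1)[OF xM] kN C(2)[OF xM, symmetric] that])
 have "F = \<Phi> ?x"
 proof (rule ext)
  fix j show "F j = \<Phi> ?x j"
  using Cx k(2) F by (cases "j < ?n") (auto simp: \<Phi>_def PiE_def extensional_def)
 qed
 then show "F : \<Phi> ` K (MM)" using xK by blast
 qed
qed
then have "card (\<Phi> ` K (MM)) = (\<Prod>j<?n. card (?co (I (Ns ! j)) ` K (Ns ! j)))"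
 by (simp add: card_PiE)
moreover have "card (?co (I (MM)) ` K (MM)) = card (\<Phi> ` K (MM))"
proof (rule card_image_same_fibres)
 fix x y assume xy: "x : K (MM)" "y : K (MM)"
 have xM: "x : MM" and yM: "y : MM" using xy KM by auto
 let ?d = "%j. C x j +. (\<ominus> \<one>) ** C y j"
 have m1: "\<ominus> \<one> : RR" by simp
 have dN: "?d j : Ns ! j" if "j < ?n" for j
 using C(1)[OF xM that] C(1)[OF yM that] that by (intro ds_add_mem[OF ds] ds_smult_mem[OF ds]) auto
 have "(\<Oplus>\<^bsub>M\<^esub>j\<in>{..<?n}. ?d j) = (\<Oplus>\<^bsub>M\<^esub>j\<in>{..<?n}. C x j) +. (\<Oplus>\<^bsub>M\<^esub>j\<in>{..<?n}. (\<ominus> \<one>) ** C y j)"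
 using C(1)[OF xM] C(1)[OF yM] cM by (intro M.finsum_addf) auto
 also have "\<dots> = x +. (\<ominus> \<one>) ** y"
 using ds_smult[OF ds m1 C(1)[OF yM]] C(2)[OF xM] C(2)[OF yM] by simp
 also have "\<dots> = x -. y" using xM yM by (simp add: smult_l_minus M.minus_eq)
 finally have d: "(\<Oplus>\<^bsub>M\<^esub>j\<in>{..<?n}. ?d j) = x -. y" .
 have "?co (I (MM)) x = ?co (I (MM)) y \<longleftrightarrow> x -. y : I (MM)"
 by (rule coset_eq_iff[OF IM xM yM])
 also have "\<dots> \<longleftrightarrow> (\<forall>j<?n. ?d j : I (Ns ! j))"
 unfolding d[symmetric] by (rule additive_inD[OF addI dN])
 also have "\<dots> \<longleftrightarrow> (\<forall>j<?n. ?co (I (Ns ! j)) (C x j) = ?co (I (Ns ! j)) (C y j))"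
 proof -
 have "?d j : I (Ns ! j) \<longleftrightarrow> ?co (I (Ns ! j)) (C x j) = ?co (I (Ns ! j)) (C y j)" if j: "j < ?n" for j
  using coset_eq_iff[OF IN[OF j] cM[OF j C(1)[OF xM j]] cM[OF j C(1)[OF yM j]]] cM[OF j C(1)[OF yM j]]
  by (simp add: smult_l_minus M.minus_eq)
 then show ?thesis by blast
 qed
 also have "\<dots> \<longleftrightarrow> \<Phi> x = \<Phi> y"
 proof
 assume "\<Phi> x = \<Phi> y"
 then have *: "\<Phi> x j = \<Phi> y j" for j by simp
 show "\<forall>j<?n. ?co (I (Ns ! j)) (C x j) = ?co (I (Ns ! j)) (C y j)"
 proof (intro allI impI)
  fix j assume "j < ?n"
  then show "?co (I (Ns ! j)) (C x j) = ?co (I (Ns ! j)) (C y j)" using *[of j] by (simp add: \<Phi>_def)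
 qed
 next
 assume *: "\<forall>j<?n. ?co (I (Ns ! j)) (C x j) = ?co (I (Ns ! j)) (C y j)"
 show "\<Phi> x = \<Phi> y" unfolding \<Phi>_def by (rule restrict_ext) (use * in simp)
 qed
 finally show "?co (I (MM)) x = ?co (I (MM)) y \<longleftrightarrow> \<Phi> x = \<Phi> y" .
qed
ultimately show ?thesis by (simp add: quot_card_def)
qed

end

end

lemma filter_singletonI:
assumes j: "j < length es" "P (es ! j)" and u: "!!l. [|l < length es; P (es ! l)|] ==> l = j"
shows "filter P es = [es ! j]"
proof -
have "{l. l < length es & P (es ! l)} = {j}" using j u by blast
then have "length (filter P es) = 1" by (simp add: length_filter_conv_card)
then obtain e where e: "filter P es = [e]" by (auto simp: length_Suc_conv)
have "es ! j : set (filter P es)" using j by simp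
then show ?thesis using e by simp
qed

lemma length_filter_split:
"length (filter h es) = length (filter h (filter T es)) + length (filter (%e. h e & ~ T e) es)"
by (induction es) auto

text \<open>Outside the torsion entries the three marks see \<open>E_Zp\<close> alone,
  \<open>E_A\<close> alone, and \<open>E_Zp\<close> together with \<open>E_reg\<close>. After
  subtracting the equal torsion parts the counts determine the three multiplicities.\<close>

lemma mset_eq_by_counts:
assumes tor: "filter tor_entry es = filter tor_entry es'"
 and h0: "length (filter h0_entry es) = length (filter h0_entry es')"
 and h1: "length (filter h1_entry es) = length (filter h1_entry es')"
 and hv: "length (filter hv_entry es) = length (filter hv_entry es')"
shows "mset es = mset es'"
proof (rule multiset_eqI)
have cnt: "count (mset xs) e = length (filter (%x. x = e) xs)" for xs :: "entry list" and e
 by (induction xs) auto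
have split: "length (filter (%e. h e & ~ tor_entry e) es) = length (filter (%e. h e & ~ tor_entry e) es')"
 if "length (filter h es) = length (filter h es')" for h
 using that length_filter_split[of h es tor_entry] length_filter_split[of h es' tor_entry] tor by simp
have e0: "(h0_entry e & ~ tor_entry e) = (e = E_Zp)" for e by (cases e) auto
have e1: "(h1_entry e & ~ tor_entry e) = (e = E_A)" for e by (cases e) auto
have ev: "(hv_entry e & ~ tor_entry e) = (e = E_Zp \<or> e = E_reg)" for e by (cases e) auto
have or: "length (filter (%e. e = E_Zp \<or> e = E_reg) xs) =
 length (filter (%e. e = E_Zp) xs) + length (filter (%e. e = E_reg) xs)" for xs
 by (induction xs) auto
fix e
show "count (mset es) e = count (mset es') e"
proof (cases "tor_entry e")
 case True
 have *: "count (mset xs) e = count (mset (filter tor_entry xs)) e" for xs using True by (induction xs) auto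
 show ?thesis using *[of es] *[of es'] tor by simp
next
 case False
 then consider "e = E_Zp" | "e = E_A" | "e = E_reg" by (cases e) auto
 then show ?thesis
 using split[OF h0] split[OF h1] split[OF hv] unfolding e0 e1 ev or cnt by cases auto
qed
qed

section \<open>Uniqueness of the decomposition\<close>

context nodal_char_module
begin

context
fixes Ns es
assumes q1: "q > 1" and ds: "direct_sum R M Ns" and pr: "list_all2 (pres R M s n q) Ns es"
 and wf: "!!e. e : set es ==> in_list q e"
begin

lemma decomp_len: "length Ns = length es"
using pr by (rule list_all2_lengthD)

lemma decomp_pres:
assumes j: "j < length Ns"
obtains t x y where "t : MM" "x : MM" "y : MM" "Ns ! j = gen3 R M t x y"
 "cond R M s n q t x y (es ! j)" "in_list q (es ! j)"
proof -
have "pres R M s n q (Ns ! j) (es ! j)" using pr j by (simp add: list_all2_conv_all_nth)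
then obtain t x y where "t : Ns ! j" "x : Ns ! j" "y : Ns ! j" "Ns ! j = gen3 R M t x y"
 "cond R M s n q t x y (es ! j)" unfolding pres_def by blast
then show ?thesis using that ds_carrier[OF ds j] wf j decomp_len nth_mem by metis
qed

text \<open>Common form of the three counts: a summand contributes a factor \<open>q\<close> where
  the mark \<open>h\<close> holds and a factor 1 elsewhere.\<close>

lemma quot_card_count:
assumes addK: "additive_in Ns K" and addI: "additive_in Ns I"
 and sub: "!!N. submodule N R M ==> submodule (K N) R M" "!!N. submodule N R M ==> submodule (I N) R M"
 and KN: "!!N. submodule N R M ==> K N <= N"
 and h: "!!t x y e. [|t : MM; x : MM; y : MM; cond R M s n q t x y e; in_list q e; h e|]
 ==> simple_quot R M s n (K (gen3 R M t x y)) (I (gen3 R M t x y))"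
 and nh: "!!t x y e. [|t : MM; x : MM; y : MM; cond R M s n q t x y e; in_list q e; ~ h e|]
 ==> K (gen3 R M t x y) <= I (gen3 R M t x y)"
shows "quot_card M (K (MM)) (I (MM)) = q ^ length (filter h es)"
proof -
have S: "submodule (Ns ! j) R M" if "j < length Ns" for j by (rule ds_sub[OF ds that])
have "quot_card M (K (MM)) (I (MM)) = (\<Prod>j<length Ns. quot_card M (K (Ns ! j)) (I (Ns ! j)))"
 using KN[OF carrier_is_submodule] KN[OF S] sub(2)[OF carrier_is_submodule] sub(2)[OF S]
 by (intro quot_card_prod[OF ds addK addI]) auto
also have "\<dots> = (\<Prod>j<length es. if h (es ! j) then q else 1)"
proof (intro prod.cong)
 fix j assume "j : {..<length es}"
 then have j: "j < length Ns" using decomp_len by simp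
 obtain t x y where g: "t : MM" "x : MM" "y : MM" "Ns ! j = gen3 R M t x y"
 "cond R M s n q t x y (es ! j)" "in_list q (es ! j)" by (rule decomp_pres[OF j])
 show "quot_card M (K (Ns ! j)) (I (Ns ! j)) = (if h (es ! j) then q else 1)"
 proof (cases "h (es ! j)")
 case True
 then show ?thesis
  using quot_card_simple[OF sub(2)[OF S[OF j]] sub(1)[OF S[OF j]]] h[OF g(1-3,5,6)] g(4) by simp
 next
 case False
 then show ?thesis
  using quot_card_trivial[OF sub(2)[OF S[OF j]] sub(1)[OF S[OF j]]] nh[OF g(1-3,5,6)] g(4) by simp
 qed
qed (simp add: decomp_len)
finally show ?thesis by (simp add: prod_filter_power)
qed

lemma count_h0: "quot_card M (Ker M s (MM)) (Img M n (MM)) = q ^ length (filter h0_entry es)"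
by (rule quot_card_count[OF additive_Ker[OF ds] additive_Img[OF ds]])
 (use Ker_submodule Img_submodule entry_h0[OF q1] in \<open>auto simp: Ker_def\<close>)

lemma count_h1: "quot_card M (Ker M n (MM)) (Img M s (MM)) = q ^ length (filter h1_entry es)"
by (rule quot_card_count[OF additive_Ker[OF ds] additive_Img[OF ds]])
 (use Ker_submodule Img_submodule entry_h1[OF q1] in \<open>auto simp: Ker_def\<close>)

lemma ImgT_subset: "submodule N R M ==> a : RR ==> ImgT R M s n a N <= N"
using sub_add sub_smult by (fastforce simp: ImgT_def Tors_def)

lemma count_hv: "quot_card M (ImgT R M s n n (MM)) (ImgT R M s n (n \<otimes> n) (MM)) =
 q ^ length (filter hv_entry es)"
by (rule quot_card_count[OF additive_ImgT[OF ds] additive_ImgT[OF ds]])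
 (use ImgT_submodule ImgT_subset entry_hv[OF q1] in auto)

lemma decomp_torsion_free:
assumes T: "Tors R M s n (MM) = {\<theta>}"
shows "filter tor_entry es = []"
proof -
have "~ tor_entry (es ! j)" if j': "j < length es" for j
proof
 assume h: "tor_entry (es ! j)"
 have j: "j < length Ns" using j' decomp_len by simp
 obtain t x y where g: "t : MM" "x : MM" "y : MM" "Ns ! j = gen3 R M t x y"
 "cond R M s n q t x y (es ! j)" "in_list q (es ! j)" by (rule decomp_pres[OF j])
 note it = entry_is_tor[OF q1 g(1-3,5,6) h]
 have "t : Tors R M s n (MM)"
 using it(2) cyc_self[OF g(1)] g(1) by (auto simp: Tors_def)
 then show False using T tor_nonzero[OF it(1)] by simp
qed
then show ?thesis by (auto simp: filter_empty_conv in_set_conv_nth)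
qed

text \<open>Cyclic torsion has a one-dimensional socle, and every torsion summand contains its
  generator \<open>?z\<close>. Two different summands share no nonzero element, so there is at most
  one torsion entry; there is at least one because the torsion is not zero.\<close>

lemma decomp_torsion:
assumes T: "Tors R M s n (MM) = cyc R M t0" and t0: "is_tor R M s n i c t0" and c: "c = 0 \<or> i >= 2"
shows "EX e:set es. filter tor_entry es = [e] & tor_entry e & tor_type R M s n q (MM) e"
proof -
have t0M: "t0 : MM" using t0 by (simp add: is_tor_def)
let ?z = "n [^] (i - 1) ** t0"
have zM: "?z : MM" and z0: "?z ~= \<theta>" using t0M t0 by (auto simp: is_tor_def)
\<comment> \<open>The torsion generator of the summand is \<open>n^k u t0\<close> with
  \<open>k < i\<close>; multiplied by \<open>n^(i-1-k)\<close> it becomes a unit multiple of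
  \<open>?z\<close>.\<close>
have zN: "?z : Ns ! j" if j: "j < length Ns" and h: "tor_entry (es ! j)" for j
proof -
 obtain t x y where g: "t : MM" "x : MM" "y : MM" "Ns ! j = gen3 R M t x y"
 "cond R M s n q t x y (es ! j)" "in_list q (es ! j)" by (rule decomp_pres[OF j])
 note it = entry_is_tor[OF q1 g(1-3,5,6) h]
 note S = ds_sub[OF ds j]
 have tN: "t : Ns ! j" using gen3_gens(1)[OF g(1-3)] g(4) by simp
 have "t : Tors R M s n (MM)" using it(2) cyc_self[OF g(1)] g(1) by (auto simp: Tors_def)
 then obtain a where a: "a : RR" "t = a ** t0" unfolding T by (auto simp: cyc_def)
 then obtain k u where k: "k < i" "u : Units R" "t = (n [^] (k::nat) \<otimes> u) ** t0"
 using tor_cases[OF t0 c a(1)] tor_nonzero[OF it(1)] by auto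
 have uc: "u : RR" using k(2) by (simp add: R.Units_closed)
 have i: "i - 1 = (i - 1 - k) + k" using k(1) by simp
 have "n [^] (i - 1 - k) ** t = (n [^] (i - 1 - k) \<otimes> (n [^] k \<otimes> u)) ** t0"
 unfolding k(3) using uc t0M by (simp add: smult_assoc1)
 also have "n [^] (i - 1 - k) \<otimes> (n [^] k \<otimes> u) = u \<otimes> n [^] (i - 1)"
 proof -
 have "n [^] (i - 1 - k) \<otimes> (n [^] k \<otimes> u) = (n [^] (i - 1 - k) \<otimes> n [^] k) \<otimes> u"
  using uc by (simp add: R.m_assoc)
 also have "n [^] (i - 1 - k) \<otimes> n [^] k = n [^] (i - 1)" using i R.nat_pow_mult[OF n_closed] by metis
 finally show ?thesis using uc by (simp add: R.m_comm)
 qed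
 also have "(u \<otimes> n [^] (i - 1)) ** t0 = u ** ?z" using uc t0M by (simp add: smult_assoc1)
 finally have "u ** ?z : Ns ! j" using sub_smult[OF S _ tN, of "n [^] (i - 1 - k)"] by simp
 then show ?thesis by (rule sub_unit[OF S zM k(2)])
qed
have uniq: "l = j" if l: "l < length Ns" "tor_entry (es ! l)" and j: "j < length Ns" "tor_entry (es ! j)" for l j
proof (rule ccontr)
 assume ne: "l ~= j"
 \<comment> \<open>Placing \<open>?z\<close> in the summand \<open>l\<close> or in the summand
   \<open>j\<close> gives two decompositions of the same element.\<close>
 let ?f = "%k r. if r = k then ?z else \<theta>"
 have f: "!!r. r < length Ns ==> ?f k r : Ns ! r" if "k < length Ns" "tor_entry (es ! k)" for k
 using zN[OF that] ds_zero[OF ds] by simp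
 have 1: "(\<Oplus>\<^bsub>M\<^esub>r\<in>{..<length Ns}. ?f l r) = ?z"
 using finsum_single_comp[OF ds l(1) zM, of "?f l"] by simp
 have 2: "(\<Oplus>\<^bsub>M\<^esub>r\<in>{..<length Ns}. ?f j r) = ?z"
 using finsum_single_comp[OF ds j(1) zM, of "?f j"] by simp
 have "?f l l = ?f j l" by (rule ds_uniq[OF ds f[OF l] f[OF j] trans[OF 1 2[symmetric]] l(1)])
 then show False using ne z0 by simp
qed
have Tj: "Tors R M s n (Ns ! j) = {\<theta>}" if j: "j < length Ns" and h: "~ tor_entry (es ! j)" for j
proof -
 obtain t x y where g: "t : MM" "x : MM" "y : MM" "Ns ! j = gen3 R M t x y"
 "cond R M s n q t x y (es ! j)" "in_list q (es ! j)" by (rule decomp_pres[OF j])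
 show ?thesis using entry_no_torsion[OF q1 g(1-3,5,6) h] g(4) by simp
qed
have comp: "\<exists>f. (\<forall>j<length Ns. f j : Tors R M s n (Ns ! j)) & x = (\<Oplus>\<^bsub>M\<^esub>j\<in>{..<length Ns}. f j)"
 if x: "x : Tors R M s n (MM)" for x
proof -
 have "x : MM" using x by (simp add: Tors_def)
 then obtain f where f: "!!j. j < length Ns ==> f j : Ns ! j" "x = (\<Oplus>\<^bsub>M\<^esub>j\<in>{..<length Ns}. f j)"
 using ds_ex[OF ds] by blast
 then show ?thesis using additive_inD[OF additive_Tors[OF ds] f(1)] x by blast
qed
have ex: "\<exists>j<length Ns. tor_entry (es ! j)"
proof (rule ccontr)
 assume none: "~ ?thesis"
 have "t0 : Tors R M s n (MM)" using T cyc_self[OF t0M] by simp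
 then obtain f where f: "!!j. j < length Ns ==> f j : Tors R M s n (Ns ! j)"
 "t0 = (\<Oplus>\<^bsub>M\<^esub>j\<in>{..<length Ns}. f j)" using comp by blast
 have "f j = \<theta>" if "j < length Ns" for j using f(1)[OF that] Tj[OF that] none that by auto
 then have "t0 = \<theta>" unfolding f(2) by (intro M.add.finprod_one_eqI) auto
 then show False using tor_nonzero[OF t0] by simp
qed
then obtain j where j: "j < length Ns" "tor_entry (es ! j)" by blast
have fil: "filter tor_entry es = [es ! j]"
proof (rule filter_singletonI)
 show "j < length es" "tor_entry (es ! j)" using j decomp_len by simp_all
 fix l assume l: "l < length es" "tor_entry (es ! l)"
 then have "l < length Ns" using decomp_len by simp
 then show "l = j" using uniq l(2) j by blast
qed
obtain t x y where g: "t : MM" "x : MM" "y : MM" "Ns ! j = gen3 R M t x y"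
 "cond R M s n q t x y (es ! j)" "in_list q (es ! j)" by (rule decomp_pres[OF j(1)])
have tt: "tor_type R M s n q (Ns ! j) (es ! j)" using entry_tor_type[OF q1 g(1-3,5,6) j(2)] g(4) by simp
have NM: "Ns ! j <= MM" using ds_carrier[OF ds j(1)] by blast
\<comment> \<open>The components of a torsion element in the other summands are torsion and hence
  zero, so the torsion of \<open>M\<close> is that of the one torsion summand.\<close>
have TT: "Tors R M s n (MM) = Tors R M s n (Ns ! j)"
proof
 show "Tors R M s n (Ns ! j) <= Tors R M s n (MM)" using NM by (auto simp: Tors_def)
 show "Tors R M s n (MM) <= Tors R M s n (Ns ! j)"
 proof
 fix w assume w: "w : Tors R M s n (MM)"
 then obtain f where f: "!!j. j < length Ns ==> f j : Tors R M s n (Ns ! j)"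
  "w = (\<Oplus>\<^bsub>M\<^esub>j\<in>{..<length Ns}. f j)" using comp by blast
 have fj: "f j : MM" using f(1)[OF j(1)] NM by (auto simp: Tors_def)
 have "f l = \<theta>" if "l < length Ns" "l ~= j" for l
  using f(1)[OF that(1)] Tj[OF that(1)] uniq[OF that(1) _ j] that(2) by auto
 then have "w = f j" unfolding f(2) by (intro finsum_single_comp[OF ds j(1) fj]) auto
 then show "w : Tors R M s n (Ns ! j)" using f(1)[OF j(1)] by simp
 qed
qed
have TN: "Tors R M s n (Ns ! j) <= Ns ! j" by (auto simp: Tors_def)
have Im: "z : Img M a (MM) \<longleftrightarrow> z : Img M a (Ns ! j)" if "z : Tors R M s n (Ns ! j)" "a : RR" for z a
 using Img_component[OF ds that(2) j(1)] that(1) TN by blast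
have soc: "socle_in_Img R M s n (MM) = socle_in_Img R M s n (Ns ! j)"
 unfolding socle_in_Img_def TT using Im by blast
have img: "(Tors R M s n (MM) <= Img M n (MM)) = (Tors R M s n (Ns ! j) <= Img M n (Ns ! j))"
 unfolding TT using Im by blast
have "tor_type R M s n q (MM) (es ! j)"
 using tt unfolding tor_type_def soc img unfolding TT .
then show ?thesis using fil j decomp_len nth_mem by metis
qed

end

theorem decomposition_unique:
assumes q1: "q > 1"
 and T: "Tors R M s n (MM) = {\<theta>} \<or>
 (\<exists>t i c. Tors R M s n (MM) = cyc R M t & is_tor R M s n i c t & (c = 0 \<or> i >= 2))"
 and d: "direct_sum R M Ns" "list_all2 (pres R M s n q) Ns es" "!!e. e : set es ==> in_list q e"
 and d': "direct_sum R M Ns'" "list_all2 (pres R M s n q) Ns' es'" "!!e. e : set es' ==> in_list q e"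
shows "mset es = mset es'"
proof (rule mset_eq_by_counts)
show "filter tor_entry es = filter tor_entry es'"
 using T
proof
 assume "Tors R M s n (MM) = {\<theta>}"
 then show ?thesis using decomp_torsion_free[OF q1 d] decomp_torsion_free[OF q1 d'] by simp
next
 assume "\<exists>t i c. Tors R M s n (MM) = cyc R M t & is_tor R M s n i c t & (c = 0 \<or> i >= 2)"
 then obtain t i c where t: "Tors R M s n (MM) = cyc R M t" "is_tor R M s n i c t" "c = 0 \<or> i >= 2" by blast
 obtain e where e: "e : set es" "filter tor_entry es = [e]" "tor_entry e" "tor_type R M s n q (MM) e"
 using decomp_torsion[OF q1 d t] by blast
 obtain e' where e': "e' : set es'" "filter tor_entry es' = [e']" "tor_entry e'" "tor_type R M s n q (MM) e'"
 using decomp_torsion[OF q1 d' t] by blast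
 have "e = e'" using tor_type_unique[OF q1 e(4,3) d(3)[OF e(1)] e'(4,3) d'(3)[OF e'(1)]] .
 then show ?thesis using e e' by simp
qed
have inj: "a = b" if "q ^ a = q ^ b" for a b :: nat using that q1 by simp
show "length (filter h0_entry es) = length (filter h0_entry es')"
 using count_h0[OF q1 d] count_h0[OF q1 d'] inj by metis
show "length (filter h1_entry es) = length (filter h1_entry es')"
 using count_h1[OF q1 d] count_h1[OF q1 d'] inj by metis
show "length (filter hv_entry es) = length (filter hv_entry es')"
 using count_hv[OF q1 d] count_hv[OF q1 d'] inj by metis
qed

end

section \<open>The p-adic integers\<close>

text \<open>A form without subtraction. It inverts elements \<open>1 - x\<close> in the group ring,
  and for \<open>\<zeta>\<close>, whose powers sum to zero, it gives
  \<open>\<zeta>^p = 1\<close>.\<close>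

lemma (in cring) geometric_sum:
assumes x: "x : carrier R"
shows "x \<otimes> (\<Oplus>j\<in>{..<N}. x [^] j) \<oplus> \<one> = (\<Oplus>j\<in>{..<N}. x [^] j) \<oplus> x [^] (N::nat)"
proof (induction N)
case (Suc N)
let ?S = "\<Oplus>j\<in>{..<N}. x [^] j"
have S: "?S : carrier R" using x by (auto intro!: finsum_closed)
have f: "(\<Oplus>j\<in>{..<Suc N}. x [^] j) = x [^] N \<oplus> ?S"
 unfolding lessThan_Suc using x by (subst finsum_insert) auto
have "x \<otimes> (x [^] N \<oplus> ?S) \<oplus> \<one> = x \<otimes> x [^] N \<oplus> (x \<otimes> ?S \<oplus> \<one>)"
 using x S by (simp add: r_distr a_assoc)
also have "\<dots> = x [^] N \<oplus> ?S \<oplus> x [^] Suc N"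
 unfolding Suc using x S by (simp add: a_ac m_comm[of x "x [^] N"])
finally show ?case unfolding f .
qed (use x in simp)

lemma Zp_simps:
"x : carrier (Zp p) \<longleftrightarrow> (\<forall>n. 0 <= x n & x n < int p ^ n & x (Suc n) mod int p ^ n = x n)"
"x \<otimes>\<^bsub>Zp p\<^esub> y = (%n. (x n * y n) mod int p ^ n)"
"x \<oplus>\<^bsub>Zp p\<^esub> y = (%n. (x n + y n) mod int p ^ n)"
"\<one>\<^bsub>Zp p\<^esub> = (%n. 1 mod int p ^ n)" "\<zero>\<^bsub>Zp p\<^esub> = (%n. 0)"
by (simp_all add: Zp_def)

lemma Zp_mod_self [simp]: "x : carrier (Zp p) ==> x n mod int p ^ n = x n"
by (simp add: Zp_simps mod_pos_pos_trivial)

lemma Zp_mod_le: "[|x : carrier (Zp p); m <= n|] ==> x n mod int p ^ m = x m"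
proof (induction n)
case (Suc n)
show ?case
proof (cases "m = Suc n")
 case False
 then have mn: "m <= n" using Suc.prems by simp
 have "x (Suc n) mod int p ^ m = x (Suc n) mod int p ^ n mod int p ^ m"
 using mn by (simp add: mod_mod_cancel le_imp_power_dvd)
 also have "\<dots> = x n mod int p ^ m" using Suc.prems by (simp add: Zp_simps)
 finally show ?thesis using Suc.IH Suc.prems mn by simp
qed (use Suc.prems Zp_mod_self[of x p "Suc n"] in \<open>simp del: power_Suc\<close>)
qed (use Zp_mod_self[of x p 0] in simp)

text \<open>The entries need to be known only up to congruence; reduction at each level selects the
  canonical representatives.\<close>

lemma Zp_I:
assumes "p > 0" "!!n. [y (Suc n) = y n] (mod int p ^ n)"
shows "(%n. y n mod int p ^ n) : carrier (Zp p)"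
proof -
have "y (Suc n) mod int p ^ Suc n mod int p ^ n = y n mod int p ^ n" for n
proof -
 have "y (Suc n) mod int p ^ Suc n mod int p ^ n = y (Suc n) mod int p ^ n"
 by (rule mod_mod_cancel) simp
 then show ?thesis using assms(2)[of n] by (simp add: cong_def)
qed
then show ?thesis using assms(1) by (simp add: Zp_simps)
qed

lemma Zp_cong: "x : carrier (Zp p) ==> [x (Suc n) = x n] (mod int p ^ n)"
using Zp_mod_le[of x p n "Suc n"] by (simp add: cong_def)

lemma Zp_cring:
assumes p: "p > 0"
shows "cring (Zp p)"
proof (rule cringI)
show "abelian_group (Zp p)"
proof (rule abelian_groupI)
 fix x y assume xy: "x : carrier (Zp p)" "y : carrier (Zp p)"
 show "x \<oplus>\<^bsub>Zp p\<^esub> y : carrier (Zp p)"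
 unfolding Zp_simps(3) by (rule Zp_I[OF p]) (intro cong_add Zp_cong xy)
 show "x \<oplus>\<^bsub>Zp p\<^esub> y = y \<oplus>\<^bsub>Zp p\<^esub> x" by (simp add: Zp_simps add.commute)
 fix z assume z: "z : carrier (Zp p)"
 show "x \<oplus>\<^bsub>Zp p\<^esub> y \<oplus>\<^bsub>Zp p\<^esub> z = x \<oplus>\<^bsub>Zp p\<^esub> (y \<oplus>\<^bsub>Zp p\<^esub> z)"
 by (simp add: Zp_simps mod_simps add.assoc)
next
 show "\<zero>\<^bsub>Zp p\<^esub> : carrier (Zp p)" using p by (simp add: Zp_simps)
 fix x assume x: "x : carrier (Zp p)"
 show "\<zero>\<^bsub>Zp p\<^esub> \<oplus>\<^bsub>Zp p\<^esub> x = x" using x by (simp add: Zp_simps(3,5))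
 have "(%n. (- x n) mod int p ^ n) : carrier (Zp p)"
 by (rule Zp_I[OF p]) (use cong_mult[OF cong_refl[of "-1"] Zp_cong[OF x]] in simp)
 moreover have "(%n. (- x n) mod int p ^ n) \<oplus>\<^bsub>Zp p\<^esub> x = \<zero>\<^bsub>Zp p\<^esub>"
 by (simp add: Zp_simps mod_simps)
 ultimately show "EX y:carrier (Zp p). y \<oplus>\<^bsub>Zp p\<^esub> x = \<zero>\<^bsub>Zp p\<^esub>" by blast
qed
show "comm_monoid (Zp p)"
proof (rule comm_monoidI)
 fix x y assume xy: "x : carrier (Zp p)" "y : carrier (Zp p)"
 show "x \<otimes>\<^bsub>Zp p\<^esub> y : carrier (Zp p)"
 unfolding Zp_simps(2) by (rule Zp_I[OF p]) (intro cong_mult Zp_cong xy)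
 show "x \<otimes>\<^bsub>Zp p\<^esub> y = y \<otimes>\<^bsub>Zp p\<^esub> x" by (simp add: Zp_simps mult.commute)
 fix z assume z: "z : carrier (Zp p)"
 show "x \<otimes>\<^bsub>Zp p\<^esub> y \<otimes>\<^bsub>Zp p\<^esub> z = x \<otimes>\<^bsub>Zp p\<^esub> (y \<otimes>\<^bsub>Zp p\<^esub> z)"
 by (simp add: Zp_simps mod_simps mult.assoc)
next
 show "\<one>\<^bsub>Zp p\<^esub> : carrier (Zp p)" unfolding Zp_simps(4) by (rule Zp_I[OF p]) simp
 fix x assume x: "x : carrier (Zp p)"
 show "\<one>\<^bsub>Zp p\<^esub> \<otimes>\<^bsub>Zp p\<^esub> x = x" using x by (simp add: Zp_simps(2,4) mod_simps)
qed
fix x y z assume "x : carrier (Zp p)" "y : carrier (Zp p)" "z : carrier (Zp p)"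
show "(x \<oplus>\<^bsub>Zp p\<^esub> y) \<otimes>\<^bsub>Zp p\<^esub> z = x \<otimes>\<^bsub>Zp p\<^esub> z \<oplus>\<^bsub>Zp p\<^esub> y \<otimes>\<^bsub>Zp p\<^esub> z"
 by (simp add: Zp_simps mod_simps distrib_right)
qed

definition Zp_int :: "nat => int => padic" where
"Zp_int p k = (%n. k mod int p ^ n)"

locale padic =
fixes p :: nat
assumes p: "Factorial_Ring.prime p"
begin

abbreviation ZZ where "ZZ \<equiv> carrier (Zp p)"
abbreviation mult_Zp (infixl "*|" 70) where "x *| y \<equiv> x \<otimes>\<^bsub>Zp p\<^esub> y"
abbreviation add_Zp (infixl "+|" 65) where "x +| y \<equiv> x \<oplus>\<^bsub>Zp p\<^esub> y"
abbreviation minus_Zp (infixl "-|" 65) where "x -| y \<equiv> x \<ominus>\<^bsub>Zp p\<^esub> y"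
abbreviation neg_Zp ("-| _" [81] 80) where "-| x \<equiv> \<ominus>\<^bsub>Zp p\<^esub> x"
abbreviation zero_Zp ("\<z>") where "\<z> \<equiv> \<zero>\<^bsub>Zp p\<^esub>"
abbreviation one_Zp ("\<u>") where "\<u> \<equiv> \<one>\<^bsub>Zp p\<^esub>"

lemma p0: "p > 0" "p > 1"
using p prime_gt_0_nat prime_gt_1_nat by auto

sublocale Zp: cring "Zp p"
by (rule Zp_cring[OF p0(1)])

lemma Zp_int_closed [simp]: "Zp_int p k : ZZ"
unfolding Zp_int_def by (rule Zp_I[OF p0(1)]) simp

lemma Zp_int_add: "Zp_int p j +| Zp_int p k = Zp_int p (j + k)"
by (simp add: Zp_simps Zp_int_def mod_simps)

lemma Zp_int_mult: "Zp_int p j *| Zp_int p k = Zp_int p (j * k)"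
by (simp add: Zp_simps Zp_int_def mod_simps)

lemma Zp_int_01: "Zp_int p 0 = \<z>" "Zp_int p 1 = \<u>"
by (simp_all add: Zp_simps Zp_int_def)

lemma Zp_minus: "x : ZZ ==> (-| x) n = (- x n) mod int p ^ n"
proof -
assume x: "x : ZZ"
have "(%n. (- x n) mod int p ^ n) : ZZ"
 by (rule Zp_I[OF p0(1)]) (use cong_mult[OF cong_refl[of "-1"] Zp_cong[OF x]] in simp)
moreover have "(%n. (- x n) mod int p ^ n) +| x = \<z>"
 by (simp add: Zp_simps mod_simps)
ultimately have "-| x = (%n. (- x n) mod int p ^ n)"
 using Zp.minus_equality x by blast
then show ?thesis by simp
qed

lemma Zp_finsum:
"[|finite A; f : A \<rightarrow> ZZ|] ==> (\<Oplus>\<^bsub>Zp p\<^esub>i\<in>A. f i) n = (\<Sum>i\<in>A. f i n) mod int p ^ n"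
proof (induction A rule: finite_induct)
case empty
then show ?case by (simp add: Zp_simps)
next
case (insert i A)
have "f : A \<rightarrow> ZZ" "f i : ZZ" using insert.prems by auto
then show ?case using insert by (simp add: Zp_simps(3) mod_simps)
qed

lemma Zp_range: "x : ZZ ==> 0 <= x n & x n < int p ^ n"
by (simp add: Zp_simps)

lemma Zp_level0: "x : ZZ ==> x 0 = 0"
using Zp_range[of x 0] by simp

lemma Zp_dvd:
assumes x: "x : ZZ" and n: "k <= n"
shows "int p ^ k dvd x n \<longleftrightarrow> x k = 0"
using Zp_mod_le[OF x n] by (simp add: dvd_eq_mod_eq_0)

text \<open>Division by \<open>p^k\<close> costs \<open>k\<close> levels of precision, so level
  \<open>n\<close> of the quotient is read off from level \<open>n + k\<close> of
  \<open>x\<close>.\<close>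

lemma Zp_divide:
assumes x: "x : ZZ" and k: "x k = 0"
shows "EX y:ZZ. x = Zp_int p (int p ^ k) *| y"
proof
define y where "y n = x (n + k) div int p ^ k" for n
have xy: "x (n + k) = int p ^ k * y n" for n
 using Zp_dvd[OF x, of k "n + k"] k by (simp add: y_def)
have c: "[y (Suc n) = y n] (mod int p ^ n)" for n
proof -
 have "[x (Suc (n + k)) = x (n + k)] (mod int p ^ (n + k))" by (rule Zp_cong[OF x])
 then have "[int p ^ k * y (Suc n) = int p ^ k * y n] (mod int p ^ k * int p ^ n)"
 using xy[of n] xy[of "Suc n"] by (simp add: power_add mult.commute)
 then show ?thesis using p0 by (simp add: cong_def mult_mod_right[symmetric])
qed
show "(%n. y n mod int p ^ n) : ZZ" by (rule Zp_I[OF p0(1) c])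
show "x = Zp_int p (int p ^ k) *| (%n. y n mod int p ^ n)"
proof
 fix n
 have "x n = x (n + k) mod int p ^ n" using Zp_mod_le[OF x, of n "n + k"] by simp
 then show "x n = (Zp_int p (int p ^ k) *| (%n. y n mod int p ^ n)) n"
 by (simp add: Zp_simps Zp_int_def mod_simps xy)
qed
qed

text \<open>Read the equation one level higher: if \<open>p^(n+1)\<close> divides
  \<open>p x (n+1)\<close>, then \<open>p^n\<close> divides \<open>x (n+1)\<close>.\<close>

lemma Zp_p_cancel:
assumes x: "x : ZZ" and z: "Zp_int p (int p) *| x = \<z>"
shows "x = \<z>"
proof
fix n
have "(Zp_int p (int p) *| x) (Suc n) = 0" using z by (simp add: Zp_simps)
then have "int p * int p ^ n dvd int p * x (Suc n)"
 by (simp add: Zp_simps Zp_int_def mod_simps dvd_eq_mod_eq_0)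
then have "int p ^ n dvd x (Suc n)" using p0 by simp
then show "x n = \<z> n" using Zp_dvd[OF x, of n "Suc n"] by (simp add: Zp_simps)
qed

text \<open>Each residue is prime to \<open>p\<close> and has an inverse at its level; the inverses
  are compatible because an inverse modulo \<open>p^n\<close> is unique.\<close>

lemma Zp_unit:
assumes x: "x : ZZ" and x1: "x 1 ~= 0"
shows "x : Units (Zp p)"
proof -
have cop: "coprime (x n) (int p ^ n)" for n
proof (cases n)
 case (Suc m)
 have "~ int p dvd x n" using Zp_dvd[OF x, of 1 n] x1 Suc by simp
 then have "coprime (int p) (x n)" using p by (intro prime_imp_coprime) auto
 then show ?thesis by (simp add: coprime_commute)
qed simp
have "\<exists>z. [x n * z = 1] (mod int p ^ n)" for n using cong_solve_coprime_int[OF cop[of n]] .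
then obtain z where z: "!!n. [x n * z n = 1] (mod int p ^ n)" by metis
have "[z (Suc n) = z n] (mod int p ^ n)" for n
proof -
 have "[x (Suc n) * z (Suc n) = 1] (mod int p ^ n)"
 using z[of "Suc n"] by (rule cong_dvd_modulus) simp
 moreover have "[x (Suc n) * z (Suc n) = x n * z (Suc n)] (mod int p ^ n)"
 by (intro cong_mult Zp_cong[OF x] cong_refl)
 ultimately have "[x n * z (Suc n) = x n * z n] (mod int p ^ n)"
 using z[of n] by (meson cong_sym cong_trans)
 then show ?thesis using cop[of n] by (simp add: cong_mult_lcancel coprime_commute)
qed
then have y: "(%n. z n mod int p ^ n) : ZZ" by (intro Zp_I[OF p0(1)])
have "x *| (%n. z n mod int p ^ n) = \<u>"
 using z by (simp add: Zp_simps mod_simps cong_def)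
then show ?thesis using x y unfolding Units_def using Zp.m_comm[OF x y] by auto
qed

text \<open>The first level at which \<open>x\<close> is nonzero is \<open>k + 1\<close>; level 0
  never is, all residues modulo 1 being zero.\<close>

lemma Zp_nonzero_unit_power:
assumes x: "x : ZZ" "x ~= \<z>"
shows "\<exists>k. EX u:Units (Zp p). x = Zp_int p (int p ^ k) *| u"
proof -
have "\<exists>n. x n ~= 0" using x(2) by (auto simp: Zp_simps)
then have L: "x (LEAST n. x n ~= 0) ~= 0" by (rule LeastI_ex)
have "(LEAST n. x n ~= 0) ~= 0" using L Zp_level0[OF x(1)] by metis
then obtain k where k: "(LEAST n. x n ~= 0) = Suc k" by (metis not0_implies_Suc)
have "x k = 0" using not_less_Least[of k "%n. x n ~= 0"] k by auto
then obtain y where y: "y : ZZ" "x = Zp_int p (int p ^ k) *| y"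
 using Zp_divide[OF x(1)] by blast
have "y 1 ~= 0"
proof
 assume "y 1 = 0"
 then obtain m where "y (Suc k) = int p * m" using Zp_dvd[OF y(1), of 1 "Suc k"] by auto
 then have "x (Suc k) = 0" unfolding y(2) by (simp add: Zp_simps Zp_int_def mod_simps mult_ac)
 then show False using L k by simp
qed
then show ?thesis using y Zp_unit by blast
qed

lemma Zp_p_pow_cancel:
assumes "x : ZZ" "Zp_int p (int p ^ k) *| x = \<z>"
shows "x = \<z>"
using assms(2)
proof (induction k)
case (Suc k)
have "Zp_int p (int p) *| (Zp_int p (int p ^ k) *| x) = \<z>"
 using Suc.prems assms(1) by (simp add: Zp.m_assoc[symmetric] Zp_int_mult)
then have "Zp_int p (int p ^ k) *| x = \<z>"
 by (rule Zp_p_cancel[rotated]) (rule Zp.m_closed[OF Zp_int_closed assms(1)])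
then show ?case by (rule Suc.IH)
qed (use assms(1) Zp_int_01(2) in simp)

text \<open>A nonzero element is a power of \<open>p\<close> times a unit, and powers of
  \<open>p\<close> cancel. Degrees of products of polynomials over Z_p depend on this.\<close>

sublocale Zp: domain "Zp p"
proof (unfold_locales)
show "\<u> ~= \<z>"
proof
 assume "\<u> = \<z>"
 then have "\<u> 1 = \<z> 1" by simp
 then show False using p0 by (simp add: Zp_simps)
qed
fix x y assume xy: "x *| y = \<z>" "x : ZZ" "y : ZZ"
show "x = \<z> \<or> y = \<z>"
proof (rule ccontr)
 assume n: "~ ?thesis"
 then obtain k u where u: "u : Units (Zp p)" "x = Zp_int p (int p ^ k) *| u"
 using Zp_nonzero_unit_power[OF xy(2)] by blast
 have "Zp_int p (int p ^ k) *| (u *| y) = \<z>"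
 using xy u Zp.Units_closed[OF u(1)] by (simp add: Zp.m_assoc)
 then have "u *| y = \<z>" using Zp_p_pow_cancel xy(3) Zp.Units_closed[OF u(1)] by simp
 moreover have "inv\<^bsub>Zp p\<^esub> u *| (u *| y) = y"
 using Zp.m_assoc[of "inv\<^bsub>Zp p\<^esub> u" u y] u(1) xy(3) Zp.Units_closed[OF u(1)] by simp
 ultimately show False using n Zp.Units_inv_closed[OF u(1)] by simp
qed
qed

end

section \<open>The group ring of a cyclic group of order p\<close>

locale padic_group = padic p + G?: group G
for p :: nat and G :: "('g, 'd) monoid_scheme" +
fixes \<tau> :: 'g
assumes odd_p: "odd p" and order: "order G = p"
 and \<tau>: "\<tau> : carrier G" and generates: "generate G {\<tau>} = carrier G"
begin

abbreviation R :: "('g => padic) ring" where "R \<equiv> ZpG p G"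

abbreviation mult_R (infixl "*:" 70) where "a *: b \<equiv> a \<otimes>\<^bsub>R\<^esub> b"
abbreviation add_R (infixl "+:" 65) where "a +: b \<equiv> a \<oplus>\<^bsub>R\<^esub> b"
abbreviation minus_R (infixl "-:" 65) where "a -: b \<equiv> a \<ominus>\<^bsub>R\<^esub> b"
abbreviation neg_R ("-: _" [81] 80) where "-: a \<equiv> \<ominus>\<^bsub>R\<^esub> a"
abbreviation pow_R (infixr "^:" 75) where "a ^: k \<equiv> a [^]\<^bsub>R\<^esub> (k :: nat)"
abbreviation zero_R ("\<o>") where "\<o> \<equiv> \<zero>\<^bsub>R\<^esub>"
abbreviation one_R ("\<r>") where "\<r> \<equiv> \<one>\<^bsub>R\<^esub>"
abbreviation mult_G (infixl "*@" 70) where "g *@ h \<equiv> g \<otimes>\<^bsub>G\<^esub> h"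
abbreviation pow_G (infixr "^@" 75) where "g ^@ k \<equiv> g [^]\<^bsub>G\<^esub> (k :: nat)"
abbreviation inv_G ("inv@ _" [81] 80) where "inv@ g \<equiv> inv\<^bsub>G\<^esub> g"
abbreviation one_G ("\<e>") where "\<e> \<equiv> \<one>\<^bsub>G\<^esub>"

lemma finite_G: "finite (carrier G)"
using order p0 by (metis order_gt_0_iff_finite)

lemma bij_tau: "bij_betw (%k. \<tau> ^@ k) {..<p} (carrier G)"
proof -
have ot: "ord \<tau> = p"
 using G.generate_pow_card[OF \<tau>] generates order by (simp add: order_def)
have "{0..ord \<tau> - 1} = {..<p}" using ot p0 by auto
then have inj: "inj_on (%k. \<tau> ^@ k) {..<p}"
 using G.ord_inj[OF \<tau>] by simp
have "(%k. \<tau> ^@ k) ` {..<p} = carrier G"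
proof (rule card_subset_eq[OF finite_G])
 show "(%k. \<tau> ^@ k) ` {..<p} <= carrier G" using \<tau> by auto
 show "card ((%k. \<tau> ^@ k) ` {..<p}) = card (carrier G)"
 using card_image[OF inj] order by (simp add: order_def)
qed
with inj show ?thesis by (simp add: bij_betw_def)
qed

lemma tau_p: "\<tau> ^@ p = \<e>"
using G.pow_order_eq_1[OF \<tau>] order by simp

lemma tau_cases: "g : carrier G ==> \<exists>k<p. g = \<tau> ^@ k"
using bij_tau unfolding bij_betw_def by blast

lemma G_comm: "[|g : carrier G; h : carrier G|] ==> g *@ h = h *@ g"
using tau_cases \<tau> by (metis G.nat_pow_mult add.commute)

lemma sum_translate:
assumes "k : carrier G"
shows "(\<Sum>h\<in>carrier G. F (k *@ h)) = (\<Sum>h\<in>carrier G. (F h :: int))"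
using sum.reindex_bij_betw[of "%h. k *@ h" "carrier G" "carrier G" F] assms
 G.inj_on_cmult G.surj_const_mult by (simp add: bij_betw_def)

lemma R_car: "a : carrier R \<longleftrightarrow> a : carrier G \<rightarrow>\<^sub>E ZZ"
by (simp add: group_ring_def)

lemma R_app [simp]: "[|a : carrier R; g : carrier G|] ==> a g : ZZ"
by (auto simp: R_car)

lemma R_eqI:
assumes "a : carrier R" "b : carrier R" "!!g. g : carrier G ==> a g = b g"
shows "a = b"
using assms by (metis PiE_ext R_car)

lemma R_add: "g : carrier G ==> (a +: b) g = a g +| b g"
and R_zero: "g : carrier G ==> \<o> g = \<z>"
and R_one: "g : carrier G ==> \<r> g = (if g = \<e> then \<u> else \<z>)"
by (simp_all add: group_ring_def)

text \<open>Convolution of integer-valued functions, that is, the product in the group ring at one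
  level before reduction. The ring laws are proved for these plain sums and then reduced modulo
  \<open>p^n\<close>.\<close>

definition conv :: "('g => int) => ('g => int) => 'g => int" where
"conv u v g = (\<Sum>h\<in>carrier G. u h * v (inv@ h *@ g))"

lemma R_mult:
assumes "a : carrier R" "b : carrier R" "g : carrier G"
shows "(a *: b) g n = conv (%h. a h n) (%h. b h n) g mod int p ^ n"
proof -
have "(a *: b) g n = (\<Sum>h\<in>carrier G. (a h *| b (inv@ h *@ g)) n) mod int p ^ n"
 using assms by (simp add: group_ring_def Zp_finsum[OF finite_G])
then show ?thesis by (simp add: Zp_simps conv_def mod_sum_eq)
qed

lemma R_mult_closed: "[|a : carrier R; b : carrier R|] ==> a *: b : carrier R"
by (auto simp: R_car group_ring_def intro!: Zp.finsum_closed)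

lemma conv_mod:
assumes g: "g : carrier G" and u: "!!h. h : carrier G ==> [u h = u' h] (mod m)"
 and v: "!!h. h : carrier G ==> [v h = v' h] (mod m)"
shows "[conv u v g = conv u' v' g] (mod m)"
unfolding conv_def by (intro cong_sum cong_mult u v) (use g in auto)

text \<open>Exchange the two sums and translate the inner variable by \<open>k\<close>.\<close>

lemma conv_assoc:
assumes g: "g : carrier G"
shows "conv (conv u v) w g = conv u (conv v w) g"
proof -
have "conv (conv u v) w g = (\<Sum>k\<in>carrier G. u k * (\<Sum>h\<in>carrier G. v (inv@ k *@ h) * w (inv@ h *@ g)))"
 unfolding conv_def sum_distrib_left sum_distrib_right by (subst sum.swap) (simp add: mult.assoc)
also have "\<dots> = (\<Sum>k\<in>carrier G. u k * conv v w (inv@ k *@ g))"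
proof (rule sum.cong[OF refl])
 fix k assume k: "k : carrier G"
 have "(\<Sum>h\<in>carrier G. v (inv@ k *@ h) * w (inv@ h *@ g))
  = (\<Sum>h\<in>carrier G. v (inv@ k *@ (k *@ h)) * w (inv@ (k *@ h) *@ g))"
 by (rule sum_translate[OF k, symmetric])
 also have "\<dots> = conv v w (inv@ k *@ g)"
 unfolding conv_def using k g
 by (intro sum.cong refl) (simp add: G.m_assoc[symmetric] G.inv_mult_group)
 finally show "u k * (\<Sum>h\<in>carrier G. v (inv@ k *@ h) * w (inv@ h *@ g))
 = u k * conv v w (inv@ k *@ g)" by simp
qed
finally show ?thesis by (simp add: conv_def)
qed

text \<open>The substitution of \<open>h^-1 g\<close> for \<open>h\<close> permutes the group and,
  the group being commutative, exchanges the two factors.\<close>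

lemma conv_comm:
assumes g: "g : carrier G"
shows "conv u v g = conv v u g"
proof -
have inj: "inj_on (%h. inv@ h *@ g) (carrier G)"
 using g by (auto simp: inj_on_def)
have "bij_betw (%h. inv@ h *@ g) (carrier G) (carrier G)"
 unfolding bij_betw_def
 by (rule conjI[OF inj endo_inj_surj[OF finite_G _ inj]]) (use g in auto)
from sum.reindex_bij_betw[OF this, of "%h. v h * u (inv@ h *@ g)"]
have "conv v u g = (\<Sum>h\<in>carrier G. v (inv@ h *@ g) * u (inv@ (inv@ h *@ g) *@ g))"
 by (simp add: conv_def)
also have "\<dots> = conv u v g"
 unfolding conv_def
proof (rule sum.cong[OF refl])
 fix h assume h: "h : carrier G"
 have "inv@ (inv@ h *@ g) *@ g = inv@ g *@ (h *@ g)"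
 using h g by (simp add: G.inv_mult_group G.m_assoc)
 also have "\<dots> = h"
 using h g by (simp add: G_comm[OF h g] G.m_assoc[symmetric])
 finally show "v (inv@ h *@ g) * u (inv@ (inv@ h *@ g) *@ g)
 = u h * v (inv@ h *@ g)" by simp
qed
finally show ?thesis by simp
qed

lemma conv_delta:
assumes "k : carrier G"
shows "conv (%h. if h = k then c else 0) v g = c * v (inv@ k *@ g)"
proof -
have "conv (%h. if h = k then c else 0) v g
 = (\<Sum>h\<in>carrier G. if h = k then c * v (inv@ h *@ g) else 0)"
 unfolding conv_def by (rule sum.cong) auto
then show ?thesis using assms finite_G by simp
qed

lemma R_mult_one:
assumes a: "a : carrier R" and g: "g : carrier G" and k: "k : carrier G" and c: "c : ZZ"
shows "(gr_single (Zp p) G c k *: a) g = c *| a (inv@ k *@ g)"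
proof
fix n
have s: "gr_single (Zp p) G c k : carrier R" using c by (auto simp: R_car gr_single_def)
have "[conv (%h. gr_single (Zp p) G c k h n) (%h. a h n) g
 = conv (%h. if h = k then c n else 0) (%h. a h n) g] (mod int p ^ n)"
 by (rule conv_mod[OF g]) (simp_all add: gr_single_def Zp_simps)
then show "(gr_single (Zp p) G c k *: a) g n = (c *| a (inv@ k *@ g)) n"
 using R_mult[OF s a g] conv_delta[OF k] by (simp add: cong_def Zp_simps)
qed

lemma R_one_single: "\<r> = gr_single (Zp p) G \<u> \<e>"
by (simp add: group_ring_def gr_single_def)

lemma gr_single_closed [simp]: "c : ZZ ==> gr_single (Zp p) G c k : carrier R"
by (auto simp: R_car gr_single_def)

sublocale R: cring R
proof (rule cringI)
have add: "a +: b : carrier R" if "a : carrier R" "b : carrier R" for a b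
 using that by (auto simp: R_car group_ring_def)
show "abelian_group R"
proof (rule abelian_groupI)
 show "\<o> : carrier R" by (auto simp: R_car group_ring_def)
 fix a b assume a: "a : carrier R" and b: "b : carrier R"
 show "a +: b : carrier R" by (rule add[OF a b])
 show "a +: b = b +: a"
 using a b add by (intro R_eqI) (simp_all add: R_add Zp.a_comm)
 fix c assume c: "c : carrier R"
 show "a +: b +: c = a +: (b +: c)"
 using a b c add by (intro R_eqI) (simp_all add: R_add Zp.a_assoc)
next
 have z: "\<o> : carrier R" by (auto simp: R_car group_ring_def)
 fix a assume a: "a : carrier R"
 show "\<o> +: a = a"
 using a add z by (intro R_eqI) (simp_all add: R_add R_zero)
 have "(\<lambda>g\<in>carrier G. -| a g) : carrier R" using a by (auto simp: R_car)
 moreover from this have "(\<lambda>g\<in>carrier G. -| a g) +: a = \<o>"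
 using a add z by (intro R_eqI) (simp_all add: R_add R_zero Zp.l_neg)
 ultimately show "EX b:carrier R. b +: a = \<o>" by blast
qed
show "comm_monoid R"
proof (rule comm_monoidI)
 show "\<r> : carrier R" by (simp add: R_one_single)
 fix a b assume a: "a : carrier R" and b: "b : carrier R"
 show "a *: b : carrier R" by (rule R_mult_closed[OF a b])
 show "a *: b = b *: a"
 proof (intro R_eqI ext)
 fix g n assume "g : carrier G"
 then show "(a *: b) g n = (b *: a) g n"
  by (simp only: R_mult a b conv_comm)
 qed (simp_all add: R_mult_closed a b)
 fix c assume c: "c : carrier R"
 show "a *: b *: c = a *: (b *: c)"
 proof (intro R_eqI ext)
 fix g n assume g: "g : carrier G"
 let ?a = "%h. a h n" and ?b = "%h. b h n" and ?c = "%h. c h n"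
 have "[conv (%h. (a *: b) h n) ?c g = conv (conv ?a ?b) ?c g] (mod int p ^ n)"
  by (rule conv_mod[OF g]) (simp_all add: R_mult a b)
 moreover have "[conv ?a (%h. (b *: c) h n) g = conv ?a (conv ?b ?c) g] (mod int p ^ n)"
  by (rule conv_mod[OF g]) (simp_all add: R_mult b c)
 ultimately show "(a *: b *: c) g n = (a *: (b *: c)) g n"
  by (simp add: R_mult[OF R_mult_closed[OF a b] c g] R_mult[OF a R_mult_closed[OF b c] g]
   conv_assoc[OF g] cong_def)
 qed (simp_all add: R_mult_closed a b c)
next
 fix a assume a: "a : carrier R"
 show "\<r> *: a = a"
 using a by (intro R_eqI) (simp_all add: R_one_single R_mult_closed R_mult_one)
qed
fix a b c assume a: "a : carrier R" and b: "b : carrier R" and c: "c : carrier R"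
show "(a +: b) *: c = a *: c +: b *: c"
proof (intro R_eqI ext)
 fix g n assume g: "g : carrier G"
 have "[conv (%h. (a +: b) h n) (%h. c h n) g = conv (%h. a h n + b h n) (%h. c h n) g] (mod int p ^ n)"
 by (rule conv_mod[OF g]) (simp_all add: R_add Zp_simps)
 also have "conv (%h. a h n + b h n) (%h. c h n) g = conv (%h. a h n) (%h. c h n) g + conv (%h. b h n) (%h. c h n) g"
 by (simp add: conv_def distrib_right sum.distrib)
 finally show "((a +: b) *: c) g n = (a *: c +: b *: c) g n"
 using g by (simp add: R_mult a b c add R_add Zp_simps(3) cong_def mod_simps)
qed (simp_all add: R_mult_closed a b c add)
qed

end

section \<open>Augmentation, norm and the element tau - 1\<close>

context padic_group
begin

definition cst :: "padic => 'g => padic" where "cst c = gr_single (Zp p) G c \<e>"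
definition T :: "'g => padic" where "T = gr_single (Zp p) G \<u> \<tau>"
definition \<sigma> :: "'g => padic" where "\<sigma> = T -: \<r>"
definition nrm :: "'g => padic" where "nrm = (\<lambda>g\<in>carrier G. \<u>)"
text \<open>The augmentation. Its kernel is generated by \<open>\<sigma>\<close>, and an element is
  a unit if its augmentation is nonzero modulo \<open>p\<close>.\<close>

definition eps :: "('g => padic) => padic" where "eps a = (\<Oplus>\<^bsub>Zp p\<^esub>g\<in>carrier G. a g)"

lemma closed [simp]: "c : ZZ ==> cst c : carrier R" "T : carrier R" "\<sigma> : carrier R"
"nrm : carrier R" "a : carrier R ==> eps a : ZZ"
by (simp_all add: cst_def T_def \<sigma>_def eps_def Zp.finsum_closed) (simp add: nrm_def R_car)

lemma cst_mult: "[|c : ZZ; a : carrier R; g : carrier G|] ==> (cst c *: a) g = c *| a g"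
by (simp add: cst_def R_mult_one)

lemma cst_one: "cst \<u> = \<r>"
by (simp add: cst_def R_one_single)

lemma cst_app: "g : carrier G ==> cst c g = (if g = \<e> then c else \<z>)"
by (simp add: cst_def gr_single_def)

lemma cst_hom:
assumes c: "c : ZZ" "d : ZZ"
shows "cst (c *| d) = cst c *: cst d" "cst (c +| d) = cst c +: cst d"
by (rule R_eqI; use c in \<open>simp add: cst_mult cst_app R_add\<close>)+

lemma cst_zero: "cst \<z> = \<o>"
by (rule R_eqI) (simp_all add: cst_app R_zero)

lemma add_pow_cst: "[d] \<cdot>\<^bsub>R\<^esub> \<r> = cst (Zp_int p (int d))" for d :: nat
proof (induction d)
case (Suc d)
have "Zp_int p (int (Suc d)) = Zp_int p (int d) +| \<u>"
 by (simp add: Zp_int_01(2)[symmetric] Zp_int_add add.commute)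
then show ?case using Suc by (simp add: cst_hom cst_one)
qed (simp add: Zp_int_01 cst_zero)

lemma cst_unit:
assumes c: "c : Units (Zp p)"
shows "cst c : Units R"
proof -
have "cst (inv\<^bsub>Zp p\<^esub> c) *: cst c = \<r>" "cst c *: cst (inv\<^bsub>Zp p\<^esub> c) = \<r>"
 using c by (simp_all add: Zp.Units_closed cst_hom(1)[symmetric] cst_one)
then show ?thesis using c unfolding Units_def[of R] by (auto simp: Zp.Units_closed)
qed

lemma eps_level: "a : carrier R ==> eps a n = (\<Sum>g\<in>carrier G. a g n) mod int p ^ n"
unfolding eps_def by (rule Zp_finsum[OF finite_G]) auto

lemma eps_mult:
assumes a: "a : carrier R" and b: "b : carrier R"
shows "eps (a *: b) = eps a *| eps b"
proof
fix n
have "(\<Sum>g\<in>carrier G. conv (%h. a h n) (%h. b h n) g)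
 = (\<Sum>h\<in>carrier G. a h n * (\<Sum>g\<in>carrier G. b (inv@ h *@ g) n))"
 unfolding conv_def sum_distrib_left by (rule sum.swap)
also have "\<dots> = (\<Sum>h\<in>carrier G. a h n) * (\<Sum>g\<in>carrier G. b g n)"
 unfolding sum_distrib_right
 by (intro sum.cong refl arg_cong2[where f = "(*)"] sum_translate[where F = "%g. b g n"]) simp
finally show "eps (a *: b) n = (eps a *| eps b) n"
 using a b by (simp add: eps_level Zp_simps(2) R_mult mod_sum_eq mod_simps)
qed

lemma eps_add:
assumes a: "a : carrier R" and b: "b : carrier R"
shows "eps (a +: b) = eps a +| eps b"
by (rule ext) (simp add: a b eps_level Zp_simps(3) R_add sum.distrib mod_sum_eq mod_simps)

lemma eps_cst: "c : ZZ ==> eps (cst c) = c"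
proof
fix n assume c: "c : ZZ"
have "(\<Sum>g\<in>carrier G. cst c g n) = (\<Sum>g\<in>carrier G. if g = \<e> then c n else 0)"
 by (rule sum.cong) (auto simp: cst_app Zp_simps)
then show "eps (cst c) n = c n" using c finite_G by (simp add: eps_level)
qed

lemma eps_one: "eps \<r> = \<u>"
using eps_cst[of "\<u>"] by (simp add: cst_one)

lemma eps_T: "eps T = \<u>"
proof
fix n
have "(\<Sum>g\<in>carrier G. T g n) = (\<Sum>g\<in>carrier G. if g = \<tau> then \<u> n else 0)"
 by (rule sum.cong) (auto simp: T_def gr_single_def Zp_simps)
then show "eps T n = \<u> n" using finite_G \<tau> by (simp add: eps_level)
qed

lemma eps_minus:
assumes a: "a : carrier R" and b: "b : carrier R"
shows "eps (a -: b) = eps a -| eps b"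
proof -
have "eps (a -: b) +| eps b = eps a"
 using a b by (simp add: eps_add[symmetric] R.minus_eq R.a_assoc R.l_neg)
then show ?thesis using a b Zp.add.m_assoc[of "eps (a -: b)" "eps b" "-| eps b"]
 by (simp add: Zp.minus_eq Zp.r_neg)
qed

lemma eps_sigma: "eps \<sigma> = \<z>"
by (simp add: \<sigma>_def eps_minus eps_T eps_one Zp.minus_eq Zp.r_neg)

lemma eps_nrm: "eps nrm = Zp_int p (int p)"
proof
fix n
have "(\<Sum>g\<in>carrier G. nrm g n) = (\<Sum>g\<in>carrier G. 1 mod int p ^ n)"
 by (rule sum.cong) (auto simp: nrm_def Zp_simps)
then show "eps nrm n = Zp_int p (int p) n"
 using order by (simp add: eps_level order_def Zp_int_def mod_simps)
qed

lemma nrm_mult: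
assumes a: "a : carrier R" and g: "g : carrier G"
shows "(nrm *: a) g = eps a"
proof
fix n
have "[conv (%h. a h n) (%h. nrm h n) g = conv (%h. a h n) (%h. 1) g] (mod int p ^ n)"
 by (rule conv_mod[OF g]) (simp_all add: nrm_def Zp_simps)
then have "(a *: nrm) g n = eps a n"
 using a g by (simp add: R_mult eps_level conv_def cong_def)
then show "(nrm *: a) g n = eps a n" using R.m_comm[OF closed(4) a] by simp
qed

lemma nrm_const:
assumes a: "a : carrier R" and c: "!!g. g : carrier G ==> a g = a \<e>"
shows "a = nrm *: cst (a \<e>)"
proof (rule R_eqI)
fix g assume g: "g : carrier G"
show "a g = (nrm *: cst (a \<e>)) g"
 unfolding c[OF g] using a g by (simp add: nrm_mult eps_cst)
qed (use a in simp_all)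

lemma nrm_zero: "a : carrier R ==> nrm *: a = \<o> \<longleftrightarrow> eps a = \<z>"
proof
assume a: "a : carrier R"
show "eps a = \<z>" if "nrm *: a = \<o>"
 using nrm_mult[OF a, of "\<e>"] that by (simp add: R_zero)
show "nrm *: a = \<o>" if "eps a = \<z>"
 by (rule R_eqI) (use a that in \<open>simp_all add: nrm_mult R_zero\<close>)
qed

lemma sigma_mult:
assumes a: "a : carrier R"
shows "g : carrier G ==> (\<sigma> *: a) g = a (inv@ \<tau> *@ g) -| a g"
proof -
assume g: "g : carrier G"
have "\<sigma> *: a +: a = T *: a"
 using a by (simp add: \<sigma>_def R.minus_eq R.l_distr R.l_minus R.a_assoc R.l_neg)
moreover have "(T *: a) g = a (inv@ \<tau> *@ g)"
 using a g \<tau> by (simp add: T_def R_mult_one)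
ultimately have "(\<sigma> *: a) g +| a g = a (inv@ \<tau> *@ g)"
 using g by (metis R_add)
then show ?thesis
 using Zp.add.m_assoc[of "(\<sigma> *: a) g" "a g" "-| a g"] a g
 by (simp add: Zp.minus_eq Zp.r_neg)
qed

lemma sigma_mult_pow:
assumes a: "a : carrier R" and k: "k < p"
shows "(\<sigma> *: a) (\<tau> ^@ k)
 = a (\<tau> ^@ (if k = 0 then p - 1 else k - 1)) -| a (\<tau> ^@ k)"
proof -
have "inv@ \<tau> *@ \<tau> ^@ Suc j = \<tau> ^@ j" for j
 using \<tau> G.nat_pow_Suc2[OF \<tau>, of j] by (simp add: G.m_assoc[symmetric] del: G.nat_pow_Suc)
moreover from this[of "p - 1"] have "inv@ \<tau> *@ \<e> = \<tau> ^@ (p - 1)"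
 using tau_p p0 by simp
ultimately have "inv@ \<tau> *@ \<tau> ^@ k = \<tau> ^@ (if k = 0 then p - 1 else k - 1)"
 by (cases k) (simp_all del: G.nat_pow_Suc)
then show ?thesis using sigma_mult[OF a] \<tau> by simp
qed

lemma R_function:
assumes "!!k. k < p ==> c k : ZZ"
obtains a where "a : carrier R" "!!k. k < p ==> a (\<tau> ^@ k) = c k"
proof -
let ?i = "inv_into {..<p} (%k. \<tau> ^@ k)"
have i: "?i g < p" if "g : carrier G" for g
 using that bij_betw_inv_into[OF bij_tau] by (auto simp: bij_betw_def)
show thesis
 by (rule that[of "\<lambda>g\<in>carrier G. c (?i g)"])
 (use assms i \<tau> bij_betw_inv_into_left[OF bij_tau] in \<open>auto simp: R_car\<close>)
qed

lemma R_pow_eqI: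
assumes "a : carrier R" "b : carrier R" "!!k. k < p ==> a (\<tau> ^@ k) = b (\<tau> ^@ k)"
shows "a = b"
using assms tau_cases by (metis R_eqI)

lemma eps_pow: "a : carrier R ==> eps a = (\<Oplus>\<^bsub>Zp p\<^esub>k\<in>{..<p}. a (\<tau> ^@ k))"
unfolding eps_def using Zp.finsum_reindex[of a "%k. \<tau> ^@ k" "{..<p}"] bij_tau
by (auto simp: bij_betw_def)

text \<open>The quotient of \<open>a\<close> by \<open>\<tau> - 1\<close> has the partial sums of the coefficients of \<open>a\<close>.\<close>

lemma eps_zero:
assumes a: "a : carrier R" and e: "eps a = \<z>"
shows "EX b:carrier R. a = \<sigma> *: b"
proof -
define S where "S k = (\<Oplus>\<^bsub>Zp p\<^esub>j\<in>{..<k}. a (\<tau> ^@ j))" for k :: nat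
have S: "S k : ZZ" for k unfolding S_def using a \<tau> by (auto intro!: Zp.finsum_closed)
have Suc: "S (Suc k) = a (\<tau> ^@ k) +| S k" for k
 unfolding S_def lessThan_Suc using a \<tau> by (subst Zp.finsum_insert) auto
obtain b where b: "b : carrier R" "!!k. k < p ==> b (\<tau> ^@ k) = -| S (Suc k)"
 using R_function[of "%k. -| S (Suc k)"] S by auto
have "a = \<sigma> *: b"
proof (rule R_pow_eqI)
 fix k assume k: "k < p"
 have prev: "b (\<tau> ^@ (if k = 0 then p - 1 else k - 1)) = -| S k"
 proof (cases k)
 case 0
 have "S p = \<z>" using e eps_pow[OF a] by (simp add: S_def)
 moreover have "S 0 = \<z>" by (simp add: S_def)
 ultimately show ?thesis using 0 b(2)[of "p - 1"] p0 by simp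
 next
 case (Suc j)
 then show ?thesis using k b(2)[of j] by simp
 qed
 have "(\<sigma> *: b) (\<tau> ^@ k) = -| S k +| (a (\<tau> ^@ k) +| S k)"
 using sigma_mult_pow[OF b(1) k] prev b(2)[OF k] S a \<tau> by (simp add: Zp.minus_eq Suc)
 also have "\<dots> = a (\<tau> ^@ k)"
 using S[of k] a \<tau> by (simp add: Zp.a_lcomm[of "-| S k"] Zp.l_neg)
 finally show "a (\<tau> ^@ k) = (\<sigma> *: b) (\<tau> ^@ k)" by simp
qed (use a b in simp_all)
then show ?thesis using b(1) by blast
qed

text \<open>\<open>\<sigma> a = 0\<close> makes the coefficients at consecutive powers of
  \<open>\<tau>\<close> equal, so \<open>a\<close> is a constant function.\<close>

lemma sigma_zero:
assumes a: "a : carrier R" and z: "\<sigma> *: a = \<o>"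
shows "a = nrm *: cst (a \<e>)"
proof (rule nrm_const[OF a])
have "a (\<tau> ^@ k) = a \<e>" if "k < p" for k
 using that
proof (induction k)
 case (Suc k)
 have "(\<sigma> *: a) (\<tau> ^@ Suc k) = \<z>" using z \<tau> by (simp only: R_zero G.nat_pow_closed)
 then have "a (\<tau> ^@ k) -| a (\<tau> ^@ Suc k) = \<z>"
 using sigma_mult_pow[OF a Suc.prems] by (simp del: G.nat_pow_Suc)
 then have "a (\<tau> ^@ k) = a (\<tau> ^@ Suc k)"
 using Zp.diff_zero_iff a \<tau> by (simp del: G.nat_pow_Suc)
 then show ?case using Suc by simp
qed simp
then show "a g = a \<e>" if "g : carrier G" for g using tau_cases[OF that] by auto
qed

lemma decompose:
assumes a: "a : carrier R"
shows "EX b:carrier R. a = cst (eps a) +: \<sigma> *: b"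
proof -
have "eps (a -: cst (eps a)) = \<z>"
 using a by (simp add: eps_minus eps_cst Zp.minus_eq Zp.r_neg)
then obtain b where b: "b : carrier R" "a -: cst (eps a) = \<sigma> *: b"
 using eps_zero[of "a -: cst (eps a)"] a by auto
have "a = cst (eps a) +: (a -: cst (eps a))"
 using a by (simp add: R.minus_eq R.a_lcomm[of _ a] R.r_neg)
then show ?thesis using b by auto
qed

lemma sigma_nrm: "\<sigma> *: nrm = \<o>"
using nrm_zero[of \<sigma>] eps_sigma R.m_comm[of \<sigma> nrm] by simp

lemma eps_sigma_mult [simp]: "b : carrier R ==> eps (\<sigma> *: b) = \<z>"
by (simp add: eps_mult eps_sigma)

text \<open>\<open>p\<close> and \<open>nrm\<close> have the same augmentation, so they differ by a
  multiple of \<open>\<sigma>\<close>. This puts \<open>p\<close> into the maximal ideal, and the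
  element \<open>b\<close> later serves to compute norms in the extensions of A.\<close>

lemma p_decompose: "EX b:carrier R. [p] \<cdot>\<^bsub>R\<^esub> \<r> = \<sigma> *: b +: nrm"
proof -
let ?p = "cst (Zp_int p (int p))"
have "eps (?p -: nrm) = \<z>"
 by (simp add: eps_minus eps_cst eps_nrm Zp.minus_eq Zp.r_neg)
then obtain b where b: "b : carrier R" "?p -: nrm = \<sigma> *: b"
 using eps_zero[of "?p -: nrm"] by auto
have "?p = ?p -: nrm +: nrm"
 by (simp add: R.minus_eq R.a_assoc R.l_neg)
then show ?thesis using b by (auto simp: add_pow_cst)
qed

end

section \<open>Z_p[G] is a nodal ring\<close>

context padic_group
begin

lemma Zp_int_app: "Zp_int p j n = j mod int p ^ n"
by (simp add: Zp_int_def)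

lemma Zp_int_minus: "Zp_int p j -| Zp_int p k = Zp_int p (j - k)"
proof -
have "Zp_int p j = Zp_int p (j - k) +| Zp_int p k" by (simp add: Zp_int_add)
then show ?thesis by (simp add: Zp.minus_eq Zp.a_assoc Zp.r_neg)
qed

text \<open>The binomial expansion of \<open>(\<tau> - 1)^k\<close>. For \<open>k < p\<close> no two
  of its terms fall on the same group element.\<close>

lemma sigma_pow_coeff:
"[|k < p; j < p|] ==> (\<sigma> ^: k) (\<tau> ^@ j) = Zp_int p ((-1) ^ (k + j) * int (k choose j))"
proof (induction k arbitrary: j)
case 0
have "\<tau> ^@ j = \<e> \<longleftrightarrow> j = 0"
 using inj_onD[of "%k. \<tau> ^@ k" "{..<p}" j 0] bij_tau 0(2) by (auto simp: bij_betw_def)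
then show ?case using \<tau> Zp_int_01 by (cases j) (simp_all add: R_one)
next
case (Suc k)
have s: "(\<sigma> ^: Suc k) (\<tau> ^@ j)
 = (\<sigma> ^: k) (\<tau> ^@ (if j = 0 then p - 1 else j - 1)) -| (\<sigma> ^: k) (\<tau> ^@ j)"
 using sigma_mult_pow[of "\<sigma> ^: k" j] Suc.prems R.m_comm[of "\<sigma> ^: k" \<sigma>] by simp
show ?case
proof (cases j)
 case 0
 \<comment> \<open>At \<open>j = 0\<close> the predecessor wraps around to \<open>p - 1\<close>,
   where the coefficient of \<open>\<sigma>^k\<close> is zero because
   \<open>k < p - 1\<close>.\<close>
 have "k choose (p - 1) = 0" using Suc.prems by simp
 then show ?thesis unfolding s using 0 Suc.IH[of 0] Suc.IH[of "p - 1"] Suc.prems p0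
 by (simp add: Zp_int_minus binomial_eq_0)
next
 case (Suc i)
 then show ?thesis unfolding s using Suc.IH[of i] Suc.IH[of j] \<open>Suc k < p\<close> \<open>j < p\<close>
 by (simp add: Zp_int_minus algebra_simps)
qed
qed

lemma divisible:
assumes a: "a : carrier R" and z: "!!g. g : carrier G ==> a g k = 0"
shows "EX d:carrier R. a = cst (Zp_int p (int p ^ k)) *: d"
proof -
have "ALL g:carrier G. \<exists>y. y : ZZ & a g = Zp_int p (int p ^ k) *| y"
 using Zp_divide a z by (meson R_app)
then obtain d where d: "!!g. g : carrier G ==> d g : ZZ & a g = Zp_int p (int p ^ k) *| d g"
 by metis
have dR: "restrict d (carrier G) : carrier R" using d by (auto simp: R_car)
have "a = cst (Zp_int p (int p ^ k)) *: restrict d (carrier G)"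
 by (rule R_eqI) (use a d dR in \<open>simp_all add: cst_mult\<close>)
then show ?thesis using dR by blast
qed

text \<open>Modulo \<open>p\<close> the inner binomial coefficients vanish. The two outer terms of
  \<open>(\<tau> - 1)^p\<close> meet at the neutral element since \<open>\<tau>^p = 1\<close>, and
  they cancel because \<open>p\<close> is odd.\<close>

lemma sigma_pow_p: "EX d:carrier R. \<sigma> ^: p = cst (Zp_int p (int p)) *: d"
proof -
obtain m where m: "p = Suc m" using p0 by (cases p) auto
then have ev: "even m" and mp: "m < p" using odd_p by auto
have sp: "\<sigma> ^: p = \<sigma> *: \<sigma> ^: m" and pm: "p - 1 = m"
 using arg_cong[OF m, of "%k. \<sigma> ^: k"] R.m_comm[of "\<sigma> ^: m" \<sigma>] by simp (use m in simp)
have "(\<sigma> ^: p) (\<tau> ^@ j) 1 = 0" if j: "j < p" for j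
proof -
 have s: "(\<sigma> ^: p) (\<tau> ^@ j)
  = (\<sigma> ^: m) (\<tau> ^@ (if j = 0 then m else j - 1)) -| (\<sigma> ^: m) (\<tau> ^@ j)"
 unfolding sp using sigma_mult_pow[of "\<sigma> ^: m" j] j unfolding pm by simp
 show ?thesis
 proof (cases j)
 case 0
 then show ?thesis unfolding s
  using sigma_pow_coeff[OF mp, of m] sigma_pow_coeff[OF mp, of 0] mp p0 ev
  by (simp add: Zp_int_minus Zp_int_app)
 next
 case (Suc i)
 have "(\<sigma> ^: p) (\<tau> ^@ j) = Zp_int p ((-1) ^ (m + i) * int (p choose j))"
 proof -
  have c: "p choose Suc i = (m choose i) + (m choose Suc i)" unfolding m by simp
  show ?thesis unfolding s using sigma_pow_coeff[OF mp, of i] sigma_pow_coeff[OF mp, of j] j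
  by (simp add: Suc c Zp_int_minus algebra_simps del: G.nat_pow_Suc)
 qed
 moreover have "int p dvd int (p choose j)" using dvd_choose_prime[of j p] p p0 j Suc by simp
 then have "int p dvd (-1) ^ (m + i) * int (p choose j)" by (rule dvd_mult)
 ultimately show ?thesis by (simp add: Zp_int_app)
 qed
qed
then have "(\<sigma> ^: p) g 1 = 0" if "g : carrier G" for g using tau_cases[OF that] by auto
then show ?thesis using divisible[of "\<sigma> ^: p" 1] by simp
qed

lemma cst_pow: "cst (Zp_int p j) ^: k = cst (Zp_int p (j ^ k))" for k :: nat
by (induction k) (simp_all add: cst_one[symmetric] Zp_int_01(2)[symmetric] cst_hom(1)[symmetric] Zp_int_mult mult.commute)

lemma sigma_pow_mult: "EX d:carrier R. \<sigma> ^: (p * k) = cst (Zp_int p (int p ^ k)) *: d" for k :: nat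
proof -
obtain d where d: "d : carrier R" "\<sigma> ^: p = cst (Zp_int p (int p)) *: d"
 using sigma_pow_p by blast
have "\<sigma> ^: (p * k) = (\<sigma> ^: p) ^: k" by (simp add: R.nat_pow_pow)
also have "\<dots> = cst (Zp_int p (int p ^ k)) *: d ^: k"
 unfolding d(2) using d(1) by (simp add: R.nat_pow_distrib cst_pow)
finally show ?thesis using d(1) by blast
qed

lemma one_minus_mult:
assumes "x : carrier R" "z : carrier R" "y : carrier R" "x *: z +: \<r> = z +: y"
shows "(\<r> -: x) *: z = \<r> -: y"
proof -
have "(\<r> -: x) *: z = (z +: y) -: y -: x *: z"
 using assms(1-3) by (simp add: R.minus_eq R.l_distr R.l_minus R.a_assoc R.r_neg)
also have "\<dots> = \<r> -: y"
 unfolding assms(4)[symmetric] using assms(1-3)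
 by (simp add: R.minus_eq R.a_ac R.r_neg R.r_neg1)
finally show ?thesis .
qed

text \<open>The geometric series converges: modulo \<open>p\<^sup>n\<close> it agrees with its first \<open>n\<close> terms.\<close>

lemma unit_minus_p:
assumes y: "y : carrier R"
shows "\<r> -: cst (Zp_int p (int p)) *: y : Units R"
proof -
define x where "x = cst (Zp_int p (int p)) *: y"
have x: "x : carrier R" using y by (simp add: x_def)
define S where "S N = (\<Oplus>\<^bsub>R\<^esub>j\<in>{..<N}. x ^: j)" for N :: nat
have S: "S N : carrier R" for N unfolding S_def using x by (auto intro!: R.finsum_closed)
have pow: "(x ^: N) g N = 0" if "g : carrier G" for g and N :: nat
proof -
 have "x ^: N = cst (Zp_int p (int p ^ N)) *: y ^: N"
 unfolding x_def using y by (simp add: R.nat_pow_distrib cst_pow)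
 then show ?thesis using that y by (simp add: cst_mult Zp_simps(2) Zp_int_app)
qed
have stable: "S (Suc N) g N = S N g N" if g: "g : carrier G" for g N
proof -
 have "S (Suc N) = x ^: N +: S N"
 unfolding S_def lessThan_Suc using x by (subst R.finsum_insert) auto
 then show ?thesis using g pow[OF g] S by (simp add: R_add Zp_simps(3))
qed
define z where "z = (\<lambda>g\<in>carrier G. %n. S n g n)"
have "(%n. S n g n) : ZZ" if g: "g : carrier G" for g
proof -
 have "S (Suc n) g (Suc n) mod int p ^ n = S n g n" for n
 using Zp_mod_le[of "S (Suc n) g" p n "Suc n"] S g stable[OF g] by simp
 then show ?thesis using Zp_range[OF R_app[OF S g]] by (simp add: Zp_simps(1))
qed
then have z: "z : carrier R" by (auto simp: R_car z_def)
have "x *: z +: \<r> = z"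
proof (rule R_eqI)
 fix g assume g: "g : carrier G"
 show "(x *: z +: \<r>) g = z g"
 proof
 fix n
 have "[conv (%h. x h n) (%h. z h n) g = conv (%h. x h n) (%h. S n h n) g] (mod int p ^ n)"
  by (rule conv_mod[OF g]) (simp_all add: z_def)
 then have "(x *: z) g n = (x *: S n) g n"
  using x z S g by (simp add: R_mult cong_def)
 then have "(x *: z +: \<r>) g n = (x *: S n +: \<r>) g n"
  using g by (simp add: R_add Zp_simps(3))
 also have "\<dots> = (S n +: x ^: n) g n" unfolding S_def R.geometric_sum[OF x] ..
 also have "\<dots> = z g n" using g pow[OF g] S by (simp add: R_add Zp_simps(3) z_def)
 finally show "(x *: z +: \<r>) g n = z g n" .
 qed
qed (use x z in simp_all)
then have "(\<r> -: x) *: z = \<r>"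
 using one_minus_mult[OF x z, of "\<o>"] z by (simp add: R.minus_eq)
then show ?thesis unfolding x_def[symmetric] using x z R.m_comm[of "\<r> -: x" z]
 unfolding Units_def[of R] by auto
qed

lemma unit_factor: "[|x : carrier R; y : carrier R; x *: y : Units R|] ==> x : Units R"
proof -
assume x: "x : carrier R" and y: "y : carrier R" and u: "x *: y : Units R"
let ?i = "y *: inv\<^bsub>R\<^esub> (x *: y)"
have "x *: ?i = \<r>" using x y u R.Units_r_inv[OF u] R.m_assoc[of x y "inv\<^bsub>R\<^esub> (x *: y)"] by simp
then show ?thesis unfolding Units_def[of R] using x y u R.m_comm[of x ?i] by auto
qed

text \<open>The \<open>p\<close>-th power of \<open>\<sigma> b\<close> is a multiple of
  \<open>p\<close>. Hence the geometric sum with \<open>p\<close> terms multiplies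
  \<open>1 - \<sigma> b\<close> to an element \<open>1 - p y\<close>, which is a unit.\<close>

lemma unit_minus_sigma:
assumes b: "b : carrier R"
shows "\<r> -: \<sigma> *: b : Units R"
proof -
let ?x = "\<sigma> *: b" and ?S = "\<Oplus>\<^bsub>R\<^esub>j\<in>{..<p}. (\<sigma> *: b) ^: j"
have x: "?x : carrier R" and S: "?S : carrier R" using b by (auto intro!: R.finsum_closed)
obtain d where d: "d : carrier R" "\<sigma> ^: p = cst (Zp_int p (int p)) *: d"
 using sigma_pow_p by blast
have xp: "?x ^: p = cst (Zp_int p (int p)) *: (d *: b ^: p)"
 using b d by (simp add: R.nat_pow_distrib R.m_assoc)
have "(\<r> -: ?x) *: ?S = \<r> -: ?x ^: p"
 by (rule one_minus_mult[OF x S _ R.geometric_sum[OF x]]) (use x in simp)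
then have "(\<r> -: ?x) *: ?S : Units R"
 unfolding xp using unit_minus_p[of "d *: b ^: p"] b d by simp
then show ?thesis using unit_factor[of "\<r> -: ?x" ?S] x S by simp
qed

text \<open>The constant given by the augmentation is a unit; dividing by it leaves an element of
  the form \<open>1 - \<sigma> b\<close>.\<close>

lemma unit_eps:
assumes a: "a : carrier R" and e: "eps a 1 ~= 0"
shows "a : Units R"
proof -
have u: "cst (eps a) : Units R" using cst_unit Zp_unit a e by simp
let ?i = "inv\<^bsub>R\<^esub> (cst (eps a))"
obtain b where b: "b : carrier R" "a = cst (eps a) +: \<sigma> *: b" using decompose[OF a] by blast
have i: "?i : carrier R" using u by simp
have "a *: ?i = cst (eps a) *: ?i +: \<sigma> *: b *: ?i"
 by (subst b(2)) (use a b(1) i in \<open>simp add: R.l_distr\<close>)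
also have "\<dots> = \<r> -: \<sigma> *: (-: (b *: ?i))"
 using u b(1) i by (simp add: R.minus_eq R.r_minus R.m_assoc)
finally show ?thesis using unit_minus_sigma[of "-: (b *: ?i)"] unit_factor[OF a i] b(1) i by simp
qed

lemma Zp_int_p_pow_nonzero: "Zp_int p (int p ^ k) ~= \<z>"
proof
assume "Zp_int p (int p ^ k) = \<z>"
then have "Zp_int p (int p ^ k) (Suc k) = 0" by (simp add: Zp_simps)
moreover have "int p ^ k mod int p ^ Suc k = int p ^ k"
 using p0 by (intro mod_pos_pos_trivial) auto
ultimately show False using p0 by (simp add: Zp_int_app)
qed

lemma eps_nrm_pow: "eps (nrm ^: k) = Zp_int p (int p ^ k)" for k :: nat
by (induction k) (simp_all add: eps_one Zp_int_01(2)[symmetric] eps_mult eps_nrm Zp_int_mult mult.commute)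

lemma eps_R_zero: "eps \<o> = \<z>"
using eps_cst[of "\<z>"] by (simp add: cst_zero)

lemma eps_nrm_mult: "b : carrier R ==> eps (nrm *: b) = Zp_int p (int p) *| eps b"
by (simp add: eps_mult eps_nrm)

text \<open>If \<open>\<sigma>^(k+1) = 0\<close>, then \<open>\<sigma>^k\<close> is
  \<open>nrm\<close> times a constant, and its augmentation is \<open>p\<close> times that constant.
  For \<open>k = 0\<close> this augmentation is 1, which is no multiple of \<open>p\<close>; for
  larger \<open>k\<close> it is 0, so the constant and with it \<open>\<sigma>^k\<close>
  vanish.\<close>

lemma sigma_pow_nonzero: "\<sigma> ^: k ~= \<o>" for k :: nat
proof (induction k)
case 0
show ?case using eps_one eps_R_zero by force
next
case (Suc k)
show ?case
proof
 let ?c = "(\<sigma> ^: k) \<e>"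
 assume "\<sigma> ^: Suc k = \<o>"
 then have n: "\<sigma> ^: k = nrm *: cst ?c"
 using sigma_zero[of "\<sigma> ^: k"] R.m_comm[of "\<sigma> ^: k" \<sigma>] by simp
 have c: "?c : ZZ" by simp
 have e: "eps (\<sigma> ^: k) = Zp_int p (int p) *| ?c"
 by (subst n) (simp add: eps_nrm_mult eps_cst)
 show False
 proof (cases k)
 case 0
 then have "\<u> 1 = (Zp_int p (int p) *| ?c) 1" using e by (simp add: eps_one)
 then show False using p0 by (simp add: Zp_simps(2,4) Zp_int_app)
 next
 case (Suc j)
 then have "Zp_int p (int p) *| ?c = \<z>" using e by (simp add: eps_mult eps_sigma)
 then have "?c = \<z>" by (rule Zp_p_cancel[OF c])
 then show False using n \<open>\<sigma> ^: k ~= \<o>\<close> by (simp add: cst_zero)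
 qed
qed
qed

lemma in_max:
assumes a: "a : carrier R" and e: "eps a 1 = 0"
shows "EX b:carrier R. EX c:carrier R. a = \<sigma> *: b +: nrm *: c"
proof -
obtain y where y: "y : ZZ" "eps a = Zp_int p (int p) *| y"
 using Zp_divide[OF closed(5)[OF a] e] by auto
have "eps (a -: nrm *: cst y) = \<z>"
 using a y by (simp add: eps_minus eps_nrm_mult eps_cst Zp.minus_eq Zp.r_neg)
then obtain b where b: "b : carrier R" "a -: nrm *: cst y = \<sigma> *: b"
 using eps_zero[of "a -: nrm *: cst y"] a y by auto
have "a = (a -: nrm *: cst y) +: nrm *: cst y"
 using a y by (simp add: R.minus_eq R.a_assoc R.l_neg)
then show ?thesis using b y by (metis closed(1))
qed

lemma eps_max: "[|a : carrier R; b : carrier R|] ==> eps (\<sigma> *: a +: nrm *: b) 1 = 0"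
by (simp add: eps_add eps_nrm_mult Zp_simps(2,3,5) Zp_int_app)

text \<open>The quotient by \<open>\<sigma>\<close> is seen through the augmentation, where
  \<open>nrm^k\<close> becomes \<open>p^k\<close>; this gives \<open>sep_s\<close>. For
  \<open>sep_n\<close>, \<open>\<sigma>^(p m)\<close> is divisible by \<open>p^m\<close>, so at
  level \<open>m\<close> the element agrees with a multiple of \<open>nrm\<close>, a constant
  function; hence it is constant at every level. The residue of \<open>r\<close> is level 1 of its
  augmentation.\<close>

sublocale nod: nodal_char R \<sigma> nrm p
proof (intro nodal_char.intro nodal_ring.intro nodal_ring_axioms.intro nodal_char_axioms.intro)
show "\<sigma> *: nrm = \<o>" by (rule sigma_nrm)
fix r assume r: "r : carrier R"
show "r : Units R \<or> (EX a:carrier R. EX b:carrier R. r = \<sigma> *: a +: nrm *: b)"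
 using in_max[OF r] unit_eps[OF r] by blast
show "EX b:carrier R. r = \<sigma> *: b" if "nrm *: r = \<o>"
 using eps_zero[OF r] nrm_zero[OF r] that by simp
show "EX b:carrier R. r = nrm *: b" if "\<sigma> *: r = \<o>"
 using sigma_zero[OF r that] r by (metis G.one_closed R_app closed(1))
show "EX b:carrier R. r = \<sigma> *: b"
 if s: "!!k::nat. EX a:carrier R. EX b:carrier R. r = nrm ^: k *: a +: \<sigma> *: b"
proof (rule eps_zero[OF r], rule ext)
 fix k :: nat
 obtain a b where "a : carrier R" "b : carrier R" "r = nrm ^: k *: a +: \<sigma> *: b"
 using s[of k] by blast
 then show "eps r k = \<z> k"
 by (simp add: eps_add eps_mult eps_nrm_pow eps_sigma Zp_simps(2,3,5) Zp_int_app)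
qed
show "EX b:carrier R. r = nrm *: b"
 if s: "!!k::nat. EX a:carrier R. EX b:carrier R. r = \<sigma> ^: k *: a +: nrm *: b"
proof -
 have "r g m = r \<e> m" if g: "g : carrier G" for g m
 proof -
 obtain a b where ab: "a : carrier R" "b : carrier R"
  "r = \<sigma> ^: (p * m) *: a +: nrm *: b" using s[of "p * m"] by blast
 obtain d where d: "d : carrier R" "\<sigma> ^: (p * m) = cst (Zp_int p (int p ^ m)) *: d"
  using sigma_pow_mult by blast
 have "r h m = eps b m" if "h : carrier G" for h
  unfolding ab(3) d(2) using that ab(1,2) d(1)
  by (simp add: R_add nrm_mult R.m_assoc cst_mult Zp_simps(2,3) Zp_int_app)
 then show ?thesis using g by simp
 qed
 then have "r = nrm *: cst (r \<e>)" by (intro nrm_const[OF r] ext)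
 then show ?thesis using r by (metis G.one_closed R_app closed(1))
qed
show "\<exists>d<p. EX a:carrier R. EX b:carrier R. r = [d] \<cdot>\<^bsub>R\<^esub> \<r> +: (\<sigma> *: a +: nrm *: b)"
proof (intro exI conjI)
 let ?d = "nat (eps r 1)"
 have rng: "0 <= eps r 1" "eps r 1 < int p" using Zp_range[OF closed(5)[OF r], of 1] by auto
 then show "?d < p" by linarith
 have "eps (r -: [?d] \<cdot>\<^bsub>R\<^esub> \<r>) 1 = 0"
 using r rng Zp_mod_self[OF closed(5)[OF r], of 1]
 by (simp add: eps_minus add_pow_cst eps_cst Zp.minus_eq Zp_simps(3) Zp_minus Zp_int_app mod_simps)
 then obtain a b where ab: "a : carrier R" "b : carrier R"
 "r -: [?d] \<cdot>\<^bsub>R\<^esub> \<r> = \<sigma> *: a +: nrm *: b"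
 using in_max[of "r -: [?d] \<cdot>\<^bsub>R\<^esub> \<r>"] r by auto
 have "r = [?d] \<cdot>\<^bsub>R\<^esub> \<r> +: (r -: [?d] \<cdot>\<^bsub>R\<^esub> \<r>)"
 using r by (simp add: R.minus_eq R.a_lcomm[of _ r] R.r_neg)
 then show "EX a:carrier R. EX b:carrier R. r = [?d] \<cdot>\<^bsub>R\<^esub> \<r> +: (\<sigma> *: a +: nrm *: b)"
 using ab by metis
qed
next
fix a b assume ab: "a : carrier R" "b : carrier R"
show "\<sigma> *: a +: nrm *: b ~= \<r>"
 using eps_max[OF ab] eps_one p0 by (auto simp: Zp_simps(4))
next
fix k :: nat
show "nrm ^: k ~= \<o>" using eps_nrm_pow[of k] Zp_int_p_pow_nonzero[of k] eps_R_zero by metis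
show "\<sigma> ^: k ~= \<o>" by (rule sigma_pow_nonzero)
next
show "EX a:carrier R. EX b:carrier R. [p] \<cdot>\<^bsub>R\<^esub> \<r> = \<sigma> *: a +: nrm *: b"
 using p_decompose by (metis R.one_closed R.r_one closed(4))
next
fix d :: nat assume d: "0 < d" "d < p"
have "Zp_int p (int d) 1 ~= 0" using d by (simp add: Zp_int_app)
then show "[d] \<cdot>\<^bsub>R\<^esub> \<r> : Units R" by (simp add: add_pow_cst cst_unit Zp_unit)
qed (simp_all add: R.is_cring)

end

section \<open>Torsion of modules over Z_p[G]\<close>

context padic_group
begin

lemma nodal_char_module: "module R M ==> nodal_char_module R \<sigma> nrm p M"
by (intro nodal_char_module.intro nodal_module.intro nod.nodal_char_axioms nod.nodal_ring_axioms)

lemma nodal_module: "module R M ==> nodal_module R \<sigma> nrm M"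
by (intro nodal_module.intro nod.nodal_ring_axioms)

lemma nrm_pow: "nrm ^: Suc k = cst (Zp_int p (int p ^ k)) *: nrm" for k :: nat
proof (induction k)
case 0
show ?case using cst_one Zp_int_01(2) by simp
next
case (Suc k)
have "nrm *: nrm = cst (Zp_int p (int p)) *: nrm"
 by (rule R_eqI) (simp_all add: nrm_mult cst_mult eps_nrm, simp add: nrm_def)
moreover have "cst (Zp_int p (int p ^ k)) *: cst (Zp_int p (int p)) = cst (Zp_int p (int p ^ Suc k))"
 by (simp add: cst_hom(1)[symmetric] Zp_int_mult mult.commute)
ultimately show ?case
 using Suc by (simp add: R.m_assoc del: power_Suc) (simp add: R.m_assoc[symmetric] del: power_Suc)
qed

text \<open>Up to a unit, a scalar is a power of \<open>p\<close>, and high powers of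
  \<open>\<sigma>\<close> and of \<open>nrm\<close> are divisible by any such power. Conversely,
  powers of \<open>p\<close> are combinations of powers of \<open>\<sigma>\<close> and
  \<open>nrm\<close>.\<close>

lemma coeff_torsion_eq:
assumes M: "module R M"
shows "coeff_torsion (Zp p) G M = Tors R M \<sigma> nrm (carrier M)"
proof -
interpret nodal_char_module R \<sigma> nrm p M by (rule nodal_char_module[OF M])
show ?thesis
proof (intro subset_antisym subsetI)
 fix x assume "x : coeff_torsion (Zp p) G M"
 then obtain a where x: "x : carrier M" and a: "a : ZZ" "a ~= \<z>"
 "cst a \<odot>\<^bsub>M\<^esub> x = \<zero>\<^bsub>M\<^esub>" by (auto simp: coeff_torsion_def cst_def)
 obtain k u where u: "u : Units (Zp p)" "a = Zp_int p (int p ^ k) *| u"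
 using Zp_nonzero_unit_power[OF a(1,2)] by blast
 let ?P = "cst (Zp_int p (int p ^ k))"
 have uc: "u : ZZ" using u(1) by (rule Zp.Units_closed)
 have "cst u \<odot>\<^bsub>M\<^esub> (?P \<odot>\<^bsub>M\<^esub> x) = \<zero>\<^bsub>M\<^esub>"
 using a(3) x uc unfolding u(2) by (simp add: cst_hom R.m_comm[of ?P] M.smult_assoc1)
 then have P: "?P \<odot>\<^bsub>M\<^esub> x = \<zero>\<^bsub>M\<^esub>"
 using unit_smult_zero[OF cst_unit[OF u(1)]] x by simp
 obtain d where d: "d : carrier R" "\<sigma> ^: (p * k) = ?P *: d" using sigma_pow_mult by blast
 \<comment> \<open>The exponent \<open>k + 1 + p k\<close> serves both elements:
   \<open>\<sigma>^(p k)\<close> and \<open>nrm^(k+1)\<close> are divisible by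
   \<open>p^k\<close>.\<close>
 have "\<sigma> ^: (Suc k + p * k) = \<sigma> ^: Suc k *: d *: ?P"
 unfolding R.nat_pow_mult[OF closed(3), symmetric] d(2)
 using d(1) by (simp add: R.m_comm[of ?P] R.m_assoc del: R.nat_pow_Suc)
 moreover have "nrm ^: (Suc k + p * k) = nrm ^: (p * k) *: nrm *: ?P"
 unfolding R.nat_pow_mult[OF closed(4), symmetric] nrm_pow
 by (simp add: R.m_ac)
 ultimately have "nrm ^: (Suc k + p * k) \<odot>\<^bsub>M\<^esub> x = \<zero>\<^bsub>M\<^esub> & \<sigma> ^: (Suc k + p * k) \<odot>\<^bsub>M\<^esub> x = \<zero>\<^bsub>M\<^esub>"
 using x d(1) P by (simp add: M.smult_assoc1 del: R.nat_pow_Suc)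
 then show "x : Tors R M \<sigma> nrm (carrier M)" unfolding Tors_def using x by blast
next
 fix x assume "x : Tors R M \<sigma> nrm (carrier M)"
 then obtain k :: nat where x: "x : carrier M" "nrm ^: k \<odot>\<^bsub>M\<^esub> x = \<zero>\<^bsub>M\<^esub>" "\<sigma> ^: k \<odot>\<^bsub>M\<^esub> x = \<zero>\<^bsub>M\<^esub>"
 unfolding Tors_def by blast
 obtain b where b: "b : carrier R" "cst (Zp_int p (int p)) = \<sigma> *: b +: nrm"
 using p_decompose by (auto simp: add_pow_cst)
 \<comment> \<open>Since \<open>\<sigma> nrm = 0\<close>, the mixed terms in the power of
   \<open>\<sigma> b + nrm\<close> vanish.\<close>
 have "cst (Zp_int p (int p)) ^: Suc k = \<sigma> ^: Suc k *: b ^: Suc k +: nrm ^: Suc k"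
 proof (induction k)
 case (Suc k)
 let ?s = "\<sigma> ^: Suc k" and ?b = "b ^: Suc k" and ?n = "nrm ^: Suc k"
 have ns: "nrm *: (\<sigma> *: u) = \<o>" if "u : carrier R" for u
  using that sigma_nrm R.m_comm[of nrm \<sigma>] by (simp add: R.m_assoc[symmetric])
 have z: "?s *: ?b *: nrm = \<o>" "?n *: (\<sigma> *: b) = \<o>"
  using b(1) by (simp_all add: R.m_ac ns)
 have "cst (Zp_int p (int p)) ^: Suc (Suc k) = (?s *: ?b +: ?n) *: (\<sigma> *: b +: nrm)"
  using Suc b(2) by simp
 also have "\<dots> = ?s *: ?b *: (\<sigma> *: b) +: ?n *: nrm"
  using b(1) z by (simp add: R.l_distr R.r_distr del: R.nat_pow_Suc)
 also have "?s *: ?b *: (\<sigma> *: b) = (?s *: \<sigma>) *: (?b *: b)"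
  using b(1) by (simp add: R.m_ac del: R.nat_pow_Suc)
 finally show ?case by simp
 qed (use b in simp)
 then have "cst (Zp_int p (int p ^ Suc k)) = b ^: Suc k *: \<sigma> *: \<sigma> ^: k +: nrm *: nrm ^: k"
 unfolding cst_pow using b(1) R.m_comm[of "nrm ^: k" nrm] by (simp add: R.m_ac del: power_Suc)
 then have "cst (Zp_int p (int p ^ Suc k)) \<odot>\<^bsub>M\<^esub> x = \<zero>\<^bsub>M\<^esub>"
 using x b(1) by (simp add: M.smult_l_distr M.smult_assoc1 del: power_Suc R.nat_pow_Suc)
 then show "x : coeff_torsion (Zp p) G M"
 unfolding coeff_torsion_def using x Zp_int_p_pow_nonzero[of "Suc k"] Zp_int_closed
 by (auto simp: cst_def)
qed
qed

lemma R_finsum: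
"[|finite A; f : A \<rightarrow> carrier R; g : carrier G|] ==> (\<Oplus>\<^bsub>R\<^esub>k\<in>A. f k) g = (\<Oplus>\<^bsub>Zp p\<^esub>k\<in>A. f k g)"
proof (induction A rule: finite_induct)
case (insert k A)
have "f : A \<rightarrow> carrier R" "f k : carrier R" using insert.prems by auto
moreover have "(%k. f k g) : A \<rightarrow> ZZ" using insert.prems by (auto intro!: R_app)
ultimately show ?case using insert by (simp add: R_add)
qed (simp add: R_zero)

lemma tau_pow_eq: "[|j < p; k < p|] ==> \<tau> ^@ j = \<tau> ^@ k \<longleftrightarrow> j = k"
using inj_onD[of "%k. \<tau> ^@ k" "{..<p}" j k] bij_tau by (auto simp: bij_betw_def)

lemma expansion:
assumes a: "a : carrier R"
shows "a = (\<Oplus>\<^bsub>R\<^esub>k\<in>{..<p}. gr_single (Zp p) G (a (\<tau> ^@ k)) (\<tau> ^@ k))"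
proof -
let ?f = "%k. gr_single (Zp p) G (a (\<tau> ^@ k)) (\<tau> ^@ k)"
have f: "?f : {..<p} \<rightarrow> carrier R" using a \<tau> by auto
show ?thesis
proof (rule R_pow_eqI[OF a R.finsum_closed[OF f]])
 fix j assume j: "j < p"
 have "(\<Oplus>\<^bsub>R\<^esub>k\<in>{..<p}. ?f k) (\<tau> ^@ j) = (\<Oplus>\<^bsub>Zp p\<^esub>k\<in>{..<p}. ?f k (\<tau> ^@ j))"
 using \<tau> by (intro R_finsum f) auto
 also have "\<dots> = (\<Oplus>\<^bsub>Zp p\<^esub>k\<in>{..<p}. if j = k then a (\<tau> ^@ k) else \<z>)"
 by (rule Zp.finsum_cong') (use a \<tau> j tau_pow_eq in \<open>auto simp: gr_single_def\<close>)
 also have "\<dots> = a (\<tau> ^@ j)"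
 by (rule Zp.finsum_singleton) (use a \<tau> j in auto)
 finally show "a (\<tau> ^@ j) = (\<Oplus>\<^bsub>R\<^esub>k\<in>{..<p}. ?f k) (\<tau> ^@ j)" by simp
qed
qed

lemma single_mult:
assumes "c : ZZ" "k : carrier G" "d : ZZ" "l : carrier G"
shows "gr_single (Zp p) G c k *: gr_single (Zp p) G d l = gr_single (Zp p) G (c *| d) (k *@ l)"
proof (rule R_eqI)
fix g assume g: "g : carrier G"
have "inv@ k *@ g = l \<longleftrightarrow> g = k *@ l"
 using assms g by (metis G.inv_closed G.inv_solve_left G.m_closed)
then show "(gr_single (Zp p) G c k *: gr_single (Zp p) G d l) g = gr_single (Zp p) G (c *| d) (k *@ l) g"
 unfolding R_mult_one[OF gr_single_closed[OF assms(3)] g assms(2,1)]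
 using assms g by (auto simp: gr_single_def)
qed (use assms in auto)

lemma single_eq: "c : ZZ ==> gr_single (Zp p) G c (\<tau> ^@ k) = cst c *: T ^: k" for k :: nat
proof (induction k)
case (Suc k)
have "gr_single (Zp p) G c (\<tau> ^@ Suc k) = gr_single (Zp p) G c (\<tau> ^@ k) *: T"
 unfolding T_def using Suc.prems \<tau> by (subst single_mult) auto
then show ?case using Suc by (simp add: R.m_assoc)
qed (simp add: cst_def)

text \<open>Constants and \<open>T\<close> generate the group ring, so that identities such as
  associativity of an action need to be checked on them only.\<close>

lemma R_induct [consumes 1, case_names add cst T mult]:
assumes a: "a : carrier R"
 and add: "!!a b. [|a : carrier R; b : carrier R; P a; P b|] ==> P (a +: b)"
 and cst: "!!c. c : ZZ ==> P (cst c)" and T: "P T"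
 and mult: "!!a b. [|a : carrier R; b : carrier R; P a; P b|] ==> P (a *: b)"
shows "P a"
proof -
have pow: "P (T ^: k)" for k :: nat
 by (induction k) (use cst[of "\<u>"] T mult cst_one in auto)
have "P (\<Oplus>\<^bsub>R\<^esub>k\<in>{..<m}. gr_single (Zp p) G (a (\<tau> ^@ k)) (\<tau> ^@ k))" for m :: nat
proof (induction m)
 case 0
 then show ?case using cst[of "\<z>"] by (simp add: cst_zero)
next
 case (Suc m)
 have f: "(%k. gr_single (Zp p) G (a (\<tau> ^@ k)) (\<tau> ^@ k)) : {..<m} \<rightarrow> carrier R" using a \<tau> by auto
 have am: "a (\<tau> ^@ m) : ZZ" using a \<tau> by simp
 have "P (gr_single (Zp p) G (a (\<tau> ^@ m)) (\<tau> ^@ m))"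
 unfolding single_eq[OF am] using am by (intro mult cst pow) auto
 then show ?case unfolding lessThan_Suc using f am Suc
 by (subst R.finsum_insert) (auto intro!: add R.finsum_closed)
qed
then show ?thesis using expansion[OF a] by metis
qed

end

section \<open>Modules given by an automorphism of order dividing p\<close>

locale tau_module = padic_group p G \<tau> + N: module "Zp p" N
for p :: nat and G :: "('g, 'd) monoid_scheme" and \<tau> :: 'g and N :: "(padic, 'm) module" +
fixes t :: "'m => 'm"
assumes t_closed [simp]: "x : carrier N ==> t x : carrier N"
 and t_add: "[|x : carrier N; y : carrier N|] ==> t (x \<oplus>\<^bsub>N\<^esub> y) = t x \<oplus>\<^bsub>N\<^esub> t y"
 and t_smult: "[|c : carrier (Zp p); x : carrier N|] ==> t (c \<odot>\<^bsub>N\<^esub> x) = c \<odot>\<^bsub>N\<^esub> t x"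
 and t_order: "x : carrier N ==> (t ^^ p) x = x"
begin

abbreviation E where "E \<equiv> tau_mod p G \<tau> N t"

lemma E_simps [simp]: "carrier E = carrier N" "x \<oplus>\<^bsub>E\<^esub> y = x \<oplus>\<^bsub>N\<^esub> y" "\<zero>\<^bsub>E\<^esub> = \<zero>\<^bsub>N\<^esub>"
by (simp_all add: tau_mod_def with_smult_def)

lemma E_smult: "a \<odot>\<^bsub>E\<^esub> x = (\<Oplus>\<^bsub>N\<^esub>k\<in>{..<p}. a (\<tau> ^@ k) \<odot>\<^bsub>N\<^esub> (t ^^ k) x)"
by (simp add: tau_mod_def with_smult_def)

lemma tk [simp]: "x : carrier N ==> (t ^^ k) x : carrier N"
by (induction k) simp_all

lemma tk_add: "[|x : carrier N; y : carrier N|] ==> (t ^^ k) (x \<oplus>\<^bsub>N\<^esub> y) = (t ^^ k) x \<oplus>\<^bsub>N\<^esub> (t ^^ k) y"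
by (induction k) (simp_all add: t_add)

lemma t_zero: "t \<zero>\<^bsub>N\<^esub> = \<zero>\<^bsub>N\<^esub>"
using t_smult[of "\<z>" "\<zero>\<^bsub>N\<^esub>"] by simp

lemma t_finsum: "[|finite A; f : A \<rightarrow> carrier N|] ==> t (\<Oplus>\<^bsub>N\<^esub>k\<in>A. f k) = (\<Oplus>\<^bsub>N\<^esub>k\<in>A. t (f k))"
proof (induction A rule: finite_induct)
case (insert k A)
have "f : A \<rightarrow> carrier N" "f k : carrier N" "(%k. t (f k)) : A \<rightarrow> carrier N"
 using insert.prems by (auto simp: Pi_iff)
then show ?case using insert by (simp add: t_add)
qed (simp add: t_zero)

lemma smult_in [simp]: "[|a : carrier R; x : carrier N|] ==> (%k. a (\<tau> ^@ k) \<odot>\<^bsub>N\<^esub> (t ^^ k) x) : A \<rightarrow> carrier N"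
using \<tau> by auto

lemma E_closed: "[|a : carrier R; x : carrier N|] ==> a \<odot>\<^bsub>E\<^esub> x : carrier N"
unfolding E_smult by (rule N.M.finsum_closed) simp

lemma E_l_distr:
assumes "a : carrier R" "b : carrier R" "x : carrier N"
shows "(a +: b) \<odot>\<^bsub>E\<^esub> x = a \<odot>\<^bsub>E\<^esub> x \<oplus>\<^bsub>N\<^esub> b \<odot>\<^bsub>E\<^esub> x"
proof -
have "(a +: b) \<odot>\<^bsub>E\<^esub> x = (\<Oplus>\<^bsub>N\<^esub>k\<in>{..<p}. a (\<tau> ^@ k) \<odot>\<^bsub>N\<^esub> (t ^^ k) x \<oplus>\<^bsub>N\<^esub> b (\<tau> ^@ k) \<odot>\<^bsub>N\<^esub> (t ^^ k) x)"
 unfolding E_smult by (rule N.M.finsum_cong') (use assms \<tau> in \<open>auto simp: R_add N.smult_l_distr\<close>)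
then show ?thesis unfolding E_smult using assms by (simp add: N.M.finsum_addf)
qed

lemma single_smult:
assumes c: "c : ZZ" and j: "j < p" and x: "x : carrier N"
shows "gr_single (Zp p) G c (\<tau> ^@ j) \<odot>\<^bsub>E\<^esub> x = c \<odot>\<^bsub>N\<^esub> (t ^^ j) x"
proof -
have "gr_single (Zp p) G c (\<tau> ^@ j) \<odot>\<^bsub>E\<^esub> x = (\<Oplus>\<^bsub>N\<^esub>k\<in>{..<p}. if j = k then c \<odot>\<^bsub>N\<^esub> (t ^^ k) x else \<zero>\<^bsub>N\<^esub>)"
 unfolding E_smult
 by (rule N.M.finsum_cong') (use assms \<tau> tau_pow_eq in \<open>auto simp: gr_single_def\<close>)
also have "\<dots> = c \<odot>\<^bsub>N\<^esub> (t ^^ j) x"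
 by (rule N.M.finsum_singleton) (use assms in auto)
finally show ?thesis .
qed

lemma cst_smult: "[|c : ZZ; x : carrier N|] ==> cst c \<odot>\<^bsub>E\<^esub> x = c \<odot>\<^bsub>N\<^esub> x"
using single_smult[of c 0 x] p0 by (simp add: cst_def)

lemma T_smult: "x : carrier N ==> T \<odot>\<^bsub>E\<^esub> x = t x"
using single_smult[of "\<u>" 1 x] p0 \<tau> by (simp add: T_def)

lemma T_mult_Suc:
assumes b: "b : carrier R"
shows "(T *: b) (\<tau> ^@ Suc k) = b (\<tau> ^@ k)"
proof -
have "inv@ \<tau> *@ \<tau> ^@ Suc k = \<tau> ^@ k"
 using \<tau> G.nat_pow_Suc2[OF \<tau>, of k] by (simp add: G.m_assoc[symmetric] del: G.nat_pow_Suc)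
then show ?thesis
 using b \<tau> by (simp add: T_def R_mult_one del: G.nat_pow_Suc)
qed

text \<open>Multiplication by \<open>T\<close> shifts the coefficients cyclically; the coefficient
  that wraps around is matched by \<open>t^p x = x\<close>.\<close>

lemma T_mult_smult:
assumes b: "b : carrier R" and x: "x : carrier N"
shows "(T *: b) \<odot>\<^bsub>E\<^esub> x = t (b \<odot>\<^bsub>E\<^esub> x)"
proof -
define Q where "Q k = b (\<tau> ^@ k) \<odot>\<^bsub>N\<^esub> (t ^^ Suc k) x" for k
define F where "F k = (T *: b) (\<tau> ^@ k) \<odot>\<^bsub>N\<^esub> (t ^^ k) x" for k
have Q: "Q : A \<rightarrow> carrier N" for A using b x \<tau> by (auto simp: Q_def intro!: N.smult_closed)
have F: "F : A \<rightarrow> carrier N" for A using b x \<tau> by (auto simp: F_def)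
\<comment> \<open>Writing \<open>p = l + 2\<close> allows the first term of one sum and the last
  term of the other to be split off.\<close>
obtain l where l: "p = Suc (Suc l)" using that[of "p - 2"] p0 by simp
have FQ: "F (Suc k) = Q k" for k
 unfolding F_def Q_def T_mult_Suc[OF b] ..
have "(T *: b) (\<tau> ^@ (0::nat)) = (T *: b) (\<tau> ^@ p)" by (simp add: tau_p)
also have "\<dots> = b (\<tau> ^@ Suc l)"
 using T_mult_Suc[OF b, of "Suc l"] arg_cong[OF l, of "%k. \<tau> ^@ k"] by simp
moreover have "(t ^^ Suc (Suc l)) x = x" using t_order[OF x] arg_cong[OF l, of "%k. (t ^^ k) x"] by simp
ultimately have F0: "F 0 = Q (Suc l)" by (simp add: F_def Q_def)
have lp: "{..<p} = {..Suc l}" using l by auto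
have "(T *: b) \<odot>\<^bsub>E\<^esub> x = (\<Oplus>\<^bsub>N\<^esub>k\<in>{..Suc l}. F k)" unfolding E_smult lp F_def ..
also have "\<dots> = (\<Oplus>\<^bsub>N\<^esub>k\<in>{..l}. F (Suc k)) \<oplus>\<^bsub>N\<^esub> F 0" by (rule N.M.finsum_Suc2[OF F])
also have "\<dots> = Q (Suc l) \<oplus>\<^bsub>N\<^esub> (\<Oplus>\<^bsub>N\<^esub>k\<in>{..l}. Q k)"
 unfolding FQ F0 using Q[of "{..l}"] Q[of UNIV] by (intro N.M.a_comm N.M.finsum_closed) auto
also have "\<dots> = (\<Oplus>\<^bsub>N\<^esub>k\<in>{..Suc l}. Q k)" by (rule N.M.finsum_Suc[OF Q, symmetric])
also have "\<dots> = (\<Oplus>\<^bsub>N\<^esub>k\<in>{..<p}. t (b (\<tau> ^@ k) \<odot>\<^bsub>N\<^esub> (t ^^ k) x))"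
 unfolding lp by (rule N.M.finsum_cong') (use b x \<tau> in \<open>auto simp: Q_def t_smult\<close>)
also have "\<dots> = t (b \<odot>\<^bsub>E\<^esub> x)"
 unfolding E_smult by (rule t_finsum[symmetric]) (use b x in auto)
finally show ?thesis .
qed

lemma E_assoc:
assumes "a : carrier R" "b : carrier R" "x : carrier N"
shows "(a *: b) \<odot>\<^bsub>E\<^esub> x = a \<odot>\<^bsub>E\<^esub> (b \<odot>\<^bsub>E\<^esub> x)"
using assms
proof (induction a arbitrary: b x rule: R_induct)
case (add a a')
then show ?case by (simp add: R.l_distr E_l_distr E_closed)
next
case (cst c)
have "(cst c *: b) \<odot>\<^bsub>E\<^esub> x = (\<Oplus>\<^bsub>N\<^esub>k\<in>{..<p}. c \<odot>\<^bsub>N\<^esub> (b (\<tau> ^@ k) \<odot>\<^bsub>N\<^esub> (t ^^ k) x))"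
 unfolding E_smult
 by (rule N.M.finsum_cong') (use cst \<tau> in \<open>auto simp: cst_mult N.smult_assoc1\<close>)
also have "\<dots> = c \<odot>\<^bsub>N\<^esub> (b \<odot>\<^bsub>E\<^esub> x)"
 unfolding E_smult by (rule N.finsum_smult_ldistr[symmetric]) (use cst \<tau> in auto)
finally show ?case using cst by (simp add: cst_smult E_closed)
next
case T
then show ?case by (simp add: T_mult_smult T_smult E_closed)
next
case (mult a a')
then show ?case by (simp add: R.m_assoc E_closed)
qed

sublocale E: module R E
proof (rule moduleI)
show "cring R" by (rule R.is_cring)
show "abelian_group E"
 by (rule abelian_groupI) (use N.M.a_assoc N.M.a_comm N.M.l_neg in \<open>auto intro!: bexI[where x = "\<ominus>\<^bsub>N\<^esub> _"]\<close>)
fix a x y assume a: "a : carrier R" and x: "x : carrier E" and y: "y : carrier E"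
show "a \<odot>\<^bsub>E\<^esub> x : carrier E" using a x E_closed by simp
have "a \<odot>\<^bsub>E\<^esub> (x \<oplus>\<^bsub>N\<^esub> y) = (\<Oplus>\<^bsub>N\<^esub>k\<in>{..<p}. a (\<tau> ^@ k) \<odot>\<^bsub>N\<^esub> (t ^^ k) x \<oplus>\<^bsub>N\<^esub> a (\<tau> ^@ k) \<odot>\<^bsub>N\<^esub> (t ^^ k) y)"
 unfolding E_smult by (rule N.M.finsum_cong') (use a x y \<tau> in \<open>auto simp: tk_add N.smult_r_distr\<close>)
then show "a \<odot>\<^bsub>E\<^esub> (x \<oplus>\<^bsub>E\<^esub> y) = a \<odot>\<^bsub>E\<^esub> x \<oplus>\<^bsub>E\<^esub> a \<odot>\<^bsub>E\<^esub> y"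
 using a x y unfolding E_smult by (simp add: N.M.finsum_addf)
next
fix x assume "x : carrier E"
then show "\<r> \<odot>\<^bsub>E\<^esub> x = x" using cst_smult[of "\<u>" x] by (simp add: cst_one)
qed (simp_all add: E_l_distr E_assoc)

lemma sigma_smult: "x : carrier N ==> \<sigma> \<odot>\<^bsub>E\<^esub> x = t x \<ominus>\<^bsub>N\<^esub> x"
proof -
assume x: "x : carrier N"
have "\<sigma> \<odot>\<^bsub>E\<^esub> x \<oplus>\<^bsub>N\<^esub> x = (\<sigma> +: \<r>) \<odot>\<^bsub>E\<^esub> x"
 using x E.smult_one[of x] by (simp add: E_l_distr)
also have "\<sigma> +: \<r> = T" by (simp add: \<sigma>_def R.minus_eq R.a_assoc R.l_neg)
finally have "\<sigma> \<odot>\<^bsub>E\<^esub> x \<oplus>\<^bsub>N\<^esub> x = t x" using x by (simp add: T_smult)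
then show ?thesis
 using N.M.a_assoc[of "\<sigma> \<odot>\<^bsub>E\<^esub> x" x "\<ominus>\<^bsub>N\<^esub> x"] x by (simp add: N.M.minus_eq N.M.r_neg E_closed)
qed

lemma nrm_smult: "x : carrier N ==> nrm \<odot>\<^bsub>E\<^esub> x = (\<Oplus>\<^bsub>N\<^esub>k\<in>{..<p}. (t ^^ k) x)"
unfolding E_smult by (rule N.M.finsum_cong') (use \<tau> in \<open>auto simp: nrm_def\<close>)

end

lemma (in abelian_group) minus_add_cancel:
"[|x : carrier G; y : carrier G|] ==> (x \<ominus> y) \<oplus> y = x"
by (simp add: minus_eq a_assoc l_neg)

lemma self_mod_simps [simp]: "carrier (self_mod S) = carrier S" "x \<oplus>\<^bsub>self_mod S\<^esub> y = x \<oplus>\<^bsub>S\<^esub> y"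
"\<zero>\<^bsub>self_mod S\<^esub> = \<zero>\<^bsub>S\<^esub>" "a \<odot>\<^bsub>self_mod S\<^esub> x = a \<otimes>\<^bsub>S\<^esub> x"
by (simp_all add: self_mod_def with_smult_def)

lemma self_mod_module: "cring S ==> module S (self_mod S)"
proof -
assume "cring S"
then interpret S: cring S .
show ?thesis
proof (rule moduleI)
 show "abelian_group (self_mod S)"
 by (rule abelian_groupI) (use S.a_assoc S.a_comm S.l_neg in \<open>auto intro!: bexI[where x = "\<ominus>\<^bsub>S\<^esub> _"]\<close>)
qed (auto simp: S.l_distr S.r_distr S.m_assoc S.is_cring)
qed

lemma prod_mod_simps [simp]: "carrier (prod_mod M N) = carrier M \<times> carrier N"
"(x, y) \<oplus>\<^bsub>prod_mod M N\<^esub> (x', y') = (x \<oplus>\<^bsub>M\<^esub> x', y \<oplus>\<^bsub>N\<^esub> y')"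
"\<zero>\<^bsub>prod_mod M N\<^esub> = (\<zero>\<^bsub>M\<^esub>, \<zero>\<^bsub>N\<^esub>)" "a \<odot>\<^bsub>prod_mod M N\<^esub> (x, y) = (a \<odot>\<^bsub>M\<^esub> x, a \<odot>\<^bsub>N\<^esub> y)"
by (simp_all add: prod_mod_def with_smult_def RDirProd_def DirProd_def monoid.defs)

lemma prod_mod_module:
assumes "module S M" "module S N"
shows "module S (prod_mod M N)"
proof -
interpret M: module S M by fact
interpret N: module S N by fact
show ?thesis
proof (rule moduleI)
 show "abelian_group (prod_mod M N)"
 proof (rule abelian_groupI)
 fix z assume "z : carrier (prod_mod M N)"
 then show "EX w:carrier (prod_mod M N). w \<oplus>\<^bsub>prod_mod M N\<^esub> z = \<zero>\<^bsub>prod_mod M N\<^esub>"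
  by (auto intro!: bexI[where x = "(\<ominus>\<^bsub>M\<^esub> fst z, \<ominus>\<^bsub>N\<^esub> snd z)"] simp: M.M.l_neg N.M.l_neg)
 qed (auto simp: M.M.a_ac N.M.a_ac)
qed (auto simp: M.smult_l_distr N.smult_l_distr M.smult_r_distr N.smult_r_distr
 M.smult_assoc1 N.smult_assoc1 M.R.is_cring)
qed

lemma Zmod_simps [simp]: "carrier (Zmod p i) = {0..int p ^ i - 1}"
"x \<oplus>\<^bsub>Zmod p i\<^esub> y = (x + y) mod int p ^ i" "\<zero>\<^bsub>Zmod p i\<^esub> = 0"
"a \<odot>\<^bsub>Zmod p i\<^esub> x = (a i * x) mod int p ^ i"
by (simp_all add: Zmod_def with_smult_def residue_ring_def)

context padic
begin

lemma mod_in [simp]: "x mod int p ^ i : carrier (Zmod p i)"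
using p0 by simp

lemma mod_le: "1 + a mod int p ^ i <= int p ^ i"
proof -
have "a mod int p ^ i < int p ^ i" using p0 by simp
then show ?thesis by linarith
qed

lemma Zmod_module: "module (Zp p) (Zmod p i)"
proof (rule moduleI)
show "abelian_group (Zmod p i)"
proof (rule abelian_groupI)
 fix z assume "z : carrier (Zmod p i)"
 then show "EX w:carrier (Zmod p i). w \<oplus>\<^bsub>Zmod p i\<^esub> z = \<zero>\<^bsub>Zmod p i\<^esub>"
 using mod_in[of "- z" i] by (intro bexI[of _ "(- z) mod int p ^ i"]) (simp_all add: mod_simps)
qed (use p0 mod_le in \<open>auto simp: mod_simps algebra_simps\<close>)
have "\<u> i = 1 mod int p ^ i" by (simp add: Zp_simps)
then show "\<u> \<odot>\<^bsub>Zmod p i\<^esub> x = x" if "x : carrier (Zmod p i)" for x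
 using that by (simp add: mod_simps)
qed (use p0 mod_le in \<open>auto simp: Zp_simps(2,3) mod_simps algebra_simps Zp.is_cring\<close>)

lemma Zmod_minus:
assumes "x : carrier (Zmod p i)" "y : carrier (Zmod p i)"
shows "x \<ominus>\<^bsub>Zmod p i\<^esub> y = (x - y) mod int p ^ i"
proof -
interpret Z: module "Zp p" "Zmod p i" by (rule Zmod_module)
have "\<ominus>\<^bsub>Zmod p i\<^esub> y = (- y) mod int p ^ i"
 by (rule Z.M.minus_equality) (use assms mod_in in \<open>auto simp: mod_simps\<close>)
then show ?thesis by (simp add: Z.M.minus_eq mod_simps)
qed

lemma Zmod_finsum:
"[|finite A; f : A \<rightarrow> carrier (Zmod p i)|] ==> (\<Oplus>\<^bsub>Zmod p i\<^esub>k\<in>A. f k) = (\<Sum>k\<in>A. f k) mod int p ^ i"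
proof (induction A rule: finite_induct)
case (insert k A)
interpret Z: module "Zp p" "Zmod p i" by (rule Zmod_module)
have "f : A \<rightarrow> carrier (Zmod p i)" "f k : carrier (Zmod p i)" using insert.prems by auto
then show ?case using insert by (simp add: mod_simps del: Zmod_simps(1))
next
case empty
interpret Z: module "Zp p" "Zmod p i" by (rule Zmod_module)
show ?case using Z.M.finsum_empty by simp
qed

end

section \<open>Extensions of lattices by Z/p^i\<close>

context padic_group
begin

lemma eps_smult:
assumes M: "module R M" and x: "x : carrier M" "\<sigma> \<odot>\<^bsub>M\<^esub> x = \<zero>\<^bsub>M\<^esub>" and a: "a : carrier R"
shows "a \<odot>\<^bsub>M\<^esub> x = cst (eps a) \<odot>\<^bsub>M\<^esub> x"
proof -
interpret M: module R M by fact
obtain b where b: "b : carrier R" "a = cst (eps a) +: \<sigma> *: b" using decompose[OF a] by blast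
have "a \<odot>\<^bsub>M\<^esub> x = cst (eps a) \<odot>\<^bsub>M\<^esub> x \<oplus>\<^bsub>M\<^esub> b \<odot>\<^bsub>M\<^esub> (\<sigma> \<odot>\<^bsub>M\<^esub> x)"
 by (subst b(2)) (use a b(1) x(1) in \<open>simp add: M.smult_l_distr M.smult_assoc1[symmetric] R.m_comm[of b]\<close>)
then show ?thesis using a b x by simp
qed

end

text \<open>An extension of the lattice \<open>L\<close>, on which \<open>\<tau>\<close> acts by \<open>l\<close>, by \<open>\<int>/p\<^sup>i\<close>.\<close>

locale ext_module = padic_group p G \<tau> + L: tau_module p G \<tau> L l
for p :: nat and G :: "('g, 'd) monoid_scheme" and \<tau> :: 'g and L :: "(padic, 'm) module"
 and l :: "'m => 'm" +
fixes i :: nat and \<phi> :: "'m => int"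
assumes i: "i >= 1"
 and \<phi>_add: "[|x : carrier L; y : carrier L|] ==> [\<phi> (x \<oplus>\<^bsub>L\<^esub> y) = \<phi> x + \<phi> y] (mod int p ^ i)"
 and \<phi>_smult: "[|c : carrier (Zp p); x : carrier L|] ==> [\<phi> (c \<odot>\<^bsub>L\<^esub> x) = c i * \<phi> x] (mod int p ^ i)"
 and \<phi>_sum: "x : carrier L ==> [(\<Sum>k<p. \<phi> ((l ^^ k) x)) = 0] (mod int p ^ i)"
begin

abbreviation ext_t :: "int \<times> 'm => int \<times> 'm" where
"ext_t \<equiv> %(u, y). ((u + \<phi> y) mod int p ^ i, l y)"

text \<open>The values of \<open>\<phi>\<close> accumulate along the orbit of \<open>y\<close>;
  \<open>\<phi>_sum\<close> therefore makes the \<open>p\<close>-th iterate the identity.\<close>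

lemma ext_pow: "u : carrier (Zmod p i) ==> (ext_t ^^ k) (u, y) = ((u + (\<Sum>j<k. \<phi> ((l ^^ j) y))) mod int p ^ i, (l ^^ k) y)"
by (induction k) (simp_all add: mod_simps algebra_simps)

sublocale X: tau_module p G \<tau> "prod_mod (Zmod p i) L" ext_t
proof (intro tau_module.intro tau_module_axioms.intro prod_mod_module Zmod_module L.N.module_axioms
 padic_group_axioms)
fix z assume z: "z : carrier (prod_mod (Zmod p i) L)"
show "ext_t z : carrier (prod_mod (Zmod p i) L)" using z p0 by auto
obtain u y where uy: "z = (u, y)" "u : carrier (Zmod p i)" "y : carrier L" using z by auto
have "(u + (\<Sum>k<p. \<phi> ((l ^^ k) y))) mod int p ^ i = u"
 using cong_add[OF cong_refl[of u] \<phi>_sum[OF uy(3)]] uy(2) by (simp add: cong_def)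
then show "(ext_t ^^ p) z = z"
 unfolding uy(1) ext_pow[OF uy(2)] by (simp add: L.t_order uy(3))
fix z' assume z': "z' : carrier (prod_mod (Zmod p i) L)"
obtain v w where vw: "z' = (v, w)" "w : carrier L" using z' by auto
show "ext_t (z \<oplus>\<^bsub>prod_mod (Zmod p i) L\<^esub> z') = ext_t z \<oplus>\<^bsub>prod_mod (Zmod p i) L\<^esub> ext_t z'"
proof -
 have "((u + v) mod int p ^ i + \<phi> (y \<oplus>\<^bsub>L\<^esub> w)) mod int p ^ i
  = ((u + \<phi> y) mod int p ^ i + (v + \<phi> w) mod int p ^ i) mod int p ^ i"
 unfolding mod_add_left_eq mod_add_right_eq
 using cong_add[OF cong_refl[of "u + v"] \<phi>_add[OF uy(3) vw(2)]] by (simp add: cong_def add_ac)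
 then show ?thesis unfolding uy(1) vw(1) by (simp add: L.t_add uy vw)
qed
next
fix c z assume c: "c : ZZ" and z: "z : carrier (prod_mod (Zmod p i) L)"
obtain u y where uy: "z = (u, y)" "y : carrier L" using z by auto
show "ext_t (c \<odot>\<^bsub>prod_mod (Zmod p i) L\<^esub> z) = c \<odot>\<^bsub>prod_mod (Zmod p i) L\<^esub> ext_t z"
 using \<phi>_smult[OF c uy(2)] mod_add_right_eq[of "c i * u" "\<phi> (c \<odot>\<^bsub>L\<^esub> y)" "int p ^ i"]
 mod_add_right_eq[of "c i * u" "c i * \<phi> y" "int p ^ i"]
 unfolding uy(1) by (simp add: L.t_smult c uy cong_def mod_simps algebra_simps)
qed

lemma snd_finsum: "[|finite A; f : A \<rightarrow> carrier (prod_mod (Zmod p i) L)|] ==>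
 snd (\<Oplus>\<^bsub>prod_mod (Zmod p i) L\<^esub>k\<in>A. f k) = (\<Oplus>\<^bsub>L\<^esub>k\<in>A. snd (f k))"
proof (induction A rule: finite_induct)
case (insert k A)
have f: "f : A \<rightarrow> carrier (prod_mod (Zmod p i) L)" "f k : carrier (prod_mod (Zmod p i) L)"
 using insert.prems by auto
have s: "(%k. snd (f k)) : A \<rightarrow> carrier L" "snd (f k) : carrier L" using insert.prems by (auto simp: Pi_iff)
have "snd (v \<oplus>\<^bsub>prod_mod (Zmod p i) L\<^esub> w) = snd v \<oplus>\<^bsub>L\<^esub> snd w" for v w
 by (cases v; cases w) simp
then show ?case using insert.IH insert.hyps f s by (simp del: prod_mod_simps)
qed simp

lemma snd_smult:
assumes a: "a : carrier R" and z: "z : carrier X.E"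
shows "snd (a \<odot>\<^bsub>X.E\<^esub> z) = a \<odot>\<^bsub>L.E\<^esub> snd z"
proof -
obtain u y where uy: "z = (u, y)" "u : carrier (Zmod p i)" "y : carrier L" using z by auto
have "snd (a \<odot>\<^bsub>X.E\<^esub> z) = (\<Oplus>\<^bsub>L\<^esub>k\<in>{..<p}. snd (a (\<tau> ^@ k) \<odot>\<^bsub>prod_mod (Zmod p i) L\<^esub> (ext_t ^^ k) z))"
 unfolding X.E_smult by (rule snd_finsum) (use X.smult_in[OF a, of z] z in auto)
also have "\<dots> = a \<odot>\<^bsub>L.E\<^esub> snd z"
 unfolding L.E_smult by (rule L.N.M.finsum_cong') (use uy a \<tau> ext_pow in auto)
finally show ?thesis .
qed

lemma sigma_X: "[|u : carrier (Zmod p i); y : carrier L|] ==> \<sigma> \<odot>\<^bsub>X.E\<^esub> (u, y) = (\<phi> y mod int p ^ i, \<sigma> \<odot>\<^bsub>L.E\<^esub> y)"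
proof -
assume u: "u : carrier (Zmod p i)" and y: "y : carrier L"
have "\<sigma> \<odot>\<^bsub>X.E\<^esub> (u, y) \<oplus>\<^bsub>prod_mod (Zmod p i) L\<^esub> (u, y) = ext_t (u, y)"
 using X.sigma_smult[of "(u, y)"] u y X.t_closed[of "(u, y)"]
 by (simp add: X.N.M.minus_add_cancel del: prod_mod_simps(2) case_prod_conv)
also have "ext_t (u, y) = (\<phi> y mod int p ^ i, \<sigma> \<odot>\<^bsub>L.E\<^esub> y) \<oplus>\<^bsub>prod_mod (Zmod p i) L\<^esub> (u, y)"
 using y by (simp add: L.sigma_smult L.N.M.minus_add_cancel mod_simps add.commute)
finally have eq: "\<sigma> \<odot>\<^bsub>X.E\<^esub> (u, y) \<oplus>\<^bsub>prod_mod (Zmod p i) L\<^esub> (u, y)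
 = (\<phi> y mod int p ^ i, \<sigma> \<odot>\<^bsub>L.E\<^esub> y) \<oplus>\<^bsub>prod_mod (Zmod p i) L\<^esub> (u, y)" .
show ?thesis
 by (rule X.N.M.add.r_cancel[OF eq])
 (use X.E_closed[of \<sigma> "(u, y)"] mod_in[of "\<phi> y" i] L.E_closed[of \<sigma> y] u y in simp_all)
qed

lemma phi_zero: "[\<phi> \<zero>\<^bsub>L\<^esub> = 0] (mod int p ^ i)"
proof -
have "\<z> i = 0" by (simp add: Zp_simps)
then show ?thesis using \<phi>_smult[OF Zp.zero_closed L.N.M.zero_closed] by simp
qed

lemma smult_t:
assumes a: "a : carrier R" and u: "u : carrier (Zmod p i)"
shows "a \<odot>\<^bsub>X.E\<^esub> (u, \<zero>\<^bsub>L\<^esub>) = ((eps a i * u) mod int p ^ i, \<zero>\<^bsub>L\<^esub>)"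
proof -
have "\<sigma> \<odot>\<^bsub>X.E\<^esub> (u, \<zero>\<^bsub>L\<^esub>) = \<zero>\<^bsub>X.E\<^esub>"
 using sigma_X[OF u, of "\<zero>\<^bsub>L\<^esub>"] phi_zero L.E.smult_r_null[of \<sigma>] by (simp add: cong_def)
then have "a \<odot>\<^bsub>X.E\<^esub> (u, \<zero>\<^bsub>L\<^esub>) = cst (eps a) \<odot>\<^bsub>X.E\<^esub> (u, \<zero>\<^bsub>L\<^esub>)"
 using eps_smult[OF X.E.module_axioms, of "(u, \<zero>\<^bsub>L\<^esub>)" a] u a by simp
then show ?thesis using X.cst_smult[of "eps a" "(u, \<zero>\<^bsub>L\<^esub>)"] a u by simp
qed

lemma is_tor_ext:
assumes v: "v : carrier (Zmod p i)" "~ int p dvd v"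
shows "is_tor R X.E \<sigma> nrm i 0 (v, \<zero>\<^bsub>L\<^esub>)"
proof -
have pw: "nrm ^: k \<odot>\<^bsub>X.E\<^esub> (v, \<zero>\<^bsub>L\<^esub>) = ((int p ^ k * v) mod int p ^ i, \<zero>\<^bsub>L\<^esub>)" for k :: nat
 using smult_t[OF _ v(1), of "nrm ^: k"] by (simp add: eps_nrm_pow Zp_int_app mod_simps)
have "int p ^ (i - 1) * v mod int p ^ i ~= 0"
proof
 assume "int p ^ (i - 1) * v mod int p ^ i = 0"
 then have d: "int p ^ i dvd int p ^ (i - 1) * v" by (simp add: dvd_eq_mod_eq_0)
 have "int p ^ i = int p ^ (i - 1) * int p" using i by (simp add: power_eq_if)
 then show False using d v(2) p0 by simp
qed
moreover have "\<sigma> \<odot>\<^bsub>X.E\<^esub> (v, \<zero>\<^bsub>L\<^esub>) = \<zero>\<^bsub>X.E\<^esub>"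
 using smult_t[OF _ v(1), of \<sigma>] by (simp add: eps_sigma Zp_simps)
ultimately show ?thesis
 using i v(1) pw[of i] pw[of "i - 1"] X.E.smult_l_null[of "(v, \<zero>\<^bsub>L\<^esub>)"]
 by (simp add: is_tor_def)
qed

text \<open>Generators of the lattice produce an element with the right second coordinate; the error
  in the first is a multiple of \<open>v\<close>, which is invertible modulo
  \<open>p^i\<close>.\<close>

lemma gen3_ext:
assumes v: "v : carrier (Zmod p i)" "~ int p dvd v" and x: "x : carrier L" and y: "y : carrier L"
 and gen: "!!z. z : carrier L ==> EX b:carrier R. EX c:carrier R. z = b \<odot>\<^bsub>L.E\<^esub> x \<oplus>\<^bsub>L\<^esub> c \<odot>\<^bsub>L.E\<^esub> y"
shows "carrier X.E = gen3 R X.E (v, \<zero>\<^bsub>L\<^esub>) (0, x) (0, y)"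
proof (intro subset_antisym subsetI)
have 0: "(0, x) : carrier X.E" "(0, y) : carrier X.E" "(v, \<zero>\<^bsub>L\<^esub>) : carrier X.E"
 using x y v(1) p0 by auto
show "z : carrier X.E" if "z : gen3 R X.E (v, \<zero>\<^bsub>L\<^esub>) (0, x) (0, y)" for z
 using that 0 X.E.smult_closed X.E.M.a_closed unfolding gen3_def by blast
fix z assume z: "z : carrier X.E"
obtain b c where bc: "b : carrier R" "c : carrier R" "snd z = b \<odot>\<^bsub>L.E\<^esub> x \<oplus>\<^bsub>L\<^esub> c \<odot>\<^bsub>L.E\<^esub> y"
 using gen[of "snd z"] z by auto
define w where "w = b \<odot>\<^bsub>X.E\<^esub> (0, x) \<oplus>\<^bsub>X.E\<^esub> c \<odot>\<^bsub>X.E\<^esub> (0, y)"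
have w: "w : carrier X.E" unfolding w_def using bc 0 X.E.smult_closed X.E.M.a_closed by blast
have "snd (m \<oplus>\<^bsub>prod_mod (Zmod p i) L\<^esub> m') = snd m \<oplus>\<^bsub>L\<^esub> snd m'" for m m'
 by (cases m; cases m') simp
then have ws: "snd w = snd z"
 unfolding w_def bc(3) using bc 0 by (simp add: snd_smult del: prod_mod_simps)
have "coprime v (int p ^ i)"
 using prime_imp_coprime[of "int p" v] v(2) p by (simp add: coprime_commute)
then obtain v' where v': "[v * v' = 1] (mod int p ^ i)" using cong_solve_coprime_int by blast
define a where "a = cst (Zp_int p (v' * (fst z - fst w)))"
have aR: "a : carrier R" by (simp add: a_def)
have "[v' * (fst z - fst w) * v + fst w = 1 * (fst z - fst w) + fst w] (mod int p ^ i)"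
 using cong_mult[OF v' cong_refl[of "fst z - fst w"]] by (intro cong_add cong_refl) (simp add: mult_ac)
then have f: "(v' * (fst z - fst w) * v + fst w) mod int p ^ i = fst z"
 using z by (auto simp: cong_def)
have "z = a \<odot>\<^bsub>X.E\<^esub> (v, \<zero>\<^bsub>L\<^esub>) \<oplus>\<^bsub>X.E\<^esub> w"
proof -
 have "a \<odot>\<^bsub>X.E\<^esub> (v, \<zero>\<^bsub>L\<^esub>) = ((v' * (fst z - fst w) * v) mod int p ^ i, \<zero>\<^bsub>L\<^esub>)"
 using smult_t[OF _ v(1), of a] by (simp add: a_def eps_cst Zp_int_app mod_simps)
 then show ?thesis using f ws w z by (cases z; cases w) (simp add: mod_simps)
qed
then have "z = a \<odot>\<^bsub>X.E\<^esub> (v, \<zero>\<^bsub>L\<^esub>) \<oplus>\<^bsub>X.E\<^esub> b \<odot>\<^bsub>X.E\<^esub> (0, x) \<oplus>\<^bsub>X.E\<^esub> c \<odot>\<^bsub>X.E\<^esub> (0, y)"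
 unfolding w_def using bc(1,2) 0 X.E.M.a_assoc[of "a \<odot>\<^bsub>X.E\<^esub> (v, \<zero>\<^bsub>L\<^esub>)" "b \<odot>\<^bsub>X.E\<^esub> (0, x)" "c \<odot>\<^bsub>X.E\<^esub> (0, y)"]
 X.E.smult_closed by (simp add: a_def del: X.E_simps)
then show "z : gen3 R X.E (v, \<zero>\<^bsub>L\<^esub>) (0, x) (0, y)" unfolding gen3_def using bc(1,2) aR by blast
qed

lemma free_over_ext:
assumes v: "v : carrier (Zmod p i)" and x: "x : carrier L" and a: "m : carrier R"
 and nz: "!!k::nat. m ^: k \<odot>\<^bsub>L.E\<^esub> x ~= \<zero>\<^bsub>L\<^esub>"
shows "free_over R X.E m (v, \<zero>\<^bsub>L\<^esub>) (0, x)"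
unfolding free_over_def
proof (intro conjI allI ballI notI)
show c: "(0, x) : carrier X.E" using x p0 by simp
fix k :: nat and b assume b: "b : carrier R" and e: "m ^: k \<odot>\<^bsub>X.E\<^esub> (0, x) = b \<odot>\<^bsub>X.E\<^esub> (v, \<zero>\<^bsub>L\<^esub>)"
have "snd (m ^: k \<odot>\<^bsub>X.E\<^esub> (0, x)) = m ^: k \<odot>\<^bsub>L.E\<^esub> x"
 using snd_smult[OF _ c, of "m ^: k"] a by simp
then show False using nz[of k] unfolding e smult_t[OF b v] by simp
qed

end

section \<open>The ring Z_p[zeta] as a module\<close>

context padic
begin

lemma cyclo_up: "cyclo_poly p : up (Zp p)"
by (auto simp: cyclo_poly_def up_def intro!: exI[of _ p])

lemma cyclo_closed [simp]: "cyclo_poly p : carrier (UP (Zp p))"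
using cyclo_up by (simp add: UP_def)

lemma coeff_cyclo: "coeff (UP (Zp p)) (cyclo_poly p) k = (if k < p then \<u> else \<z>)"
using cyclo_up by (simp add: UP_def) (simp add: cyclo_poly_def)

lemma cyclo_ideal_iff: "P : cyclo_ideal p \<longleftrightarrow> (EX q:carrier (UP (Zp p)). P = q \<otimes>\<^bsub>UP (Zp p)\<^esub> cyclo_poly p)"
unfolding cyclo_ideal_def cgenideal_def by blast

lemma Zp_zeta_zero: "\<zero>\<^bsub>Zp_zeta p\<^esub> = cyclo_ideal p"
by (simp add: Zp_zeta_def FactRing_def)

end

locale zeta_ring = padic_group p G \<tau> for p G \<tau>
begin

sublocale U: UP_domain "Zp p" "UP (Zp p)"
by unfold_locales

sublocale I: ideal "cyclo_ideal p" "UP (Zp p)"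
unfolding cyclo_ideal_def by (rule U.P.cgenideal_ideal) simp

definition cls :: "(nat => padic) => (nat => padic) set" where
"cls P = cyclo_ideal p +>\<^bsub>UP (Zp p)\<^esub> P"

sublocale cls: ring_hom_cring "UP (Zp p)" "Zp_zeta p" cls
unfolding cls_def[abs_def] Zp_zeta_def by (rule I.rcos_ring_hom_cring) (rule U.P.is_cring)

abbreviation mon :: "padic => nat => nat => padic" where "mon c k \<equiv> monom (UP (Zp p)) c k"

lemma zeta_cls: "zeta p = cls (mon \<u> 1)" "zeta_const p c = cls (mon c 0)"
by (simp_all add: zeta_def zeta_const_def cls_def)

lemma zeta_closed [simp]: "zeta p : carrier (Zp_zeta p)"
"c : ZZ ==> zeta_const p c : carrier (Zp_zeta p)"
by (simp_all add: zeta_cls)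

lemma cls_surj: "y : carrier (Zp_zeta p) ==> EX P:carrier (UP (Zp p)). y = cls P"
by (auto simp: Zp_zeta_def FactRing_def A_RCOSETS_def' cls_def)

lemma cls_zero:
assumes P: "P : carrier (UP (Zp p))"
shows "cls P = \<zero>\<^bsub>Zp_zeta p\<^esub> \<longleftrightarrow> (EX q:carrier (UP (Zp p)). P = q \<otimes>\<^bsub>UP (Zp p)\<^esub> cyclo_poly p)"
proof -
have "cls P = cyclo_ideal p \<longleftrightarrow> P : cyclo_ideal p"
 unfolding cls_def using I.a_rcos_self[OF P] I.a_rcos_const by blast
then show ?thesis unfolding Zp_zeta_zero cyclo_ideal_iff .
qed

lemma zeta_pow: "zeta p [^]\<^bsub>Zp_zeta p\<^esub> k = cls (mon \<u> k)" for k :: nat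
proof (induction k)
case (Suc k)
have "mon \<u> (Suc k) = mon \<u> k \<otimes>\<^bsub>UP (Zp p)\<^esub> mon \<u> 1" by (rule U.monom_one_Suc)
then show ?case using Suc by (simp add: zeta_cls)
qed simp

lemma zeta_mon:
fixes k :: nat
assumes c: "c : ZZ"
shows "zeta_const p c \<otimes>\<^bsub>Zp_zeta p\<^esub> zeta p [^]\<^bsub>Zp_zeta p\<^esub> k = cls (mon c k)"
proof -
have "mon c k = mon c 0 \<otimes>\<^bsub>UP (Zp p)\<^esub> mon \<u> k"
 using U.monom_mult[OF c Zp.one_closed, of 0 k] c by (simp del: U.monom_mult)
moreover have "cls (mon c 0 \<otimes>\<^bsub>UP (Zp p)\<^esub> mon \<u> k) = cls (mon c 0) \<otimes>\<^bsub>Zp_zeta p\<^esub> cls (mon \<u> k)"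
 by (rule cls.hom_mult) (use c in auto)
ultimately show ?thesis unfolding zeta_pow zeta_cls(2) by simp
qed

lemma mon_sum_coeff:
assumes c: "!!k. k < p ==> c k : ZZ"
shows "coeff (UP (Zp p)) (\<Oplus>\<^bsub>UP (Zp p)\<^esub>k\<in>{..<p}. mon (c k) k) j = (if j < p then c j else \<z>)"
proof -
have "coeff (UP (Zp p)) (\<Oplus>\<^bsub>UP (Zp p)\<^esub>k\<in>{..<p}. mon (c k) k) j
 = (\<Oplus>\<^bsub>Zp p\<^esub>k\<in>{..<p}. coeff (UP (Zp p)) (mon (c k) k) j)"
 by (rule U.coeff_finsum) (use c in auto)
also have "\<dots> = (\<Oplus>\<^bsub>Zp p\<^esub>k\<in>{..<p}. if j = k then c k else \<z>)"
 by (rule Zp.finsum_cong') (use c in auto)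
also have "\<dots> = (if j < p then c j else \<z>)"
proof (cases "j < p")
 case True
 then show ?thesis using Zp.finsum_singleton[of j "{..<p}" c] c by auto
next
 case False
 then have "(\<Oplus>\<^bsub>Zp p\<^esub>k\<in>{..<p}. if j = k then c k else \<z>) = (\<Oplus>\<^bsub>Zp p\<^esub>k\<in>{..<p}. \<z>)"
 by (intro Zp.finsum_cong') auto
 then show ?thesis using False Zp.finsum_zero by simp
qed
finally show ?thesis .
qed

lemma mon_sum_closed:
"(!!k. k < p ==> c k : ZZ) ==> (\<Oplus>\<^bsub>UP (Zp p)\<^esub>k\<in>{..<p}. mon (c k) k) : carrier (UP (Zp p))"
by (rule U.P.finsum_closed) auto

lemma zeta_sum: "(\<Oplus>\<^bsub>Zp_zeta p\<^esub>k\<in>{..<p}. zeta p [^]\<^bsub>Zp_zeta p\<^esub> k) = \<zero>\<^bsub>Zp_zeta p\<^esub>"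
proof -
let ?P = "\<Oplus>\<^bsub>UP (Zp p)\<^esub>k\<in>{..<p}. mon \<u> k"
have "?P = cyclo_poly p"
 by (rule U.up_eqI) (use mon_sum_coeff[of "%_. \<u>"] mon_sum_closed[of "%_. \<u>"] coeff_cyclo in auto)
then have "cls ?P = \<zero>\<^bsub>Zp_zeta p\<^esub>"
 using cls_zero[of ?P] by (metis U.P.l_one U.P.one_closed cyclo_closed)
moreover have "cls ?P = (\<Oplus>\<^bsub>Zp_zeta p\<^esub>k\<in>{..<p}. (cls \<circ> (%k. mon \<u> k)) k)"
 by (rule cls.hom_finsum) auto
ultimately show ?thesis by (simp add: zeta_pow o_def)
qed

lemma zeta_p: "zeta p [^]\<^bsub>Zp_zeta p\<^esub> p = \<one>\<^bsub>Zp_zeta p\<^esub>"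
using cls.S.geometric_sum[of "zeta p" p] unfolding zeta_sum by simp

lemma Zp_zeta_mod_simps [simp]: "carrier (Zp_zeta_mod p) = carrier (Zp_zeta p)"
"x \<oplus>\<^bsub>Zp_zeta_mod p\<^esub> y = x \<oplus>\<^bsub>Zp_zeta p\<^esub> y" "\<zero>\<^bsub>Zp_zeta_mod p\<^esub> = \<zero>\<^bsub>Zp_zeta p\<^esub>"
"c \<odot>\<^bsub>Zp_zeta_mod p\<^esub> x = zeta_const p c \<otimes>\<^bsub>Zp_zeta p\<^esub> x"
by (simp_all add: Zp_zeta_mod_def with_smult_def)

lemma Zp_zeta_finsum: "(\<Oplus>\<^bsub>Zp_zeta_mod p\<^esub>k\<in>A. h k) = (\<Oplus>\<^bsub>Zp_zeta p\<^esub>k\<in>A. h k)"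
by (simp add: finsum_def finprod_def Zp_zeta_mod_def with_smult_def)

lemma zeta_const_hom:
assumes "c : ZZ" "d : ZZ"
shows "zeta_const p (c +| d) = zeta_const p c \<oplus>\<^bsub>Zp_zeta p\<^esub> zeta_const p d"
 "zeta_const p (c *| d) = zeta_const p c \<otimes>\<^bsub>Zp_zeta p\<^esub> zeta_const p d"
using assms U.monom_mult[of c d 0 0] by (simp_all add: zeta_cls)

lemma Zp_zeta_module: "module (Zp p) (Zp_zeta_mod p)"
proof (rule moduleI)
show "abelian_group (Zp_zeta_mod p)"
 by (rule abelian_groupI)
 (use cls.S.a_assoc cls.S.a_comm cls.S.l_neg in \<open>auto intro!: bexI[where x = "\<ominus>\<^bsub>Zp_zeta p\<^esub> _"]\<close>)
have "zeta_const p \<u> = \<one>\<^bsub>Zp_zeta p\<^esub>" by (simp add: zeta_cls)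
then show "\<u> \<odot>\<^bsub>Zp_zeta_mod p\<^esub> x = x" if "x : carrier (Zp_zeta_mod p)" for x using that by simp
qed (simp_all add: zeta_const_hom cls.S.l_distr cls.S.r_distr cls.S.m_assoc Zp.is_cring)

lemma zeta_iter: "y : carrier (Zp_zeta p) ==> ((%y. zeta p \<otimes>\<^bsub>Zp_zeta p\<^esub> y) ^^ k) y = zeta p [^]\<^bsub>Zp_zeta p\<^esub> k \<otimes>\<^bsub>Zp_zeta p\<^esub> y"
by (induction k) (simp_all add: cls.S.m_assoc[symmetric] cls.S.m_comm[of "zeta p" "zeta p [^]\<^bsub>Zp_zeta p\<^esub> _"])

sublocale Z: tau_module p G \<tau> "Zp_zeta_mod p" "%y. zeta p \<otimes>\<^bsub>Zp_zeta p\<^esub> y"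
proof (intro tau_module.intro tau_module_axioms.intro Zp_zeta_module padic_group_axioms)
fix c x assume "c : ZZ" "x : carrier (Zp_zeta_mod p)"
then show "zeta p \<otimes>\<^bsub>Zp_zeta p\<^esub> (c \<odot>\<^bsub>Zp_zeta_mod p\<^esub> x) = c \<odot>\<^bsub>Zp_zeta_mod p\<^esub> (zeta p \<otimes>\<^bsub>Zp_zeta p\<^esub> x)"
 by (simp add: cls.S.m_lcomm)
next
fix x assume "x : carrier (Zp_zeta_mod p)"
then show "((%y. zeta p \<otimes>\<^bsub>Zp_zeta p\<^esub> y) ^^ p) x = x" by (simp add: zeta_iter zeta_p)
qed (simp_all add: cls.S.r_distr)

lemma Z_smult_one: "a : carrier R ==> a \<odot>\<^bsub>Z.E\<^esub> \<one>\<^bsub>Zp_zeta p\<^esub> = cls (\<Oplus>\<^bsub>UP (Zp p)\<^esub>k\<in>{..<p}. mon (a (\<tau> ^@ k)) k)"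
proof -
assume a: "a : carrier R"
let ?m = "%k. mon (a (\<tau> ^@ k)) k"
have "a \<odot>\<^bsub>Z.E\<^esub> \<one>\<^bsub>Zp_zeta p\<^esub> = (\<Oplus>\<^bsub>Zp_zeta p\<^esub>k\<in>{..<p}. (cls \<circ> ?m) k)"
 unfolding Z.E_smult Zp_zeta_finsum
 by (rule cls.S.finsum_cong') (use a \<tau> in \<open>auto simp: zeta_iter zeta_mon\<close>)
also have "\<dots> = cls (\<Oplus>\<^bsub>UP (Zp p)\<^esub>k\<in>{..<p}. ?m k)"
 by (rule cls.hom_finsum[symmetric]) (use a \<tau> in auto)
finally show ?thesis .
qed

text \<open>A multiple of the cyclotomic polynomial of degree below \<open>p\<close> is a constant multiple.\<close>

lemma Z_smult_one_zero:
assumes a: "a : carrier R" and z: "a \<odot>\<^bsub>Z.E\<^esub> \<one>\<^bsub>Zp_zeta p\<^esub> = \<zero>\<^bsub>Zp_zeta p\<^esub>"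
shows "a = nrm *: cst (a \<e>)"
proof -
let ?c = "%k. a (\<tau> ^@ k)"
let ?P = "\<Oplus>\<^bsub>UP (Zp p)\<^esub>k\<in>{..<p}. mon (?c k) k"
have c: "?c k : ZZ" for k :: nat using a \<tau> by simp
have P: "?P : carrier (UP (Zp p))" by (rule mon_sum_closed) (rule c)
have Pc: "coeff (UP (Zp p)) ?P j = (if j < p then ?c j else \<z>)" for j
 by (rule mon_sum_coeff) (rule c)
obtain q where q: "q : carrier (UP (Zp p))" "?P = q \<otimes>\<^bsub>UP (Zp p)\<^esub> cyclo_poly p"
 using z cls_zero[OF P] Z_smult_one[OF a] by auto
have "EX d:ZZ. q = mon d 0"
proof (cases "q = \<zero>\<^bsub>UP (Zp p)\<^esub>")
 case False
 have cn: "cyclo_poly p ~= \<zero>\<^bsub>UP (Zp p)\<^esub>" using coeff_cyclo[of 0] p0 by auto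
 have "p - 1 <= deg (Zp p) (cyclo_poly p)"
 by (rule U.deg_belowI) (use p0 in \<open>simp_all add: coeff_cyclo\<close>)
 moreover have "deg (Zp p) ?P <= p - 1" by (rule U.deg_aboveI) (use P Pc in auto)
 ultimately have "deg (Zp p) q = 0" using U.deg_mult[OF False cn q(1) cyclo_closed] q(2) by simp
 then show ?thesis using U.deg_zero_impl_monom[OF q(1)] U.coeff_closed[OF q(1)] by metis
qed (use U.monom_zero in \<open>auto intro!: bexI[of _ "\<z>"]\<close>)
then obtain d where d: "d : ZZ" "q = mon d 0" by blast
have "?c j = d" if "j < p" for j
proof -
 have "?c j = coeff (UP (Zp p)) (mon d 0 \<otimes>\<^bsub>UP (Zp p)\<^esub> cyclo_poly p) j" using Pc[of j] that q(2) d(2) by simp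
 also have "\<dots> = d" using d(1) that by (simp add: U.monom_mult_is_smult coeff_cyclo del: U.coeff_mult)
 finally show ?thesis .
qed
then have all: "a g = d" if "g : carrier G" for g using tau_cases[OF that] by auto
show ?thesis by (rule nrm_const[OF a]) (simp add: all)
qed

lemma nrm_one: "nrm \<odot>\<^bsub>Z.E\<^esub> \<one>\<^bsub>Zp_zeta p\<^esub> = \<zero>\<^bsub>Zp_zeta p\<^esub>"
proof -
have "nrm \<odot>\<^bsub>Z.E\<^esub> \<one>\<^bsub>Zp_zeta p\<^esub> = (\<Oplus>\<^bsub>Zp_zeta p\<^esub>k\<in>{..<p}. zeta p [^]\<^bsub>Zp_zeta p\<^esub> k)"
 using Z.nrm_smult[of "\<one>\<^bsub>Zp_zeta p\<^esub>"] unfolding Zp_zeta_finsum by (simp add: zeta_iter)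
then show ?thesis by (simp add: zeta_sum)
qed

text \<open>A class is represented by a polynomial, and the monomial \<open>c X^k\<close> is what
  \<open>cst c *: T ^: k\<close> makes of 1.\<close>

lemma Z_generated: "y : carrier (Zp_zeta p) ==> EX a:carrier R. y = a \<odot>\<^bsub>Z.E\<^esub> \<one>\<^bsub>Zp_zeta p\<^esub>"
proof -
assume "y : carrier (Zp_zeta p)"
then obtain P where P: "P : carrier (UP (Zp p))" "y = cls P" using cls_surj by blast
let ?m = "%i. mon (coeff (UP (Zp p)) P i) i"
have "EX a:carrier R. cls (\<Oplus>\<^bsub>UP (Zp p)\<^esub>i\<in>{..<n}. ?m i) = a \<odot>\<^bsub>Z.E\<^esub> \<one>\<^bsub>Zp_zeta p\<^esub>" for n :: nat
proof (induction n)
 case 0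
 show ?case using Z.E.smult_l_null[of "\<one>\<^bsub>Zp_zeta p\<^esub>"] R.zero_closed by force
next
 case (Suc n)
 then obtain a where a: "a : carrier R" "cls (\<Oplus>\<^bsub>UP (Zp p)\<^esub>i\<in>{..<n}. ?m i) = a \<odot>\<^bsub>Z.E\<^esub> \<one>\<^bsub>Zp_zeta p\<^esub>" by blast
 let ?c = "coeff (UP (Zp p)) P n"
 have c: "?c : ZZ" using P(1) by simp
 have "T ^: k \<odot>\<^bsub>Z.E\<^esub> \<one>\<^bsub>Zp_zeta p\<^esub> = zeta p [^]\<^bsub>Zp_zeta p\<^esub> k" for k :: nat
 proof (induction k)
 case 0
 show ?case using Z.E.smult_one[of "\<one>\<^bsub>Zp_zeta p\<^esub>"] by simp
 next
 case (Suc k)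
 have "T ^: Suc k \<odot>\<^bsub>Z.E\<^esub> \<one>\<^bsub>Zp_zeta p\<^esub> = zeta p \<otimes>\<^bsub>Zp_zeta p\<^esub> (T ^: k \<odot>\<^bsub>Z.E\<^esub> \<one>\<^bsub>Zp_zeta p\<^esub>)"
  using Z.T_mult_smult[of "T ^: k" "\<one>\<^bsub>Zp_zeta p\<^esub>"] R.m_comm[of "T ^: k" T] by simp
 then show ?case using Suc cls.S.m_comm[of "zeta p" "zeta p [^]\<^bsub>Zp_zeta p\<^esub> k"] by simp
 qed
 then have "(cst ?c *: T ^: n) \<odot>\<^bsub>Z.E\<^esub> \<one>\<^bsub>Zp_zeta p\<^esub> = cls (?m n)"
 using c by (simp add: Z.E_assoc Z.cst_smult zeta_mon)
 moreover have "(\<Oplus>\<^bsub>UP (Zp p)\<^esub>i\<in>{..<Suc n}. ?m i) = ?m n \<oplus>\<^bsub>UP (Zp p)\<^esub> (\<Oplus>\<^bsub>UP (Zp p)\<^esub>i\<in>{..<n}. ?m i)"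
 unfolding lessThan_Suc by (rule U.P.finsum_insert) (use P(1) in auto)
 moreover have "(\<Oplus>\<^bsub>UP (Zp p)\<^esub>i\<in>{..<n}. ?m i) : carrier (UP (Zp p))"
 by (rule U.P.finsum_closed) (use P(1) in auto)
 ultimately have "cls (\<Oplus>\<^bsub>UP (Zp p)\<^esub>i\<in>{..<Suc n}. ?m i) = (cst ?c *: T ^: n +: a) \<odot>\<^bsub>Z.E\<^esub> \<one>\<^bsub>Zp_zeta p\<^esub>"
 using a c by (simp add: Z.E_l_distr)
 moreover have "cst ?c *: T ^: n +: a : carrier R" using a c by simp
 ultimately show ?case by blast
qed
from this[of "Suc (deg (Zp p) P)"] show ?thesis
 using U.up_repr[OF P(1)] P(2) by (simp only: lessThan_Suc_atMost)
qed

text \<open>Write \<open>y\<close> as \<open>a\<close> applied to 1. Then \<open>\<sigma> a\<close>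
  is \<open>nrm\<close> times a constant, and taking augmentations shows that the constant is zero.
  So \<open>\<sigma> a = 0\<close>, which makes \<open>a\<close> a multiple of \<open>nrm\<close>,
  and \<open>nrm\<close> kills 1.\<close>

lemma sigma_cancel:
assumes y: "y : carrier (Zp_zeta p)" and z: "\<sigma> \<odot>\<^bsub>Z.E\<^esub> y = \<zero>\<^bsub>Zp_zeta p\<^esub>"
shows "y = \<zero>\<^bsub>Zp_zeta p\<^esub>"
proof -
obtain a where a: "a : carrier R" "y = a \<odot>\<^bsub>Z.E\<^esub> \<one>\<^bsub>Zp_zeta p\<^esub>" using Z_generated[OF y] by blast
have "(\<sigma> *: a) \<odot>\<^bsub>Z.E\<^esub> \<one>\<^bsub>Zp_zeta p\<^esub> = \<zero>\<^bsub>Zp_zeta p\<^esub>" using z a by (simp add: Z.E_assoc)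
from Z_smult_one_zero[OF _ this] have n: "\<sigma> *: a = nrm *: cst ((\<sigma> *: a) \<e>)" using a(1) by simp
have d: "(\<sigma> *: a) \<e> : ZZ" using a(1) by simp
have "Zp_int p (int p) *| (\<sigma> *: a) \<e> = eps (\<sigma> *: a)"
 by (subst (2) n) (use d in \<open>simp add: eps_nrm_mult eps_cst\<close>)
then have "(\<sigma> *: a) \<e> = \<z>" using Zp_p_cancel[OF d] a(1) by simp
then have "\<sigma> *: a = \<o>" using n by (simp add: cst_zero)
then have "a = nrm *: cst (a \<e>)" by (rule sigma_zero[OF a(1)])
then have "y = (cst (a \<e>) *: nrm) \<odot>\<^bsub>Z.E\<^esub> \<one>\<^bsub>Zp_zeta p\<^esub>" using a R.m_comm[of nrm "cst (a \<e>)"] by simp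
then show ?thesis using a(1) Z.E.smult_r_null[of "cst (a \<e>)"] by (simp add: Z.E_assoc nrm_one)
qed

end

section \<open>Presentations of the modules in the list\<close>

lemma gen3_zero:
assumes "module R M" "x : carrier M"
 and gen: "!!z. z : carrier M ==> EX a:carrier R. z = a \<odot>\<^bsub>M\<^esub> x"
shows "carrier M = gen3 R M x \<zero>\<^bsub>M\<^esub> \<zero>\<^bsub>M\<^esub>" "carrier M = gen3 R M \<zero>\<^bsub>M\<^esub> x \<zero>\<^bsub>M\<^esub>"
 "carrier M = gen3 R M \<zero>\<^bsub>M\<^esub> \<zero>\<^bsub>M\<^esub> x"
proof -
interpret module R M by fact
have "z : gen3 R M x \<zero>\<^bsub>M\<^esub> \<zero>\<^bsub>M\<^esub> & z : gen3 R M \<zero>\<^bsub>M\<^esub> x \<zero>\<^bsub>M\<^esub> & z : gen3 R M \<zero>\<^bsub>M\<^esub> \<zero>\<^bsub>M\<^esub> x"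
 if z: "z : carrier M" for z
proof -
 obtain a where a: "a : carrier R" "z = a \<odot>\<^bsub>M\<^esub> x" using gen[OF z] by blast
 have "z = a \<odot>\<^bsub>M\<^esub> x \<oplus>\<^bsub>M\<^esub> \<zero>\<^bsub>R\<^esub> \<odot>\<^bsub>M\<^esub> \<zero>\<^bsub>M\<^esub> \<oplus>\<^bsub>M\<^esub> \<zero>\<^bsub>R\<^esub> \<odot>\<^bsub>M\<^esub> \<zero>\<^bsub>M\<^esub>"
 "z = \<zero>\<^bsub>R\<^esub> \<odot>\<^bsub>M\<^esub> \<zero>\<^bsub>M\<^esub> \<oplus>\<^bsub>M\<^esub> a \<odot>\<^bsub>M\<^esub> x \<oplus>\<^bsub>M\<^esub> \<zero>\<^bsub>R\<^esub> \<odot>\<^bsub>M\<^esub> \<zero>\<^bsub>M\<^esub>"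
 "z = \<zero>\<^bsub>R\<^esub> \<odot>\<^bsub>M\<^esub> \<zero>\<^bsub>M\<^esub> \<oplus>\<^bsub>M\<^esub> \<zero>\<^bsub>R\<^esub> \<odot>\<^bsub>M\<^esub> \<zero>\<^bsub>M\<^esub> \<oplus>\<^bsub>M\<^esub> a \<odot>\<^bsub>M\<^esub> x"
 using a z assms(2) by simp_all
 then show ?thesis unfolding gen3_def using a(1) R.zero_closed by blast
qed
then show "carrier M = gen3 R M x \<zero>\<^bsub>M\<^esub> \<zero>\<^bsub>M\<^esub>" "carrier M = gen3 R M \<zero>\<^bsub>M\<^esub> x \<zero>\<^bsub>M\<^esub>"
 "carrier M = gen3 R M \<zero>\<^bsub>M\<^esub> \<zero>\<^bsub>M\<^esub> x"
 using assms(2) by (auto simp: gen3_def)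
qed

lemma presI:
"[|t : N; x : N; y : N; N = gen3 R M t x y; cond R M s n q t x y e|] ==> pres R M s n q N e"
unfolding pres_def by blast

context padic_group
begin

lemma pow_binomial:
assumes d: "m dvd e * e"
shows "[(1 + e) ^ k = 1 + int k * e] (mod m)"
proof (induction k)
case (Suc k)
have "[(1 + e) ^ Suc k = (1 + e) * (1 + int k * e)] (mod m)" using Suc by (auto intro: cong_mult)
also have "(1 + e) * (1 + int k * e) = 1 + int (Suc k) * e + int k * (e * e)" by (simp add: algebra_simps)
also have "[\<dots> = 1 + int (Suc k) * e + 0] (mod m)"
 using d by (intro cong_add cong_refl) (simp add: cong_0_iff)
finally show ?case by simp
qed simp

text \<open>Treats the trivial action, \<open>c = 0\<close>, and F_i together. The norm acts as
  \<open>p\<close>: with \<open>e = c p^(i-1)\<close>, the numbers \<open>1 + k e\<close> for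
  \<open>k < p\<close> add up to \<open>p + e p (p-1)/2\<close>, and for odd \<open>p\<close> the
  second term is divisible by \<open>p^i\<close>.\<close>

lemma Zmod_tau:
assumes tm: "tau_module p G \<tau> (Zmod p i) t" and i: "i >= 1"
 and t: "!!u. u : carrier (Zmod p i) ==> t u = ((1 + int c * int p ^ (i - 1)) * u) mod int p ^ i"
 and c: "c = 0 \<or> i >= 2"
defines "E \<equiv> tau_mod p G \<tau> (Zmod p i) t"
shows "is_tor R E \<sigma> nrm i c 1" "carrier E = gen3 R E 1 0 0"
proof -
interpret tm: tau_module p G \<tau> "Zmod p i" t by fact
let ?P = "int p ^ i" and ?e = "int c * int p ^ (i - 1)"
have P1: "?P > 1" using p0 i one_less_power[of "int p" i] by simp
then have one: "1 : carrier (Zmod p i)" by simp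
have Pi: "?P = int p * int p ^ (i - 1)" using i by (simp add: power_eq_if)
have ee: "?P dvd ?e * ?e"
proof (cases "c = 0")
 case False
 then have "i <= (i - 1) + (i - 1)" using c by simp
 then have "?P dvd int p ^ (i - 1) * int p ^ (i - 1)" by (simp add: power_add[symmetric] le_imp_power_dvd)
 then show ?thesis by (simp add: mult_ac)
qed simp
have tk: "(t ^^ k) u = ((1 + ?e) ^ k * u) mod ?P" if u: "u : carrier (Zmod p i)" for u k
proof (induction k)
 case (Suc k)
 have "(t ^^ Suc k) u = ((1 + ?e) * ((1 + ?e) ^ k * u mod ?P)) mod ?P"
 using t[of "(t ^^ k) u"] tm.tk[OF u, of k] Suc by simp
 then show ?case by (simp add: mod_mult_right_eq mult.assoc)
qed (use u in simp)
have n: "nrm \<odot>\<^bsub>E\<^esub> u = (int p * u) mod ?P" if u: "u : carrier (Zmod p i)" for u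
proof -
 obtain m where m: "p = 2 * m + 1" using odd_p by (auto elim: oddE)
 have s2: "2 * (\<Sum>k<N. int k) = int N * (int N - 1)" for N by (induction N) (simp_all add: algebra_simps)
 have sk: "(\<Sum>k<p. int k) = int p * int m" using s2[of p] m by (simp add: algebra_simps)
 have "nrm \<odot>\<^bsub>E\<^esub> u = (\<Sum>k<p. (t ^^ k) u) mod ?P"
 unfolding E_def tm.nrm_smult[OF u] by (rule Zmod_finsum) (use tm.tk[OF u] in auto)
 also have "\<dots> = (\<Sum>k<p. (1 + int k * ?e) * u) mod ?P"
 unfolding cong_def[symmetric]
 by (rule cong_sum) (use pow_binomial[OF ee] in \<open>auto simp: tk[OF u] intro: cong_mult\<close>)
 also have "(\<Sum>k<p. (1 + int k * ?e) * u) = int p * u + (\<Sum>k<p. int k) * (?e * u)"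
 proof -
 have "(1 + int k * ?e) * u = u + int k * (?e * u)" for k by (simp add: algebra_simps)
 then show ?thesis by (simp add: sum.distrib sum_distrib_right del: mult.assoc)
 qed
 also have "\<dots> = int p * u + ?P * (int m * int c * u)"
 unfolding sk Pi by (simp add: mult_ac)
 finally show ?thesis by simp
qed
have np: "nrm ^: k \<odot>\<^bsub>E\<^esub> 1 = int p ^ k mod ?P" for k :: nat
proof (induction k)
 case 0
 then show ?case using tm.E.smult_one[of 1] one P1 by (simp add: E_def)
next
 case (Suc k)
 have "nrm ^: Suc k \<odot>\<^bsub>E\<^esub> 1 = nrm \<odot>\<^bsub>E\<^esub> (nrm ^: k \<odot>\<^bsub>E\<^esub> 1)"
 using tm.E.smult_assoc1[of nrm "nrm ^: k" 1] one R.m_comm[of nrm "nrm ^: k"]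
 by (simp add: E_def)
 then show ?case using n[OF mod_in] Suc by (simp add: mod_simps)
qed
have s: "\<sigma> \<odot>\<^bsub>E\<^esub> 1 = ?e mod ?P"
 using tm.sigma_smult[OF one] t[OF one] Zmod_minus[OF mod_in one, of "1 + ?e"]
 by (simp add: E_def mod_simps)
have cs: "([c] \<cdot>\<^bsub>R\<^esub> \<r> *: nrm ^: (i - 1)) \<odot>\<^bsub>E\<^esub> 1 = ?e mod ?P"
proof -
 have "([c] \<cdot>\<^bsub>R\<^esub> \<r> *: nrm ^: (i - 1)) \<odot>\<^bsub>E\<^esub> 1 = cst (Zp_int p (int c)) \<odot>\<^bsub>E\<^esub> (int p ^ (i - 1) mod ?P)"
 using tm.E.smult_assoc1[of "cst (Zp_int p (int c))" "nrm ^: (i - 1)" 1] one np[of "i - 1"]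
 by (simp add: E_def add_pow_cst)
 then show ?thesis using tm.cst_smult[OF Zp_int_closed mod_in, of "int c"]
 by (simp add: E_def Zp_int_app mod_simps)
qed
have "int p ^ (i - 1) mod ?P = int p ^ (i - 1)"
 using p0 i by (intro mod_pos_pos_trivial) (simp_all add: power_strict_increasing)
then show "is_tor R E \<sigma> nrm i c 1"
 using s cs np[of i] np[of "i - 1"] i one p0 unfolding is_tor_def by (simp add: E_def)
show "carrier E = gen3 R E 1 0 0"
proof -
 have "EX a:carrier R. z = a \<odot>\<^bsub>E\<^esub> 1" if z: "z : carrier E" for z
 proof (rule bexI[of _ "cst (Zp_int p z)"])
 show "z = cst (Zp_int p z) \<odot>\<^bsub>E\<^esub> 1"
  using z tm.cst_smult[OF Zp_int_closed one, of z] by (simp add: E_def Zp_int_app)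
 qed simp
 then show ?thesis using gen3_zero(1)[of R E 1] tm.E.module_axioms one by (simp add: E_def)
qed
qed

lemma tau_id: "module (Zp p) N ==> tau_module p G \<tau> N (%x. x)"
proof (intro tau_module.intro tau_module_axioms.intro padic_group_axioms)
show "((%x. x) ^^ p) x = x" for x :: 'b by (induction p) auto
qed auto

lemma M_cyc_pres:
assumes i: "i >= 1"
shows "module R (M_cyc p G \<tau> i)" "pres R (M_cyc p G \<tau> i) \<sigma> nrm p (carrier (M_cyc p G \<tau> i)) (E_cyc i)"
proof -
note tm = tau_id[OF Zmod_module[of i]]
interpret tm: tau_module p G \<tau> "Zmod p i" "%x. x" by (rule tm)
show "module R (M_cyc p G \<tau> i)" unfolding M_cyc_def by (rule tm.E.module_axioms)
have g: "is_tor R tm.E \<sigma> nrm i 0 1" "carrier tm.E = gen3 R tm.E 1 0 0"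
 using Zmod_tau[OF tm i, of 0] by auto
have one: "1 : carrier tm.E" "0 : carrier tm.E"
 using p0 one_less_power[of "int p" i] i by simp_all
have "cond R tm.E \<sigma> nrm p 1 0 0 (E_cyc i)" using g(1) i by simp
then show "pres R (M_cyc p G \<tau> i) \<sigma> nrm p (carrier (M_cyc p G \<tau> i)) (E_cyc i)"
 unfolding M_cyc_def by (rule presI[OF one one(2) g(2)])
qed

lemma M_F_pres:
assumes i: "i >= 2" and w: "admissible_unit p i w"
shows "module R (M_F p G \<tau> i w)" "pres R (M_F p G \<tau> i w) \<sigma> nrm p (carrier (M_F p G \<tau> i w)) (E_F i w)"
proof -
have wc: "w = 1 + int (F_coeff p i w) * int p ^ (i - 1)"
 using F_coeff[of p i w] p0 i w by simp
let ?e = "int (F_coeff p i w) * int p ^ (i - 1)"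
have ee: "int p ^ i dvd ?e * ?e"
proof -
 have "i <= (i - 1) + (i - 1)" using i by simp
 then have "int p ^ i dvd int p ^ (i - 1) * int p ^ (i - 1)" by (simp add: power_add[symmetric] le_imp_power_dvd)
 then show ?thesis by (simp add: mult_ac)
qed
have "[w ^ p = 1 + int p * ?e] (mod int p ^ i)" by (subst wc) (rule pow_binomial[OF ee])
also have "[1 + int p * ?e = 1 + 0] (mod int p ^ i)"
 using i by (intro cong_add cong_refl) (simp add: cong_0_iff power_eq_if)
finally have wp: "[w ^ p = 1] (mod int p ^ i)" by simp
have it: "((%u. (w * u) mod int p ^ i) ^^ k) u = (w ^ k * u) mod int p ^ i" if "u : carrier (Zmod p i)" for u k
 by (induction k) (use that in \<open>simp_all add: mod_mult_right_eq mult.assoc\<close>)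
have tm: "tau_module p G \<tau> (Zmod p i) (%u. (w * u) mod int p ^ i)"
proof (intro tau_module.intro tau_module_axioms.intro Zmod_module padic_group_axioms)
 fix x assume x: "x : carrier (Zmod p i)"
 have "(w ^ p * x) mod int p ^ i = x" using cong_mult[OF wp cong_refl[of x]] x by (simp add: cong_def)
 then show "((%u. (w * u) mod int p ^ i) ^^ p) x = x" using it[OF x] by simp
qed (use mod_in in \<open>simp_all add: mod_simps algebra_simps del: Zmod_simps(1)\<close>)
interpret tm: tau_module p G \<tau> "Zmod p i" "%u. (w * u) mod int p ^ i" by (rule tm)
show "module R (M_F p G \<tau> i w)" unfolding M_F_def by (rule tm.E.module_axioms)
have g: "is_tor R tm.E \<sigma> nrm i (F_coeff p i w) 1" "carrier tm.E = gen3 R tm.E 1 0 0"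
 using Zmod_tau[OF tm, of "F_coeff p i w"] i wc by auto
have one: "1 : carrier tm.E" "0 : carrier tm.E"
 using p0 one_less_power[of "int p" i] i by simp_all
have "cond R tm.E \<sigma> nrm p 1 0 0 (E_F i w)" using g(1) i by simp
then show "pres R (M_F p G \<tau> i w) \<sigma> nrm p (carrier (M_F p G \<tau> i w)) (E_F i w)"
 unfolding M_F_def by (rule presI[OF one one(2) g(2)])
qed

lemma Zp_smult_one:
assumes "a : carrier R" "x : ZZ"
shows "a \<odot>\<^bsub>tau_mod p G \<tau> (self_mod (Zp p)) (%x. x)\<^esub> x = eps a *| x"
proof -
interpret tm: tau_module p G \<tau> "self_mod (Zp p)" "%x. x"
 by (rule tau_id[OF self_mod_module[OF Zp.is_cring]])
have "\<sigma> \<odot>\<^bsub>tm.E\<^esub> x = \<zero>\<^bsub>tm.E\<^esub>"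
 using tm.sigma_smult[of x] assms by (simp add: tm.N.M.minus_eq tm.N.M.r_neg[simplified])
then show ?thesis using eps_smult[OF tm.E.module_axioms, of x a] tm.cst_smult[of "eps a" x] assms by simp
qed

lemma M_Zp_pres: "module R (M_Zp p G \<tau>)" "pres R (M_Zp p G \<tau>) \<sigma> nrm p (carrier (M_Zp p G \<tau>)) E_Zp"
proof -
interpret tm: tau_module p G \<tau> "self_mod (Zp p)" "%x. x"
 by (rule tau_id[OF self_mod_module[OF Zp.is_cring]])
show M: "module R (M_Zp p G \<tau>)" unfolding M_Zp_def by (rule tm.E.module_axioms)
have "EX a:carrier R. z = a \<odot>\<^bsub>tm.E\<^esub> \<u>" if "z : carrier tm.E" for z
 by (rule bexI[of _ "cst z"]) (use that in \<open>simp_all add: Zp_smult_one eps_cst\<close>)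
then have "carrier tm.E = gen3 R tm.E \<zero>\<^bsub>tm.E\<^esub> \<u> \<zero>\<^bsub>tm.E\<^esub>"
 by (intro gen3_zero(2) tm.E.module_axioms) auto
moreover have "free_over R tm.E nrm \<zero>\<^bsub>tm.E\<^esub> \<u>"
 using tm.E.smult_r_null Zp_int_p_pow_nonzero by (auto simp: free_over_def Zp_smult_one eps_nrm_pow)
moreover have "\<sigma> \<odot>\<^bsub>tm.E\<^esub> \<u> = \<zero>\<^bsub>tm.E\<^esub>" by (simp add: Zp_smult_one eps_sigma)
ultimately show "pres R (M_Zp p G \<tau>) \<sigma> nrm p (carrier (M_Zp p G \<tau>)) E_Zp"
 unfolding M_Zp_def
 by (intro presI[where t = "\<zero>\<^bsub>tm.E\<^esub>" and x = "\<u>" and y = "\<zero>\<^bsub>tm.E\<^esub>"]) auto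
qed

lemma M_reg_pres: "module R (M_reg p G)" "pres R (M_reg p G) \<sigma> nrm p (carrier (M_reg p G)) E_reg"
proof -
show M: "module R (M_reg p G)" unfolding M_reg_def by (rule self_mod_module[OF R.is_cring])
have "carrier (M_reg p G) = gen3 R (M_reg p G) \<zero>\<^bsub>M_reg p G\<^esub> \<r> \<zero>\<^bsub>M_reg p G\<^esub>"
 by (intro gen3_zero(2) M) (auto simp: M_reg_def)
then show "pres R (M_reg p G) \<sigma> nrm p (carrier (M_reg p G)) E_reg"
 by (intro presI[where t = "\<zero>\<^bsub>M_reg p G\<^esub>" and x = "\<r>" and y = "\<zero>\<^bsub>M_reg p G\<^esub>"])
 (use sigma_pow_nonzero nod.n_pow in \<open>auto simp: free_over_def M_reg_def\<close>)
qed

lemma g_act_pow: "g_act (Zp p) G M (\<tau> ^@ k) x = T ^: k \<odot>\<^bsub>M\<^esub> x" for k :: nat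
using single_eq[of "\<u>" k] by (simp add: g_act_def cst_one)

lemma norm_map_eq:
assumes M: "module R M" and x: "x : carrier M"
shows "norm_map (Zp p) G M x = nrm \<odot>\<^bsub>M\<^esub> x"
proof -
interpret M: module R M by fact
let ?f = "%g. gr_single (Zp p) G \<u> g"
have f: "?f : carrier G \<rightarrow> carrier R" by auto
have "nrm = (\<Oplus>\<^bsub>R\<^esub>g\<in>carrier G. ?f g)"
proof (rule R_eqI[OF closed(4) R.finsum_closed[OF f]])
 fix g assume g: "g : carrier G"
 have "(\<Oplus>\<^bsub>R\<^esub>h\<in>carrier G. ?f h) g = (\<Oplus>\<^bsub>Zp p\<^esub>h\<in>carrier G. if g = h then \<u> else \<z>)"
 unfolding R_finsum[OF finite_G f g] by (rule Zp.finsum_cong') (use g in \<open>auto simp: gr_single_def\<close>)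
 then show "nrm g = (\<Oplus>\<^bsub>R\<^esub>h\<in>carrier G. ?f h) g"
 using Zp.finsum_singleton[OF g finite_G, of "%_. \<u>"] g by (simp add: nrm_def)
qed
moreover have "(\<Oplus>\<^bsub>R\<^esub>g\<in>A. ?f g) \<odot>\<^bsub>M\<^esub> x = (\<Oplus>\<^bsub>M\<^esub>g\<in>A. ?f g \<odot>\<^bsub>M\<^esub> x)" if "finite A" for A
 using that
proof (induction A rule: finite_induct)
 case (insert g A)
 have "(%g. ?f g \<odot>\<^bsub>M\<^esub> x) : A \<rightarrow> carrier M" "?f : A \<rightarrow> carrier R" using x by auto
 then show ?case using insert x R.finsum_closed[of ?f A] by (simp add: M.smult_l_distr)
qed (use x in simp)
ultimately show ?thesis using finite_G by (simp add: norm_map_def g_act_def)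
qed

text \<open>By \<open>ann_n\<close> the kernel of the norm on Z_p[G] is generated by
  \<open>\<sigma>\<close>, which plays the part of \<open>y\<close>.\<close>

lemma M_A_pres: "module R (M_A p G)" "pres R (M_A p G) \<sigma> nrm p (carrier (M_A p G)) E_A"
proof -
interpret M: nodal_char_module R \<sigma> nrm p "M_reg p G" by (rule nodal_char_module[OF M_reg_pres(1)])
have c: "carrier (M_A p G) = Ker (M_reg p G) nrm (carrier (M_reg p G))"
 using norm_map_eq[OF M_reg_pres(1)] by (auto simp: M_A_def Ker_def)
have "submodule (carrier (M_A p G)) R (M_reg p G)"
 unfolding c by (rule M.Ker_submodule) (auto intro: M.carrier_is_submodule)
then show M: "module R (M_A p G)"
 using submodule.submodule_is_module[OF _ M_reg_pres(1)] by (auto simp: M_A_def)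
have k: "a : carrier (M_A p G) \<longleftrightarrow> a : carrier R & nrm *: a = \<o>" for a
 unfolding c by (auto simp: Ker_def M_reg_def)
have o: "\<zero>\<^bsub>M_A p G\<^esub> = \<o>" "a \<odot>\<^bsub>M_A p G\<^esub> b = a *: b" for a b
 by (simp_all add: M_A_def M_reg_def)
have s: "\<sigma> : carrier (M_A p G)" "\<o> : carrier (M_A p G)" by (simp_all add: k nod.ns)
have "EX b:carrier R. a = b \<odot>\<^bsub>M_A p G\<^esub> \<sigma>" if "a : carrier (M_A p G)" for a
 using nod.ann_n[of a] that R.m_comm[of \<sigma>] by (auto simp: k o)
then have "carrier (M_A p G) = gen3 R (M_A p G) \<o> \<o> \<sigma>"
 using gen3_zero(3)[OF M s(1)] by (simp add: o)
moreover have "free_over R (M_A p G) \<sigma> \<o> \<sigma>"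
 using s(1) sigma_pow_nonzero[of "Suc _"] by (auto simp: free_over_def o)
ultimately show "pres R (M_A p G) \<sigma> nrm p (carrier (M_A p G)) E_A"
 using s by (intro presI[where t = "\<o>" and x = "\<o>" and y = \<sigma>]) (auto simp: o nod.ns)
qed

end

context ext_module
begin

text \<open>Multiplication by \<open>p = \<sigma> b + nrm\<close> annihilates the torsion coordinate of \<open>(0, y)\<close>.\<close>

lemma nrm_X:
assumes y: "y : carrier L" "nrm \<odot>\<^bsub>L.E\<^esub> y = \<zero>\<^bsub>L\<^esub>"
 and b: "b : carrier R" "cst (Zp_int p (int p)) = \<sigma> *: b +: nrm"
shows "nrm \<odot>\<^bsub>X.E\<^esub> (0, y) = ((- \<phi> (b \<odot>\<^bsub>L.E\<^esub> y)) mod int p ^ i, \<zero>\<^bsub>L\<^esub>)"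
proof -
have z: "(0, y) : carrier X.E" using y p0 by simp
let ?w = "b \<odot>\<^bsub>X.E\<^esub> (0, y)" and ?m = "nrm \<odot>\<^bsub>X.E\<^esub> (0, y)"
have wc: "?w : carrier X.E" and mc: "?m : carrier X.E"
 using X.E.smult_closed[OF b(1) z] X.E.smult_closed[OF closed(4) z] by auto
have ws: "snd ?w = b \<odot>\<^bsub>L.E\<^esub> y" and ms: "snd ?m = \<zero>\<^bsub>L\<^esub>"
 using snd_smult[OF b(1) z] snd_smult[OF closed(4) z] y by auto
have "\<sigma> \<odot>\<^bsub>X.E\<^esub> ?w = (\<phi> (snd ?w) mod int p ^ i, \<sigma> \<odot>\<^bsub>L.E\<^esub> snd ?w)"
 using sigma_X[of "fst ?w" "snd ?w"] wc by (auto simp: mem_Times_iff)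
moreover have "cst (Zp_int p (int p)) \<odot>\<^bsub>X.E\<^esub> (0, y) = \<sigma> \<odot>\<^bsub>X.E\<^esub> ?w \<oplus>\<^bsub>X.E\<^esub> ?m"
 unfolding b(2) using b(1) z X.E.smult_l_distr X.E.smult_assoc1 by simp
moreover have "cst (Zp_int p (int p)) \<odot>\<^bsub>X.E\<^esub> (0, y) = (0, Zp_int p (int p) \<odot>\<^bsub>L\<^esub> y)"
 using X.cst_smult[of "Zp_int p (int p)" "(0, y)"] z by simp
\<comment> \<open>Compare first coordinates in
  \<open>p (0, y) = \<sigma> (b (0, y)) + nrm (0, y)\<close>: on the left it is 0, and the term with
  \<open>\<sigma>\<close> contributes the value of \<open>\<phi>\<close> at
  \<open>b y\<close>.\<close>
ultimately have "(0, Zp_int p (int p) \<odot>\<^bsub>L\<^esub> y) = (\<phi> (snd ?w) mod int p ^ i, \<sigma> \<odot>\<^bsub>L.E\<^esub> snd ?w) \<oplus>\<^bsub>X.E\<^esub> ?m"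
 by simp
then have "(\<phi> (snd ?w) mod int p ^ i + fst ?m) mod int p ^ i = 0" by (cases ?m) simp
then have "[fst ?m = - \<phi> (snd ?w)] (mod int p ^ i)"
 unfolding mod_add_left_eq by (simp add: mod_eq_0_iff_dvd cong_iff_dvd_diff add.commute)
moreover have "fst ?m mod int p ^ i = fst ?m" using mc by (auto simp: mem_Times_iff)
ultimately have "fst ?m = (- \<phi> (b \<odot>\<^bsub>L.E\<^esub> y)) mod int p ^ i" by (simp add: cong_def ws)
then show ?thesis using ms by (simp add: prod_eq_iff)
qed

end

context padic_group
begin

abbreviation phi_Zp :: "nat => padic => int" where "phi_Zp i x \<equiv> int p ^ (i - 1) * x i"

lemma phi_Zp_cong:
assumes i: "i >= 1"
shows "[phi_Zp i (x +| y) = phi_Zp i x + phi_Zp i y] (mod int p ^ i)"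
 "[phi_Zp i (c *| x) = c i * phi_Zp i x] (mod int p ^ i)"
 "[(\<Sum>k<p. phi_Zp i x) = 0] (mod int p ^ i)"
proof -
have "(\<Sum>k<p. phi_Zp i x) = int p ^ i * x i" using i by (simp add: power_eq_if)
then show "[(\<Sum>k<p. phi_Zp i x) = 0] (mod int p ^ i)"
 by (simp only: cong_0_iff dvd_triv_left)
qed (simp_all add: cong_def Zp_simps mod_simps algebra_simps)

lemma id_pow: "((%x. x) ^^ k) x = x"
by (induction k) auto

lemma M_ext_Zp_pres:
assumes i: "i >= 1"
shows "module R (M_ext_Zp p G \<tau> i)" "pres R (M_ext_Zp p G \<tau> i) \<sigma> nrm p (carrier (M_ext_Zp p G \<tau> i)) (E_ext_Zp i)"
proof -
interpret X: ext_module p G \<tau> "self_mod (Zp p)" "%x. x" i "phi_Zp i"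
 by (intro ext_module.intro ext_module_axioms.intro padic_group_axioms tau_id self_mod_module Zp.is_cring)
 (use phi_Zp_cong[OF i] i in \<open>simp_all add: id_pow\<close>)
have M: "M_ext_Zp p G \<tau> i = X.X.E" by (simp add: M_ext_Zp_def)
show "module R (M_ext_Zp p G \<tau> i)" unfolding M by (rule X.X.E.module_axioms)
let ?t = "(1, \<z>)" and ?x = "(0, \<u>)" and ?y = "(0, \<z>)"
have one: "1 : carrier (Zmod p i)" "~ int p dvd 1" using p0 one_less_power[of "int p" i] i by simp_all
have gen: "EX b:carrier R. EX c:carrier R. z = b \<odot>\<^bsub>X.L.E\<^esub> \<u> \<oplus>\<^bsub>self_mod (Zp p)\<^esub> c \<odot>\<^bsub>X.L.E\<^esub> \<z>"
 if "z : carrier (self_mod (Zp p))" for z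
 by (rule bexI[of _ "cst z"], rule bexI[of _ "\<o>"]) (use that in \<open>simp_all add: Zp_smult_one eps_cst eps_R_zero\<close>)
have g: "carrier X.X.E = gen3 R X.X.E ?t ?x ?y"
 using X.gen3_ext[OF one _ _ gen] by simp
have tor: "is_tor R X.X.E \<sigma> nrm i 0 ?t" using X.is_tor_ext[OF one] by simp
have free: "free_over R X.X.E nrm ?t ?x"
 using X.free_over_ext[OF one(1), of "\<u>" nrm] Zp_int_p_pow_nonzero
 by (simp add: Zp_smult_one eps_nrm_pow)
have "\<u> i = 1 mod int p ^ i" by (simp add: Zp_simps)
then have "\<sigma> \<odot>\<^bsub>X.X.E\<^esub> ?x = nrm ^: (i - 1) \<odot>\<^bsub>X.X.E\<^esub> ?t"
 using X.sigma_X[of 0 "\<u>"] X.smult_t[OF _ one(1), of "nrm ^: (i - 1)"] p0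
 by (simp add: Zp_smult_one eps_sigma eps_nrm_pow Zp_int_app mod_simps)
moreover have "\<zero>\<^bsub>X.X.E\<^esub> = ?y"
 by (simp only: X.X.E_simps prod_mod_simps Zmod_simps self_mod_simps)
ultimately have c: "cond R X.X.E \<sigma> nrm p ?t ?x ?y (E_ext_Zp i)" using tor free by simp
have "?t : carrier X.X.E" "?x : carrier X.X.E" "?y : carrier X.X.E"
 unfolding X.X.E_simps using one(1) p0 by simp_all
then show "pres R (M_ext_Zp p G \<tau> i) \<sigma> nrm p (carrier (M_ext_Zp p G \<tau> i)) (E_ext_Zp i)"
 unfolding M by (rule presI[OF _ _ _ g c])
qed

end

context zeta_ring
begin

text \<open>Otherwise \<open>\<sigma>^k\<close> would be a multiple of \<open>nrm\<close>, and
  \<open>\<sigma>^(k+1)\<close> would vanish.\<close>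

lemma sigma_pow_Z: "\<sigma> ^: k \<odot>\<^bsub>Z.E\<^esub> \<one>\<^bsub>Zp_zeta p\<^esub> ~= \<zero>\<^bsub>Zp_zeta p\<^esub>" for k :: nat
proof
assume "\<sigma> ^: k \<odot>\<^bsub>Z.E\<^esub> \<one>\<^bsub>Zp_zeta p\<^esub> = \<zero>\<^bsub>Zp_zeta p\<^esub>"
then have n: "\<sigma> ^: k = nrm *: cst ((\<sigma> ^: k) \<e>)" by (intro Z_smult_one_zero) auto
have "\<sigma> ^: Suc k = \<sigma> *: \<sigma> ^: k" using R.m_comm[of "\<sigma> ^: k" \<sigma>] by simp
also have "\<dots> = \<sigma> *: nrm *: cst ((\<sigma> ^: k) \<e>)" by (subst n) (simp add: R.m_assoc[symmetric])
finally show False using sigma_pow_nonzero[of "Suc k"] by (simp add: sigma_nrm)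
qed

lemma nrm_Z: "y : carrier (Zp_zeta p) ==> nrm \<odot>\<^bsub>Z.E\<^esub> y = \<zero>\<^bsub>Zp_zeta p\<^esub>"
proof -
assume "y : carrier (Zp_zeta p)"
then obtain a where a: "a : carrier R" "y = a \<odot>\<^bsub>Z.E\<^esub> \<one>\<^bsub>Zp_zeta p\<^esub>" using Z_generated by blast
have "nrm \<odot>\<^bsub>Z.E\<^esub> y = a \<odot>\<^bsub>Z.E\<^esub> (nrm \<odot>\<^bsub>Z.E\<^esub> \<one>\<^bsub>Zp_zeta p\<^esub>)"
 unfolding a(2) using a(1) Z.E_assoc[of nrm a] Z.E_assoc[of a nrm] R.m_comm[of nrm a] by simp
then show ?thesis using Z.E.smult_r_null[OF a(1)] by (simp add: nrm_one)
qed

lemma admissible_cong: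
assumes f: "admissible_map p i f"
shows "[|x : carrier (Zp_zeta p); y : carrier (Zp_zeta p)|] ==> [f (x \<oplus>\<^bsub>Zp_zeta p\<^esub> y) = f x + f y] (mod int p ^ i)"
 "[|c : ZZ; x : carrier (Zp_zeta p)|] ==> [f (zeta_const p c \<otimes>\<^bsub>Zp_zeta p\<^esub> x) = c i * f x] (mod int p ^ i)"
 "f \<zero>\<^bsub>Zp_zeta p\<^esub> = 0" "x : carrier (Zp_zeta p) ==> f x : carrier (Zmod p i)"
proof -
have h: "f : mod_hom (Zp p) (Zp_zeta_mod p) (Zmod p i)" using f by (simp add: admissible_map_def)
show "f x : carrier (Zmod p i)" if "x : carrier (Zp_zeta p)"
 using h that by (auto simp: mod_hom_def)
show "[f (x \<oplus>\<^bsub>Zp_zeta p\<^esub> y) = f x + f y] (mod int p ^ i)"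
 if "x : carrier (Zp_zeta p)" "y : carrier (Zp_zeta p)"
 using h that by (simp add: mod_hom_def cong_def)
show s: "[f (zeta_const p c \<otimes>\<^bsub>Zp_zeta p\<^esub> x) = c i * f x] (mod int p ^ i)"
 if "c : ZZ" "x : carrier (Zp_zeta p)" for c x
 using h that by (simp add: mod_hom_def cong_def)
have "\<z> i = 0" by (simp add: Zp_simps)
then have "[f \<zero>\<^bsub>Zp_zeta p\<^esub> = 0] (mod int p ^ i)"
 using s[OF Zp.zero_closed cls.S.zero_closed] by simp
moreover have "f \<zero>\<^bsub>Zp_zeta p\<^esub> : carrier (Zmod p i)" using h by (auto simp: mod_hom_def)
ultimately show "f \<zero>\<^bsub>Zp_zeta p\<^esub> = 0" by (simp add: cong_def)
qed

text \<open>By additivity the sum is the value of \<open>f\<close> at the norm of \<open>y\<close>,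
  which is zero. It is the condition under which the extended action of \<open>\<tau>\<close> has
  order dividing \<open>p\<close>.\<close>

lemma admissible_sum:
assumes f: "admissible_map p i f" and y: "y : carrier (Zp_zeta p)"
shows "[(\<Sum>k<p. f (((%y. zeta p \<otimes>\<^bsub>Zp_zeta p\<^esub> y) ^^ k) y)) = 0] (mod int p ^ i)"
proof -
let ?z = "%k. ((%y. zeta p \<otimes>\<^bsub>Zp_zeta p\<^esub> y) ^^ k) y"
have z: "?z k : carrier (Zp_zeta p)" for k using y by (simp add: zeta_iter)
have "[f (\<Oplus>\<^bsub>Zp_zeta p\<^esub>k\<in>{..<m}. ?z k) = (\<Sum>k<m. f (?z k))] (mod int p ^ i)" for m :: nat
proof (induction m)
 case (Suc m)
 have A: "[f (?z m \<oplus>\<^bsub>Zp_zeta p\<^esub> (\<Oplus>\<^bsub>Zp_zeta p\<^esub>k\<in>{..<m}. ?z k)) = f (?z m) + f (\<Oplus>\<^bsub>Zp_zeta p\<^esub>k\<in>{..<m}. ?z k)] (mod int p ^ i)"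
 using z by (intro admissible_cong[OF f]) (auto intro!: cls.S.finsum_closed)
 show ?case using cong_trans[OF A cong_add[OF cong_refl Suc]] z unfolding lessThan_Suc by (subst cls.S.finsum_insert) auto
qed (simp add: admissible_cong(3)[OF f])
moreover have "(\<Oplus>\<^bsub>Zp_zeta p\<^esub>k\<in>{..<p}. ?z k) = \<zero>\<^bsub>Zp_zeta p\<^esub>"
 using Z.nrm_smult[of y] y nrm_Z[OF y] by (simp add: Zp_zeta_finsum)
ultimately show ?thesis using admissible_cong(3)[OF f] by (metis cong_sym)
qed

text \<open>From \<open>p = \<sigma> b + nrm\<close>, where \<open>nrm\<close> acts as zero,
  \<open>b\<close> applied to 1 is the quotient of \<open>p\<close> by \<open>\<zeta> - 1\<close>.
  Its negative is the element \<open>p/(1-\<zeta>)\<close> of the admissibility condition, unique by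
  \<open>sigma_cancel\<close>.\<close>

lemma admissible_value:
assumes f: "admissible_map p i f" and i: "i >= 1"
 and b: "b : carrier R" "cst (Zp_int p (int p)) = \<sigma> *: b +: nrm"
shows "~ int p dvd (- f (b \<odot>\<^bsub>Z.E\<^esub> \<one>\<^bsub>Zp_zeta p\<^esub>)) mod int p ^ i"
proof -
let ?S = "Zp_zeta p"
let ?y = "b \<odot>\<^bsub>Z.E\<^esub> \<one>\<^bsub>Zp_zeta p\<^esub>"
obtain y0 where y0: "y0 : carrier ?S" "(\<one>\<^bsub>?S\<^esub> \<ominus>\<^bsub>?S\<^esub> zeta p) \<otimes>\<^bsub>?S\<^esub> y0 = [p] \<cdot>\<^bsub>?S\<^esub> \<one>\<^bsub>?S\<^esub>"
 "f y0 ~: (%t. (int p * t) mod int p ^ i) ` carrier (Zmod p i)"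
 using f by (auto simp: admissible_map_def)
have y: "?y : carrier ?S" using Z.E_closed[OF b(1), of "\<one>\<^bsub>?S\<^esub>"] by simp
have sm: "\<sigma> \<odot>\<^bsub>Z.E\<^esub> x = zeta p \<otimes>\<^bsub>?S\<^esub> x \<ominus>\<^bsub>?S\<^esub> x" if x: "x : carrier ?S" for x
proof -
 have "\<sigma> \<odot>\<^bsub>Z.E\<^esub> x \<oplus>\<^bsub>?S\<^esub> x = zeta p \<otimes>\<^bsub>?S\<^esub> x"
 using Z.sigma_smult[of x] x Z.N.M.minus_add_cancel[of "zeta p \<otimes>\<^bsub>?S\<^esub> x" x] by simp
 then show ?thesis using cls.S.a_assoc[of "\<sigma> \<odot>\<^bsub>Z.E\<^esub> x" x "\<ominus>\<^bsub>?S\<^esub> x"] x Z.E_closed[of \<sigma> x]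
 by (simp add: cls.S.minus_eq cls.S.r_neg)
qed
have "cst (Zp_int p (int p)) \<odot>\<^bsub>Z.E\<^esub> \<one>\<^bsub>?S\<^esub> = \<sigma> \<odot>\<^bsub>Z.E\<^esub> ?y \<oplus>\<^bsub>?S\<^esub> nrm \<odot>\<^bsub>Z.E\<^esub> \<one>\<^bsub>?S\<^esub>"
 unfolding b(2) using b(1) by (simp add: Z.E_l_distr Z.E_assoc)
then have py: "\<sigma> \<odot>\<^bsub>Z.E\<^esub> ?y = cst (Zp_int p (int p)) \<odot>\<^bsub>Z.E\<^esub> \<one>\<^bsub>?S\<^esub>"
 using nrm_one y Z.E_closed[of \<sigma> ?y] by simp
have "cst (Zp_int p (int d)) \<odot>\<^bsub>Z.E\<^esub> \<one>\<^bsub>?S\<^esub> = [d] \<cdot>\<^bsub>?S\<^esub> \<one>\<^bsub>?S\<^esub>" for d :: nat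
proof (induction d)
 case 0
 then show ?case using Z.E.smult_l_null[of "\<one>\<^bsub>?S\<^esub>"] by (simp add: Zp_int_01 cst_zero)
next
 case (Suc d)
 have "cst (Zp_int p (int (Suc d))) = cst (Zp_int p (int d)) +: \<r>"
 using add_pow_cst[of "Suc d"] add_pow_cst[of d] by simp
 then show ?case using Suc Z.E.smult_one[of "\<one>\<^bsub>?S\<^esub>"] by (simp add: Z.E_l_distr)
qed
then have "\<sigma> \<odot>\<^bsub>Z.E\<^esub> ?y = [p] \<cdot>\<^bsub>?S\<^esub> \<one>\<^bsub>?S\<^esub>" using py by simp
moreover have "\<sigma> \<odot>\<^bsub>Z.E\<^esub> y0 = \<ominus>\<^bsub>?S\<^esub> ([p] \<cdot>\<^bsub>?S\<^esub> \<one>\<^bsub>?S\<^esub>)"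
 unfolding y0(2)[symmetric] using y0(1)
 by (simp add: sm cls.S.minus_eq cls.S.l_distr cls.S.l_minus cls.S.minus_add cls.S.a_comm)
ultimately have "\<sigma> \<odot>\<^bsub>Z.E\<^esub> (y0 \<oplus>\<^bsub>?S\<^esub> ?y) = \<zero>\<^bsub>?S\<^esub>"
 using Z.E.smult_r_distr[of \<sigma> y0 ?y] y0(1) y by (simp add: cls.S.l_neg)
then have "y0 \<oplus>\<^bsub>?S\<^esub> ?y = \<zero>\<^bsub>?S\<^esub>" using sigma_cancel[of "y0 \<oplus>\<^bsub>?S\<^esub> ?y"] y0(1) y by simp
then have "[f y0 + f ?y = 0] (mod int p ^ i)"
 using admissible_cong(1,3)[OF f] y0(1) y by (metis cong_sym)
then have "[- f ?y = f y0] (mod int p ^ i)"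
 by (simp add: cong_iff_dvd_diff cong_0_iff) (metis dvd_minus_iff minus_add_distrib add.commute diff_conv_add_uminus)
moreover have fy: "f y0 : carrier (Zmod p i)" by (rule admissible_cong(4)[OF f y0(1)])
ultimately have eq: "(- f ?y) mod int p ^ i = f y0" by (simp add: cong_def)
show ?thesis
 unfolding eq
proof
 assume "int p dvd f y0"
 then obtain d where d: "f y0 = int p * d" by blast
 have d0: "0 <= d" using fy p0 d by (auto simp: zero_le_mult_iff)
 have "1 * d <= int p * d" by (rule mult_right_mono) (use p0 d0 in auto)
 then have "d <= f y0" using d by simp
 then have "d : carrier (Zmod p i)" using fy d0 by simp
 moreover have "f y0 = (int p * d) mod int p ^ i" using fy d by simp
 ultimately show False using y0(3) by blast
qed
qed

lemma M_ext_A_pres: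
assumes i: "i >= 1" and f: "admissible_map p i f"
shows "module R (M_ext_A p G \<tau> f i)"
 "pres R (M_ext_A p G \<tau> f i) \<sigma> nrm p (carrier (M_ext_A p G \<tau> f i)) (E_ext_A i)"
proof -
let ?S = "Zp_zeta p"
interpret X: ext_module p G \<tau> "Zp_zeta_mod p" "%y. zeta p \<otimes>\<^bsub>?S\<^esub> y" i f
 by (intro ext_module.intro ext_module_axioms.intro padic_group_axioms Z.tau_module_axioms)
 (use admissible_cong[OF f] admissible_sum[OF f] i in simp_all)
have M: "M_ext_A p G \<tau> f i = X.X.E" by (simp add: M_ext_A_def)
show "module R (M_ext_A p G \<tau> f i)" unfolding M by (rule X.X.E.module_axioms)
obtain b where b: "b : carrier R" "cst (Zp_int p (int p)) = \<sigma> *: b +: nrm"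
 using p_decompose by (auto simp: add_pow_cst)
\<comment> \<open>The torsion coordinate of the norm of \<open>(0, 1)\<close>, computed by
  \<open>nrm_X\<close>. Taking it as torsion generator makes \<open>n y = t\<close> hold
  exactly.\<close>
define v where "v = (- f (b \<odot>\<^bsub>Z.E\<^esub> \<one>\<^bsub>?S\<^esub>)) mod int p ^ i"
have v: "v : carrier (Zmod p i)" "~ int p dvd v"
 unfolding v_def using mod_in admissible_value[OF f i b] by blast+
let ?t = "(v, \<zero>\<^bsub>?S\<^esub>)" and ?x = "(0, \<zero>\<^bsub>?S\<^esub>)" and ?y = "(0, \<one>\<^bsub>?S\<^esub>)"
have gen: "EX a:carrier R. EX c:carrier R. z = a \<odot>\<^bsub>Z.E\<^esub> \<zero>\<^bsub>?S\<^esub> \<oplus>\<^bsub>Zp_zeta_mod p\<^esub> c \<odot>\<^bsub>Z.E\<^esub> \<one>\<^bsub>?S\<^esub>"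
 if zL: "z : carrier (Zp_zeta_mod p)" for z
proof -
 obtain c where c: "c : carrier R" "z = c \<odot>\<^bsub>Z.E\<^esub> \<one>\<^bsub>?S\<^esub>" using Z_generated[of z] zL by auto
 then have "z = \<o> \<odot>\<^bsub>Z.E\<^esub> \<zero>\<^bsub>?S\<^esub> \<oplus>\<^bsub>Zp_zeta_mod p\<^esub> c \<odot>\<^bsub>Z.E\<^esub> \<one>\<^bsub>?S\<^esub>"
 using Z.E.smult_l_null[of "\<zero>\<^bsub>?S\<^esub>"] zL by simp
 then show ?thesis using c(1) R.zero_closed by blast
qed
have g: "carrier X.X.E = gen3 R X.X.E ?t ?x ?y" using X.gen3_ext[OF v _ _ gen] by simp
have "nrm \<odot>\<^bsub>X.X.E\<^esub> ?y = ?t" using X.nrm_X[OF _ _ b, of "\<one>\<^bsub>?S\<^esub>"] nrm_one by (simp add: v_def)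
moreover have "is_tor R X.X.E \<sigma> nrm i 0 ?t" using X.is_tor_ext[OF v] by simp
moreover have "free_over R X.X.E \<sigma> ?t ?y"
 using X.free_over_ext[OF v(1), of "\<one>\<^bsub>?S\<^esub>" \<sigma>] sigma_pow_Z by simp
ultimately have c: "cond R X.X.E \<sigma> nrm p ?t ?x ?y (E_ext_A i)" by simp
have "?t : carrier X.X.E" "?x : carrier X.X.E" "?y : carrier X.X.E" using v(1) p0 by simp_all
then show "pres R (M_ext_A p G \<tau> f i) \<sigma> nrm p (carrier (M_ext_A p G \<tau> f i)) (E_ext_A i)"
 unfolding M by (rule presI[OF _ _ _ g c])
qed

lemma M_ext_ZpA_pres:
assumes i: "i >= 1" and f: "admissible_map p i f"
shows "module R (M_ext_ZpA p G \<tau> f i)"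
 "pres R (M_ext_ZpA p G \<tau> f i) \<sigma> nrm p (carrier (M_ext_ZpA p G \<tau> f i)) (E_ext_ZpA i)"
proof -
let ?S = "Zp_zeta p"
let ?L = "prod_mod (self_mod (Zp p)) (Zp_zeta_mod p)" and ?l = "%(x, y). (x, zeta p \<otimes>\<^bsub>?S\<^esub> y)"
let ?phi = "%(x, y). phi_Zp i x + f y"
have lk: "(?l ^^ k) (x, y) = (x, ((%y. zeta p \<otimes>\<^bsub>?S\<^esub> y) ^^ k) y)" for k and x :: padic and y
 by (induction k) simp_all
interpret L: tau_module p G \<tau> ?L ?l
 by (intro tau_module.intro tau_module_axioms.intro padic_group_axioms prod_mod_module
  self_mod_module Zp.is_cring Zp_zeta_module)
 (auto simp: lk Z.t_add[simplified] Z.t_smult[simplified] Z.t_order[simplified])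
interpret X: ext_module p G \<tau> ?L ?l i ?phi
proof (intro ext_module.intro ext_module_axioms.intro padic_group_axioms L.tau_module_axioms i)
 fix z w assume "z : carrier ?L" "w : carrier ?L"
 then show "[?phi (z \<oplus>\<^bsub>?L\<^esub> w) = ?phi z + ?phi w] (mod int p ^ i)"
 using cong_add[OF phi_Zp_cong(1)[OF i, of "fst z" "fst w"] admissible_cong(1)[OF f, of "snd z" "snd w"]]
 by (auto simp: add_ac)
next
 fix c z assume "c : ZZ" "z : carrier ?L"
 then show "[?phi (c \<odot>\<^bsub>?L\<^esub> z) = c i * ?phi z] (mod int p ^ i)"
 using cong_add[OF phi_Zp_cong(2)[OF i, of c "fst z"] admissible_cong(2)[OF f, of c "snd z"]]
 by (auto simp: distrib_left)
next
 fix z assume "z : carrier ?L"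
 then obtain x y where z: "z = (x, y)" "y : carrier ?S" by auto
 show "[(\<Sum>k<p. ?phi ((?l ^^ k) z)) = 0] (mod int p ^ i)"
 using cong_add[OF phi_Zp_cong(3)[OF i, of x] admissible_sum[OF f z(2)]]
 unfolding z(1) lk by (simp add: sum.distrib)
qed
have "(%(t, x, y). ((t + int p ^ (i - 1) * x i + f y) mod int p ^ i, x, zeta p \<otimes>\<^bsub>?S\<^esub> y))
 = (%(u, z). ((u + ?phi z) mod int p ^ i, ?l z))"
 by (auto simp: fun_eq_iff add.assoc)
then have M: "M_ext_ZpA p G \<tau> f i = X.X.E" by (simp add: M_ext_ZpA_def)
show "module R (M_ext_ZpA p G \<tau> f i)" unfolding M by (rule X.X.E.module_axioms)
have sm: "a \<odot>\<^bsub>L.E\<^esub> (x, y) = (eps a *| x, a \<odot>\<^bsub>Z.E\<^esub> y)"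
 if "a : carrier R" "x : ZZ" "y : carrier ?S" for a x y
 using that
proof (induction a arbitrary: x y rule: R_induct)
 case (add a a')
 then show ?case by (simp add: L.E_l_distr Z.E_l_distr eps_add Zp.l_distr)
next
 case (cst c)
 then show ?case by (simp add: L.cst_smult Z.cst_smult eps_cst)
next
 case T
 then show ?case by (simp add: L.T_smult Z.T_smult eps_T)
next
 case (mult a a')
 have "a' \<odot>\<^bsub>Z.E\<^esub> y : carrier ?S" using Z.E_closed[of a' y] mult by simp
 then show ?case using mult by (simp add: L.E_assoc Z.E_assoc eps_mult Zp.m_assoc)
qed
obtain b where b: "b : carrier R" "cst (Zp_int p (int p)) = \<sigma> *: b +: nrm"
 using p_decompose by (auto simp: add_pow_cst)
define v where "v = (- f (b \<odot>\<^bsub>Z.E\<^esub> \<one>\<^bsub>?S\<^esub>)) mod int p ^ i"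
have v: "v : carrier (Zmod p i)" "~ int p dvd v"
 unfolding v_def using mod_in admissible_value[OF f i b] by blast+
\<comment> \<open>Since \<open>t\<close> has torsion coordinate \<open>v\<close> instead of 1, the
  generator of Z_p is rescaled by the same unit, so that \<open>s x = n^(i-1) t\<close>.\<close>
define V where "V = Zp_int p v"
have Vc: "V : ZZ" by (simp add: V_def)
have V: "V : Units (Zp p)"
 using Zp_unit[OF Vc] v(2) by (simp add: V_def Zp_int_app dvd_eq_mod_eq_0)
then have Vi: "inv\<^bsub>Zp p\<^esub> V : ZZ" "inv\<^bsub>Zp p\<^esub> V *| V = \<u>" by simp_all
have Vn: "V ~= \<z>" using Vi Zp.r_null[OF Vi(1)] Zp.one_not_zero by metis
let ?t = "(v, \<zero>\<^bsub>?L\<^esub>)" and ?x = "(0, V, \<zero>\<^bsub>?S\<^esub>)" and ?y = "(0, \<z>, \<one>\<^bsub>?S\<^esub>)"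
have z0: "a \<odot>\<^bsub>Z.E\<^esub> \<zero>\<^bsub>?S\<^esub> = \<zero>\<^bsub>?S\<^esub>" if "a : carrier R" for a using Z.E.smult_r_null[OF that] by simp
have gen: "EX a:carrier R. EX c:carrier R. z = a \<odot>\<^bsub>L.E\<^esub> (V, \<zero>\<^bsub>?S\<^esub>) \<oplus>\<^bsub>?L\<^esub> c \<odot>\<^bsub>L.E\<^esub> (\<z>, \<one>\<^bsub>?S\<^esub>)"
 if "z : carrier ?L" for z
proof -
 obtain x y where z: "z = (x, y)" "x : ZZ" "y : carrier ?S" using \<open>z : carrier ?L\<close> by auto
 obtain c where c: "c : carrier R" "y = c \<odot>\<^bsub>Z.E\<^esub> \<one>\<^bsub>?S\<^esub>" using Z_generated[OF z(3)] by auto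
 define a where "a = cst (x *| inv\<^bsub>Zp p\<^esub> V)"
 have a: "a : carrier R" "eps a = x *| inv\<^bsub>Zp p\<^esub> V" using z(2) Vi by (simp_all add: a_def eps_cst)
 have "z = a \<odot>\<^bsub>L.E\<^esub> (V, \<zero>\<^bsub>?S\<^esub>) \<oplus>\<^bsub>?L\<^esub> c \<odot>\<^bsub>L.E\<^esub> (\<z>, \<one>\<^bsub>?S\<^esub>)"
 using a c z Vc Vi by (simp add: sm z0 Zp.m_assoc)
 then show ?thesis using a(1) c(1) by blast
qed
have g: "carrier X.X.E = gen3 R X.X.E ?t ?x ?y" using X.gen3_ext[OF v _ _ gen] Vc by simp
have "nrm \<odot>\<^bsub>X.X.E\<^esub> ?y = ?t"
proof -
 have "\<z> i = 0" by (simp add: Zp_simps)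
 then show ?thesis using X.nrm_X[OF _ _ b, of "(\<z>, \<one>\<^bsub>?S\<^esub>)"] nrm_one b(1) by (simp add: v_def sm)
qed
moreover have "is_tor R X.X.E \<sigma> nrm i 0 ?t" using X.is_tor_ext[OF v] by simp
moreover have "free_over R X.X.E \<sigma> ?t ?y"
 using X.free_over_ext[OF v(1), of "(\<z>, \<one>\<^bsub>?S\<^esub>)" \<sigma>] sigma_pow_Z by (simp add: sm)
moreover have "free_over R X.X.E nrm ?t ?x"
 using X.free_over_ext[OF v(1), of "(V, \<zero>\<^bsub>?S\<^esub>)" nrm] Vc Vn Zp_int_p_pow_nonzero
 by (simp add: sm eps_nrm_pow Zp.integral_iff)
moreover have "\<sigma> \<odot>\<^bsub>X.X.E\<^esub> ?x = nrm ^: (i - 1) \<odot>\<^bsub>X.X.E\<^esub> ?t"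
 using X.sigma_X[of 0 "(V, \<zero>\<^bsub>?S\<^esub>)"] X.smult_t[OF _ v(1), of "nrm ^: (i - 1)"] p0 Vc
 by (simp add: sm z0 eps_sigma eps_nrm_pow admissible_cong(3)[OF f] Zp_int_app V_def mod_simps)
ultimately have c: "cond R X.X.E \<sigma> nrm p ?t ?x ?y (E_ext_ZpA i)" by simp
have "?t : carrier X.X.E" "?x : carrier X.X.E" "?y : carrier X.X.E" 
 unfolding X.X.E_simps using v(1) p0 Vc by simp_all
then show "pres R (M_ext_ZpA p G \<tau> f i) \<sigma> nrm p (carrier (M_ext_ZpA p G \<tau> f i)) (E_ext_ZpA i)"
 unfolding M by (rule presI[OF _ _ _ g c])
qed

end

section \<open>Tate cohomology as groups\<close>

lemma quot_iso:
assumes A: "group A" and h: "h : hom A (integer_mod_group n)" "h ` carrier A = carrier (integer_mod_group n)"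
shows "(A Mod {x : carrier A. h x = 0}) \<cong> integer_mod_group n" "group (A Mod {x : carrier A. h x = 0})"
proof -
interpret group_hom A "integer_mod_group n" h
 using A h(1) by (simp add: group_hom_def group_hom_axioms_def)
have k: "kernel A (integer_mod_group n) h = {x : carrier A. h x = 0}" by (simp add: kernel_def)
show "(A Mod {x : carrier A. h x = 0}) \<cong> integer_mod_group n" using FactGroup_iso[OF h(2)] k by simp
show "group (A Mod {x : carrier A. h x = 0})"
 using normal.factorgroup_is_group[OF normal_kernel] k by simp
qed

lemma quot_trivial: "group A ==> trivial_group (A Mod carrier A)"
proof -
assume A: "group A"
have h: "(%_. 0) : hom A (integer_mod_group 1)" "(%_. 0) ` carrier A = carrier (integer_mod_group 1)"
 using group.is_monoid[OF A] monoid.one_closed by (auto simp: hom_def carrier_integer_mod_group)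
show ?thesis
 using quot_iso[OF A h] isomorphic_group_triviality[of "A Mod carrier A" "integer_mod_group 1"]
 trivial_integer_mod_group[of 1] by simp
qed

context nodal_char_module
begin

text \<open>The map sends \<open>x\<close> to the number \<open>d < q\<close> with \<open>x\<close>
  congruent to \<open>d u\<close> modulo \<open>I\<close>. It is additive modulo \<open>q\<close>
  because \<open>q\<close> is in the maximal ideal and thus sends \<open>u\<close> into
  \<open>I\<close>.\<close>

lemma simple_quot_hom:
assumes I: "submodule I R M" and K: "submodule K R M" "I <= K" and sq: "simple_quot R M s n K I" and q: "q > 1"
shows "\<exists>h :: 'c => int. h ` K = carrier (integer_mod_group q) &
 (ALL x:K. ALL y:K. h (x +. y) = (h x + h y) mod int q) & (ALL x:K. h x = 0 \<longleftrightarrow> x : I)"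
proof -
note KM = sub_carrier[OF K(1)] and IM = sub_carrier[OF I]
obtain u where uK: "u : K" and u: "u ~: I" "s ** u : I" "n ** u : I"
 and gen: "!!x. x : K ==> EX a:RR. EX z:I. x = a ** u +. z"
 using sq by (auto simp: simple_quot_def)
have uM: "u : MM" by (rule KM[OF uK])
let ?m = "%d::nat. ([d] \<cdot>\<^bsub>R\<^esub> \<one>) ** u"
have m: "?m d : MM" for d using uM by simp
have madd: "?m (d + e) = ?m d +. ?m e" for d e
 using uM R.add.nat_pow_mult[of \<one> d e] by (simp add: smult_l_distr[symmetric])
define r where "r x d \<longleftrightarrow> (EX z:I. x = ?m d +. z)" for x d
have radd: "r (x +. y) (d + e)" if xy: "r x d" "r y e" for x y d e
proof -
 obtain z w where zw: "z : I" "x = ?m d +. z" "w : I" "y = ?m e +. w" using xy by (auto simp: r_def)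
 then have "x +. y = ?m (d + e) +. (z +. w)" using m IM by (simp add: madd M.a_ac)
 then show ?thesis using sub_add[OF I zw(1,3)] by (auto simp: r_def)
qed
have mq: "?m q : I"
proof -
 obtain a b where ab: "a : RR" "b : RR" "[q] \<cdot>\<^bsub>R\<^esub> \<one> = s \<otimes> a \<oplus> n \<otimes> b" using q_mx by blast
 have "?m q = a ** (s ** u) +. b ** (n ** u)"
 unfolding ab(3) using ab(1,2) uM by (simp add: smult_l_distr smult_assoc1 smult_comm[of a] smult_comm[of b])
 then show ?thesis using sub_add[OF I] sub_smult[OF I] ab(1,2) u by simp
qed
have rq: "r x (q * k + d) ==> r x d" for x k d
proof (induction k)
 case (Suc k)
 obtain z where z: "z : I" "x = ?m (q * Suc k + d) +. z" using Suc.prems by (auto simp: r_def)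
 have "x = ?m (q * k + d) +. (?m q +. z)"
 using z madd[of q "q * k + d"] m IM by (simp add: M.a_ac add_ac)
 then show ?case using Suc.IH sub_add[OF I mq z(1)] by (auto simp: r_def)
qed simp
have runiq: "d = e" if r2: "r x d" "r x e" "d < q" "e < q" for x d e
proof -
 obtain z w where zw: "z : I" "x = ?m d +. z" "w : I" "x = ?m e +. w" using r2 by (auto simp: r_def)
 have "?m d = (?m d +. z) -. z" using zw(1) IM m by (simp add: M.minus_eq M.a_assoc M.r_neg)
 also have "?m d +. z = ?m e +. w" using zw by simp
 also have "\<dots> -. z = ?m e +. (w -. z)" using zw(1,3) IM m by (simp add: M.minus_eq M.a_assoc)
 finally have "?m d -. ?m e = w -. z" using zw(1,3) IM m by (simp add: M.minus_eq M.a_ac M.r_neg1 M.r_neg)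
 then have "?m d -. ?m e : I" using zw(1,3) sub_add[OF I] sub_neg[OF I] by (simp add: M.minus_eq)
 then show ?thesis by (rule simple_quot_inj[OF I uM u(1) r2(3,4)])
qed
have "\<exists>d<q. r x d" if x: "x : K" for x
proof -
 obtain a z where a: "a : RR" "z : I" "x = a ** u +. z" using gen[OF x] by blast
 obtain d where d: "d < q" "x -. ?m d : I" using simple_quot_reps[OF I uM u a(1,2)] a(3) by blast
 have "x = ?m d +. (x -. ?m d)" using KM[OF x] m by (simp add: M.minus_eq M.a_lcomm[of _ x] M.r_neg)
 then show ?thesis using d by (auto simp: r_def)
qed
then obtain g where g: "!!x. x : K ==> g x < q & r x (g x)" by metis
have guniq: "g x = d mod q" if "x : K" "r x d" for x d
 using that g[of x] rq[of x "d div q" "d mod q"] runiq[of x "g x" "d mod q"] q by simp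
have rI: "r x 0 \<longleftrightarrow> x : I" if "x : K" for x
 using IM uM by (auto simp: r_def intro!: bexI[of _ x])
show ?thesis
proof (intro exI[of _ "%x. int (g x)"] conjI ballI)
 show "int (g (x +. y)) = (int (g x) + int (g y)) mod int q" if "x : K" "y : K" for x y
 using guniq[of "x +. y" "g x + g y"] radd g that sub_add[OF K(1)] by (simp add: zmod_int)
 show "int (g x) = 0 \<longleftrightarrow> x : I" if "x : K" for x
 using guniq[OF that, of 0] rI[OF that] g[OF that] by auto
 have "d : (%x. int (g x)) ` K" if d: "0 <= d" "d < int q" for d
 proof -
 have K: "?m (nat d) : K" using sub_smult[OF K(1) _ uK] by simp
 have "r (?m (nat d)) (nat d)" using sub_zero[OF I] m by (auto simp: r_def intro!: bexI[of _ "\<theta>"])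
 then have "int (g (?m (nat d))) = d" using guniq[OF K] d by simp
 then show ?thesis using K by (metis imageI)
 qed
 then show "(%x. int (g x)) ` K = carrier (integer_mod_group q)"
 using g q by (auto simp: carrier_integer_mod_group)
qed
qed

end

context padic_group
begin

text \<open>Partial norms: a cocycle takes the value \<open>Nk k\<close> times its value at
  \<open>\<tau>\<close> on \<open>\<tau>^k\<close>, and \<open>Nk p\<close> is the norm.\<close>

definition Nk :: "nat => 'g => padic" where "Nk k = (\<Oplus>\<^bsub>R\<^esub>j\<in>{..<k}. T ^: j)"

lemma Nk_closed [simp]: "Nk k : carrier R"
unfolding Nk_def by (rule R.finsum_closed) auto

lemma Nk_0: "Nk 0 = \<o>"
by (simp add: Nk_def)

lemma Nk_Suc: "Nk (Suc k) = T ^: k +: Nk k"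
unfolding Nk_def lessThan_Suc by (subst R.finsum_insert) auto

lemma Nk_add: "Nk (j + k) = Nk j +: T ^: j *: Nk k"
proof (induction k)
case (Suc k)
have "Nk (j + Suc k) = T ^: j *: T ^: k +: (Nk j +: T ^: j *: Nk k)"
 using Suc by (simp add: Nk_Suc R.nat_pow_mult)
then show ?case by (simp add: Nk_Suc R.r_distr R.a_lcomm)
qed (simp add: Nk_0)

lemma Nk_p: "Nk p = nrm"
proof -
have "nrm = (\<Oplus>\<^bsub>R\<^esub>k\<in>{..<p}. T ^: k)"
 using \<tau> by (subst expansion, simp, intro R.finsum_cong') (auto simp: nrm_def single_eq cst_one)
then show ?thesis by (simp add: Nk_def)
qed

lemma T_p: "T ^: p = \<r>"
using single_eq[of "\<u>" p] by (simp add: tau_p cst_one R_one_single[symmetric])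

lemma T_eq: "T = \<sigma> +: \<r>"
by (simp add: \<sigma>_def R.minus_add_cancel)

lemma T_pow_eq: "T ^: k = \<sigma> *: Nk k +: \<r>" for k :: nat
proof (induction k)
case (Suc k)
have "T ^: Suc k = T ^: k *: \<sigma> +: T ^: k"
 using R.r_distr[of \<sigma> "\<r>" "T ^: k"] T_eq by simp
also have "\<dots> = \<sigma> *: T ^: k +: (\<sigma> *: Nk k +: \<r>)"
 using Suc R.m_comm[of "T ^: k" \<sigma>] by simp
also have "\<dots> = \<sigma> *: Nk (Suc k) +: \<r>" by (simp add: Nk_Suc R.r_distr R.a_assoc)
finally show ?case .
qed (simp add: Nk_0)

lemma g_act_eq:
fixes k :: nat
assumes M: "module R M" and x: "x : carrier M"
shows "g_act (Zp p) G M (\<tau> ^@ k) x = Nk k \<odot>\<^bsub>M\<^esub> (\<sigma> \<odot>\<^bsub>M\<^esub> x) \<oplus>\<^bsub>M\<^esub> x"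
proof -
interpret M: module R M by fact
show ?thesis unfolding g_act_pow T_pow_eq
 using x R.m_comm[of \<sigma> "Nk k"] by (simp add: M.smult_l_distr M.smult_assoc1)
qed

lemma invariants_eq: "module R M ==> invariants (Zp p) G M = Ker M \<sigma> (carrier M)"
proof -
assume M: "module R M"
interpret M: module R M by fact
have "\<sigma> \<odot>\<^bsub>M\<^esub> x = \<zero>\<^bsub>M\<^esub>" if x: "x : carrier M" and i: "ALL g:carrier G. g_act (Zp p) G M g x = x" for x
proof -
 have "Nk 1 = \<r>" using Nk_Suc[of 0] by (simp add: Nk_0)
 then have "\<sigma> \<odot>\<^bsub>M\<^esub> x \<oplus>\<^bsub>M\<^esub> x = x"
 using bspec[OF i \<tau>] g_act_eq[OF M x, of 1] x \<tau> by simp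
 then show ?thesis using M.M.add.r_cancel_one[of x "\<sigma> \<odot>\<^bsub>M\<^esub> x"] x by simp
qed
moreover have "g_act (Zp p) G M g x = x" if "x : carrier M" "\<sigma> \<odot>\<^bsub>M\<^esub> x = \<zero>\<^bsub>M\<^esub>" "g : carrier G" for g x
 using tau_cases[OF that(3)] g_act_eq[OF M that(1)] that(1,2) by auto
ultimately show ?thesis by (auto simp: invariants_def Ker_def)
qed

lemma cocycle_pow:
fixes k :: nat
assumes M: "module R M" and c: "c : carrier (cocycles (Zp p) G M)"
shows "c (\<tau> ^@ k) = Nk k \<odot>\<^bsub>M\<^esub> c \<tau>"
proof (induction k)
interpret M: module R M by fact
have cl: "c g : carrier M" if "g : carrier G" for g using c that by (auto simp: cocycles_def)
have co: "c (g *@ h) = c g \<oplus>\<^bsub>M\<^esub> g_act (Zp p) G M g (c h)" if "g : carrier G" "h : carrier G" for g h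
 using c that by (auto simp: cocycles_def)
case 0
have "c \<e> = c \<e> \<oplus>\<^bsub>M\<^esub> c \<e>"
 using co[of "\<e>" "\<e>"] cl[of "\<e>"] by (simp add: g_act_def R_one_single[symmetric])
then show ?case using M.M.add.l_cancel_one[of "c \<e>" "c \<e>"] cl \<tau> by (simp add: Nk_0)
next
interpret M: module R M by fact
case (Suc k)
have "c (\<tau> ^@ k *@ \<tau>) = c (\<tau> ^@ k) \<oplus>\<^bsub>M\<^esub> g_act (Zp p) G M (\<tau> ^@ k) (c \<tau>)" "c \<tau> : carrier M"
 using c \<tau> by (auto simp: cocycles_def)
then show ?case using Suc \<tau> by (simp add: g_act_pow Nk_Suc M.smult_l_distr M.M.a_comm)
qed

lemma cocycles_group: "module R M ==> group (cocycles (Zp p) G M)"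
proof -
assume M: "module R M"
interpret M: module R M by fact
let ?C = "cocycles (Zp p) G M" and ?act = "g_act (Zp p) G M"
have act: "?act g x : carrier M" "?act g (\<ominus>\<^bsub>M\<^esub> x) = \<ominus>\<^bsub>M\<^esub> ?act g x" "?act g \<zero>\<^bsub>M\<^esub> = \<zero>\<^bsub>M\<^esub>"
 if "x : carrier M" for g x
 using that by (simp_all add: g_act_def M.smult_r_minus)
have act_add: "?act g (x \<oplus>\<^bsub>M\<^esub> y) = ?act g x \<oplus>\<^bsub>M\<^esub> ?act g y" if "x : carrier M" "y : carrier M" for g x y
 using that by (simp add: g_act_def M.smult_r_distr)
show ?thesis
proof (rule groupI)
 fix c d assume cd: "c : carrier ?C" "d : carrier ?C"
 have "c g : carrier M" "d g : carrier M" if "g : carrier G" for g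
 using cd that by (auto simp: cocycles_def)
 then show "c \<otimes>\<^bsub>?C\<^esub> d : carrier ?C" using cd by (auto simp: cocycles_def act act_add M.M.a_ac)
 fix e assume "e : carrier ?C"
 then show "c \<otimes>\<^bsub>?C\<^esub> d \<otimes>\<^bsub>?C\<^esub> e = c \<otimes>\<^bsub>?C\<^esub> (d \<otimes>\<^bsub>?C\<^esub> e)"
 using cd by (auto simp: cocycles_def M.M.a_assoc PiE_iff)
next
 show "\<one>\<^bsub>?C\<^esub> : carrier ?C" by (auto simp: cocycles_def act(3)[OF M.M.zero_closed])
 fix c assume c: "c : carrier ?C"
 have cg: "c g : carrier M" if "g : carrier G" for g using c that by (auto simp: cocycles_def)
 show "\<one>\<^bsub>?C\<^esub> \<otimes>\<^bsub>?C\<^esub> c = c"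
 using c cg by (intro PiE_ext[of _ "carrier G" "%_. carrier M"]) (auto simp: cocycles_def)
 show "EX d:carrier ?C. d \<otimes>\<^bsub>?C\<^esub> c = \<one>\<^bsub>?C\<^esub>"
 by (rule bexI[of _ "\<lambda>g\<in>carrier G. \<ominus>\<^bsub>M\<^esub> c g"])
  (use c cg in \<open>auto simp: cocycles_def act M.M.l_neg M.M.minus_add\<close>)
qed
qed

text \<open>A full period contributes \<open>nrm x = 0\<close>. This makes the cocycle with given
  value at \<open>\<tau>\<close> well defined on the group.\<close>

lemma Nk_period:
assumes M: "module R M" and x: "x : carrier M" "nrm \<odot>\<^bsub>M\<^esub> x = \<zero>\<^bsub>M\<^esub>"
shows "Nk (k mod p) \<odot>\<^bsub>M\<^esub> x = Nk k \<odot>\<^bsub>M\<^esub> x"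
proof -
interpret M: module R M by fact
have "Nk (p * j + r) \<odot>\<^bsub>M\<^esub> x = Nk r \<odot>\<^bsub>M\<^esub> x" for j r
proof (induction j)
 case (Suc j)
 have "Nk (p + (p * j + r)) \<odot>\<^bsub>M\<^esub> x = nrm \<odot>\<^bsub>M\<^esub> x \<oplus>\<^bsub>M\<^esub> Nk (p * j + r) \<odot>\<^bsub>M\<^esub> x"
 unfolding Nk_add Nk_p T_p using x(1) by (simp add: M.smult_l_distr)
 then show ?case using Suc x by (simp add: add.assoc)
qed simp
from this[of "k div p" "k mod p"] show ?thesis by simp
qed

text \<open>The cocycle rule along \<open>\<tau>^p = 1\<close> makes the norm of the value at
  \<open>\<tau>\<close> equal to the value at the neutral element, which is zero. Conversely,
  partial norms of an element killed by \<open>nrm\<close> form a cocycle.\<close>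

lemma cocycle_values:
assumes M: "module R M"
shows "(%c. c \<tau>) ` carrier (cocycles (Zp p) G M) = Ker M nrm (carrier M)"
proof (intro subset_antisym subsetI)
interpret M: module R M by fact
fix x assume "x : (%c. c \<tau>) ` carrier (cocycles (Zp p) G M)"
then obtain c where c: "c : carrier (cocycles (Zp p) G M)" "x = c \<tau>" by blast
have xM: "c \<tau> : carrier M" using c \<tau> by (auto simp: cocycles_def)
have "nrm \<odot>\<^bsub>M\<^esub> c \<tau> = c (\<tau> ^@ p)" using cocycle_pow[OF M c(1), of p] by (simp add: Nk_p)
also have "\<dots> = c (\<tau> ^@ (0::nat))" by (simp add: tau_p)
also have "\<dots> = \<zero>\<^bsub>M\<^esub>" unfolding cocycle_pow[OF M c(1)] Nk_0 using xM by simp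
finally show "x : Ker M nrm (carrier M)" using xM c(2) by (simp add: Ker_def)
next
interpret M: module R M by fact
fix x assume "x : Ker M nrm (carrier M)"
then have x: "x : carrier M" "nrm \<odot>\<^bsub>M\<^esub> x = \<zero>\<^bsub>M\<^esub>" by (simp_all add: Ker_def)
let ?i = "inv_into {..<p} (%k. \<tau> ^@ k)"
define c where "c = (\<lambda>g\<in>carrier G. Nk (?i g) \<odot>\<^bsub>M\<^esub> x)"
have ck: "c (\<tau> ^@ k) = Nk k \<odot>\<^bsub>M\<^esub> x" for k :: nat
proof -
 have "\<tau> ^@ k = \<tau> ^@ (p * (k div p)) *@ \<tau> ^@ (k mod p)"
 using \<tau> by (simp add: G.nat_pow_mult)
 also have "\<tau> ^@ (p * (k div p)) = \<e>" using \<tau> tau_p by (simp add: G.nat_pow_pow[symmetric])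
 finally have "\<tau> ^@ k = \<tau> ^@ (k mod p)" using \<tau> by simp
 then have "?i (\<tau> ^@ k) = k mod p"
 using bij_betw_inv_into_left[OF bij_tau, of "k mod p"] p0 by simp
 then show ?thesis using \<tau> Nk_period[OF M x, of k] by (simp add: c_def)
qed
have "c : carrier (cocycles (Zp p) G M)"
proof -
 have "c (g *@ h) = c g \<oplus>\<^bsub>M\<^esub> g_act (Zp p) G M g (c h)" if gh: "g : carrier G" "h : carrier G" for g h
 proof -
 obtain j k where jk: "g = \<tau> ^@ (j::nat)" "h = \<tau> ^@ (k::nat)" using tau_cases gh by metis
 have "c (g *@ h) = Nk (j + k) \<odot>\<^bsub>M\<^esub> x" unfolding jk G.nat_pow_mult[OF \<tau>] ck ..
 then show ?thesis unfolding jk ck g_act_pow Nk_add using x by (simp add: M.smult_l_distr M.smult_assoc1)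
 qed
 then show ?thesis using x by (auto simp: cocycles_def c_def)
qed
moreover have "c \<tau> = x"
proof -
 have "Nk 1 = \<r>" using Nk_Suc[of 0] by (simp add: Nk_0)
 then show ?thesis using ck[of 1] \<tau> x by simp
qed
ultimately show "x : (%c. c \<tau>) ` carrier (cocycles (Zp p) G M)" by blast
qed

text \<open>A cocycle is determined by its value at \<open>\<tau>\<close>, and the coboundary of
  \<open>x\<close> has the value \<open>\<sigma> x\<close> there.\<close>

lemma coboundaries_eq:
assumes M: "module R M"
shows "coboundaries (Zp p) G M = {c : carrier (cocycles (Zp p) G M). c \<tau> : Img M \<sigma> (carrier M)}"
proof -
interpret M: module R M by fact
let ?b = "%x. \<lambda>g\<in>carrier G. g_act (Zp p) G M g x \<ominus>\<^bsub>M\<^esub> x"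
have b: "?b x (\<tau> ^@ k) = Nk k \<odot>\<^bsub>M\<^esub> (\<sigma> \<odot>\<^bsub>M\<^esub> x)" if x: "x : carrier M" for x and k :: nat
 using x \<tau> by (simp add: g_act_eq[OF M x] M.M.minus_eq M.M.a_assoc M.M.r_neg)
have eqI: "c = ?b x" if c: "c : carrier (cocycles (Zp p) G M)" and x: "x : carrier M" and e: "c \<tau> = \<sigma> \<odot>\<^bsub>M\<^esub> x" for c x
proof
 fix g
 show "c g = ?b x g"
 proof (cases "g : carrier G")
 case True
 then obtain k :: nat where k: "g = \<tau> ^@ k" using tau_cases by blast
 show ?thesis unfolding k b[OF x] cocycle_pow[OF M c] e ..
 next
 case False
 then show ?thesis using c by (auto simp: cocycles_def)
 qed
qed
have nk: "nrm \<odot>\<^bsub>M\<^esub> (\<sigma> \<odot>\<^bsub>M\<^esub> x) = \<zero>\<^bsub>M\<^esub>" if "x : carrier M" for x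
 using that M.smult_assoc1[of nrm \<sigma> x] nod.ns by simp
have "?b x : carrier (cocycles (Zp p) G M) & ?b x \<tau> = \<sigma> \<odot>\<^bsub>M\<^esub> x" if x: "x : carrier M" for x
proof -
 have "\<sigma> \<odot>\<^bsub>M\<^esub> x : Ker M nrm (carrier M)" using x nk[OF x] by (simp add: Ker_def)
 then have "\<sigma> \<odot>\<^bsub>M\<^esub> x : (%c. c \<tau>) ` carrier (cocycles (Zp p) G M)"
 unfolding cocycle_values[OF M] .
 then obtain c where c: "c : carrier (cocycles (Zp p) G M)" "\<sigma> \<odot>\<^bsub>M\<^esub> x = c \<tau>" by blast
 show ?thesis using c eqI[OF c(1) x c(2)[symmetric]] by simp
qed
then show ?thesis unfolding coboundaries_def Img_def using eqI by blast
qed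

lemma cohomology:
assumes M: "module R M" and e: "in_list p e" and P: "pres R M \<sigma> nrm p (carrier M) e"
shows "h0_entry e ==> tate_H0 (Zp p) G M \<cong> integer_mod_group p"
 "~ h0_entry e ==> trivial_group (tate_H0 (Zp p) G M)"
 "h1_entry e ==> group_H1 (Zp p) G M \<cong> integer_mod_group p"
 "~ h1_entry e ==> trivial_group (group_H1 (Zp p) G M)"
proof -
interpret nodal_char_module R \<sigma> nrm p M by (rule nodal_char_module[OF M])
obtain t x y where t: "t : carrier M" "x : carrier M" "y : carrier M"
 and g: "carrier M = gen3 R M t x y" and c: "cond R M \<sigma> nrm p t x y e"
 using P by (auto simp: pres_def)
note q = p0(2)
let ?K0 = "Ker M \<sigma> (carrier M)" and ?I0 = "Img M nrm (carrier M)"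
let ?K1 = "Ker M nrm (carrier M)" and ?I1 = "Img M \<sigma> (carrier M)"
have sub: "submodule ?K0 R M" "submodule ?I0 R M" "submodule ?K1 R M" "submodule ?I1 R M"
 using Ker_submodule Img_submodule carrier_is_submodule by auto
have IK: "?I0 <= ?K0" "?I1 <= ?K1"
 using smult_assoc1[of \<sigma> nrm] smult_assoc1[of nrm \<sigma>] by (auto simp: Ker_def Img_def)
let ?A = "(add_monoid M)\<lparr>carrier := ?K0\<rparr>"
have A: "group ?A"
 using subgroup.subgroup_is_group[OF submodule.axioms(1)[OF sub(1)]] M.a_group by simp
have H0: "tate_H0 (Zp p) G M = ?A Mod ?I0"
 unfolding tate_H0_def invariants_eq[OF M] using norm_map_eq[OF M] by (auto simp: Img_def intro!: arg_cong2[where f = "(Mod)"])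
let ?C = "cocycles (Zp p) G M"
have C: "group ?C" by (rule cocycles_group[OF M])
have H1: "group_H1 (Zp p) G M = ?C Mod {c : carrier ?C. c \<tau> : ?I1}"
 by (simp add: group_H1_def coboundaries_eq[OF M])
have ev: "c \<tau> : ?K1" if "c : carrier ?C" for c using that cocycle_values[OF M] by blast
note e0 = entry_h0[OF q t c e, folded g] and e1 = entry_h1[OF q t c e, folded g]
show "tate_H0 (Zp p) G M \<cong> integer_mod_group p" if h: "h0_entry e"
proof -
 obtain h where h: "h ` ?K0 = carrier (integer_mod_group p)"
 "!!x y. [|x : ?K0; y : ?K0|] ==> h (x \<oplus>\<^bsub>M\<^esub> y) = (h x + h y) mod int p" "!!x. x : ?K0 ==> h x = 0 \<longleftrightarrow> x : ?I0"
 using simple_quot_hom[OF sub(2,1) IK(1) e0(1)[OF h] q] by auto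
 have hom: "h : hom ?A (integer_mod_group p)" using h(1,2) by (auto simp: hom_def)
 have "{x : carrier ?A. h x = 0} = ?I0" using h(3) IK by auto
 then show ?thesis using quot_iso(1)[OF A hom] h(1) by (simp add: H0)
qed
show "trivial_group (tate_H0 (Zp p) G M)" if "~ h0_entry e"
proof -
 have "?I0 = ?K0" by (rule subset_antisym[OF IK(1) e0(2)[OF that]])
 then show ?thesis unfolding H0 using quot_trivial[OF A] by simp
qed
show "group_H1 (Zp p) G M \<cong> integer_mod_group p" if h: "h1_entry e"
proof -
 obtain h where h: "h ` ?K1 = carrier (integer_mod_group p)"
 "!!x y. [|x : ?K1; y : ?K1|] ==> h (x \<oplus>\<^bsub>M\<^esub> y) = (h x + h y) mod int p" "!!x. x : ?K1 ==> h x = 0 \<longleftrightarrow> x : ?I1"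
 using simple_quot_hom[OF sub(4,3) IK(2) e1(1)[OF h] q] by auto
 have "(c \<otimes>\<^bsub>?C\<^esub> d) \<tau> = c \<tau> \<oplus>\<^bsub>M\<^esub> d \<tau>" for c d using \<tau> by (simp add: cocycles_def)
 then have hom: "(%c. h (c \<tau>)) : hom ?C (integer_mod_group p)" using h(1,2) ev by (auto simp: hom_def)
 have im: "(%c. h (c \<tau>)) ` carrier ?C = carrier (integer_mod_group p)"
 unfolding h(1)[symmetric] cocycle_values[OF M, symmetric] by (auto simp: image_image)
 have "{c : carrier ?C. h (c \<tau>) = 0} = {c : carrier ?C. c \<tau> : ?I1}" using h(3) ev by auto
 then show ?thesis using quot_iso(1)[OF C hom im] by (simp add: H1)
qed
show "trivial_group (group_H1 (Zp p) G M)" if "~ h1_entry e"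
proof -
 have "{c : carrier ?C. c \<tau> : ?I1} = carrier ?C" using ev e1(2)[OF that] by blast
 then show ?thesis using quot_trivial[OF C] by (simp add: H1)
qed
qed

end

section \<open>Modules with cyclic torsion and the decomposition theorem\<close>

context padic_group
begin

text \<open>A generator \<open>t\<close> of the group makes every ring element act by an integer, in
  particular \<open>\<sigma>\<close> by some \<open>a\<close>. Nilpotency of \<open>\<sigma>\<close>
  on torsion gives \<open>p\<close> dividing \<open>a\<close>; this controls the integer
  \<open>B\<close> by which the norm acts, and \<open>\<sigma> nrm = 0\<close> then forces
  \<open>p^(i-1)\<close> to divide \<open>a\<close>.\<close>

lemma cyclic_torsion:
assumes M: "module R M" and T: "S = Tors R M \<sigma> nrm (carrier M)"
 and cg: "cyclic_group ((add_monoid M)\<lparr>carrier := S\<rparr>)"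
shows "S = {\<zero>\<^bsub>M\<^esub>} \<or> (\<exists>t i c. S = cyc R M t & is_tor R M \<sigma> nrm i c t & c < p & (c = 0 \<or> i >= 2))"
proof -
interpret nodal_char_module R \<sigma> nrm p M by (rule nodal_char_module[OF M])
let ?A = "(add_monoid M)\<lparr>carrier := S\<rparr>"
have sub: "submodule S R M" unfolding T by (rule Tors_submodule[OF carrier_is_submodule])
have A: "group ?A"
 using subgroup.subgroup_is_group[OF submodule.axioms(1)[OF sub]] M.a_group by simp
obtain t where t: "t : S" "subgroup_generated ?A {t} = ?A" using cg by (auto simp: cyclic_group_def)
have gen: "generate ?A {t} = S"
 using arg_cong[OF t(2), of carrier] t(1) by (simp add: subgroup_generated_def Int_absorb2)
have tM: "t : carrier M" by (rule sub_carrier[OF sub t(1)])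
\<comment> \<open>Integer multiples of \<open>t\<close>, written through the module structure. As
  \<open>t\<close> generates the group, they exhaust \<open>S\<close>.\<close>
define z where "z m = cst (Zp_int p m) \<odot>\<^bsub>M\<^esub> t" for m
have zc: "z m : carrier M" and zS: "z m : S" for m
 using tM sub_smult[OF sub _ t(1)] by (simp_all add: z_def)
have zadd: "z (m + l) = z m \<oplus>\<^bsub>M\<^esub> z l" for m l
 using tM by (simp add: z_def Zp_int_add[symmetric] cst_hom smult_l_distr)
have zmult: "z (m * l) = cst (Zp_int p m) \<odot>\<^bsub>M\<^esub> z l" for m l
 using tM by (simp add: z_def Zp_int_mult[symmetric] cst_hom smult_assoc1)
have z0: "z 0 = \<zero>\<^bsub>M\<^esub>" and z1: "z 1 = t"
 using tM by (simp_all add: z_def Zp_int_01[simplified] cst_zero cst_one)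
have all: "\<exists>m. x = z m" if "x : S" for x
proof -
 have "x : generate ?A {t}" using that gen by simp
 then show ?thesis
 proof (induction rule: generate.induct)
 case one
 show ?case using z0 by (intro exI[of _ 0]) simp
 next
 case (incl h)
 then show ?case using z1 by (intro exI[of _ 1]) simp
 next
 case (inv h)
 have "z (- 1) \<oplus>\<^bsub>M\<^esub> t = \<zero>\<^bsub>M\<^esub>" using zadd[of "- 1" 1] z0 z1 by simp
 then have "inv\<^bsub>?A\<^esub> t = z (- 1)" using group.inv_equality[OF A, of "z (- 1)" t] zS t(1) by simp
 then show ?case using inv by blast
 next
 case (eng h1 h2)
 then obtain m l where "h1 = z m" "h2 = z l" by blast
 then show ?case using zadd[of m l] by (intro exI[of _ "m + l"]) simp
 qed
qed
show ?thesis
proof (cases "t = \<zero>\<^bsub>M\<^esub>")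
 case True
 have z: "z m = \<zero>\<^bsub>M\<^esub>" for m using True by (simp add: z_def)
 have "x = \<zero>\<^bsub>M\<^esub>" if "x : S" for x using all[OF that] unfolding z by blast
 then have "S = {\<zero>\<^bsub>M\<^esub>}" using sub_zero[OF sub] by blast
 then show ?thesis by blast
next
 case False
 have "t : coeff_torsion (Zp p) G M" using t(1) T coeff_torsion_eq[OF M] by simp
 then obtain a where a: "a : ZZ" "a ~= \<z>" "cst a \<odot>\<^bsub>M\<^esub> t = \<zero>\<^bsub>M\<^esub>"
 by (auto simp: coeff_torsion_def cst_def)
 obtain k u where u: "u : Units (Zp p)" "a = Zp_int p (int p ^ k) *| u"
 using Zp_nonzero_unit_power[OF a(1,2)] by blast
 have uc: "u : ZZ" using u(1) by (rule Zp.Units_closed)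
 have "cst u \<odot>\<^bsub>M\<^esub> z (int p ^ k) = \<zero>\<^bsub>M\<^esub>"
 using a(3) tM uc unfolding u(2) z_def
 by (simp add: cst_hom R.m_comm[of "cst (Zp_int p (int p ^ k))"] smult_assoc1)
 then have ex: "z (int p ^ k) = \<zero>\<^bsub>M\<^esub>" by (rule unit_smult_zero[OF cst_unit[OF u(1)] zc])
 \<comment> \<open>The order of \<open>t\<close> is \<open>p^i\<close>; a power of \<open>p\<close>
   kills \<open>t\<close> because \<open>t\<close> is torsion over Z_p.\<close>
 define i where "i = (LEAST k. z (int p ^ k) = \<zero>\<^bsub>M\<^esub>)"
 have zi: "z (int p ^ i) = \<zero>\<^bsub>M\<^esub>" unfolding i_def by (rule LeastI[of "%k. z (int p ^ k) = \<zero>\<^bsub>M\<^esub>", OF ex])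
 have zl: "z (int p ^ j) ~= \<zero>\<^bsub>M\<^esub>" if "j < i" for j using not_less_Least[of j] that by (auto simp: i_def)
 have i1: "i >= 1"
 proof (rule ccontr)
 assume "~ i >= 1"
 then have "i = 0" by simp
 then show False using zi z1 \<open>t ~= \<zero>\<^bsub>M\<^esub>\<close> by simp
 qed
 have zdvd0: "z m = \<zero>\<^bsub>M\<^esub>" if d: "int p ^ i dvd m" for m
 proof -
 obtain l where l: "m = int p ^ i * l" using d by (rule dvdE)
 have "z (l * int p ^ i) = \<zero>\<^bsub>M\<^esub>" unfolding zmult zi by simp
 then show ?thesis unfolding l by (simp add: mult.commute)
 qed
 have zcong: "z m = z l" if "[m = l] (mod int p ^ i)" for m l
 proof -
 have "z (m - l) = \<zero>\<^bsub>M\<^esub>" using that by (intro zdvd0) (simp add: cong_iff_dvd_diff)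
 then show ?thesis using zadd[of "m - l" l] zc by simp
 qed
 \<comment> \<open>Write \<open>m = p^j m'\<close> with \<open>m'\<close> prime to \<open>p\<close>.
   Inverting \<open>m'\<close> modulo \<open>p^i\<close> gives \<open>z (p^j) = 0\<close>, so
   \<open>j\<close> is at least \<open>i\<close>.\<close>
 have zdvd: "int p ^ i dvd m" if zm: "z m = \<zero>\<^bsub>M\<^esub>" for m
 proof (cases "m = 0")
 case False
 have nu: "~ is_unit (int p)" using p0 by simp
 define j where "j = multiplicity (int p) m"
 obtain m' where m': "m = int p ^ j * m'" "~ int p dvd m'"
  using multiplicity_decompose'[OF False nu] unfolding j_def by blast
 have "coprime m' (int p ^ i)" using prime_imp_coprime[of "int p" m'] m'(2) p by (simp add: coprime_commute)
 then obtain l where l: "[m' * l = 1] (mod int p ^ i)" using cong_solve_coprime_int by blast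
 have "[int p ^ j * (m' * l) = int p ^ j * 1] (mod int p ^ i)" by (rule cong_mult[OF cong_refl l])
 then have "[l * m = int p ^ j] (mod int p ^ i)" unfolding m'(1) by (simp add: mult_ac)
 then have "z (int p ^ j) = \<zero>\<^bsub>M\<^esub>" using zcong zmult[of l m] zm by simp
 then have "i <= j" using zl by (meson not_le)
 then show ?thesis unfolding m'(1) by (simp add: le_imp_power_dvd)
 qed simp
 have "\<sigma> \<odot>\<^bsub>M\<^esub> t : S" by (rule sub_smult[OF sub _ t(1)]) simp
 then obtain a where a: "\<sigma> \<odot>\<^bsub>M\<^esub> t = z a" using all by blast
 have act: "r \<odot>\<^bsub>M\<^esub> z m = z (m * l)" if r: "r : carrier R" "r \<odot>\<^bsub>M\<^esub> t = z l" for r m l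
 using r tM zmult[of m l] by (simp add: z_def smult_comm[of r])
 have sk: "\<sigma> ^: k \<odot>\<^bsub>M\<^esub> t = z (a ^ k)" for k :: nat
 proof (induction k)
 case (Suc k)
 have "\<sigma> ^: Suc k \<odot>\<^bsub>M\<^esub> t = \<sigma> ^: k \<odot>\<^bsub>M\<^esub> z a" using tM by (simp add: smult_assoc1 a)
 then show ?case using act[OF _ Suc, of a] by simp
 qed (use tM z1 in simp)
 \<comment> \<open>Some power of \<open>\<sigma>\<close> kills \<open>t\<close>, so
   \<open>p^i\<close> divides a power of \<open>a\<close>, and the prime \<open>p\<close> divides
   \<open>a\<close>.\<close>
 obtain k :: nat where "\<sigma> ^: k \<odot>\<^bsub>M\<^esub> t = \<zero>\<^bsub>M\<^esub>" using t(1) unfolding T Tors_def by blast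
 then have "int p ^ i dvd a ^ k" using sk zdvd by simp
 moreover have "int p dvd int p ^ i" using i1 by simp
 ultimately have "int p dvd a ^ k" by (rule dvd_trans[rotated])
 then have pa: "int p dvd a" using p prime_dvd_power[of "int p" a k] by simp
 have Tt: "T ^: k \<odot>\<^bsub>M\<^esub> t = z ((1 + a) ^ k)" for k :: nat
 proof (induction k)
 case (Suc k)
 have "T \<odot>\<^bsub>M\<^esub> t = z (1 + a)"
  unfolding T_eq using tM a z1 zadd[of a 1] by (simp add: smult_l_distr add.commute)
 then have "T ^: Suc k \<odot>\<^bsub>M\<^esub> t = T ^: k \<odot>\<^bsub>M\<^esub> z (1 + a)" using tM by (simp add: smult_assoc1)
 then show ?case using act[OF _ Suc, of "1 + a"] by simp
 qed (use tM z1 in simp)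
 define B where "B = (\<Sum>k<p. (1 + a) ^ k)"
 have "Nk k \<odot>\<^bsub>M\<^esub> t = z (\<Sum>j<k. (1 + a) ^ j)" for k
 proof (induction k)
 case (Suc k)
 then show ?case using tM Tt[of k] zadd by (simp add: Nk_Suc smult_l_distr add.commute[of _ "(1 + a) ^ k"])
 qed (use tM z0 in \<open>simp add: Nk_0\<close>)
 then have nB: "nrm \<odot>\<^bsub>M\<^esub> t = z B" by (simp add: B_def Nk_p[symmetric])
 obtain h where h: "p = 2 * h + 1" using odd_p by (auto elim: oddE)
 have s2: "2 * (\<Sum>k<N. int k) = int N * (int N - 1)" for N by (induction N) (simp_all add: algebra_simps)
 have sk2: "(\<Sum>k<p. int k) = int p * int h" using s2[of p] h by (simp add: algebra_simps)
 have Bc: "[B = int p] (mod m)" if m: "m dvd a * a" "m dvd a * int p" for m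
 proof -
 have "[B = (\<Sum>k<p. 1 + int k * a)] (mod m)"
  unfolding B_def by (rule cong_sum) (rule pow_binomial[OF m(1)])
 moreover have "(\<Sum>k<p. 1 + int k * a) = int p + (a * int p) * int h"
  using sk2 by (simp add: sum.distrib sum_distrib_right[symmetric])
 moreover have "[int p + (a * int p) * int h = int p + 0] (mod m)"
  using m(2) by (intro cong_add cong_refl) (simp add: cong_0_iff)
 ultimately show ?thesis by (simp add: cong_def)
 qed
 obtain a1 where a1: "a = int p * a1" using pa by blast
 \<comment> \<open>First approximation: \<open>B\<close> is \<open>p\<close> times a number prime to
   \<open>p\<close>. Since \<open>B a\<close> kills \<open>t\<close>, it follows that
   \<open>p^i\<close> divides \<open>p a\<close>; with this the approximation improves to
   \<open>B = p\<close> modulo \<open>p^i\<close>.\<close>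
 have "[B = int p] (mod int p * int p)"
 by (rule Bc) (simp_all add: a1 mult_ac)
 then obtain e where "B - int p = int p * int p * e" by (auto simp: cong_iff_dvd_diff)
 then have e: "B = int p * (1 + int p * e)" by (simp add: algebra_simps)
 have "z (B * a) = \<zero>\<^bsub>M\<^esub>"
 proof -
 have "z (B * a) = \<sigma> \<odot>\<^bsub>M\<^esub> (nrm \<odot>\<^bsub>M\<^esub> t)" unfolding nB using act[OF _ a, of B] by simp
 then show ?thesis using tM smult_assoc1[of \<sigma> nrm t] by simp
 qed
 then have "int p ^ i dvd (int p * a) * (1 + int p * e)" using zdvd[of "B * a"] by (simp add: e mult_ac)
 moreover have "coprime (int p ^ i) (1 + int p * e)"
 proof -
 have "~ int p dvd 1 + int p * e" using p0 by (simp add: dvd_add_left_iff)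
 then show ?thesis using prime_imp_coprime[of "int p" "1 + int p * e"] p by simp
 qed
 ultimately have ipa: "int p ^ i dvd int p * a" by (simp add: coprime_dvd_mult_left_iff)
 have Pi: "int p ^ i = int p * int p ^ (i - 1)" using i1 by (simp add: power_eq_if)
 then have "int p ^ (i - 1) dvd a" using ipa p0 by simp
 then obtain a' where a': "a = int p ^ (i - 1) * a'" by blast
 \<comment> \<open>For \<open>i = 1\<close> the factor \<open>p^(i-1)\<close> is 1, and
   \<open>p\<close> divides \<open>a\<close>, so \<open>\<sigma>\<close> kills \<open>t\<close>;
   hence the value 0 in that case.\<close>
 define c where "c = (if i >= 2 then nat (a' mod int p) else 0)"
 have cp: "c < p" using p0 pos_mod_bound[of "int p" a'] by (simp add: c_def nat_less_iff)
 have ca: "[a = int c * int p ^ (i - 1)] (mod int p ^ i)"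
 proof (cases "i >= 2")
 case True
 have "int c = a' mod int p" using True p0 by (simp add: c_def)
 then have "int p dvd a' - int c" by (simp add: mod_eq_dvd_iff[symmetric])
 then have "int p ^ i dvd int p ^ (i - 1) * (a' - int c)" unfolding Pi by (simp add: mult.commute mult_dvd_mono)
 then show ?thesis by (simp add: cong_iff_dvd_diff a' algebra_simps)
 next
 case False
 then have "i = 1" using i1 by simp
 then show ?thesis using pa by (simp add: c_def cong_0_iff)
 qed
 have "[B = int p] (mod int p ^ i)"
 proof (cases "i >= 2")
 case True
 then have "i <= (i - 1) + (i - 1)" by simp
 then have "int p ^ i dvd int p ^ (i - 1) * int p ^ (i - 1)"
  by (simp add: power_add[symmetric] le_imp_power_dvd)
 then have "int p ^ i dvd a * a" using dvd_mult2[of _ "int p ^ (i - 1) * int p ^ (i - 1)" "a' * a'"] by (simp add: a' mult_ac)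
 then show ?thesis using Bc ipa by (simp add: mult.commute)
 next
 case False
 then have "i = 1" using i1 by simp
 then show ?thesis by (simp add: e cong_iff_dvd_diff)
 qed
 then have np: "nrm \<odot>\<^bsub>M\<^esub> t = z (int p)" using nB zcong by simp
 have nk: "nrm ^: k \<odot>\<^bsub>M\<^esub> t = z (int p ^ k)" for k :: nat
 proof (induction k)
 case (Suc k)
 have "nrm ^: Suc k \<odot>\<^bsub>M\<^esub> t = nrm ^: k \<odot>\<^bsub>M\<^esub> z (int p)" using tM by (simp add: smult_assoc1 np)
 then show ?case using act[OF _ Suc, of "int p"] by simp
 qed (use tM z1 in simp)
 have "\<sigma> \<odot>\<^bsub>M\<^esub> t = ([c] \<cdot>\<^bsub>R\<^esub> \<r> *: nrm ^: (i - 1)) \<odot>\<^bsub>M\<^esub> t"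
 unfolding a zcong[OF ca] zmult using tM nk[of "i - 1"] by (simp add: add_pow_cst smult_assoc1)
 then have tor: "is_tor R M \<sigma> nrm i c t"
 using i1 tM nk[of i] nk[of "i - 1"] zi zl[of "i - 1"] by (simp add: is_tor_def)
 have "S = cyc R M t"
 proof (intro subset_antisym subsetI)
 fix x assume "x : S"
 then obtain m where "x = z m" using all by blast
 then show "x : cyc R M t" by (simp add: z_def cycI)
 next
 fix x assume "x : cyc R M t"
 then show "x : S" using sub_smult[OF sub _ t(1)] by (auto simp: cyc_def)
 qed
 moreover have "c = 0 \<or> i >= 2" by (simp add: c_def)
 ultimately show ?thesis using tor cp by blast
qed
qed

lemma F_param:
assumes c: "0 < c" "c < p" and i: "i >= 2"
defines "w \<equiv> 1 + int c * int p ^ (i - 1)"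
shows "admissible_unit p i w" "F_coeff p i w = c"
proof -
have P: "int p ^ (i - 1) > 1" using p0 i one_less_power[of "int p" "i - 1"] by simp
have "(int c + 1) * int p ^ (i - 1) <= int p * int p ^ (i - 1)" using c P by (intro mult_right_mono) auto
moreover have "int p ^ i = int p * int p ^ (i - 1)" using i by (simp add: power_eq_if)
ultimately have "w < int p ^ i" using P by (simp add: w_def algebra_simps)
then show "admissible_unit p i w"
 using c P by (auto simp: admissible_unit_def w_def cong_iff_dvd_diff)
have "(w - 1) div int p ^ (i - 1) = int c"
 using nonzero_mult_div_cancel_right[of "int p ^ (i - 1)" "int c"] P by (simp only: w_def) (use p0 in simp)
then show "F_coeff p i w = c" unfolding F_coeff_def by (simp only: nat_int)
qed

lemma exists_decomposition:
assumes M: "module R M" "fin_gen R M"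
 and cg: "cyclic_group ((add_monoid M)\<lparr>carrier := Tors R M \<sigma> nrm (carrier M)\<rparr>)"
shows "\<exists>Ns es. direct_sum R M Ns & list_all2 (pres R M \<sigma> nrm p) Ns es & (ALL e:set es. in_list p e)"
proof -
interpret nodal_char_module R \<sigma> nrm p M by (rule nodal_char_module[OF M(1)])
interpret O: nodal_over R \<sigma> nrm M "Tors R M \<sigma> nrm (carrier M)" by (rule nodal_over_Tors)
consider "Tors R M \<sigma> nrm (carrier M) = {\<zero>\<^bsub>M\<^esub>}"
 | t i c where "Tors R M \<sigma> nrm (carrier M) = cyc R M t" "is_tor R M \<sigma> nrm i c t" "c < p" "c = 0 \<or> i >= 2"
 using cyclic_torsion[OF M(1) refl cg] by blast
then show ?thesis
proof cases
 case 1
 obtain Ns es where d: "direct_sum R M Ns" "list_all2 (pres R M \<sigma> nrm p) Ns es"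
 "set es <= {E_Zp, E_A, E_reg}" using O.exists_torsion_free[OF M(2) 1] by blast
 have "ALL e:set es. in_list p e" using d(3) by auto
 then show ?thesis using d(1,2) by blast
next
 case (2 t i c)
 have i1: "i >= 1" using 2(2) by (simp add: is_tor_def)
 show ?thesis
 proof (cases "c = 0")
 case True
 obtain Ns es where d: "direct_sum R M Ns" "list_all2 (pres R M \<sigma> nrm p) Ns es"
  "set es <= {E_cyc i, E_ext_Zp i, E_ext_A i, E_ext_ZpA i, E_Zp, E_A, E_reg}"
  using O.exists_cyclic[OF M(2) 2(2)[unfolded True] 2(1)] by blast
 have "ALL e:set es. in_list p e" using d(3) i1 by auto
 then show ?thesis using d(1,2) by blast
 next
 case False
 then have c: "0 < c" "i >= 2" using 2(4) by auto
 let ?w = "1 + int c * int p ^ (i - 1)"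
 note F = F_param[OF c(1) 2(3) c(2)]
 obtain Ns es where d: "direct_sum R M Ns" "list_all2 (pres R M \<sigma> nrm p) Ns es"
  "set es <= {E_F i ?w, E_Zp, E_A, E_reg}"
  using O.exists_F[of i p ?w t] M(2) 2 c nod.q_units[OF c(1) 2(3)] F(2) by auto
 have "ALL e:set es. in_list p e" using d(3) c(2) F(1) by auto
 then show ?thesis using d(1,2) by blast
 qed
qed
qed

lemma pres_carrier:
assumes S: "S <= carrier M"
shows "pres R (M\<lparr>carrier := S\<rparr>) s n q S e \<longleftrightarrow> pres R M s n q S e"
proof -
have "cond R (M\<lparr>carrier := S\<rparr>) s n q t x y e \<longleftrightarrow> cond R M s n q t x y e"
 if "t : S" "x : S" "y : S" for t x y
 using that S by (cases e) (auto simp: is_tor_def free_over_def)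
then show ?thesis unfolding pres_def gen3_def by (intro bex_cong refl) auto
qed

end

context zeta_ring
begin

lemma iso_to_entry_iff:
assumes f: "!!i. i >= 1 ==> admissible_map p i (f i)" and N: "module R N" and e: "in_list p e"
shows "iso_to_entry p G \<tau> f N e \<longleftrightarrow> pres R N \<sigma> nrm p (carrier N) e"
proof -
show ?thesis using e
 by (cases e) (simp_all add: iso_iff_pres[OF nodal_module[OF N] nodal_module[OF M_cyc_pres(1)] M_cyc_pres(2)]
 iso_iff_pres[OF nodal_module[OF N] nodal_module[OF M_F_pres(1)] M_F_pres(2)]
 iso_iff_pres[OF nodal_module[OF N] nodal_module[OF M_Zp_pres(1)] M_Zp_pres(2)]
 iso_iff_pres[OF nodal_module[OF N] nodal_module[OF M_A_pres(1)] M_A_pres(2)]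
 iso_iff_pres[OF nodal_module[OF N] nodal_module[OF M_reg_pres(1)] M_reg_pres(2)]
 iso_iff_pres[OF nodal_module[OF N] nodal_module[OF M_ext_Zp_pres(1)] M_ext_Zp_pres(2)]
 iso_iff_pres[OF nodal_module[OF N] nodal_module[OF M_ext_A_pres(1)] M_ext_A_pres(2)] f
 iso_iff_pres[OF nodal_module[OF N] nodal_module[OF M_ext_ZpA_pres(1)] M_ext_ZpA_pres(2)])
qed

text \<open>The summands are submodules of \<open>M\<close>, so being isomorphic to an entry can be
  replaced by having its presentation inside \<open>M\<close>.\<close>

lemma decomposes_as_iff:
assumes f: "!!i. i >= 1 ==> admissible_map p i (f i)" and M: "module R M"
shows "decomposes_as p G \<tau> f M es \<longleftrightarrow>
 (ALL e:set es. in_list p e) & (\<exists>Ns. direct_sum R M Ns & list_all2 (pres R M \<sigma> nrm p) Ns es)"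
proof -
have "iso_to_entry p G \<tau> f (M\<lparr>carrier := N\<rparr>) e \<longleftrightarrow> pres R M \<sigma> nrm p N e"
 if N: "submodule N R M" and e: "in_list p e" for N e
proof -
 have "N <= carrier M" using module.submoduleE(1)[OF M N] .
 then show ?thesis
 using iso_to_entry_iff[OF f submodule.submodule_is_module[OF N M] e] pres_carrier[of N M] by simp
qed
then have "list_all2 (%N e. iso_to_entry p G \<tau> f (M\<lparr>carrier := N\<rparr>) e) Ns es \<longleftrightarrow> list_all2 (pres R M \<sigma> nrm p) Ns es"
 if "direct_sum R M Ns" "ALL e:set es. in_list p e" for Ns
 using that unfolding direct_sum_def list_all2_conv_all_nth by auto
then show ?thesis unfolding decomposes_as_def by blast
qed

lemma unique_decomposition:
assumes f: "!!i. i >= 1 ==> admissible_map p i (f i)" and M: "module R M" "fin_gen R M"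
 and cg: "cyclic_group ((add_monoid M)\<lparr>carrier := coeff_torsion (Zp p) G M\<rparr>)"
shows "\<exists>es. decomposes_as p G \<tau> f M es & (\<forall>es'. decomposes_as p G \<tau> f M es' --> mset es' = mset es)"
proof -
interpret nodal_char_module R \<sigma> nrm p M by (rule nodal_char_module[OF M(1)])
note cg' = cg[unfolded coeff_torsion_eq[OF M(1)]]
have T: "Tors R M \<sigma> nrm (carrier M) = {\<zero>\<^bsub>M\<^esub>} \<or>
 (\<exists>t i c. Tors R M \<sigma> nrm (carrier M) = cyc R M t & is_tor R M \<sigma> nrm i c t & (c = 0 \<or> i >= 2))"
 using cyclic_torsion[OF M(1) refl cg'] by blast
obtain Ns es where d: "direct_sum R M Ns" "list_all2 (pres R M \<sigma> nrm p) Ns es" "ALL e:set es. in_list p e"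
 using exists_decomposition[OF M cg'] by blast
have iff: "decomposes_as p G \<tau> f M es \<longleftrightarrow> (ALL e:set es. in_list p e) &
 (\<exists>Ns. direct_sum R M Ns & list_all2 (pres R M \<sigma> nrm p) Ns es)" for es
 by (rule decomposes_as_iff[OF _ M(1)]) (rule f)
have "mset es' = mset es" if d': "decomposes_as p G \<tau> f M es'" for es'
proof -
 obtain Ns' where "direct_sum R M Ns'" "list_all2 (pres R M \<sigma> nrm p) Ns' es'" "ALL e:set es'. in_list p e"
 using d' unfolding iff by blast
 then show ?thesis using decomposition_unique[OF p0(2) T, of Ns' es' Ns es] d by blast
qed
moreover have "decomposes_as p G \<tau> f M es" unfolding iff using d by blast
ultimately show ?thesis by blast
qed

end

theorem theorem4p4:
  fixes p :: nat
    and G :: "('g, 'd) monoid_scheme"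
    and \<tau> :: 'g
    and f :: "nat \<Rightarrow> (nat \<Rightarrow> padic) set \<Rightarrow> int"
    and M :: "('g \<Rightarrow> padic, 'm, 'e) module_scheme"
  assumes p: "Factorial_Ring.prime p" "odd p"
    and G: "group G" "order G = p" "\<tau> \<in> carrier G" "generate G {\<tau>} = carrier G"
    and f: "\<And>i. i \<ge> 1 \<Longrightarrow> admissible_map p i (f i)"
    and M: "module (ZpG p G) M" "fin_gen (ZpG p G) M"
    and torsion: "cyclic_group ((add_monoid M)\<lparr>carrier := coeff_torsion (Zp p) G M\<rparr>)"
  shows "(\<exists>es. decomposes_as p G \<tau> f M es \<and>
            (\<forall>es'. decomposes_as p G \<tau> f M es' \<longrightarrow> mset es' = mset es))
    \<and> (\<forall>i\<ge>1. tate_H0 (Zp p) G (M_cyc p G \<tau> i) \<cong> integer_mod_group p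
            \<and> group_H1 (Zp p) G (M_cyc p G \<tau> i) \<cong> integer_mod_group p)
    \<and> (\<forall>i\<ge>2. \<forall>w. admissible_unit p i w \<longrightarrow>
            trivial_group (tate_H0 (Zp p) G (M_F p G \<tau> i w))
            \<and> trivial_group (group_H1 (Zp p) G (M_F p G \<tau> i w)))
    \<and> tate_H0 (Zp p) G (M_Zp p G \<tau>) \<cong> integer_mod_group p
    \<and> trivial_group (group_H1 (Zp p) G (M_Zp p G \<tau>))
    \<and> trivial_group (tate_H0 (Zp p) G (M_A p G))
    \<and> group_H1 (Zp p) G (M_A p G) \<cong> integer_mod_group p
    \<and> trivial_group (tate_H0 (Zp p) G (M_reg p G))
    \<and> trivial_group (group_H1 (Zp p) G (M_reg p G))
    \<and> (\<forall>i\<ge>1. tate_H0 (Zp p) G (M_ext_Zp p G \<tau> i) \<cong> integer_mod_group p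
            \<and> trivial_group (group_H1 (Zp p) G (M_ext_Zp p G \<tau> i)))
    \<and> (\<forall>i\<ge>1. trivial_group (tate_H0 (Zp p) G (M_ext_A p G \<tau> (f i) i))
            \<and> group_H1 (Zp p) G (M_ext_A p G \<tau> (f i) i) \<cong> integer_mod_group p)
    \<and> (\<forall>i\<ge>1. trivial_group (tate_H0 (Zp p) G (M_ext_ZpA p G \<tau> (f i) i))
            \<and> trivial_group (group_H1 (Zp p) G (M_ext_ZpA p G \<tau> (f i) i)))"
proof -
interpret zeta_ring p G \<tau>
 by (intro zeta_ring.intro padic_group.intro padic_group_axioms.intro padic.intro p G)
show ?thesis
 using unique_decomposition[OF f M torsion]
 cohomology[OF M_cyc_pres(1) _ M_cyc_pres(2)] cohomology[OF M_F_pres(1) _ M_F_pres(2)]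
 cohomology[OF M_Zp_pres(1) _ M_Zp_pres(2)] cohomology[OF M_A_pres(1) _ M_A_pres(2)]
 cohomology[OF M_reg_pres(1) _ M_reg_pres(2)] cohomology[OF M_ext_Zp_pres(1) _ M_ext_Zp_pres(2)]
 cohomology[OF M_ext_A_pres(1) _ M_ext_A_pres(2)] cohomology[OF M_ext_ZpA_pres(1) _ M_ext_ZpA_pres(2)] f
 by simp
qed

end
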